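(* Let $G$ be a [SIN] group, and let $x_0\in VN(G)$ be such that $\Delta^2(x_0)\in VN(G)\otimes VN(G)\otimes VN(G)$. Then $x_0\in C^*_\delta(G)$.
   Context: $G$ is a locally compact group. $G$ is a [SIN] group if it contains arbitrarily small neighbourhoods of the identity which are invariant under inner automorphisms. $VN(G)$ is the group von Neumann algebra, generated by the left translation operators $\lambda(s)$ ($s\in G$) on $L^2(G)$. $\Delta:VN(G)\to VN(G)\overline\otimes VN(G)$ is the normal unital $*$-homomorphism with $\Delta(\lambda(s))=\lambda(s)\otimes\lambda(s)$, and $\Delta^2=(\Delta\otimes\iota)\Delta=(\iota\otimes\Delta)\Delta:VN(G)\to VN(G)\overline\otimes VN(G)\overline\otimes VN(G)$. Here $\otimes$ between von Neumann algebras denotes the minimal C$^*$-algebra tensor product, i.e. the norm closure of the algebraic tensor product inside the von Neumann tensor product. $C^*_\delta(G)$ is the C$^*$-subalgebra of $VN(G)$ generated by $\{\lambda(s):s\in G\}$. *)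

theory Defs
  imports "HOL-Analysis.Analysis"
begin

section \<open>Locally compact groups\<close>

text \<open>
  The group type classes of HOL are additive, and \<^class>\<open>topological_group_add\<close> is not assumed to be
  commutative.  So the group product \<open>s t\<close> is written \<open>s + t\<close>, the identity is \<open>0\<close> and the inverse
  is \<open>- s\<close>.  The class below is that of locally compact Hausdorff groups together with a chosen
  left Haar measure, i.e. a nonzero left invariant Radon measure on the Borel sets.  Such a measure
  always exists and is unique up to a positive factor.
\<close>

class haar_group = topological_group_add + t2_space +
  fixes haar :: "'a measure"
  assumes locally_compact: "\<exists>U K. x \<in> U \<and> U \<subseteq> K \<and> open U \<and> compact K"
    and sets_haar_sigma: "sets haar = sigma_sets UNIV {U. open U}"
    and haar_left_invariant: "A \<in> sets haar \<Longrightarrow> emeasure haar ((+) s ` A) = emeasure haar A"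
    and haar_finite_on_compact: "compact K \<Longrightarrow> emeasure haar K < \<infinity>"
    and haar_outer_regular: "A \<in> sets haar \<Longrightarrow>
      emeasure haar A = (INF U\<in>{U. open U \<and> A \<subseteq> U}. emeasure haar U)"
    and haar_inner_regular: "open U \<Longrightarrow>
      emeasure haar U = (SUP K\<in>{K. compact K \<and> K \<subseteq> U}. emeasure haar K)"
    and haar_nonzero: "emeasure haar UNIV \<noteq> 0"

lemma sets_haar [measurable_cong, simp]: "sets (haar :: 'g::haar_group measure) = sets borel"
  by (simp add: sets_haar_sigma borel_def)

lemma space_haar [simp]: "space (haar :: 'g::haar_group measure) = UNIV"
  using sets_eq_imp_space_eq[OF sets_haar] by simp

definition SIN_group :: "'g::topological_group_add itself \<Rightarrow> bool" where
  "SIN_group _ \<longleftrightarrow> (\<forall>U :: 'g set. open U \<and> 0 \<in> U \<longrightarrow>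
     (\<exists>V. V \<subseteq> U \<and> 0 \<in> interior V \<and> (\<forall>g. (\<lambda>x. g + x - g) ` V = V)))"


section \<open>Complex Hilbert spaces\<close>

class complex_inner = real_inner +
  fixes scaleC :: "complex \<Rightarrow> 'a \<Rightarrow> 'a" (infixr "*\<^sub>C" 75)
    and cinner :: "'a \<Rightarrow> 'a \<Rightarrow> complex"
  assumes scaleC_add_right: "a *\<^sub>C (x + y) = a *\<^sub>C x + a *\<^sub>C y"
    and scaleC_add_left: "(a + b) *\<^sub>C x = a *\<^sub>C x + b *\<^sub>C x"
    and scaleC_scaleC [simp]: "a *\<^sub>C (b *\<^sub>C x) = (a * b) *\<^sub>C x"
    and scaleC_of_real: "complex_of_real r *\<^sub>C x = r *\<^sub>R x"
    and cinner_commute: "cinner x y = cnj (cinner y x)"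
    and cinner_add_left: "cinner (x + y) z = cinner x z + cinner y z"
    and cinner_scaleC_left [simp]: "cinner (a *\<^sub>C x) y = a * cinner x y"
    and inner_eq_Re_cinner: "inner x y = Re (cinner x y)"

class complex_hilbert = complex_inner + complete_space

lemma cinner_scaleC_right [simp]: "cinner x (a *\<^sub>C y) = cnj a * cinner x (y :: 'a::complex_inner)"
  by (metis cinner_commute cinner_scaleC_left complex_cnj_mult)

lemma cinner_self: "cinner x x = complex_of_real ((norm (x :: 'a::complex_inner))\<^sup>2)"
proof -
  have "Im (cinner x x) = 0"
    using cinner_commute[of x x] by (metis Im_complex_of_real complex_In_mult_cnj_zero
        Reals_cnj_iff complex_is_Real_iff)
  then show ?thesis
    by (simp add: complex_eq_iff flip: inner_eq_Re_cinner power2_norm_eq_inner)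
qed

lemma norm_scaleC [simp]: "norm (a *\<^sub>C (x :: 'a::complex_inner)) = cmod a * norm x"
proof -
  have "complex_of_real ((norm (a *\<^sub>C x))\<^sup>2) = (a * cnj a) * cinner x x"
    by (simp add: cinner_self[symmetric, of "a *\<^sub>C x"] del: of_real_power of_real_mult)
  also have "\<dots> = complex_of_real ((cmod a * norm x)\<^sup>2)"
    by (simp add: cinner_self complex_norm_square[symmetric] power_mult_distrib)
  finally have "(norm (a *\<^sub>C x))\<^sup>2 = (cmod a * norm x)\<^sup>2"
    by (simp only: of_real_eq_iff)
  then show ?thesis
    by simp
qed

lemma bounded_linear_scaleC: "bounded_linear (\<lambda>x :: 'a::complex_inner. a *\<^sub>C x)"
proof (rule bounded_linear_intro)
  show "a *\<^sub>C (r *\<^sub>R x) = r *\<^sub>R (a *\<^sub>C x)" for r and x :: 'a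
    by (simp add: mult.commute flip: scaleC_of_real)
  show "norm (a *\<^sub>C x) \<le> norm x * cmod a" for x :: 'a
    by simp
qed (rule scaleC_add_right)


section \<open>Algebras of operators\<close>

text \<open>
  Bounded operators are elements of the library type \<open>'h \<Rightarrow>\<^sub>L 'h\<close> of bounded \<open>\<real>\<close>-linear maps; those in
  \<open>bounded_operators\<close> are the \<open>\<complex>\<close>-linear ones.  The norm of \<open>'h \<Rightarrow>\<^sub>L 'h\<close> is the operator norm.
\<close>

definition bounded_operators :: "('h::complex_inner \<Rightarrow>\<^sub>L 'h) set" where
  "bounded_operators = {T :: 'h \<Rightarrow>\<^sub>L 'h. \<forall>c x. T (c *\<^sub>C x) = c *\<^sub>C T x}"

lift_definition scaleC_op ::
    "complex \<Rightarrow> ('h::complex_inner \<Rightarrow>\<^sub>L 'h) \<Rightarrow> 'h \<Rightarrow>\<^sub>L 'h" is "\<lambda>c T x. c *\<^sub>C T x"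
  by (rule bounded_linear_compose[OF bounded_linear_scaleC])

definition cadjoint :: "('h::complex_hilbert \<Rightarrow>\<^sub>L 'h) \<Rightarrow> 'h \<Rightarrow>\<^sub>L 'h" where
  "cadjoint T = (THE S :: 'h \<Rightarrow>\<^sub>L 'h. \<forall>x y. cinner (T x) y = cinner x (S y))"

definition star_subalgebra :: "('h::complex_hilbert \<Rightarrow>\<^sub>L 'h) set \<Rightarrow> bool" where
  "star_subalgebra M \<longleftrightarrow> M \<subseteq> bounded_operators \<and> 0 \<in> M \<and>
     (\<forall>S\<in>M. \<forall>T\<in>M. S + T \<in> M \<and> S o\<^sub>L T \<in> M) \<and>
     (\<forall>c. \<forall>T\<in>M. scaleC_op c T \<in> M) \<and> (\<forall>T\<in>M. cadjoint T \<in> M)"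

definition cstar_generated :: "('h::complex_hilbert \<Rightarrow>\<^sub>L 'h) set \<Rightarrow> ('h \<Rightarrow>\<^sub>L 'h) set" where
  "cstar_generated X = \<Inter>{M. star_subalgebra M \<and> closed M \<and> X \<subseteq> M}"

definition von_neumann_algebra :: "('h::complex_hilbert \<Rightarrow>\<^sub>L 'h) set \<Rightarrow> bool" where
  "von_neumann_algebra M \<longleftrightarrow>
     star_subalgebra M \<and> id_blinfun \<in> M \<and> closedin strong_operator_topology M"

definition vn_generated :: "('h::complex_hilbert \<Rightarrow>\<^sub>L 'h) set \<Rightarrow> ('h \<Rightarrow>\<^sub>L 'h) set" where
  "vn_generated X = \<Inter>{M. von_neumann_algebra M \<and> X \<subseteq> M}"

text \<open>
  The ultraweak (\<open>\<sigma>\<close>-weak) topology is the initial topology for the functionals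
  \<open>T \<mapsto> \<Sum>n. \<langle>T \<xi>\<^sub>n, \<eta>\<^sub>n\<rangle>\<close> with square summable sequences \<open>\<xi>\<close> and \<open>\<eta>\<close>; the second \<open>euclidean\<close>
  topology below is that of pointwise convergence.
\<close>

definition ultraweak_functional ::
    "('h::complex_inner \<Rightarrow>\<^sub>L 'h) \<Rightarrow> (nat \<Rightarrow> 'h) \<times> (nat \<Rightarrow> 'h) \<Rightarrow> complex" where
  "ultraweak_functional T = (\<lambda>(\<xi>, \<eta>).
     if summable (\<lambda>n. (norm (\<xi> n))\<^sup>2) \<and> summable (\<lambda>n. (norm (\<eta> n))\<^sup>2)
     then \<Sum>n. cinner (T (\<xi> n)) (\<eta> n) else 0)"

definition ultraweak_topology :: "('h::complex_inner \<Rightarrow>\<^sub>L 'h) topology" where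
  "ultraweak_topology = pullback_topology UNIV ultraweak_functional euclidean"

definition normal_unital_star_hom ::
    "('h::complex_hilbert \<Rightarrow>\<^sub>L 'h) set \<Rightarrow> ('k::complex_hilbert \<Rightarrow>\<^sub>L 'k) set \<Rightarrow>
     (('h \<Rightarrow>\<^sub>L 'h) \<Rightarrow> 'k \<Rightarrow>\<^sub>L 'k) \<Rightarrow> bool" where
  "normal_unital_star_hom M N \<Phi> \<longleftrightarrow>
     (\<forall>S\<in>M. \<Phi> S \<in> N) \<and> \<Phi> id_blinfun = id_blinfun \<and>
     (\<forall>S\<in>M. \<forall>T\<in>M. \<Phi> (S + T) = \<Phi> S + \<Phi> T \<and> \<Phi> (S o\<^sub>L T) = \<Phi> S o\<^sub>L \<Phi> T) \<and>
     (\<forall>c. \<forall>T\<in>M. \<Phi> (scaleC_op c T) = scaleC_op c (\<Phi> T)) \<and>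
     (\<forall>T\<in>M. \<Phi> (cadjoint T) = cadjoint (\<Phi> T)) \<and>
     continuous_map (subtopology ultraweak_topology M) (subtopology ultraweak_topology N) \<Phi>"


section \<open>Tensor products\<close>

text \<open>
  \<open>hilbert_tensor tp\<close> says that \<open>'k\<close> together with \<open>tp\<close> is the Hilbert space tensor product of \<open>'h1\<close>
  and \<open>'h2\<close>; this determines \<open>'k\<close> up to a unitary compatible with the elementary tensors.  The real
  span of the elementary tensors is a complex subspace, since \<open>tp\<close> is complex bilinear.
\<close>

definition hilbert_tensor ::
    "('h1::complex_hilbert \<Rightarrow> 'h2::complex_hilbert \<Rightarrow> 'k::complex_hilbert) \<Rightarrow> bool" where
  "hilbert_tensor tp \<longleftrightarrow>
     (\<forall>x x' y. tp (x + x') y = tp x y + tp x' y) \<and>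
     (\<forall>x y y'. tp x (y + y') = tp x y + tp x y') \<and>
     (\<forall>c x y. tp (c *\<^sub>C x) y = c *\<^sub>C tp x y \<and> tp x (c *\<^sub>C y) = c *\<^sub>C tp x y) \<and>
     (\<forall>x x' y y'. cinner (tp x y) (tp x' y') = cinner x x' * cinner y y') \<and>
     closure (span {tp x y | x y. True}) = UNIV"

definition op_tensor ::
    "('h1::complex_hilbert \<Rightarrow> 'h2::complex_hilbert \<Rightarrow> 'k::complex_hilbert) \<Rightarrow>
     ('h1 \<Rightarrow>\<^sub>L 'h1) \<Rightarrow> ('h2 \<Rightarrow>\<^sub>L 'h2) \<Rightarrow> 'k \<Rightarrow>\<^sub>L 'k" where
  "op_tensor tp S T = (THE R :: 'k \<Rightarrow>\<^sub>L 'k. \<forall>x y. R (tp x y) = tp (S x) (T y))"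

definition vn_tensor ::
    "('h1::complex_hilbert \<Rightarrow> 'h2::complex_hilbert \<Rightarrow> 'k::complex_hilbert) \<Rightarrow>
     ('h1 \<Rightarrow>\<^sub>L 'h1) set \<Rightarrow> ('h2 \<Rightarrow>\<^sub>L 'h2) set \<Rightarrow> ('k \<Rightarrow>\<^sub>L 'k) set" where
  "vn_tensor tp M N = vn_generated {op_tensor tp S T | S T. S \<in> M \<and> T \<in> N}"

text \<open>
  The span below is the algebraic tensor product; again the real span suffices because \<open>A\<close> is
  closed under multiplication by complex scalars in all uses.
\<close>

definition min_tensor ::
    "('h1::complex_hilbert \<Rightarrow> 'h2::complex_hilbert \<Rightarrow> 'k::complex_hilbert) \<Rightarrow>
     ('h1 \<Rightarrow>\<^sub>L 'h1) set \<Rightarrow> ('h2 \<Rightarrow>\<^sub>L 'h2) set \<Rightarrow> ('k \<Rightarrow>\<^sub>L 'k) set" where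
  "min_tensor tp A B = closure (span {op_tensor tp S T | S T. S \<in> A \<and> T \<in> B})"

text \<open>
  \<open>tensor_with_id tp tp' M N P \<Phi> \<Psi>\<close>: for a normal unital \<open>*\<close>-homomorphism \<open>\<Phi> : M \<rightarrow> N\<close>, the map \<open>\<Psi>\<close> is
  \<open>\<Phi> \<otimes> \<iota>\<close> from the von Neumann tensor product of \<open>M\<close> and \<open>P\<close> to that of \<open>N\<close> and \<open>P\<close>, i.e. the normal
  extension of \<open>x \<otimes> y \<mapsto> \<Phi> x \<otimes> y\<close>.
\<close>

definition tensor_with_id ::
    "('h1::complex_hilbert \<Rightarrow> 'h2::complex_hilbert \<Rightarrow> 'k::complex_hilbert) \<Rightarrow>
     ('h1'::complex_hilbert \<Rightarrow> 'h2 \<Rightarrow> 'k'::complex_hilbert) \<Rightarrow>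
     ('h1 \<Rightarrow>\<^sub>L 'h1) set \<Rightarrow> ('h1' \<Rightarrow>\<^sub>L 'h1') set \<Rightarrow> ('h2 \<Rightarrow>\<^sub>L 'h2) set \<Rightarrow>
     (('h1 \<Rightarrow>\<^sub>L 'h1) \<Rightarrow> 'h1' \<Rightarrow>\<^sub>L 'h1') \<Rightarrow> (('k \<Rightarrow>\<^sub>L 'k) \<Rightarrow> 'k' \<Rightarrow>\<^sub>L 'k') \<Rightarrow> bool" where
  "tensor_with_id tp tp' M N P \<Phi> \<Psi> \<longleftrightarrow>
     normal_unital_star_hom (vn_tensor tp M P) (vn_tensor tp' N P) \<Psi> \<and>
     (\<forall>x\<in>M. \<forall>y\<in>P. \<Psi> (op_tensor tp x y) = op_tensor tp' (\<Phi> x) y)"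


section \<open>The Hilbert space of square integrable functions\<close>

definition square_integrable :: "('g::haar_group \<Rightarrow> complex) \<Rightarrow> bool" where
  "square_integrable f \<longleftrightarrow>
     f \<in> borel_measurable haar \<and> integrable haar (\<lambda>x. (cmod (f x))\<^sup>2)"

definition L2_rel :: "('g::haar_group \<Rightarrow> complex) \<Rightarrow> ('g \<Rightarrow> complex) \<Rightarrow> bool" where
  "L2_rel f g \<longleftrightarrow> square_integrable f \<and> square_integrable g \<and> (AE x in haar. f x = g x)"

lemma square_integrable_0: "square_integrable (\<lambda>_. 0)"
  by (simp add: square_integrable_def)

lemma square_integrable_mult:
  assumes "square_integrable f" "square_integrable g"
  shows "integrable haar (\<lambda>x. f x * cnj (g x))"
proof (rule Bochner_Integration.integrable_bound)
  show "integrable haar (\<lambda>x. (cmod (f x))\<^sup>2 + (cmod (g x))\<^sup>2)"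
    using assms by (auto simp: square_integrable_def)
  have "cmod (f x * cnj (g x)) \<le> (cmod (f x))\<^sup>2 + (cmod (g x))\<^sup>2" for x
  proof -
    have "2 * (cmod (f x) * cmod (g x)) \<le> (cmod (f x))\<^sup>2 + (cmod (g x))\<^sup>2"
      using sum_squares_bound[of "cmod (f x)" "cmod (g x)"] by (simp add: mult.assoc)
    moreover have "0 \<le> cmod (f x) * cmod (g x)"
      by simp
    ultimately show ?thesis
      unfolding norm_mult complex_mod_cnj by linarith
  qed
  then show "AE x in haar. cmod (f x * cnj (g x)) \<le> norm ((cmod (f x))\<^sup>2 + (cmod (g x))\<^sup>2)"
    by simp
  show "(\<lambda>x. f x * cnj (g x)) \<in> borel_measurable haar"
    using assms unfolding square_integrable_def by (auto intro!: borel_measurable_times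
        borel_measurable_continuous_on[of cnj, OF continuous_on_cnj[OF continuous_on_id]])
qed

lemma square_integrable_add:
  assumes "square_integrable f" "square_integrable g"
  shows "square_integrable (\<lambda>x. f x + g x)"
  unfolding square_integrable_def
proof (intro conjI)
  have [measurable]: "f \<in> borel_measurable haar" "g \<in> borel_measurable haar"
    using assms by (auto simp: square_integrable_def)
  show "(\<lambda>x. f x + g x) \<in> borel_measurable haar"
    by measurable
  show "integrable haar (\<lambda>x. (cmod (f x + g x))\<^sup>2)"
  proof (rule Bochner_Integration.integrable_bound)
    show "integrable haar (\<lambda>x. 2 * (cmod (f x))\<^sup>2 + 2 * (cmod (g x))\<^sup>2)"
      using assms by (auto simp: square_integrable_def)
    have "(cmod (f x + g x))\<^sup>2 \<le> 2 * (cmod (f x))\<^sup>2 + 2 * (cmod (g x))\<^sup>2" for x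
    proof -
      have "(cmod (f x + g x))\<^sup>2 \<le> (cmod (f x) + cmod (g x))\<^sup>2"
        by (intro power_mono norm_triangle_ineq) auto
      then show ?thesis
        using sum_squares_bound[of "cmod (f x)" "cmod (g x)"] by (simp add: power2_sum)
    qed
    then show "AE x in haar. norm ((cmod (f x + g x))\<^sup>2) \<le>
        norm (2 * (cmod (f x))\<^sup>2 + 2 * (cmod (g x))\<^sup>2)"
      by simp
  qed measurable
qed

lemma square_integrable_cmult:
  assumes "square_integrable f" shows "square_integrable (\<lambda>x. c * f x)"
  using assms by (auto simp: square_integrable_def norm_mult power_mult_distrib)

quotient_type (overloaded) 'g L2 = "'g::haar_group \<Rightarrow> complex" / partial: L2_rel
proof (rule part_equivpI)
  show "\<exists>f :: 'g \<Rightarrow> complex. L2_rel f f"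
    by (rule exI[of _ "\<lambda>_. 0"]) (simp add: L2_rel_def square_integrable_0)
  show "symp (L2_rel :: ('g \<Rightarrow> complex) \<Rightarrow> _)"
    by (rule sympI) (auto simp: L2_rel_def eq_commute)
  show "transp (L2_rel :: ('g \<Rightarrow> complex) \<Rightarrow> _)"
    by (rule transpI) (auto simp: L2_rel_def elim: eventually_elim2)
qed

instantiation L2 :: (haar_group) complex_inner
begin

lift_definition zero_L2 :: "'a L2" is "\<lambda>_. 0"
  by (simp add: L2_rel_def square_integrable_0)

lift_definition plus_L2 :: "'a L2 \<Rightarrow> 'a L2 \<Rightarrow> 'a L2" is "\<lambda>f g x. f x + g x"
  by (auto simp: L2_rel_def square_integrable_add elim: eventually_elim2)

lift_definition scaleC_L2 :: "complex \<Rightarrow> 'a L2 \<Rightarrow> 'a L2" is "\<lambda>c f x. c * f x"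
  by (auto simp: L2_rel_def square_integrable_cmult)

definition scaleR_L2 :: "real \<Rightarrow> 'a L2 \<Rightarrow> 'a L2" where
  "scaleR_L2 r f = complex_of_real r *\<^sub>C f"

definition uminus_L2 :: "'a L2 \<Rightarrow> 'a L2" where
  "uminus_L2 f = (- 1) *\<^sub>C f"

definition minus_L2 :: "'a L2 \<Rightarrow> 'a L2 \<Rightarrow> 'a L2" where
  "minus_L2 f g = f + (- g)"

lift_definition cinner_L2 :: "'a L2 \<Rightarrow> 'a L2 \<Rightarrow> complex" is
  "\<lambda>f g. \<integral>x. f x * cnj (g x) \<partial>haar"
  subgoal for f f' g g'
  proof -
    assume a: "L2_rel f f'" "L2_rel g g'"
    show "(\<integral>x. f x * cnj (g x) \<partial>haar) = (\<integral>x. f' x * cnj (g' x) \<partial>haar)"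
    proof (rule integral_cong_AE)
      show "AE x in haar. f x * cnj (g x) = f' x * cnj (g' x)"
        using a by (auto simp: L2_rel_def elim: eventually_elim2)
    qed (use a in \<open>auto simp: L2_rel_def intro!: borel_measurable_integrable square_integrable_mult\<close>)
  qed
  done

definition inner_L2 :: "'a L2 \<Rightarrow> 'a L2 \<Rightarrow> real" where
  "inner_L2 f g = Re (cinner f g)"

definition norm_L2 :: "'a L2 \<Rightarrow> real" where
  "norm_L2 f = sqrt (inner f f)"

definition sgn_L2 :: "'a L2 \<Rightarrow> 'a L2" where
  "sgn_L2 f = inverse (norm f) *\<^sub>R f"

definition dist_L2 :: "'a L2 \<Rightarrow> 'a L2 \<Rightarrow> real" where
  "dist_L2 f g = norm (f - g)"

definition uniformity_L2 :: "('a L2 \<times> 'a L2) filter" where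
  "uniformity_L2 = (INF e\<in>{0 <..}. principal {(f, g). dist f g < e})"

definition open_L2 :: "'a L2 set \<Rightarrow> bool" where
  "open_L2 U \<longleftrightarrow> (\<forall>f\<in>U. eventually (\<lambda>(f', g). f' = f \<longrightarrow> g \<in> U) uniformity)"

instance
proof
  fix f g h :: "'a L2" and r s :: real and a b :: complex
  show add: "f + g + h = f + (g + h)"
    by transfer (auto simp: L2_rel_def add.assoc intro!: square_integrable_add)
  show "f + g = g + f"
    by transfer (auto simp: L2_rel_def add.commute intro!: square_integrable_add)
  show "0 + f = f"
    by transfer (auto simp: L2_rel_def)
  show "- f + f = 0"
    unfolding uminus_L2_def by transfer (auto simp: L2_rel_def square_integrable_0
        intro!: square_integrable_add square_integrable_cmult)
  show "f - g = f + - g"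
    by (fact minus_L2_def)
  show scaleC1: "a *\<^sub>C (f + g) = a *\<^sub>C f + a *\<^sub>C g" for a
    by transfer (auto simp: L2_rel_def algebra_simps
        intro!: square_integrable_add square_integrable_cmult)
  show scaleC2: "(a + b) *\<^sub>C f = a *\<^sub>C f + b *\<^sub>C f" for a b
    by transfer (auto simp: L2_rel_def algebra_simps
        intro!: square_integrable_add square_integrable_cmult)
  show scaleC3: "a *\<^sub>C (b *\<^sub>C f) = (a * b) *\<^sub>C f" for a b
    by transfer (auto simp: L2_rel_def algebra_simps intro!: square_integrable_cmult)
  show "complex_of_real r *\<^sub>C f = r *\<^sub>R f"
    by (simp add: scaleR_L2_def)
  show "r *\<^sub>R (f + g) = r *\<^sub>R f + r *\<^sub>R g"
    by (simp add: scaleR_L2_def scaleC1)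
  show "(r + s) *\<^sub>R f = r *\<^sub>R f + s *\<^sub>R f"
    by (simp add: scaleR_L2_def scaleC2)
  show "r *\<^sub>R s *\<^sub>R f = (r * s) *\<^sub>R f"
    by (simp add: scaleR_L2_def scaleC3)
  show "1 *\<^sub>R f = f"
    unfolding scaleR_L2_def by transfer (auto simp: L2_rel_def)
  show comm: "cinner f g = cnj (cinner g f)" for f g :: "'a L2"
  proof transfer
    fix f g :: "'a \<Rightarrow> complex"
    show "(\<integral>x. f x * cnj (g x) \<partial>haar) = cnj (\<integral>x. g x * cnj (f x) \<partial>haar)"
      by (subst Bochner_Integration.integral_cnj[symmetric]) (simp add: mult.commute)
  qed
  show add: "cinner (f + g) h = cinner f h + cinner g h"
    by transfer (auto simp: L2_rel_def distrib_right intro!: Bochner_Integration.integral_add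
        square_integrable_mult)
  show scl: "cinner (a *\<^sub>C f) g = a * cinner f g" for a
    by transfer (simp add: mult.assoc)
  show "inner f g = Re (cinner f g)"
    by (fact inner_L2_def)
  show "inner f g = inner g f"
    by (simp add: inner_L2_def comm[of f g])
  show "inner (f + g) h = inner f h + inner g h"
    by (simp add: inner_L2_def add)
  show "inner (r *\<^sub>R f) g = r * inner f g"
    by (simp add: inner_L2_def scaleR_L2_def scl)
  have 1: "0 \<le> Re (cinner f f) \<and> (Re (cinner f f) = 0 \<longleftrightarrow> f = 0)"
  proof transfer
    fix f :: "'a \<Rightarrow> complex"
    assume "L2_rel f f"
    then have f: "f \<in> borel_measurable haar" "integrable haar (\<lambda>x. (cmod (f x))\<^sup>2)"
      "square_integrable f"
      by (auto simp: L2_rel_def square_integrable_def)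
    have eq: "Re (\<integral>x. f x * cnj (f x) \<partial>haar) = (\<integral>x. (cmod (f x))\<^sup>2 \<partial>haar)"
      by (simp only: complex_norm_square[symmetric] integral_complex_of_real Re_complex_of_real)
    show "0 \<le> Re (\<integral>x. f x * cnj (f x) \<partial>haar) \<and>
          (Re (\<integral>x. f x * cnj (f x) \<partial>haar) = 0 \<longleftrightarrow> L2_rel f (\<lambda>_. 0))"
      unfolding eq using f
      by (subst integral_nonneg_eq_0_iff_AE) (auto simp: L2_rel_def square_integrable_0)
  qed
  then show "0 \<le> inner f f" "inner f f = 0 \<longleftrightarrow> f = 0"
    by (simp_all add: inner_L2_def)
  show "norm f = sqrt (inner f f)"
    by (fact norm_L2_def)
  show "sgn f = inverse (norm f) *\<^sub>R f"
    by (fact sgn_L2_def)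
  show "dist f g = norm (f - g)"
    by (fact dist_L2_def)
  show "uniformity = (INF e\<in>{0 <..}. principal {(f, g :: 'a L2). dist f g < e})"
    by (fact uniformity_L2_def)
  show "open U \<longleftrightarrow> (\<forall>f\<in>U. eventually (\<lambda>(f', g). f' = f \<longrightarrow> g \<in> U) uniformity)" for U :: "'a L2 set"
    by (fact open_L2_def)
qed

end

lemma L2_repE:
  obtains f where "square_integrable f" "x = abs_L2 f"
  by (metis L2_rel_def Quotient_L2 Quotient_abs_rep Quotient_rep_reflp)

lemma L2_rel_refl: "L2_rel f f \<longleftrightarrow> square_integrable f"
  by (simp add: L2_rel_def)

lemma square_integrable_diff:
  "square_integrable f \<Longrightarrow> square_integrable g \<Longrightarrow> square_integrable (\<lambda>x. f x - g x)"
  using square_integrable_add[of f "\<lambda>x. - 1 * g x"] square_integrable_cmult[of g "- 1"] by simp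

lemma abs_L2_diff:
  assumes "square_integrable f" "square_integrable g"
  shows "abs_L2 f - abs_L2 g = abs_L2 (\<lambda>x. f x - g x)"
  using assms square_integrable_cmult[of g "- 1"]
  by (simp add: minus_L2_def uminus_L2_def scaleC_L2.abs_eq plus_L2.abs_eq L2_rel_refl)

lemma norm_abs_L2:
  assumes "square_integrable f"
  shows "(norm (abs_L2 f))\<^sup>2 = (\<integral>x. (cmod (f x))\<^sup>2 \<partial>haar)"
proof -
  have "complex_of_real ((norm (abs_L2 f))\<^sup>2) = (\<integral>x. f x * cnj (f x) \<partial>haar)"
    using assms by (simp add: cinner_self[symmetric] cinner_L2.abs_eq L2_rel_refl del: of_real_power)
  also have "\<dots> = complex_of_real (\<integral>x. (cmod (f x))\<^sup>2 \<partial>haar)"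
    by (simp only: complex_norm_square[symmetric] integral_complex_of_real)
  finally show ?thesis
    by (simp only: of_real_eq_iff)
qed

lemma nn_integral_abs_L2:
  assumes "square_integrable f" "square_integrable g"
  shows "(\<integral>\<^sup>+x. ennreal ((cmod (f x - g x))\<^sup>2) \<partial>haar) = ennreal ((norm (abs_L2 f - abs_L2 g))\<^sup>2)"
  using square_integrable_diff[OF assms]
  by (simp add: abs_L2_diff[OF assms] norm_abs_L2 nn_integral_eq_integral square_integrable_def)

instance L2 :: (haar_group) complex_hilbert
proof
  fix X :: "nat \<Rightarrow> 'a L2"
  assume "Cauchy X"
  then have "\<forall>k. \<exists>N. \<forall>m\<ge>N. \<forall>n\<ge>N. dist (X m) (X n) < (1/2) ^ k"
    unfolding Cauchy_def by simp
  then obtain N where N: "\<And>k m n. m \<ge> N k \<Longrightarrow> n \<ge> N k \<Longrightarrow> dist (X m) (X n) < (1/2) ^ k"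
    by metis
  have "\<forall>n. \<exists>f. square_integrable f \<and> X n = abs_L2 f"
    by (metis L2_repE)
  then obtain F where F: "\<And>n. square_integrable (F n)" "\<And>n. X n = abs_L2 (F n)"
    by metis
  have [measurable]: "F n \<in> borel_measurable haar" for n
    using F(1)[of n] by (simp add: square_integrable_def)
  have dF: "(\<integral>\<^sup>+x. ennreal ((cmod (F m x - F n x))\<^sup>2) \<partial>haar) \<le> ennreal ((1/4) ^ k)"
    if "m \<ge> N k" "n \<ge> N k" for m n k
  proof -
    have "(norm (X m - X n))\<^sup>2 \<le> ((1/2) ^ k)\<^sup>2"
      using N[OF that] by (intro power_mono) (auto simp: dist_norm)
    also have "\<dots> = (1/4 :: real) ^ k"
      by (simp add: power2_eq_square flip: power_mult_distrib)
    finally show ?thesis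
      by (simp add: nn_integral_abs_L2 F(1) F(2)[symmetric])
  qed

  define r where "r k = (\<Sum>i\<le>k. N i) + k" for k
  have r: "r k \<ge> N j" if "j \<le> k" for j k
    unfolding r_def using that by (intro trans_le_add1 member_le_sum) auto
  define D where "D k x = 2 ^ k * (cmod (F (r (Suc k)) x - F (r k) x))\<^sup>2" for k x
  have [measurable]: "D k \<in> borel_measurable haar" for k
    unfolding D_def by measurable
  have D_le: "(\<integral>\<^sup>+x. ennreal (D k x) \<partial>haar) \<le> ennreal ((1/2) ^ k)" for k
  proof -
    have "(\<integral>\<^sup>+x. ennreal (D k x) \<partial>haar) =
        ennreal (2 ^ k) * (\<integral>\<^sup>+x. ennreal ((cmod (F (r (Suc k)) x - F (r k) x))\<^sup>2) \<partial>haar)"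
      unfolding D_def by (simp add: ennreal_mult nn_integral_cmult)
    also have "\<dots> \<le> ennreal (2 ^ k) * ennreal ((1/4) ^ k)"
      by (intro mult_left_mono dF r) auto
    also have "\<dots> = ennreal ((1/2) ^ k)"
      by (simp flip: ennreal_mult power_mult_distrib)
    finally show ?thesis .
  qed
  have "(\<integral>\<^sup>+x. (\<Sum>k. ennreal (D k x)) \<partial>haar) \<le> (\<Sum>k. ennreal ((1/2) ^ k))"
    by (subst nn_integral_suminf) (auto intro!: suminf_le D_le)
  also have "\<dots> = ennreal (\<Sum>k. (1/2) ^ k)"
    by (intro suminf_ennreal2) auto
  also have "\<dots> < \<infinity>"
    by simp
  finally have "AE x in haar. (\<Sum>k. ennreal (D k x)) \<noteq> \<infinity>"
    by (intro nn_integral_noteq_infinite) auto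
  then have conv: "AE x in haar. convergent (\<lambda>k. F (r k) x)"
  proof eventually_elim
    case (elim x)
    have "summable (\<lambda>k. D k x)"
      using elim by (intro summable_suminf_not_top) (auto simp: D_def)
    then have "Bseq (\<lambda>k. D k x)"
      by (intro convergent_imp_Bseq) (auto dest: summable_LIMSEQ_zero simp: convergent_def)
    then obtain C where C: "C > 0" "\<And>k. D k x \<le> C"
      unfolding Bseq_def by (auto simp: D_def)
    have "summable (\<lambda>k. sqrt C * sqrt (1/2) ^ k)"
      by (intro summable_mult summable_geometric) simp
    then have "summable (\<lambda>k. F (r (Suc k)) x - F (r k) x)"
    proof (rule summable_comparison_test')
      fix k
      have "(cmod (F (r (Suc k)) x - F (r k) x))\<^sup>2 \<le> C * (1/2) ^ k"
        using C(2)[of k] by (simp add: D_def field_simps)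
      then have "cmod (F (r (Suc k)) x - F (r k) x) \<le> sqrt (C * (1/2) ^ k)"
        by (rule real_le_rsqrt)
      then show "cmod (F (r (Suc k)) x - F (r k) x) \<le> sqrt C * sqrt (1/2) ^ k"
        by (simp only: real_sqrt_mult real_sqrt_power)
    qed
    then have "convergent (\<lambda>n. \<Sum>k<n. F (r (Suc k)) x - F (r k) x)"
      by (simp add: summable_iff_convergent)
    then have "convergent (\<lambda>n. F (r n) x - F (r 0) x)"
      by (simp add: sum_lessThan_telescope[of "\<lambda>k. F (r k) x"])
    then show ?case
      by (simp add: convergent_diff_const_right_iff)
  qed

  define g where "g x = lim (\<lambda>k. F (r k) x)" for x
  have [measurable]: "g \<in> borel_measurable haar"
    unfolding g_def by measurable
  have Fg: "(\<integral>\<^sup>+x. ennreal ((cmod (F n x - g x))\<^sup>2) \<partial>haar) \<le> ennreal ((1/4) ^ k)"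
    if "n \<ge> N k" for n k
  proof -
    have "(\<integral>\<^sup>+x. ennreal ((cmod (F n x - g x))\<^sup>2) \<partial>haar) =
        (\<integral>\<^sup>+x. liminf (\<lambda>j. ennreal ((cmod (F n x - F (r j) x))\<^sup>2)) \<partial>haar)"
    proof (rule nn_integral_cong_AE)
      show "AE x in haar. ennreal ((cmod (F n x - g x))\<^sup>2) =
          liminf (\<lambda>j. ennreal ((cmod (F n x - F (r j) x))\<^sup>2))"
        using conv
      proof eventually_elim
        case (elim x)
        then have "(\<lambda>j. F (r j) x) \<longlonglongrightarrow> g x"
          by (simp add: g_def convergent_LIMSEQ_iff)
        then have "(\<lambda>j. ennreal ((cmod (F n x - F (r j) x))\<^sup>2)) \<longlonglongrightarrow> ennreal ((cmod (F n x - g x))\<^sup>2)"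
          by (intro tendsto_intros)
        then show ?case
          using lim_imp_Liminf by (metis trivial_limit_sequentially)
      qed
    qed
    also have "\<dots> \<le> liminf (\<lambda>j. \<integral>\<^sup>+x. ennreal ((cmod (F n x - F (r j) x))\<^sup>2) \<partial>haar)"
      by (rule nn_integral_liminf) measurable
    also have "\<dots> \<le> liminf (\<lambda>j::nat. ennreal ((1/4) ^ k))"
    proof (rule Liminf_mono)
      show "\<forall>\<^sub>F j in sequentially. (\<integral>\<^sup>+x. ennreal ((cmod (F n x - F (r j) x))\<^sup>2) \<partial>haar) \<le> ennreal ((1/4) ^ k)"
        using eventually_ge_at_top[of k] by eventually_elim (intro dF that r)
    qed
    also have "\<dots> = ennreal ((1/4) ^ k)"
      by (simp add: Liminf_const)
    finally show ?thesis .
  qed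
  have "square_integrable (\<lambda>x. F (N 0) x - g x)"
    unfolding square_integrable_def
  proof (intro conjI integrableI_nonneg)
    show "(\<integral>\<^sup>+x. ennreal ((cmod (F (N 0) x - g x))\<^sup>2) \<partial>haar) < \<infinity>"
      using Fg[of 0 "N 0"] by (simp add: le_less_trans)
  qed auto
  from square_integrable_diff[OF F(1)[of "N 0"] this] have g: "square_integrable g"
    by simp
  have "X \<longlonglongrightarrow> abs_L2 g"
  proof (rule metric_LIMSEQ_I)
    fix e :: real
    assume "e > 0"
    then obtain k where k: "(1/2) ^ k < e"
      using real_arch_pow_inv[of e "1/2"] by auto
    show "\<exists>M. \<forall>n\<ge>M. dist (X n) (abs_L2 g) < e"
    proof (intro exI[of _ "N k"] allI impI)
      fix n
      assume "n \<ge> N k"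
      from Fg[OF this] have "(norm (X n - abs_L2 g))\<^sup>2 \<le> (1/4) ^ k"
        by (simp add: nn_integral_abs_L2 F(1) g F(2)[symmetric])
      also have "\<dots> = ((1/2 :: real) ^ k)\<^sup>2"
        by (simp add: power2_eq_square flip: power_mult_distrib)
      finally have "norm (X n - abs_L2 g) \<le> (1/2) ^ k"
        by (rule power2_le_imp_le) simp
      then show "dist (X n) (abs_L2 g) < e"
        using k by (simp add: dist_norm)
    qed
  qed
  then show "convergent X"
    by (rule convergentI)
qed


section \<open>The group von Neumann algebra\<close>

lemma measurable_translate: "(\<lambda>t. s + t) \<in> measurable haar (haar :: 'g::haar_group measure)"
proof -
  have "(\<lambda>t. s + t) \<in> borel_measurable (borel :: 'g measure)"
    by (intro borel_measurable_continuous_onI continuous_intros)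
  then show ?thesis
    by (simp cong: measurable_cong_sets)
qed

lemma distr_translate: "distr haar haar (\<lambda>t. s + t) = (haar :: 'g::haar_group measure)"
proof (rule measure_eqI)
  fix A :: "'g set"
  assume A: "A \<in> sets (distr haar haar (\<lambda>t. s + t))"
  have "(\<lambda>t. s + t) -` A = (+) (- s) ` A"
    by (force simp: image_iff simp flip: add.assoc)
  then show "emeasure (distr haar haar (\<lambda>t. s + t)) A = emeasure haar A"
    using A by (simp add: emeasure_distr[OF measurable_translate] haar_left_invariant)
qed simp

lemma integral_translate:
  fixes f :: "'g::haar_group \<Rightarrow> 'b::{banach, second_countable_topology}"
  assumes "f \<in> borel_measurable haar"
  shows "(\<integral>t. f (s + t) \<partial>haar) = (\<integral>t. f t \<partial>haar)"
  using integral_distr[OF measurable_translate assms, of s] by (simp add: distr_translate)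

lemma square_integrable_translate:
  assumes "square_integrable f"
  shows "square_integrable (\<lambda>t. f (s + t))"
proof -
  have f: "f \<in> borel_measurable haar" "integrable haar (\<lambda>t. (cmod (f t))\<^sup>2)"
    using assms by (auto simp: square_integrable_def)
  show ?thesis
    unfolding square_integrable_def
  proof
    show "(\<lambda>t. f (s + t)) \<in> borel_measurable haar"
      by (rule measurable_compose[OF measurable_translate f(1)])
    show "integrable haar (\<lambda>t. (cmod (f (s + t)))\<^sup>2)"
      using integrable_distr[OF measurable_translate, of s "\<lambda>t. (cmod (f t))\<^sup>2"] f(2)
      by (simp add: distr_translate)
  qed
qed

lemma AE_translate:
  assumes "AE t in (haar :: 'g::haar_group measure). P t"
  shows "AE t in haar. P (s + t)"
proof -
  have "AE t in distr haar haar (\<lambda>t. s + t). P t"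
    using assms by (simp only: distr_translate)
  then show ?thesis
    by (rule AE_distrD[OF measurable_translate])
qed

lift_definition translate :: "'g::haar_group \<Rightarrow> 'g L2 \<Rightarrow> 'g L2" is "\<lambda>s f t. f (- s + t)"
  subgoal for s f g
    using AE_translate[of "\<lambda>t. f t = g t" "- s"]
    by (simp add: L2_rel_def square_integrable_translate)
  done

lift_definition lreg :: "'g::haar_group \<Rightarrow> 'g L2 \<Rightarrow>\<^sub>L 'g L2" is translate
proof (rule bounded_linear_intro)
  fix s :: 'g and x y :: "'g L2" and r :: real
  show "translate s (x + y) = translate s x + translate s y"
    by transfer (auto simp: L2_rel_def intro!: square_integrable_translate square_integrable_add)
  show "translate s (r *\<^sub>R x) = r *\<^sub>R translate s x"
    unfolding scaleR_L2_def
    by transfer (auto simp: L2_rel_def intro!: square_integrable_translate square_integrable_cmult)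
  obtain f where f: "square_integrable f" "x = abs_L2 f"
    by (rule L2_repE)
  have "(norm (translate s x))\<^sup>2 = (norm x)\<^sup>2"
    using f integral_translate[of "\<lambda>t. (cmod (f t))\<^sup>2" "- s"]
    by (simp add: translate.abs_eq L2_rel_refl norm_abs_L2 square_integrable_translate)
      (auto simp: square_integrable_def)
  then show "norm (translate s x) \<le> norm x * 1"
    by simp
qed

definition VN :: "('g::haar_group L2 \<Rightarrow>\<^sub>L 'g L2) set" where
  "VN = vn_generated (range lreg)"

definition Cstar_delta :: "('g::haar_group L2 \<Rightarrow>\<^sub>L 'g L2) set" where
  "Cstar_delta = cstar_generated (range lreg)"

text \<open>The defining properties of \<open>\<Delta> : VN G \<rightarrow> VN G \<otimes> VN G\<close>, which determine \<open>\<Delta>\<close> on \<^const>\<open>VN\<close>.\<close>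

definition comultiplication ::
    "('g::haar_group L2 \<Rightarrow> 'g L2 \<Rightarrow> 'k::complex_hilbert) \<Rightarrow>
     (('g L2 \<Rightarrow>\<^sub>L 'g L2) \<Rightarrow> 'k \<Rightarrow>\<^sub>L 'k) \<Rightarrow> bool" where
  "comultiplication tp \<Delta> \<longleftrightarrow> normal_unital_star_hom VN (vn_tensor tp VN VN) \<Delta> \<and>
     (\<forall>s. \<Delta> (lreg s) = op_tensor tp (lreg s) (lreg s))"

end

theory Submission
  imports Defs
begin

text \<open>
  For an inner invariant compact neighbourhood \<open>V\<close> of the identity let \<open>\<zeta>\<^sub>V\<close> be its normalised
  indicator function.  The coisometry sending \<open>\<theta> \<otimes> f\<close> to \<open>y \<mapsto> \<langle>\<theta>, \<lambda>(y) \<zeta>\<^sub>V\<rangle> f(y)\<close> intertwines \<open>\<Delta>(x)\<close> with \<open>x\<close>,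
  so two of them, for neighbourhoods \<open>W\<close> and \<open>V\<close>, give a coisometry \<open>Q\<close> with
  \<open>\<langle>\<Delta>\<^sup>2(x) Q\<^sup>* \<xi>, Q\<^sup>* \<eta>\<rangle> = \<langle>x \<xi>, \<eta>\<rangle>\<close>.  Now let first \<open>W\<close> and then \<open>V\<close> shrink along an ultrafilter.
  For \<open>a \<otimes> b \<otimes> c\<close> in place of \<open>\<Delta>\<^sup>2(x)\<close> invariance of \<open>\<zeta>\<close> turns the left hand side, up to a small error,
  into \<open>\<integral> h\<^sub>W G\<^sub>V\<close>, where \<open>h\<^sub>W = a \<zeta>\<^sub>W \<cdot> b \<zeta>\<^sub>W\<close> is bounded in \<open>L\<^sup>1\<close> and \<open>G\<^sub>V\<close> has, by Bessel's inequality,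
  square summable values at points with disjoint translates of \<open>V\<close>.  So \<open>G\<^sub>V\<close> is small outside few
  translates of a small set, and only finitely many atoms \<open>t\<close> of the limit of \<open>h\<^sub>W\<close> matter; near them
  \<open>G\<^sub>V(t)\<close> tends to a multiple of \<open>\<langle>\<lambda>(t) \<xi>, \<eta>\<rangle>\<close>.  Hence the limit is that of a finite linear combination
  of translations up to \<open>\<epsilon>\<close>, uniformly in unit vectors \<open>\<xi>\<close> and \<open>\<eta>\<close> of compact support.  This property
  passes to the norm closure of the algebraic tensor product, and for \<open>\<Delta>\<^sup>2(x\<^sub>0)\<close> it says that \<open>x\<^sub>0\<close> is a
  norm limit of such combinations.
\<close>

section \<open>Complex Hilbert spaces\<close>

text \<open>The obstacle is the diffuse part of the limit of \<open>h\<^sub>W\<close>. Tested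
  against a fixed coefficient function it would survive, and rightly so: on the circle, convolution
  by a nonzero integrable function lies in \<open>VN\<close> but not in \<open>Cstar_delta\<close>.
  The third leg supplies a test function that lives on the scale of \<open>V\<close>, and at that
  scale a diffuse limit has no mass to offer. The order of choices carries the argument. The finite
  combination may depend on the elementary tensor and on the error only, so the atoms and their
  weights are extracted from the limit over \<open>W\<close> before \<open>V\<close>, the vectors or
  the test function appear. Compact supports enter because the neighbourhood on which the limit is
  under control away from atoms is uniform only over compact sets. Invariant neighbourhoods do
  double duty. Haar measure is assumed left invariant only; its right invariance on compact sets is
  derived from them, and then the diagonal coefficients of \<open>\<zeta>\<close> are class
  functions. Identities about \<open>\<Delta>\<close> are checked on translations and extended by
  normality, which requires the ultraweak density of the span of translations in
  \<open>VN\<close>.\<close>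

instance complex_hilbert \<subseteq> banach ..

lemma cinner_add_right: "cinner x (y + z) = cinner x y + cinner x (z :: 'a::complex_inner)"
  by (simp add: cinner_commute[of x] cinner_add_left)

lemma cinner_scaleR_left [simp]: "cinner (r *\<^sub>R x) y = of_real r * cinner x (y :: 'a::complex_inner)"
  by (simp flip: scaleC_of_real)

lemma cinner_scaleR_right [simp]: "cinner x (r *\<^sub>R y) = of_real r * cinner x (y :: 'a::complex_inner)"
  by (simp flip: scaleC_of_real)

lemma scaleC_minus1: "(- 1) *\<^sub>C x = - (x :: 'a::complex_inner)"
  using scaleC_of_real[of "- 1" x] by simp

lemma scaleC_one [simp]: "1 *\<^sub>C x = (x :: 'a::complex_inner)"
  using scaleC_of_real[of 1 x] by simp

lemma scaleC_zero_left [simp]: "0 *\<^sub>C x = (0 :: 'a::complex_inner)"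
  using scaleC_of_real[of 0 x] by simp

lemma scaleC_zero_right [simp]: "c *\<^sub>C 0 = (0 :: 'a::complex_inner)"
  using scaleC_scaleC[of c 0 "0 :: 'a"] by simp

lemma scaleC_minus_right: "c *\<^sub>C (- x) = - (c *\<^sub>C (x :: 'a::complex_inner))"
  by (simp flip: scaleC_minus1)

lemma scaleC_diff_right: "c *\<^sub>C (x - y) = c *\<^sub>C x - c *\<^sub>C (y :: 'a::complex_inner)"
  unfolding diff_conv_add_uminus by (simp only: scaleC_add_right scaleC_minus_right)

lemma cmod_cinner_le: "cmod (cinner x y) \<le> norm x * norm (y :: 'a::complex_inner)"
proof -
  define c where "c = cinner x y"
  have "(cmod c)\<^sup>2 = Re (c * cnj c)"
    by (simp add: cmod_power2 flip: power2_eq_square)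
  also have "\<dots> = Re (cinner (cnj c *\<^sub>C x) y)"
    by (simp add: c_def mult.commute)
  also have "\<dots> = inner (cnj c *\<^sub>C x) y"
    by (simp add: inner_eq_Re_cinner)
  also have "\<dots> \<le> norm (cnj c *\<^sub>C x) * norm y"
    by (rule norm_cauchy_schwarz)
  finally have "cmod c * cmod c \<le> cmod c * (norm x * norm y)"
    by (simp add: power2_eq_square mult_ac)
  then show ?thesis
    unfolding c_def by (cases "cinner x y = 0") auto
qed

lemma cmod_cinner_self: "cmod (cinner x x) = norm x * norm (x :: 'a::complex_inner)"
  unfolding cinner_self norm_of_real by (simp add: power2_eq_square)

lemma bounded_bilinear_cinner: "bounded_bilinear (cinner :: 'a::complex_inner \<Rightarrow> 'a \<Rightarrow> complex)"
proof
  show "\<exists>K. \<forall>a b :: 'a. norm (cinner a b) \<le> norm a * norm b * K"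
    by (rule exI[of _ 1]) (auto intro: cmod_cinner_le)
qed (auto simp: cinner_add_left cinner_add_right scaleR_conv_of_real)

lemmas cinner_diff_left = bounded_bilinear.diff_left[OF bounded_bilinear_cinner]
  and cinner_diff_right = bounded_bilinear.diff_right[OF bounded_bilinear_cinner]
  and cinner_zero_left [simp] = bounded_bilinear.zero_left[OF bounded_bilinear_cinner]
  and cinner_zero_right [simp] = bounded_bilinear.zero_right[OF bounded_bilinear_cinner]
  and cinner_minus_right = bounded_bilinear.minus_right[OF bounded_bilinear_cinner]
  and cinner_sum_left = bounded_bilinear.sum_left[OF bounded_bilinear_cinner]
  and cinner_sum_right = bounded_bilinear.sum_right[OF bounded_bilinear_cinner]
  and continuous_on_cinner [continuous_intros] = bounded_bilinear.continuous_on[OF bounded_bilinear_cinner]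
  and bounded_linear_cinner_left = bounded_bilinear.bounded_linear_left[OF bounded_bilinear_cinner]

lemma cinner_ext:
  assumes "\<And>y. cinner x y = cinner x' (y :: 'a::complex_inner)"
  shows "x = x'"
proof -
  have "inner (x - x') (x - x') = 0"
    by (simp add: inner_eq_Re_cinner cinner_diff_left assms)
  then show ?thesis
    by simp
qed

text \<open>The imaginary part of \<open>cinner x z\<close> is the real part of
  \<open>cinner ((- \<i>) *\<^sub>C x) z\<close>. This turns Riesz representation for the real inner
  product into complex adjoints.\<close>

lemma cinner_eq_if_inner_eq:
  assumes "\<And>x. inner (f x) y = inner x (z :: 'a::complex_inner)" "\<And>c x. f (c *\<^sub>C x) = c *\<^sub>C f x"
  shows "cinner (f x) (y :: 'b::complex_inner) = cinner x z"
proof (rule complex_eqI)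
  show "Re (cinner (f x) y) = Re (cinner x z)"
    using assms(1)[of x] by (simp add: inner_eq_Re_cinner)
  show "Im (cinner (f x) y) = Im (cinner x z)"
    using assms(1)[of "(- \<i>) *\<^sub>C x"] by (simp add: inner_eq_Re_cinner assms(2))
qed

lemma norm_diff_square:
  "(norm (x - y :: 'a::complex_inner))\<^sup>2 = (norm x)\<^sup>2 + (norm y)\<^sup>2 - 2 * Re (cinner x y)"
  by (simp add: power2_norm_eq_inner inner_diff_left inner_diff_right inner_commute[of y x]
      inner_eq_Re_cinner[symmetric])

subsection \<open>Projections, Riesz representation and adjoints\<close>

text \<open>A minimising sequence for the distance is Cauchy by the parallelogram law, and
  minimality along lines gives orthogonality. The real setting fits the real spans that occur
  everywhere below.\<close>

lemma projection_exists:
  fixes S :: "'a::{real_inner,complete_space} set"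
  assumes "subspace S" "closed S"
  shows "\<exists>p\<in>S. \<forall>y\<in>S. inner (x - p) y = 0"
proof -
  define d where "d = Inf ((\<lambda>y. (norm (x - y))\<^sup>2) ` S)"
  have bdd: "bdd_below ((\<lambda>y. (norm (x - y))\<^sup>2) ` S)"
    by (rule bdd_belowI[of _ 0]) auto
  have ne: "(\<lambda>y. (norm (x - y))\<^sup>2) ` S \<noteq> {}"
    using subspace_0[OF assms(1)] by auto
  have d_le: "d \<le> (norm (x - y))\<^sup>2" if "y \<in> S" for y
    unfolding d_def using that by (intro cInf_lower bdd) auto
  have "\<exists>y\<in>S. (norm (x - y))\<^sup>2 < d + e" if "e > 0" for e
    using cInf_lessD[OF ne, of "d + e"] that unfolding d_def by auto
  then have "\<forall>n. \<exists>y\<in>S. (norm (x - y))\<^sup>2 < d + inverse (real (Suc n))"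
    by simp
  then obtain p where p: "\<And>n. p n \<in> S" "\<And>n. (norm (x - p n))\<^sup>2 < d + inverse (real (Suc n))"
    by metis
  have par: "(norm (p m - p n))\<^sup>2 \<le> 2 * inverse (real (Suc m)) + 2 * inverse (real (Suc n))" for m n
  proof -
    have "(1/2) *\<^sub>R (p m + p n) \<in> S"
      using assms(1) p by (intro subspace_scale subspace_add)
    from d_le[OF this] have "4 * d \<le> 4 * (norm (x - (1/2) *\<^sub>R (p m + p n)))\<^sup>2"
      by simp
    also have "\<dots> = (norm ((x - p m) + (x - p n)))\<^sup>2"
    proof -
      have "(x - p m) + (x - p n) = 2 *\<^sub>R (x - (1/2) *\<^sub>R (p m + p n))"
        by (simp add: algebra_simps scaleR_2)
      then show ?thesis
        by (simp add: power_mult_distrib)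
    qed
    finally have 1: "4 * d \<le> (norm ((x - p m) + (x - p n)))\<^sup>2" .
    have "(norm ((x - p m) + (x - p n)))\<^sup>2 + (norm ((x - p m) - (x - p n)))\<^sup>2
        = 2 * (norm (x - p m))\<^sup>2 + 2 * (norm (x - p n))\<^sup>2"
      by (simp add: power2_norm_eq_inner inner_simps inner_commute)
    moreover have "norm ((x - p m) - (x - p n)) = norm (p m - p n)"
      by (simp add: norm_minus_commute)
    ultimately show ?thesis
      using 1 p(2)[of m] p(2)[of n] by simp
  qed
  have "Cauchy p"
  proof (rule metric_CauchyI)
    fix e :: real
    assume "e > 0"
    then obtain N where N: "inverse (real (Suc N)) < e\<^sup>2 / 4"
      using reals_Archimedean[of "e\<^sup>2 / 4"] by auto
    show "\<exists>M. \<forall>m\<ge>M. \<forall>n\<ge>M. dist (p m) (p n) < e"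
    proof (intro exI allI impI)
      fix m n
      assume "m \<ge> N" "n \<ge> N"
      then have "inverse (real (Suc m)) \<le> inverse (real (Suc N))" "inverse (real (Suc n))
          \<le> inverse (real (Suc N))"
        by (auto intro!: le_imp_inverse_le)
      then have "(norm (p m - p n))\<^sup>2 < e\<^sup>2"
        using par[of m n] N by linarith
      then show "dist (p m) (p n) < e"
        using \<open>e > 0\<close> by (simp add: dist_norm power_less_imp_less_base)
    qed
  qed
  then obtain q where q: "p \<longlonglongrightarrow> q"
    using Cauchy_convergent convergent_def by blast
  have qS: "q \<in> S"
    using closed_sequentially[OF assms(2)] p(1) q by blast
  have "(\<lambda>n. (norm (x - p n))\<^sup>2) \<longlonglongrightarrow> (norm (x - q))\<^sup>2"
    by (intro tendsto_intros q)
  moreover have "(\<lambda>n. d + inverse (real (Suc n))) \<longlonglongrightarrow> d + 0"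
    by (intro tendsto_intros LIMSEQ_inverse_real_of_nat)
  ultimately have qd: "(norm (x - q))\<^sup>2 \<le> d"
    using LIMSEQ_le[of "\<lambda>n. (norm (x - p n))\<^sup>2" _ "\<lambda>n. d + inverse (real (Suc n))" "d + 0"] p(2)
    by (auto intro: less_imp_le)
  have "inner (x - q) y = 0" if y: "y \<in> S" for y
  proof (rule ccontr)
    assume ne: "inner (x - q) y \<noteq> 0"
    define a where "a = inner (x - q) y"
    define b where "b = inner y y"
    have b: "b > 0"
      using ne by (auto simp: b_def)
    \<comment> \<open>This is the point of the line through \<open>q\<close> in direction
      \<open>y\<close> nearest to \<open>x\<close>; it would lower the squared distance by
      \<open>a\<^sup>2 / b\<close>.\<close>
    have "q + (a / b) *\<^sub>R y \<in> S"
      using assms(1) qS y by (intro subspace_add subspace_scale)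
    from order.trans[OF qd d_le[OF this]] have "(norm (x - q))\<^sup>2 \<le> (norm (x - q - (a / b) *\<^sub>R y))\<^sup>2"
      by (simp add: diff_diff_eq)
    also have "\<dots> = (norm (x - q))\<^sup>2 - a\<^sup>2 / b"
    proof -
      have "(norm (u - c *\<^sub>R y))\<^sup>2 = (norm u)\<^sup>2 - 2 * c * inner u y + c\<^sup>2 * inner y y" for u c
        unfolding power2_norm_eq_inner
        by (simp add: inner_diff_left inner_diff_right inner_commute power2_eq_square algebra_simps)
      from this[of "x - q" "a / b"] show ?thesis
        using b by (simp add: a_def[symmetric] b_def[symmetric] power2_eq_square field_simps)
    qed
    finally have "a\<^sup>2 / b \<le> 0"
      by simp
    then show False
      using ne b by (simp add: a_def divide_le_0_iff)
  qed
  then show ?thesis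
    using qS by blast
qed

text \<open>The component of a vector outside the kernel that is orthogonal to the kernel represents
  \<open>f\<close> after rescaling.\<close>

lemma riesz_representation:
  fixes f :: "'a::{real_inner,complete_space} \<Rightarrow> real"
  assumes "bounded_linear f"
  shows "\<exists>z. \<forall>x. f x = inner x z"
proof (cases "\<forall>x. f x = 0")
  case True
  then show ?thesis
    by (intro exI[of _ 0]) simp
next
  case False
  then obtain w where w: "f w \<noteq> 0"
    by blast
  interpret f: bounded_linear f
    by fact
  have sub: "subspace {x. f x = 0}"
    by (auto simp: subspace_def f.add f.scaleR f.zero)
  have "closed {x. f x = 0}"
    by (intro closed_Collect_eq f.continuous_on continuous_on_id continuous_on_const)
  from projection_exists[OF sub this, of w] obtain p
    where p: "f p = 0" "\<And>y. f y = 0 \<Longrightarrow> inner (w - p) y = 0"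
    by blast
  define v where "v = w - p"
  have fv: "f v \<noteq> 0"
    using w p(1) by (simp add: v_def f.diff)
  have vv: "inner v v \<noteq> 0"
    using fv f.zero by auto
  have "f x = inner x ((f v / inner v v) *\<^sub>R v)" for x
  proof -
    have "inner v (x - (f x / f v) *\<^sub>R v) = 0"
      unfolding v_def by (rule p(2)) (use fv in \<open>simp add: f.diff f.scaleR v_def\<close>)
    then have "inner v x = f x / f v * inner v v"
      by (simp add: inner_diff_right)
    then show ?thesis
      using fv vv by (simp add: inner_commute field_simps)
  qed
  then show ?thesis
    by blast
qed

text \<open>\<open>bounded_operators\<close> speaks of operators on one space; the coisometries used
  later go between different spaces.\<close>

definition clin :: "('a::complex_inner \<Rightarrow>\<^sub>L 'b::complex_inner) \<Rightarrow> bool" where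
  "clin T \<longleftrightarrow> (\<forall>c x. T (c *\<^sub>C x) = c *\<^sub>C T x)"

lemma clinD: "clin T \<Longrightarrow> T (c *\<^sub>C x) = c *\<^sub>C T x"
  by (simp add: clin_def)

lemma bounded_operators_iff_clin: "T \<in> bounded_operators \<longleftrightarrow> clin T"
  by (simp add: bounded_operators_def clin_def)

lemma clin_id [simp]: "clin id_blinfun"
  by (simp add: clin_def)

lemma clin_compose: "clin S \<Longrightarrow> clin T \<Longrightarrow> clin (S o\<^sub>L T)"
  by (simp add: clin_def)

lemma clin_add: "clin S \<Longrightarrow> clin T \<Longrightarrow> clin (S + T)"
  by (simp add: clin_def blinfun.add_left scaleC_add_right)

lemma clin_diff: "clin S \<Longrightarrow> clin T \<Longrightarrow> clin (S - T)"
  by (simp add: clin_def blinfun.diff_left scaleC_diff_right)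

lemma clin_zero [simp]: "clin 0"
  by (simp add: clin_def)

lemma scaleC_op_apply [simp]: "scaleC_op c T x = c *\<^sub>C T x"
  by transfer simp

lemma clin_scaleC_op: "clin T \<Longrightarrow> clin (scaleC_op c T)"
  by (simp add: clin_def mult.commute)

text \<open>An adjoint for maps between two spaces, which \<open>cadjoint\<close> does not provide;
  on complex linear operators of one space the two agree by \<open>cadjoint_eq_adj\<close>.\<close>

definition adj :: "('a::complex_hilbert \<Rightarrow>\<^sub>L 'b::complex_hilbert) \<Rightarrow> 'b \<Rightarrow>\<^sub>L 'a" where
  "adj T = (SOME S :: 'b \<Rightarrow>\<^sub>L 'a. \<forall>x y. cinner (T x) y = cinner x (S y))"

lemma adj_exists:
  fixes T :: "'a::complex_hilbert \<Rightarrow>\<^sub>L 'b::complex_hilbert"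
  assumes "clin T"
  shows "\<exists>S :: 'b \<Rightarrow>\<^sub>L 'a. \<forall>x y. cinner (T x) y = cinner x (S y)"
proof -
  have "\<exists>z. \<forall>x. inner (T x) y = inner x z" for y
    by (intro riesz_representation bounded_linear_compose[OF bounded_linear_inner_left]
        blinfun.bounded_linear_right)
  then obtain S where S: "\<And>x y. inner (T x) y = inner x (S y)"
    by metis
  have ext: "u = v" if "\<And>x. inner x u = inner x v" for u v :: 'a
  proof -
    have "inner (u - v) (u - v) = 0"
      using that[of "u - v"] by (simp add: inner_diff_right)
    then show ?thesis
      by simp
  qed
  have "bounded_linear S"
  proof (rule bounded_linear_intro)
    show "S (x + y) = S x + S y" for x y
      by (rule ext) (simp add: inner_add_right flip: S)
    show "S (r *\<^sub>R x) = r *\<^sub>R S x" for r x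
      by (rule ext) (simp flip: S)
    show "norm (S y) \<le> norm y * norm T" for y
    proof -
      have "norm (S y) * norm (S y) = inner (T (S y)) y"
        by (simp add: S flip: power2_norm_eq_inner power2_eq_square)
      also have "\<dots> \<le> (norm T * norm (S y)) * norm y"
        by (rule order.trans[OF norm_cauchy_schwarz]) (intro mult_right_mono norm_blinfun norm_ge_zero)
      finally show ?thesis
        by (cases "S y = 0") (auto simp: mult_ac)
    qed
  qed
  then have "cinner (T x) y = cinner x (Blinfun S y)" for x y
    by (simp add: bounded_linear_Blinfun_apply S cinner_eq_if_inner_eq clinD[OF assms])
  then show ?thesis
    by blast
qed

lemma cinner_adj: "clin T \<Longrightarrow> cinner (T x) y = cinner x (adj T y)"
  using someI_ex[OF adj_exists, of T] unfolding adj_def[symmetric] by blast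

lemma cinner_adj': "clin T \<Longrightarrow> cinner (adj T x) y = cinner x (T y)"
  by (subst cinner_commute, subst cinner_adj[symmetric]) (auto intro: cinner_commute[symmetric])

lemma adj_unique:
  fixes S :: "'b::complex_hilbert \<Rightarrow>\<^sub>L 'a::complex_hilbert"
  assumes "clin T" "\<And>x y. cinner (T x) y = cinner x (S y)"
  shows "adj T = S"
proof (rule blinfun_eqI)
  fix y
  have "cinner (adj T y) x = cinner (S y) x" for x
    using assms(2)[of x y] cinner_adj[OF assms(1), of x y]
    by (simp add: cinner_commute[of "adj T y"] cinner_commute[of "S y"])
  then show "adj T y = S y"
    by (rule cinner_ext)
qed

lemma clin_adj [simp]:
  assumes "clin T"
  shows "clin (adj T)"
  unfolding clin_def
proof (intro allI)
  fix c x
  show "adj T (c *\<^sub>C x) = c *\<^sub>C adj T x"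
    by (rule cinner_ext) (simp add: cinner_adj'[OF assms])
qed

lemma norm_adj_le:
  assumes "clin T"
  shows "norm (adj T) \<le> norm T"
proof (rule norm_blinfun_bound)
  fix y
  have "norm (adj T y) * norm (adj T y) = cmod (cinner (T (adj T y)) y)"
    unfolding cinner_adj[OF assms] cmod_cinner_self ..
  also have "\<dots> \<le> (norm T * norm (adj T y)) * norm y"
    by (rule order.trans[OF cmod_cinner_le]) (intro mult_right_mono norm_blinfun norm_ge_zero)
  finally show "norm (adj T y) \<le> norm T * norm y"
    by (cases "adj T y = 0") (auto simp: mult_ac)
qed simp

lemma cadjoint_eq_adj:
  assumes "clin T"
  shows "cadjoint T = adj T"
  unfolding cadjoint_def
proof (rule the_equality)
  show "\<forall>x y. cinner (T x) y = cinner x (adj T y)"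
    by (simp add: cinner_adj assms)
  fix S :: "'a \<Rightarrow>\<^sub>L 'a"
  assume "\<forall>x y. cinner (T x) y = cinner x (S y)"
  then show "S = adj T"
    using adj_unique[OF assms, of S] by simp
qed

lemma adj_adj: "clin T \<Longrightarrow> adj (adj T) = T"
  by (rule adj_unique) (auto simp: cinner_adj')

lemma adj_compose: "clin S \<Longrightarrow> clin T \<Longrightarrow> adj (S o\<^sub>L T) = adj T o\<^sub>L adj S"
  by (rule adj_unique) (auto simp: cinner_adj clin_compose)

section \<open>Equality of operators and vectors tested on dense spans\<close>

lemma closure_span_subset:
  fixes S :: "'a::real_normed_vector set"
  assumes "subspace S" "closed S" "X \<subseteq> S"
  shows "closure (span X) \<subseteq> S"
  using assms by (intro closure_minimal span_minimal)

lemma bounded_linear_eq_on_dense: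
  assumes "closure (span X) = UNIV" "bounded_linear f" "bounded_linear g" "\<And>x. x \<in> X \<Longrightarrow> f x = g x"
  shows "f = g"
proof -
  interpret f: bounded_linear f by fact
  interpret g: bounded_linear g by fact
  have "subspace {x. f x = g x}"
    by (auto simp: subspace_def f.add g.add f.scaleR g.scaleR f.zero g.zero)
  moreover have "closed {x. f x = g x}"
    by (intro closed_Collect_eq f.continuous_on g.continuous_on continuous_on_id)
  ultimately have "closure (span X) \<subseteq> {x. f x = g x}"
    using assms(4) by (intro closure_span_subset) auto
  then show ?thesis
    using assms(1) by auto
qed

lemma blinfun_eq_on_dense:
  assumes "closure (span X) = UNIV" "\<And>x. x \<in> X \<Longrightarrow> blinfun_apply S x = blinfun_apply T x"
  shows "S = T"
  using bounded_linear_eq_on_dense[OF assms(1) blinfun.bounded_linear_right blinfun.bounded_linear_right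
      assms(2)]
  by (simp add: blinfun_apply_inject)

lemma cinner_eq_on_dense:
  assumes "closure (span X) = UNIV" "\<And>x. x \<in> X \<Longrightarrow> cinner x u = cinner x (v :: 'a::complex_inner)"
  shows "u = v"
proof (rule cinner_ext)
  fix y
  have "(\<lambda>x. cinner x u) = (\<lambda>x. cinner x v)"
    by (rule bounded_linear_eq_on_dense[OF assms(1) bounded_linear_cinner_left bounded_linear_cinner_left
        assms(2)])
  then show "cinner u y = cinner v y"
    unfolding cinner_commute[of u] cinner_commute[of v] by metis
qed

lemma norm_le_if_cinner_le:
  assumes "0 \<le> C" "\<And>y. cmod (cinner x y) \<le> C * norm (y :: 'a::complex_inner)"
  shows "norm x \<le> C"
  using assms(2)[of x] assms(1)
  by (cases "x = 0") (auto simp: cmod_cinner_self)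

section \<open>Hilbert space tensor products\<close>

context
  fixes tp :: "'a::complex_hilbert \<Rightarrow> 'b::complex_hilbert \<Rightarrow> 'k::complex_hilbert"
  assumes tp: "hilbert_tensor tp"
begin

lemma tensor_add_left: "tp (x + x') y = tp x y + tp x' y"
  using tp by (simp add: hilbert_tensor_def)

lemma tensor_add_right: "tp x (y + y') = tp x y + tp x y'"
  using tp by (simp add: hilbert_tensor_def)

lemma tensor_scaleC_left: "tp (c *\<^sub>C x) y = c *\<^sub>C tp x y"
  using tp by (simp add: hilbert_tensor_def)

lemma tensor_scaleC_right: "tp x (c *\<^sub>C y) = c *\<^sub>C tp x y"
  using tp by (simp add: hilbert_tensor_def)

lemma cinner_tensor: "cinner (tp x y) (tp x' y') = cinner x x' * cinner y y'"
  using tp by (simp add: hilbert_tensor_def)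

lemma tensor_dense: "closure (span {tp x y | x y. True}) = UNIV"
  using tp by (simp add: hilbert_tensor_def)

lemma norm_tensor: "norm (tp x y) = norm x * norm y"
proof -
  have "complex_of_real ((norm (tp x y))\<^sup>2) = complex_of_real ((norm x * norm y)\<^sup>2)"
    by (simp only: cinner_self[symmetric] cinner_tensor) (simp add: cinner_self power_mult_distrib)
  then have "(norm (tp x y))\<^sup>2 = (norm x * norm y)\<^sup>2"
    by (simp only: of_real_eq_iff)
  then show ?thesis
    by simp
qed

lemma bounded_bilinear_tensor: "bounded_bilinear tp"
proof
  show "tp (r *\<^sub>R x) y = r *\<^sub>R tp x y" "tp x (r *\<^sub>R y) = r *\<^sub>R tp x y" for r x y
    by (simp_all add: tensor_scaleC_left tensor_scaleC_right flip: scaleC_of_real)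
  show "\<exists>K. \<forall>x y. norm (tp x y) \<le> norm x * norm y * K"
    by (rule exI[of _ 1]) (simp add: norm_tensor)
qed (fact tensor_add_left tensor_add_right)+

lemma hilbert_tensor_flip: "hilbert_tensor (\<lambda>y x. tp x y)"
proof -
  have "{tp x y | y x. True} = {tp x y | x y. True}"
    by auto
  then show ?thesis
    using tp by (simp add: hilbert_tensor_def mult.commute)
qed

end

text \<open>Lists serve as formal sums of elementary tensors, that is, as unreduced representatives
  of the algebraic tensor product. No quotient is formed: well-definedness always comes from a norm
  bound valid for every list.\<close>

definition tensor_sum :: "('a \<Rightarrow> 'b \<Rightarrow> 'c::monoid_add) \<Rightarrow> ('a \<times> 'b) list \<Rightarrow> 'c" where
  "tensor_sum B L = (\<Sum>(x, y)\<leftarrow>L. B x y)"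

lemma tensor_sum_simps [simp]:
  "tensor_sum B [] = 0" "tensor_sum B ((x, y) # L) = B x y + tensor_sum B L"
  "tensor_sum B (L @ L') = tensor_sum B L + tensor_sum B L'"
  by (simp_all add: tensor_sum_def)

lemma tensor_sum_scale:
  assumes "\<And>x y. B (r *\<^sub>R x) y = r *\<^sub>R (B x y :: 'c::real_vector)"
  shows "tensor_sum B (map (\<lambda>(x, y). (r *\<^sub>R x, y)) L) = r *\<^sub>R tensor_sum B L"
  by (induction L) (auto simp: assms scaleR_add_right)

lemma span_tensor_subset:
  assumes tp: "hilbert_tensor tp"
  shows "span {tp x y | x y. True} \<subseteq> range (tensor_sum tp)"
proof (rule span_minimal)
  show "{tp x y | x y. True} \<subseteq> range (tensor_sum tp)"
  proof safe
    fix x y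
    show "tp x y \<in> range (tensor_sum tp)"
      by (rule range_eqI[of _ _ "[(x, y)]"]) simp
  qed
  show "subspace (range (tensor_sum tp))"
    unfolding subspace_def
  proof (intro conjI ballI allI)
    show "0 \<in> range (tensor_sum tp)"
      by (rule range_eqI[of _ _ "[]"]) simp
    fix u v r
    assume "u \<in> range (tensor_sum tp)" "v \<in> range (tensor_sum tp)"
    then show "u + v \<in> range (tensor_sum tp)"
      by (auto simp flip: tensor_sum_simps(3))
  next
    fix u r
    assume "u \<in> range (tensor_sum tp)"
    then obtain L where "u = tensor_sum tp L"
      by auto
    then show "r *\<^sub>R u \<in> range (tensor_sum tp)"
      using tensor_sum_scale[of tp r, OF bounded_bilinear.scaleR_left[OF bounded_bilinear_tensor[OF tp]], of L]
      by (metis \<open>u = tensor_sum tp L\<close> rangeI)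
  qed
qed

text \<open>The bound over all formal sums makes the closure of the graph the graph of a function:
  density and completeness give totality, the bound gives uniqueness. Addition is concatenation of
  lists, and scaling acts on the first entries.\<close>

lemma tensor_extend:
  fixes tp :: "'a::complex_hilbert \<Rightarrow> 'b::complex_hilbert \<Rightarrow> 'k::complex_hilbert"
    and B :: "'a \<Rightarrow> 'b \<Rightarrow> 'c::banach"
  assumes tp: "hilbert_tensor tp"
    and scale: "\<And>r x y. B (r *\<^sub>R x) y = r *\<^sub>R B x y"
    and bound: "\<And>L. norm (tensor_sum B L) \<le> C * norm (tensor_sum tp L)"
    and C: "0 \<le> C"
  shows "\<exists>R :: 'k \<Rightarrow>\<^sub>L 'c. (\<forall>x y. blinfun_apply R (tp x y) = B x y) \<and> norm R \<le> C"
proof -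
  \<comment> \<open>\<open>G\<close> is the sequential closure of the set of pairs (tensor sum,
    intended image).\<close>
  define G where "G z w \<longleftrightarrow> (\<exists>L. (\<lambda>n. tensor_sum tp (L n)) \<longlonglongrightarrow> z \<and> (\<lambda>n::nat. tensor_sum B (L n)) \<longlonglongrightarrow> w)" for z w
  note tpscale = bounded_bilinear.scaleR_left[OF bounded_bilinear_tensor[OF tp]]
  have G_add: "G (z + z') (w + w')" if G: "G z w" "G z' w'" for z z' w w'
  proof -
    obtain L L' where "(\<lambda>n. tensor_sum tp (L n)) \<longlonglongrightarrow> z" "(\<lambda>n. tensor_sum B (L n)) \<longlonglongrightarrow> w"
      "(\<lambda>n. tensor_sum tp (L' n)) \<longlonglongrightarrow> z'" "(\<lambda>n. tensor_sum B (L' n)) \<longlonglongrightarrow> w'"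
      using G unfolding G_def by blast
    then show ?thesis
      unfolding G_def by (intro exI[of _ "\<lambda>n. L n @ L' n"]) (auto intro: tendsto_add)
  qed
  have G_scale: "G (r *\<^sub>R z) (r *\<^sub>R w)" if G: "G z w" for r z w
  proof -
    obtain L where "(\<lambda>n. tensor_sum tp (L n)) \<longlonglongrightarrow> z" "(\<lambda>n. tensor_sum B (L n)) \<longlonglongrightarrow> w"
      using G unfolding G_def by blast
    then show ?thesis
      unfolding G_def
      by (intro exI[of _ "\<lambda>n. map (\<lambda>(x, y). (r *\<^sub>R x, y)) (L n)"])
         (auto simp: tensor_sum_scale[of B, OF scale] tensor_sum_scale[of tp, OF tpscale]
             intro!: tendsto_intros)
  qed
  have G_norm: "norm w \<le> C * norm z" if G: "G z w" for z w
  proof -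
    obtain L where "(\<lambda>n. tensor_sum tp (L n)) \<longlonglongrightarrow> z" "(\<lambda>n. tensor_sum B (L n)) \<longlonglongrightarrow> w"
      using G unfolding G_def by blast
    then show ?thesis
      by (intro LIMSEQ_le[OF tendsto_norm tendsto_mult[OF tendsto_const tendsto_norm]]) (auto intro: bound)
  qed
  have G_total: "\<exists>w. G z w" for z
  proof -
    have "z \<in> closure (range (tensor_sum tp))"
      using tensor_dense[OF tp] closure_mono[OF span_tensor_subset[OF tp]] by auto
    then obtain u where "\<And>n. u n \<in> range (tensor_sum tp)" "u \<longlonglongrightarrow> z"
      unfolding closure_sequential by blast
    then have "\<exists>L. \<forall>n. u n = tensor_sum tp (L n)"
      by (intro choice) auto
    then obtain L where "u = (\<lambda>n. tensor_sum tp (L n))"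
      by auto
    with \<open>u \<longlonglongrightarrow> z\<close> have L: "(\<lambda>n. tensor_sum tp (L n)) \<longlonglongrightarrow> z"
      by simp
    have d: "dist (tensor_sum B (L m)) (tensor_sum B (L n))
        \<le> C * dist (tensor_sum tp (L m)) (tensor_sum tp (L n))" for m n
    proof -
      let ?L = "L m @ map (\<lambda>(x, y). ((- 1) *\<^sub>R x, y)) (L n)"
      have "tensor_sum B ?L = tensor_sum B (L m) - tensor_sum B (L n)"
        "tensor_sum tp ?L = tensor_sum tp (L m) - tensor_sum tp (L n)"
        using tensor_sum_scale[of B "- 1", OF scale, of "L n"]
          tensor_sum_scale[of tp "- 1", OF tpscale, of "L n"] by simp_all
      then show ?thesis
        using bound[of ?L] by (simp add: dist_norm)
    qed
    have "Cauchy (\<lambda>n. tensor_sum B (L n))"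
    proof (rule metric_CauchyI)
      fix e :: real
      assume e: "e > 0"
      have "Cauchy (\<lambda>n. tensor_sum tp (L n))"
        using L by (rule LIMSEQ_imp_Cauchy)
      then obtain M where M: "\<And>m n. m \<ge> M \<Longrightarrow> n \<ge> M \<Longrightarrow> dist (tensor_sum tp (L m)) (tensor_sum tp (L n))
          < e / (C + 1)"
        using C e unfolding Cauchy_def by (metis add_nonneg_pos divide_pos_pos zero_less_one)
      show "\<exists>M. \<forall>m\<ge>M. \<forall>n\<ge>M. dist (tensor_sum B (L m)) (tensor_sum B (L n)) < e"
      proof (intro exI allI impI)
        fix m n
        assume "m \<ge> M" "n \<ge> M"
        then have "C * dist (tensor_sum tp (L m)) (tensor_sum tp (L n)) \<le> C * (e / (C + 1))"
          using M C by (intro mult_left_mono) (auto intro: less_imp_le)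
        also have "\<dots> < e"
          using C e by (simp add: field_simps)
        finally show "dist (tensor_sum B (L m)) (tensor_sum B (L n)) < e"
          using d[of m n] by linarith
      qed
    qed
    then show ?thesis
      unfolding G_def using L Cauchy_convergent convergent_def by blast
  qed
  have G_unique: "w = w'" if "G z w" "G z w'" for z w w'
    using G_norm[OF G_add[OF that(1) G_scale[OF that(2), of "- 1"]]] by simp
  obtain R where R: "\<And>z. G z (R z)"
    using G_total by metis
  have "bounded_linear R"
  proof (rule bounded_linear_intro)
    show "R (z + z') = R z + R z'" for z z'
      by (rule G_unique[OF R G_add[OF R R]])
    show "R (r *\<^sub>R z) = r *\<^sub>R R z" for r z
      by (rule G_unique[OF R G_scale[OF R]])
    show "norm (R z) \<le> norm z * C" for z
      using G_norm[OF R, of z] by (simp add: mult.commute)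
  qed
  then have bl: "blinfun_apply (Blinfun R) = R"
    by (rule bounded_linear_Blinfun_apply)
  show ?thesis
  proof (intro exI conjI allI)
    fix x y
    have "G (tp x y) (B x y)"
      unfolding G_def by (intro exI[of _ "\<lambda>_. [(x, y)]"]) simp
    then show "Blinfun R (tp x y) = B x y"
      using G_unique[OF R] bl by simp
    show "norm (Blinfun R) \<le> C"
      using G_norm[OF R] C by (intro norm_blinfun_bound) (auto simp: bl)
  qed
qed

lemma clin_on_tensor:
  assumes tp: "hilbert_tensor tp" and "\<And>c x y. blinfun_apply R (c *\<^sub>C tp x y) = c *\<^sub>C blinfun_apply R (tp x y)"
  shows "clin R"
  unfolding clin_def
proof (intro allI)
  fix c z
  have "(\<lambda>z. R (c *\<^sub>C z)) = (\<lambda>z. c *\<^sub>C R z)"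
    by (rule bounded_linear_eq_on_dense[OF tensor_dense[OF tp]])
       (use assms(2) in \<open>auto intro!: bounded_linear_compose[OF blinfun.bounded_linear_right]
         bounded_linear_compose[OF bounded_linear_scaleC] bounded_linear_scaleC blinfun.bounded_linear_right\<close>)
  then show "R (c *\<^sub>C z) = c *\<^sub>C R z"
    by metis
qed

lemma tensor_blinfun_eqI:
  assumes "hilbert_tensor tp" "\<And>x y. blinfun_apply R (tp x y) = blinfun_apply R' (tp x y)"
  shows "R = R'"
  by (rule blinfun_eq_on_dense[OF tensor_dense[OF assms(1)]]) (use assms(2) in auto)

text \<open>Boundedness of \<open>S\<close> tensored with the identity, without orthonormal bases.
  Making the second entries orthogonal to that of the first term splits off one elementary tensor.
  It is orthogonal to the rest both before and after applying \<open>S\<close>, because the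
  orthogonality sits in the untouched leg; Pythagoras and induction on the number of terms
  finish.\<close>

lemma tensor_left_bound:
  fixes tp :: "'a::complex_hilbert \<Rightarrow> 'b::complex_hilbert \<Rightarrow> 'k::complex_hilbert"
    and tp' :: "'c::complex_hilbert \<Rightarrow> 'b \<Rightarrow> 'l::complex_hilbert"
    and S :: "'a \<Rightarrow>\<^sub>L 'c"
  assumes tp: "hilbert_tensor tp" and tp': "hilbert_tensor tp'" and S: "clin S"
  shows "(norm (tensor_sum (\<lambda>x y. tp' (S x) y) L))\<^sup>2 \<le> (norm S)\<^sup>2 * (norm (tensor_sum tp L))\<^sup>2"
proof (induction "length L" arbitrary: L)
  case 0
  then show ?case
    by simp
next
  case (Suc n)
  then obtain x0 y0 L' where L: "L = (x0, y0) # L'"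
    by (metis length_Suc_conv surj_pair)
  interpret T: bounded_bilinear tp
    by (rule bounded_bilinear_tensor[OF tp])
  interpret T': bounded_bilinear tp'
    by (rule bounded_bilinear_tensor[OF tp'])
  define c where "c y = (if y0 = 0 then 0 else cinner y y0 / (norm y0)\<^sup>2)" for y
  have c: "cinner y0 (y - c y *\<^sub>C y0) = 0" for y
    by (auto simp: c_def cinner_diff_right cinner_self) (metis cinner_commute)
  define L2 where "L2 = map (\<lambda>(x, y). (x, y - c y *\<^sub>C y0)) L'"
  \<comment> \<open>Absorbs the components of all other second entries along \<open>y0\<close>, so
    the remaining list \<open>L2\<close> is one term shorter than \<open>L\<close>.\<close>
  define x1 where "x1 = x0 + (\<Sum>(x, y)\<leftarrow>L'. c y *\<^sub>C x)"
  have 1: "tensor_sum tp L = tp x1 y0 + tensor_sum tp L2"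
    unfolding L L2_def x1_def
    by (induction L') (auto simp: T.add_left T.diff_right tensor_scaleC_left[OF tp]
        tensor_scaleC_right[OF tp] algebra_simps)
  have 2: "tensor_sum (\<lambda>x y. tp' (S x) y) L = tp' (S x1) y0 + tensor_sum (\<lambda>x y. tp' (S x) y) L2"
    unfolding L L2_def x1_def
    by (induction L') (auto simp: T'.add_left T'.diff_right tensor_scaleC_left[OF tp']
        tensor_scaleC_right[OF tp']
        blinfun.add_right clinD[OF S] algebra_simps blinfun.zero_right T'.zero_left)
  have o1: "cinner (tp x1 y0) (tensor_sum tp L2) = 0"
    unfolding L2_def by (induction L') (auto simp: cinner_add_right cinner_tensor[OF tp] c)
  have o2: "cinner (tp' (S x1) y0) (tensor_sum (\<lambda>x y. tp' (S x) y) L2) = 0"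
    unfolding L2_def by (induction L') (auto simp: cinner_add_right cinner_tensor[OF tp'] c)
  have pyth: "(norm (u + v))\<^sup>2 = (norm u)\<^sup>2 + (norm v)\<^sup>2" if "cinner u v = 0" for u v :: "'z::complex_inner"
    using norm_diff_square[of u "- v"] that by (simp add: cinner_minus_right)
  have "(norm (tensor_sum (\<lambda>x y. tp' (S x) y) L))\<^sup>2
      = (norm (S x1) * norm y0)\<^sup>2 + (norm (tensor_sum (\<lambda>x y. tp' (S x) y) L2))\<^sup>2"
    unfolding 2 pyth[OF o2] by (simp add: norm_tensor[OF tp'])
  also have "\<dots> \<le> ((norm S * norm x1) * norm y0)\<^sup>2 + (norm S)\<^sup>2 * (norm (tensor_sum tp L2))\<^sup>2"
    using Suc.hyps by (intro add_mono power_mono mult_right_mono norm_blinfun) (auto simp: L2_def L)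
  also have "\<dots> = (norm S)\<^sup>2 * (norm (tensor_sum tp L))\<^sup>2"
    unfolding 1 pyth[OF o1] by (simp add: norm_tensor[OF tp] power_mult_distrib algebra_simps)
  finally show ?case .
qed

lemma tensor_left_exists:
  fixes tp :: "'a::complex_hilbert \<Rightarrow> 'b::complex_hilbert \<Rightarrow> 'k::complex_hilbert"
    and tp' :: "'c::complex_hilbert \<Rightarrow> 'b \<Rightarrow> 'l::complex_hilbert"
    and S :: "'a \<Rightarrow>\<^sub>L 'c"
  assumes tp: "hilbert_tensor tp" and tp': "hilbert_tensor tp'" and S: "clin S"
  shows "\<exists>R :: 'k \<Rightarrow>\<^sub>L 'l. (\<forall>x y. blinfun_apply R (tp x y) = tp' (S x) y) \<and> norm R \<le> norm S"
proof (rule tensor_extend[OF tp, where B = "\<lambda>x y. tp' (blinfun_apply S x) y"])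
  show "tp' (S (r *\<^sub>R x)) y = r *\<^sub>R tp' (S x) y" for r x y
    using bounded_bilinear.scaleR_left[OF bounded_bilinear_tensor[OF tp']] by (simp add: blinfun.scaleR_right)
  show "norm (tensor_sum (\<lambda>x y. tp' (S x) y) L) \<le> norm S * norm (tensor_sum tp L)" for L
    by (rule power2_le_imp_le) (use tensor_left_bound[OF assms, of L] in \<open>simp_all add: power_mult_distrib\<close>)
qed simp

lemma tensor_clinI:
  assumes tp: "hilbert_tensor tp" and tp': "hilbert_tensor tp'" and "clin S"
    and R: "\<And>x y. blinfun_apply R (tp x y) = tp' (blinfun_apply S x) (f y)"
  shows "clin R"
proof (rule clin_on_tensor[OF tp])
  fix c x y
  have "R (c *\<^sub>C tp x y) = R (tp (c *\<^sub>C x) y)"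
    by (simp add: tensor_scaleC_left[OF tp])
  then show "R (c *\<^sub>C tp x y) = c *\<^sub>C R (tp x y)"
    by (simp add: R clinD[OF \<open>clin S\<close>] tensor_scaleC_left[OF tp'])
qed

lemma clin_scaleR: "clin T \<Longrightarrow> clin (r *\<^sub>R T)"
  by (simp add: clin_def blinfun.scaleR_left mult.commute flip: scaleC_of_real)

text \<open>\<open>S\<close> tensored with the identity when \<open>S\<close> changes the space.
  \<open>op_tensor\<close> keeps both legs, so it cannot express the coisometry on the first two
  legs of a triple tensor product.\<close>

definition tensor_left ::
    "('a::complex_hilbert \<Rightarrow> 'b::complex_hilbert \<Rightarrow> 'k::complex_hilbert) \<Rightarrow>
     ('c::complex_hilbert \<Rightarrow> 'b \<Rightarrow> 'l::complex_hilbert) \<Rightarrow> ('a \<Rightarrow>\<^sub>L 'c) \<Rightarrow> 'k \<Rightarrow>\<^sub>L 'l" where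
  "tensor_left tp tp' S = (SOME R :: 'k \<Rightarrow>\<^sub>L 'l. (\<forall>x y. blinfun_apply R (tp x y) = tp' (S x) y) \<and> norm R
      \<le> norm S)"

context
  fixes tp :: "'a::complex_hilbert \<Rightarrow> 'b::complex_hilbert \<Rightarrow> 'k::complex_hilbert"
    and tp' :: "'c::complex_hilbert \<Rightarrow> 'b \<Rightarrow> 'l::complex_hilbert"
    and S :: "'a \<Rightarrow>\<^sub>L 'c"
  assumes tp: "hilbert_tensor tp" and tp': "hilbert_tensor tp'" and S: "clin S"
begin

lemma tensor_left_apply [simp]: "tensor_left tp tp' S (tp x y) = tp' (S x) y"
  and norm_tensor_left: "norm (tensor_left tp tp' S) \<le> norm S"
  using someI_ex[OF tensor_left_exists[OF tp tp' S]] unfolding tensor_left_def by simp_all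

lemma clin_tensor_left [simp]: "clin (tensor_left tp tp' S)"
  by (rule tensor_clinI[OF tp tp' S tensor_left_apply])

end

lemma adj_tensor_left_apply:
  assumes tp: "hilbert_tensor tp" and tp': "hilbert_tensor tp'" and S: "clin S"
  shows "adj (tensor_left tp tp' S) (tp' x y) = tp (adj S x) y"
proof (rule cinner_eq_on_dense[OF tensor_dense[OF tp]])
  fix z
  assume "z \<in> {tp x y | x y. True}"
  then show "cinner z (adj (tensor_left tp tp' S) (tp' x y)) = cinner z (tp (adj S x) y)"
    by (auto simp: cinner_adj[symmetric] assms cinner_tensor[OF tp] cinner_tensor[OF tp'])
qed

section \<open>Tensor products of two operators\<close>

context
  fixes tp :: "'a::complex_hilbert \<Rightarrow> 'b::complex_hilbert \<Rightarrow> 'k::complex_hilbert"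
  assumes tp: "hilbert_tensor tp"
begin

text \<open>The product of two one-leg operators; the one acting on the right leg is
  \<open>tensor_left\<close> for the flipped tensor product.\<close>

lemma op_tensor_exists:
  assumes S: "clin S" and T: "clin T"
  shows "\<exists>R :: 'k \<Rightarrow>\<^sub>L 'k. (\<forall>x y. blinfun_apply R (tp x y) = tp (S x) (T y)) \<and> norm R \<le> norm S * norm T"
proof -
  note fl = hilbert_tensor_flip[OF tp]
  let ?A = "tensor_left tp tp S" and ?B = "tensor_left (\<lambda>y x. tp x y) (\<lambda>y x. tp x y) T"
  have "?B (tp x y) = tp x (T y)" for x y
    using tensor_left_apply[OF fl fl T] .
  then have "(?A o\<^sub>L ?B) (tp x y) = tp (S x) (T y)" for x y
    by (simp add: tensor_left_apply[OF tp tp S])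
  moreover have "norm (?A o\<^sub>L ?B) \<le> norm S * norm T"
    by (rule order.trans[OF norm_blinfun_compose])
       (intro mult_mono norm_tensor_left tp fl S T norm_ge_zero)
  ultimately show ?thesis
    by blast
qed

lemma
  assumes S: "clin S" and T: "clin T"
  shows op_tensor_apply: "op_tensor tp S T (tp x y) = tp (S x) (T y)"
    and norm_op_tensor: "norm (op_tensor tp S T) \<le> norm S * norm T"
proof -
  obtain R :: "'k \<Rightarrow>\<^sub>L 'k" where R: "\<And>x y. R (tp x y) = tp (S x) (T y)" "norm R \<le> norm S * norm T"
    using op_tensor_exists[OF assms] by blast
  have "op_tensor tp S T = R"
    unfolding op_tensor_def
    by (rule the_equality) (use R in \<open>auto intro: tensor_blinfun_eqI[OF tp]\<close>)
  then show "op_tensor tp S T (tp x y) = tp (S x) (T y)" "norm (op_tensor tp S T) \<le> norm S * norm T"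
    using R by auto
qed

lemma op_tensor_eqI:
  assumes "\<And>x y. blinfun_apply R (tp x y) = tp (blinfun_apply S x) (blinfun_apply T y)" "clin S" "clin T"
  shows "op_tensor tp S T = R"
  by (rule tensor_blinfun_eqI[OF tp]) (simp add: assms op_tensor_apply)

lemma clin_op_tensor:
  assumes "clin S" "clin T"
  shows "clin (op_tensor tp S T)"
  by (rule tensor_clinI[OF tp tp assms(1) op_tensor_apply[OF assms]])

lemma op_tensor_id: "op_tensor tp id_blinfun id_blinfun = id_blinfun"
  by (rule op_tensor_eqI) auto

lemma op_tensor_add_left:
  assumes "clin S" "clin T" "clin S'"
  shows "op_tensor tp (S + S') T = op_tensor tp S T + op_tensor tp S' T"
  by (rule op_tensor_eqI)
     (simp_all add: assms op_tensor_apply clin_add blinfun.add_left tensor_add_left[OF tp])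

lemma op_tensor_diff_left:
  assumes "clin S" "clin T" "clin S'"
  shows "op_tensor tp (S - S') T = op_tensor tp S T - op_tensor tp S' T"
  by (rule op_tensor_eqI)
     (simp_all add: assms op_tensor_apply clin_diff blinfun.diff_left
       bounded_bilinear.diff_left[OF bounded_bilinear_tensor[OF tp]])

lemma op_tensor_scaleR_left:
  assumes "clin S" "clin T"
  shows "op_tensor tp (r *\<^sub>R S) T = r *\<^sub>R op_tensor tp S T"
  by (rule op_tensor_eqI)
     (simp_all add: assms op_tensor_apply clin_scaleR blinfun.scaleR_left
       bounded_bilinear.scaleR_left[OF bounded_bilinear_tensor[OF tp]])

end

section \<open>Square summable families\<close>

text \<open>The Hilbert sum of copies of \<open>'h\<close> over an arbitrary index set. It is the
  stage for the amplification trick in the density theorem.\<close>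

typedef (overloaded) ('i, 'h::complex_hilbert) ell2 =
    "{f :: 'i \<Rightarrow> 'h. (\<lambda>i. (norm (f i))\<^sup>2) summable_on UNIV}"
  by (rule exI[of _ "\<lambda>_. 0"]) simp

setup_lifting type_definition_ell2

lemma sq_summable_add:
  fixes f g :: "'i \<Rightarrow> 'h::complex_hilbert"
  assumes "(\<lambda>i. (norm (f i))\<^sup>2) summable_on UNIV" "(\<lambda>i. (norm (g i))\<^sup>2) summable_on UNIV"
  shows "(\<lambda>i. (norm (f i + g i))\<^sup>2) summable_on UNIV"
proof (rule summable_on_comparison_test)
  show "(\<lambda>i. 2 * (norm (f i))\<^sup>2 + 2 * (norm (g i))\<^sup>2) summable_on UNIV"
    by (intro summable_on_add summable_on_cmult_right assms)
  fix i
  have "(norm (f i + g i))\<^sup>2 \<le> (norm (f i) + norm (g i))\<^sup>2"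
    by (intro power_mono norm_triangle_ineq) auto
  also have "\<dots> \<le> 2 * (norm (f i))\<^sup>2 + 2 * (norm (g i))\<^sup>2"
    using sum_squares_bound[of "norm (f i)" "norm (g i)"] by (simp add: power2_sum)
  finally show "(norm (f i + g i))\<^sup>2 \<le> 2 * (norm (f i))\<^sup>2 + 2 * (norm (g i))\<^sup>2" .
qed auto

lemma sq_summable_cinner:
  fixes f g :: "'i \<Rightarrow> 'h::complex_hilbert"
  assumes "(\<lambda>i. (norm (f i))\<^sup>2) summable_on UNIV" "(\<lambda>i. (norm (g i))\<^sup>2) summable_on UNIV"
  shows "(\<lambda>i. cinner (f i) (g i)) summable_on UNIV"
proof (rule abs_summable_summable, rule Infinite_Sum.abs_summable_on_comparison_test'[OF
    summable_on_add[OF assms]])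
  fix i
  have "cmod (cinner (f i) (g i)) \<le> norm (f i) * norm (g i)"
    by (rule cmod_cinner_le)
  also have "\<dots> \<le> (norm (f i))\<^sup>2 + (norm (g i))\<^sup>2"
  proof -
    have "2 * (norm (f i) * norm (g i)) \<le> (norm (f i))\<^sup>2 + (norm (g i))\<^sup>2"
      using sum_squares_bound[of "norm (f i)" "norm (g i)"] by (simp add: mult.assoc)
    moreover have "0 \<le> norm (f i) * norm (g i)"
      by simp
    ultimately show ?thesis
      by linarith
  qed
  finally show "norm (cinner (f i) (g i)) \<le> (norm (f i))\<^sup>2 + (norm (g i))\<^sup>2" .
qed

lemma sq_summable_bound:
  fixes f g :: "'i \<Rightarrow> 'h::complex_hilbert"
  assumes "(\<lambda>i. (norm (f i))\<^sup>2) summable_on UNIV" "\<And>i. norm (g i) \<le> C * norm (f i)"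
  shows "(\<lambda>i. (norm (g i))\<^sup>2) summable_on UNIV"
proof (rule summable_on_comparison_test)
  show "(\<lambda>i. C\<^sup>2 * (norm (f i))\<^sup>2) summable_on UNIV"
    by (intro summable_on_cmult_right assms)
  show "(norm (g i))\<^sup>2 \<le> C\<^sup>2 * (norm (f i))\<^sup>2" for i
    using power_mono[OF assms(2)[of i], of 2] by (simp add: power_mult_distrib)
qed auto

instantiation ell2 :: (type, complex_hilbert) complex_inner
begin

lift_definition zero_ell2 :: "('a, 'b) ell2" is "\<lambda>_. 0"
  by simp

lift_definition plus_ell2 :: "('a, 'b) ell2 \<Rightarrow> ('a, 'b) ell2 \<Rightarrow> ('a, 'b) ell2" is "\<lambda>f g i. f i + g i"
  by (rule sq_summable_add)

lift_definition minus_ell2 :: "('a, 'b) ell2 \<Rightarrow> ('a, 'b) ell2 \<Rightarrow> ('a, 'b) ell2" is "\<lambda>f g i. f i - g i"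
  subgoal for f g
    using sq_summable_add[of f "\<lambda>i. - g i"] by simp
  done

lift_definition uminus_ell2 :: "('a, 'b) ell2 \<Rightarrow> ('a, 'b) ell2" is "\<lambda>f i. - f i"
  by simp

lift_definition scaleC_ell2 :: "complex \<Rightarrow> ('a, 'b) ell2 \<Rightarrow> ('a, 'b) ell2" is "\<lambda>c f i. c *\<^sub>C f i"
  by (rule sq_summable_bound[where C = "cmod c" for c]) auto

lift_definition scaleR_ell2 :: "real \<Rightarrow> ('a, 'b) ell2 \<Rightarrow> ('a, 'b) ell2" is "\<lambda>c f i. c *\<^sub>R f i"
  by (rule sq_summable_bound[where C = "\<bar>c\<bar>" for c]) auto

lift_definition cinner_ell2 :: "('a, 'b) ell2 \<Rightarrow> ('a, 'b) ell2 \<Rightarrow> complex" is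
  "\<lambda>f g. infsum (\<lambda>i. cinner (f i) (g i)) UNIV" .

definition inner_ell2 :: "('a, 'b) ell2 \<Rightarrow> ('a, 'b) ell2 \<Rightarrow> real" where
  "inner_ell2 f g = Re (cinner f g)"

definition norm_ell2 :: "('a, 'b) ell2 \<Rightarrow> real" where
  "norm_ell2 f = sqrt (inner f f)"

definition sgn_ell2 :: "('a, 'b) ell2 \<Rightarrow> ('a, 'b) ell2" where
  "sgn_ell2 f = inverse (norm f) *\<^sub>R f"

definition dist_ell2 :: "('a, 'b) ell2 \<Rightarrow> ('a, 'b) ell2 \<Rightarrow> real" where
  "dist_ell2 f g = norm (f - g)"

definition uniformity_ell2 :: "(('a, 'b) ell2 \<times> ('a, 'b) ell2) filter" where
  "uniformity_ell2 = (INF e\<in>{0 <..}. principal {(f, g). dist f g < e})"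

definition open_ell2 :: "('a, 'b) ell2 set \<Rightarrow> bool" where
  "open_ell2 U \<longleftrightarrow> (\<forall>f\<in>U. eventually (\<lambda>(f', g). f' = f \<longrightarrow> g \<in> U) uniformity)"

lemma cinner_self_ell2_aux:
  fixes f :: "'i \<Rightarrow> 'h::complex_hilbert"
  assumes "(\<lambda>i. (norm (f i))\<^sup>2) summable_on UNIV"
  shows "infsum (\<lambda>i. cinner (f i) (f i)) UNIV = of_real (infsum (\<lambda>i. (norm (f i))\<^sup>2) UNIV)"
  unfolding cinner_self using assms by (intro infsumI has_sum_of_real has_sum_infsum)

instance
proof
  fix f g h :: "('a, 'b) ell2" and r s :: real and a b :: complex
  show "f + g + h = f + (g + h)" "f + g = g + f" "0 + f = f" "- f + f = 0" "f - g = f + - g"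
    by (transfer, simp add: add_ac fun_eq_iff)+
  show "a *\<^sub>C (f + g) = a *\<^sub>C f + a *\<^sub>C g" "(a + b) *\<^sub>C f = a *\<^sub>C f + b *\<^sub>C f"
      "a *\<^sub>C (b *\<^sub>C f) = (a * b) *\<^sub>C f" "complex_of_real r *\<^sub>C f = r *\<^sub>R f"
    by (transfer, simp add: scaleC_add_right scaleC_add_left scaleC_of_real fun_eq_iff)+
  show "r *\<^sub>R (f + g) = r *\<^sub>R f + r *\<^sub>R g" "(r + s) *\<^sub>R f = r *\<^sub>R f + s *\<^sub>R f"
      "r *\<^sub>R s *\<^sub>R f = (r * s) *\<^sub>R f" "1 *\<^sub>R f = f"
    by (transfer, simp add: scaleR_add_right scaleR_add_left fun_eq_iff)+
  show comm: "cinner f g = cnj (cinner g f)" for f g :: "('a, 'b) ell2"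
    by transfer (simp flip: infsum_cnj cinner_commute)
  show add: "cinner (f + g) h = cinner f h + cinner g h"
    by transfer (simp add: cinner_add_left infsum_add sq_summable_cinner)
  show scl: "cinner (a *\<^sub>C f) g = a * cinner f g" for a
    by transfer (simp add: infsum_cmult_right')
  show "inner f g = Re (cinner f g)"
    by (fact inner_ell2_def)
  show "inner f g = inner g f"
    by (simp add: inner_ell2_def comm[of f g])
  show "inner (f + g) h = inner f h + inner g h"
    by (simp add: inner_ell2_def add)
  have "complex_of_real r *\<^sub>C f = r *\<^sub>R f"
    by transfer (simp add: scaleC_of_real)
  then show "inner (r *\<^sub>R f) g = r * inner f g"
    using scl[of "complex_of_real r"] by (simp add: inner_ell2_def)
  have 1: "0 \<le> Re (cinner f f) \<and> (Re (cinner f f) = 0 \<longleftrightarrow> f = 0)"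
  proof transfer
    fix f :: "'a \<Rightarrow> 'b"
    assume f: "(\<lambda>i. (norm (f i))\<^sup>2) summable_on UNIV"
    have "f = (\<lambda>_. 0)" if "infsum (\<lambda>i. (norm (f i))\<^sup>2) UNIV = 0"
      using nonneg_infsum_le_0D[of "\<lambda>i. (norm (f i))\<^sup>2" UNIV] f that by auto
    then show "0 \<le> Re (infsum (\<lambda>i. cinner (f i) (f i)) UNIV) \<and>
          (Re (infsum (\<lambda>i. cinner (f i) (f i)) UNIV) = 0 \<longleftrightarrow> f = (\<lambda>_. 0))"
      by (auto simp: cinner_self_ell2_aux[OF f] infsum_nonneg)
  qed
  then show "0 \<le> inner f f" "inner f f = 0 \<longleftrightarrow> f = 0"
    by (simp_all add: inner_ell2_def)
  show "norm f = sqrt (inner f f)"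
    by (fact norm_ell2_def)
  show "sgn f = inverse (norm f) *\<^sub>R f"
    by (fact sgn_ell2_def)
  show "dist f g = norm (f - g)"
    by (fact dist_ell2_def)
  show "uniformity = (INF e\<in>{0 <..}. principal {(f, g :: ('a, 'b) ell2). dist f g < e})"
    by (fact uniformity_ell2_def)
  show "open U \<longleftrightarrow> (\<forall>f\<in>U. eventually (\<lambda>(f', g). f' = f \<longrightarrow> g \<in> U) uniformity)" for U :: "('a, 'b) ell2 set"
    by (fact open_ell2_def)
qed

end

lemma norm_ell2_square: "(norm f)\<^sup>2 = infsum (\<lambda>i. (norm (Rep_ell2 f i))\<^sup>2) UNIV"
proof -
  have "complex_of_real ((norm f)\<^sup>2) = complex_of_real (infsum (\<lambda>i. (norm (Rep_ell2 f i))\<^sup>2) UNIV)"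
    unfolding cinner_self[symmetric] using Rep_ell2[of f]
    by (simp add: cinner_ell2.rep_eq cinner_self_ell2_aux)
  then show ?thesis
    by (simp only: of_real_eq_iff)
qed

lemma sum_le_norm_ell2_square:
  assumes "finite F"
  shows "(\<Sum>i\<in>F. (norm (Rep_ell2 f i))\<^sup>2) \<le> (norm f)\<^sup>2"
  unfolding norm_ell2_square using assms Rep_ell2[of f] by (intro finite_sum_le_infsum) auto

lemma norm_Rep_ell2_le: "norm (Rep_ell2 f i) \<le> norm f"
  by (rule power2_le_imp_le) (use sum_le_norm_ell2_square[of "{i}" f] in simp_all)

lemma ell2_boundI:
  fixes g :: "'i \<Rightarrow> 'h::complex_hilbert"
  assumes "\<And>F. finite F \<Longrightarrow> (\<Sum>i\<in>F. (norm (g i))\<^sup>2) \<le> C"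
  shows "(\<lambda>i. (norm (g i))\<^sup>2) summable_on UNIV" and "(norm (Abs_ell2 g))\<^sup>2 \<le> C"
proof -
  show *: "(\<lambda>i. (norm (g i))\<^sup>2) summable_on UNIV"
    by (rule nonneg_bdd_above_summable_on) (auto intro!: bdd_aboveI[of _ C] assms)
  show "(norm (Abs_ell2 g))\<^sup>2 \<le> C"
    unfolding norm_ell2_square using * assms
    by (intro infsum_le_finite_sums) (auto simp: Abs_ell2_inverse)
qed

instance ell2 :: (type, complex_hilbert) complex_hilbert
proof
  fix X :: "nat \<Rightarrow> ('a, 'b) ell2"
  assume X: "Cauchy X"
  have "Cauchy (\<lambda>n. Rep_ell2 (X n) i)" for i
  proof (rule metric_CauchyI)
    fix e :: real
    assume "e > 0"
    then obtain M where M: "\<And>m n. m \<ge> M \<Longrightarrow> n \<ge> M \<Longrightarrow> dist (X m) (X n) < e"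
      using metric_CauchyD[OF X] by blast
    have "dist (Rep_ell2 (X m) i) (Rep_ell2 (X n) i) \<le> dist (X m) (X n)" for m n
      using norm_Rep_ell2_le[of "X m - X n" i] by (simp add: dist_norm minus_ell2.rep_eq)
    then show "\<exists>M. \<forall>m\<ge>M. \<forall>n\<ge>M. dist (Rep_ell2 (X m) i) (Rep_ell2 (X n) i) < e"
      using M le_less_trans by blast
  qed
  then have "\<forall>i. \<exists>g. (\<lambda>n. Rep_ell2 (X n) i) \<longlonglongrightarrow> g"
    using Cauchy_convergent convergent_def by blast
  then obtain g where g: "\<And>i. (\<lambda>n. Rep_ell2 (X n) i) \<longlonglongrightarrow> g i"
    by metis
  \<comment> \<open>Coordinatewise limits can be exchanged with finite sums only. The norm is the
    supremum over these, so a bound uniform in \<open>F\<close> is what completeness needs.\<close>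
  have key: "(\<Sum>i\<in>F. (norm (Rep_ell2 (X m) i - g i))\<^sup>2) \<le> e\<^sup>2"
    if "\<And>n. n \<ge> M \<Longrightarrow> dist (X m) (X n) < e" "finite F" for F m M e
  proof (rule LIMSEQ_le_const2)
    show "(\<lambda>n. \<Sum>i\<in>F. (norm (Rep_ell2 (X m) i - Rep_ell2 (X n) i))\<^sup>2)
        \<longlonglongrightarrow> (\<Sum>i\<in>F. (norm (Rep_ell2 (X m) i - g i))\<^sup>2)"
      by (intro tendsto_intros g)
    show "\<exists>N. \<forall>n\<ge>N. (\<Sum>i\<in>F. (norm (Rep_ell2 (X m) i - Rep_ell2 (X n) i))\<^sup>2) \<le> e\<^sup>2"
    proof (intro exI[of _ M] allI impI)
      fix n
      assume "n \<ge> M"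
      have "(\<Sum>i\<in>F. (norm (Rep_ell2 (X m) i - Rep_ell2 (X n) i))\<^sup>2) \<le> (norm (X m - X n))\<^sup>2"
        using sum_le_norm_ell2_square[OF that(2), of "X m - X n"] by (simp add: minus_ell2.rep_eq)
      also have "\<dots> \<le> e\<^sup>2"
        using that(1)[OF \<open>n \<ge> M\<close>] by (intro power_mono) (auto simp: dist_norm)
      finally show "(\<Sum>i\<in>F. (norm (Rep_ell2 (X m) i - Rep_ell2 (X n) i))\<^sup>2) \<le> e\<^sup>2" .
    qed
  qed
  obtain M0 where "\<And>m n. m \<ge> M0 \<Longrightarrow> n \<ge> M0 \<Longrightarrow> dist (X m) (X n) < 1"
    using metric_CauchyD[OF X, of 1] by auto
  then have "(\<lambda>i. (norm (Rep_ell2 (X M0) i - g i))\<^sup>2) summable_on UNIV"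
    by (intro ell2_boundI(1)[of _ "1\<^sup>2"] key[of M0]) auto
  then have "(\<lambda>i. (norm (Rep_ell2 (X M0) i + (g i - Rep_ell2 (X M0) i)))\<^sup>2) summable_on UNIV"
    using Rep_ell2[of "X M0"] by (intro sq_summable_add) (auto simp: norm_minus_commute)
  then have g2: "Rep_ell2 (Abs_ell2 g) = g"
    by (intro Abs_ell2_inverse) simp
  have "X \<longlonglongrightarrow> Abs_ell2 g"
  proof (rule metric_LIMSEQ_I)
    fix e :: real
    assume "e > 0"
    then obtain M where M: "\<And>m n. m \<ge> M \<Longrightarrow> n \<ge> M \<Longrightarrow> dist (X m) (X n) < e / 2"
      using metric_CauchyD[OF X, of "e / 2"] by auto
    have "dist (X m) (Abs_ell2 g) < e" if "m \<ge> M" for m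
    proof -
      have "(norm (X m - Abs_ell2 g))\<^sup>2 \<le> (e / 2)\<^sup>2"
        unfolding norm_ell2_square using Rep_ell2[of "X m - Abs_ell2 g"]
        by (intro infsum_le_finite_sums) (auto simp: minus_ell2.rep_eq g2 intro!: key M that)
      then have "norm (X m - Abs_ell2 g) \<le> e / 2"
        by (rule power2_le_imp_le) (use \<open>e > 0\<close> in simp)
      then show ?thesis
        using \<open>e > 0\<close> by (simp add: dist_norm)
    qed
    then show "\<exists>M. \<forall>m\<ge>M. dist (X m) (Abs_ell2 g) < e"
      by blast
  qed
  then show "convergent X"
    by (rule convergentI)
qed

lift_definition single :: "'i \<Rightarrow> 'h \<Rightarrow> ('i, 'h::complex_hilbert) ell2" is "\<lambda>i v j. if j = i then v else 0"
  subgoal for i v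
  proof (rule ell2_boundI(1)[where C = "(norm v)\<^sup>2"])
    fix F :: "'i set"
    assume "finite F"
    have "(\<Sum>j\<in>F. (norm (if j = i then v else 0))\<^sup>2) = (\<Sum>j\<in>F. if j = i then (norm v)\<^sup>2 else 0)"
      by (intro sum.cong) auto
    also have "\<dots> \<le> (norm v)\<^sup>2"
      using \<open>finite F\<close> by (simp add: sum.delta)
    finally show "(\<Sum>j\<in>F. (norm (if j = i then v else 0))\<^sup>2) \<le> (norm v)\<^sup>2" .
  qed
  done

lemma cinner_single: "cinner f (single i v) = cinner (Rep_ell2 f i) v"
proof -
  have "cinner f (single i v) = infsum (\<lambda>j. cinner (Rep_ell2 f j) (if j = i then v else 0)) UNIV"
    by (simp add: cinner_ell2.rep_eq single.rep_eq)
  also have "\<dots> = infsum (\<lambda>j. cinner (Rep_ell2 f j) v) {i}"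
    by (rule infsum_cong_neutral) auto
  finally show ?thesis
    by simp
qed

lemma subspace_closure:
  fixes S :: "'a::real_normed_vector set"
  assumes "subspace S"
  shows "subspace (closure S)"
  unfolding subspace_def
proof (intro conjI ballI allI)
  show "0 \<in> closure S"
    using subspace_0[OF assms] closure_subset by blast
  fix u
  assume "u \<in> closure S"
  then obtain f where f: "\<And>n. f n \<in> S" "f \<longlonglongrightarrow> u"
    unfolding closure_sequential by blast
  show "r *\<^sub>R u \<in> closure S" for r
    unfolding closure_sequential
    by (intro exI[of _ "\<lambda>n. r *\<^sub>R f n"]) (auto intro!: tendsto_intros f subspace_scale[OF assms])
  fix v
  assume "v \<in> closure S"
  then obtain g where g: "\<And>n. g n \<in> S" "g \<longlonglongrightarrow> v"
    unfolding closure_sequential by blast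
  show "u + v \<in> closure S"
    unfolding closure_sequential
    by (intro exI[of _ "\<lambda>n. f n + g n"]) (auto intro!: tendsto_intros f g subspace_add[OF assms])
qed

lemma dense_if_orthogonal_trivial:
  fixes X :: "'a::{real_inner,complete_space} set"
  assumes "\<And>x. (\<And>y. y \<in> X \<Longrightarrow> inner x y = 0) \<Longrightarrow> x = 0"
  shows "closure (span X) = UNIV"
proof -
  have "x \<in> closure (span X)" for x
  proof -
    obtain p where p: "p \<in> closure (span X)" "\<And>y. y \<in> closure (span X) \<Longrightarrow> inner (x - p) y = 0"
      using projection_exists[of "closure (span X)" x]
          by (auto intro: closed_closure subspace_span subspace_closure)
    have "x - p = 0"
      by (rule assms) (use p(2) span_base closure_subset in blast)
    then show ?thesis
      using p(1) by simp
  qed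
  then show ?thesis
    by auto
qed

lemma single_dense: "closure (span {single i v | i v. True}) = (UNIV :: ('i, 'h::complex_hilbert) ell2 set)"
proof (rule dense_if_orthogonal_trivial)
  fix f :: "('i, 'h) ell2"
  assume *: "\<And>y. y \<in> {single i v | i v. True} \<Longrightarrow> inner f y = 0"
  have "Rep_ell2 f i = 0" for i
    using *[of "single i (Rep_ell2 f i)"] by (auto simp: inner_eq_Re_cinner cinner_single cinner_self)
  then show "f = 0"
    by (metis Rep_ell2_inject ext zero_ell2.rep_eq)
qed

section \<open>Diagonal amplification and matrix entries\<close>

lift_definition amp_fun :: "('h \<Rightarrow>\<^sub>L 'h) \<Rightarrow> ('i, 'h) ell2 \<Rightarrow> ('i, 'h::complex_hilbert) ell2"
    is "\<lambda>T f i. blinfun_apply T (f i)"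
  by (rule sq_summable_bound[OF _ norm_blinfun])

lift_definition amp :: "('h \<Rightarrow>\<^sub>L 'h) \<Rightarrow> ('i, 'h) ell2 \<Rightarrow>\<^sub>L ('i, 'h::complex_hilbert) ell2" is amp_fun
proof (rule bounded_linear_intro)
  fix T :: "'h \<Rightarrow>\<^sub>L 'h" and f g :: "('i, 'h) ell2" and r :: real
  show "amp_fun T (f + g) = amp_fun T f + amp_fun T g"
    by transfer (simp add: blinfun.add_right)
  show "amp_fun T (r *\<^sub>R f) = r *\<^sub>R amp_fun T f"
    by transfer (simp add: blinfun.scaleR_right)
  have "(norm (amp_fun T f))\<^sup>2 \<le> (norm f * norm T)\<^sup>2"
  proof -
    have "(norm (amp_fun T f))\<^sup>2 \<le> infsum (\<lambda>i. (norm T)\<^sup>2 * (norm (Rep_ell2 f i))\<^sup>2) UNIV"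
      unfolding norm_ell2_square using Rep_ell2[of "amp_fun T f"] Rep_ell2[of f]
      by (intro infsum_mono summable_on_cmult_right)
         (auto simp: amp_fun.rep_eq power_mult_distrib[symmetric] intro!: power_mono norm_blinfun)
    also have "\<dots> = (norm f * norm T)\<^sup>2"
      by (simp add: infsum_cmult_right' norm_ell2_square power_mult_distrib)
    finally show ?thesis .
  qed
  then show "norm (amp_fun T f) \<le> norm f * norm T"
    by (rule power2_le_imp_le) simp
qed

lemma Rep_amp [simp]: "Rep_ell2 (amp T f) i = T (Rep_ell2 f i)"
  by (simp add: amp.rep_eq amp_fun.rep_eq)

lemma ell2_eqI: "(\<And>i. Rep_ell2 f i = Rep_ell2 g i) \<Longrightarrow> f = g"
  by (metis Rep_ell2_inject ext)

lemma amp_single: "amp T (single i v) = single i (T v)"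
  by (rule ell2_eqI) (simp add: single.rep_eq)

lemma cinner_amp_adj:
  assumes "clin T"
  shows "cinner (amp T f) g = cinner f (amp (adj T) g)"
  unfolding cinner_ell2.rep_eq Rep_amp cinner_adj[OF assms] ..

lift_definition coord :: "'i \<Rightarrow> ('i, 'h::complex_hilbert) ell2 \<Rightarrow>\<^sub>L 'h" is "\<lambda>i f. Rep_ell2 f i"
  by (rule bounded_linear_intro[where K = 1])
     (auto simp: plus_ell2.rep_eq scaleR_ell2.rep_eq norm_Rep_ell2_le)

lift_definition incl :: "'i \<Rightarrow> 'h \<Rightarrow>\<^sub>L ('i, 'h::complex_hilbert) ell2" is single
proof (rule bounded_linear_intro)
  fix i :: 'i and v w :: 'h and r :: real
  show "single i (v + w) = single i v + single i w"
    by (rule ell2_eqI) (simp add: single.rep_eq plus_ell2.rep_eq)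
  show "single i (r *\<^sub>R v) = r *\<^sub>R single i v"
    by (rule ell2_eqI) (simp add: single.rep_eq scaleR_ell2.rep_eq)
  have "norm (single i v) * norm (single i v) = norm v * norm v"
    unfolding cmod_cinner_self[symmetric] cinner_single by (simp add: single.rep_eq)
  then have "(norm (single i v))\<^sup>2 = (norm v)\<^sup>2"
    by (simp only: power2_eq_square)
  then show "norm (single i v) \<le> norm v * 1"
    by simp
qed

lemma clin_incl: "clin (incl i)"
  unfolding clin_def by (auto simp: incl.rep_eq single.rep_eq scaleC_ell2.rep_eq intro!: ell2_eqI)

lemma clin_coord: "clin (coord i)"
  unfolding clin_def by (simp add: coord.rep_eq scaleC_ell2.rep_eq)

section \<open>The von Neumann density theorem\<close>

lemma projection_blinfun_exists:
  fixes S :: "'a::{real_inner,complete_space} set"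
  assumes S: "subspace S" "closed S"
  obtains P :: "'a \<Rightarrow>\<^sub>L 'a" where "\<And>x. P x \<in> S" "\<And>x y. y \<in> S \<Longrightarrow> inner (x - P x) y = 0"
    "\<And>x q. q \<in> S \<Longrightarrow> (\<And>y. y \<in> S \<Longrightarrow> inner (x - q) y = 0) \<Longrightarrow> P x = q"
proof -
  have "\<exists>p. \<forall>x. p x \<in> S \<and> (\<forall>y\<in>S. inner (x - p x) y = 0)"
    using projection_exists[OF S] by (intro choice) blast
  then obtain p where p: "\<And>x. p x \<in> S" "\<And>x y. y \<in> S \<Longrightarrow> inner (x - p x) y = 0"
    by blast
  have uniq: "p x = q" if q: "q \<in> S" "\<And>y. y \<in> S \<Longrightarrow> inner (x - q) y = 0" for x q
  proof -
    have d: "p x - q \<in> S"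
      using p(1) q(1) by (intro subspace_diff S)
    have "inner (p x - q) (p x - q) = inner (x - q) (p x - q) - inner (x - p x) (p x - q)"
      by (simp add: inner_diff_left)
    also have "\<dots> = 0"
      using p(2)[OF d] q(2)[OF d] by simp
    finally show ?thesis
      by simp
  qed
  have "bounded_linear p"
  proof (rule bounded_linear_intro)
    show "p (x + y) = p x + p y" for x y
    proof (rule uniq)
      show "p x + p y \<in> S"
        by (intro subspace_add S p)
      fix z
      assume "z \<in> S"
      then show "inner (x + y - (p x + p y)) z = 0"
        using p(2)[of z x] p(2)[of z y] by (simp add: inner_simps)
    qed
    show "p (r *\<^sub>R x) = r *\<^sub>R p x" for r x
    proof (rule uniq)
      show "r *\<^sub>R p x \<in> S"
        by (intro subspace_scale S p)
      fix z
      assume "z \<in> S"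
      then show "inner (r *\<^sub>R x - r *\<^sub>R p x) z = 0"
        using p(2)[of z x] by (simp flip: scaleR_diff_right)
    qed
    show "norm (p x) \<le> norm x * 1" for x
    proof -
      have "norm (p x) * norm (p x) = inner x (p x)"
        using p(2)[OF p(1), of x x] by (simp add: inner_diff_left flip: power2_norm_eq_inner power2_eq_square)
      also have "\<dots> \<le> norm x * norm (p x)"
        by (rule norm_cauchy_schwarz)
      finally show ?thesis
        by (cases "p x = 0") auto
    qed
  qed
  then have "blinfun_apply (Blinfun p) = p"
    by (rule bounded_linear_Blinfun_apply)
  then show ?thesis
    using p uniq by (intro that[of "Blinfun p"]) auto
qed

text \<open>Commuting with \<open>adj S\<close> as well as with \<open>S\<close> makes the set
  closed under adjoints. It is strongly closed because each condition equates two continuous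
  functions of values of \<open>T\<close> at fixed vectors.\<close>

lemma von_neumann_algebra_commutant:
  fixes S :: "'h::complex_hilbert \<Rightarrow>\<^sub>L 'h"
  assumes S: "clin S"
  shows "von_neumann_algebra {T. clin T \<and> T o\<^sub>L S = S o\<^sub>L T \<and> T o\<^sub>L adj S = adj S o\<^sub>L T}"
proof -
  let ?N = "{T. clin T \<and> T o\<^sub>L S = S o\<^sub>L T \<and> T o\<^sub>L adj S = adj S o\<^sub>L T}"
  have cadj: "cadjoint T \<in> ?N" if T: "T \<in> ?N" for T
  proof -
    have c: "clin T" "T o\<^sub>L S = S o\<^sub>L T" "T o\<^sub>L adj S = adj S o\<^sub>L T"
      using T by auto
    have "adj S o\<^sub>L adj T = adj T o\<^sub>L adj S" "S o\<^sub>L adj T = adj T o\<^sub>L S"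
      using adj_compose[OF c(1) S] adj_compose[OF S c(1)] adj_compose[OF c(1) clin_adj[OF S]]
        adj_compose[OF clin_adj[OF S] c(1)] c S by (simp_all add: adj_adj)
    then show ?thesis
      using c S by (simp add: cadjoint_eq_adj)
  qed
  have "star_subalgebra ?N"
    unfolding star_subalgebra_def
  proof (intro conjI ballI allI)
    show "?N \<subseteq> bounded_operators"
      by (auto simp: bounded_operators_iff_clin)
    show "0 \<in> ?N"
      by simp
    fix A B
    assume AB: "A \<in> ?N" "B \<in> ?N"
    then show "A + B \<in> ?N"
      by (auto simp: clin_add bounded_bilinear.add_left[OF bounded_bilinear_blinfun_compose]
          bounded_bilinear.add_right[OF bounded_bilinear_blinfun_compose])
    have *: "(A o\<^sub>L B) o\<^sub>L R = R o\<^sub>L (A o\<^sub>L B)" if "A o\<^sub>L R = R o\<^sub>L A" "B o\<^sub>L R = R o\<^sub>L B" for R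
    proof (rule blinfun_eqI)
      fix y
      have "A (R z) = R (A z)" "B (R z) = R (B z)" for z
        using that by (metis blinfun_apply_blinfun_compose)+
      then show "((A o\<^sub>L B) o\<^sub>L R) y = (R o\<^sub>L (A o\<^sub>L B)) y"
        by simp
    qed
    show "A o\<^sub>L B \<in> ?N"
      using AB by (auto simp: clin_compose *)
  next
    fix c T
    assume T: "T \<in> ?N"
    have *: "scaleC_op c T o\<^sub>L R = R o\<^sub>L scaleC_op c T" if "T o\<^sub>L R = R o\<^sub>L T" "clin R" for R
    proof (rule blinfun_eqI)
      fix x
      show "(scaleC_op c T o\<^sub>L R) x = (R o\<^sub>L scaleC_op c T) x"
        using arg_cong[OF that(1), of "\<lambda>Z. blinfun_apply Z x"] by (simp add: clinD[OF that(2)])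
    qed
    show "scaleC_op c T \<in> ?N"
      using T S by (auto simp: clin_scaleC_op *)
  qed (use cadj in blast)
  moreover have "closedin strong_operator_topology ?N"
  proof -
    have ev: "continuous_map strong_operator_topology euclidean (\<lambda>T. R (blinfun_apply T x))"
      if "continuous_on UNIV R" for R :: "'h \<Rightarrow> 'h" and x
      using continuous_map_compose[OF strong_operator_topology_continuous_evaluation, of euclidean R x] that
      by (simp add: o_def)
    have eq: "closedin strong_operator_topology {T. R (blinfun_apply T x) = R' (blinfun_apply T y)}"
      if "continuous_on UNIV R" "continuous_on UNIV R'" for R R' :: "'h \<Rightarrow> 'h" and x y
      using closedin_continuous_maps_eq[OF Hausdorff_space_euclidean ev[OF that(1), of x] ev[OF that(2), of y]]
      by (simp add: strong_operator_topology_topspace)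
    \<comment> \<open>The \<open>id\<close> puts every condition into the shape
      \<open>R (T x) = R' (T y)\<close> handled by \<open>eq\<close>.\<close>
    have N: "?N = (\<Inter>x. \<Inter>c. {T. id (blinfun_apply T (c *\<^sub>C x)) = c *\<^sub>C blinfun_apply T x}) \<inter>
        (\<Inter>x. {T. id (blinfun_apply T (S x)) = S (blinfun_apply T x)}) \<inter>
        (\<Inter>x. {T. id (blinfun_apply T (adj S x)) = adj S (blinfun_apply T x)})"
      by (auto simp: clin_def intro!: blinfun_eqI dest: arg_cong[of _ _ blinfun_apply] simp: fun_eq_iff)
    show ?thesis
      unfolding N
      by (intro closedin_Int closedin_INT eq) (auto intro!: blinfun.continuous_on continuous_on_id
          linear_continuous_on bounded_linear_scaleC blinfun.bounded_linear_right)
  qed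
  moreover have "id_blinfun o\<^sub>L R = R o\<^sub>L id_blinfun" for R :: "'h \<Rightarrow>\<^sub>L 'h"
    by (rule blinfun_eqI) simp
  ultimately show ?thesis
    by (simp add: von_neumann_algebra_def)
qed

text \<open>The set of operators commuting with \<open>S\<close> and \<open>adj S\<close> is one of
  the von Neumann algebras over which \<open>vn_generated X\<close> intersects. Only this half of
  the bicommutant theorem enters.\<close>

lemma vn_generated_commutes:
  fixes S :: "'h::complex_hilbert \<Rightarrow>\<^sub>L 'h"
  assumes S: "clin S" and X: "\<And>a. a \<in> X \<Longrightarrow> clin a" "\<And>a. a \<in> X \<Longrightarrow> adj a \<in> X"
    and comm: "\<And>a. a \<in> X \<Longrightarrow> a o\<^sub>L S = S o\<^sub>L a"
    and x: "x \<in> vn_generated X"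
  shows "x o\<^sub>L S = S o\<^sub>L x"
proof -
  have "a o\<^sub>L adj S = adj S o\<^sub>L a" if "a \<in> X" for a
  proof -
    have "adj (adj a o\<^sub>L S) = adj (S o\<^sub>L adj a)"
      using comm[OF X(2)[OF that]] by simp
    then show ?thesis
      using S X(1)[OF that] by (simp add: adj_compose adj_adj)
  qed
  then have "X \<subseteq> {T. clin T \<and> T o\<^sub>L S = S o\<^sub>L T \<and> T o\<^sub>L adj S = adj S o\<^sub>L T}"
    using X comm by auto
  then show ?thesis
    using x von_neumann_algebra_commutant[OF S] unfolding vn_generated_def by blast
qed

text \<open>The commutant of the identity is the von Neumann algebra of all complex linear
  operators, and it contains \<open>X\<close>.\<close>

lemma vn_generated_clin:
  fixes x :: "'h::complex_hilbert \<Rightarrow>\<^sub>L 'h"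
  assumes X: "\<And>a. a \<in> X \<Longrightarrow> clin a" and x: "x \<in> vn_generated X"
  shows "clin x"
proof -
  have "adj id_blinfun = (id_blinfun :: 'h \<Rightarrow>\<^sub>L 'h)"
    by (rule adj_unique) auto
  then have "X \<subseteq> {T. clin T \<and> T o\<^sub>L id_blinfun = id_blinfun o\<^sub>L T \<and> T o\<^sub>L adj id_blinfun
      = adj id_blinfun o\<^sub>L T}"
    using X by (auto intro!: blinfun_eqI)
  then show ?thesis
    using x von_neumann_algebra_commutant[OF clin_id] unfolding vn_generated_def by blast
qed

lemma vn_generated_superset: "X \<subseteq> vn_generated X"
  by (auto simp: vn_generated_def)

lemma vn_generated_star:
  fixes X :: "('h::complex_hilbert \<Rightarrow>\<^sub>L 'h) set"
  shows "id_blinfun \<in> vn_generated X"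
    and "S \<in> vn_generated X \<Longrightarrow> T \<in> vn_generated X \<Longrightarrow> S + T \<in> vn_generated X"
    and "S \<in> vn_generated X \<Longrightarrow> T \<in> vn_generated X \<Longrightarrow> S o\<^sub>L T \<in> vn_generated X"
    and "T \<in> vn_generated X \<Longrightarrow> scaleC_op c T \<in> vn_generated X"
    and "T \<in> vn_generated X \<Longrightarrow> cadjoint T \<in> vn_generated X"
    and "0 \<in> vn_generated X"
  unfolding vn_generated_def by (auto simp: von_neumann_algebra_def star_subalgebra_def)

section \<open>Density of a unital star algebra of operators in the von Neumann algebra it
  generates\<close>

context
  fixes A :: "('h::complex_hilbert \<Rightarrow>\<^sub>L 'h) set"
  assumes clin: "\<And>a. a \<in> A \<Longrightarrow> clin a" and sub: "subspace A"
    and scaleC: "\<And>c a. a \<in> A \<Longrightarrow> scaleC_op c a \<in> A"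
    and comp: "\<And>a b. a \<in> A \<Longrightarrow> b \<in> A \<Longrightarrow> a o\<^sub>L b \<in> A"
    and adj: "\<And>a. a \<in> A \<Longrightarrow> adj a \<in> A" and id: "id_blinfun \<in> A"
begin

text \<open>Von Neumann's argument. The projection onto the closure \<open>M\<close> of the vectors
  \<open>amp a f\<close> commutes with every \<open>amp a\<close>, since \<open>M\<close> is
  invariant under \<open>A\<close> and its adjoints. Then it also commutes with
  \<open>amp x\<close>, and \<open>f\<close> itself lies in \<open>M\<close> because
  \<open>A\<close> contains the identity.\<close>

lemma amp_density:
  fixes f :: "('i, 'h) ell2"
  assumes x: "x \<in> vn_generated A" and e: "e > 0"
  shows "\<exists>a\<in>A. norm (amp x f - amp a f) < e"
proof -
  define M where "M = closure ((\<lambda>a. amp a f) ` A)"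
  have amp_add: "amp (a + b) f = amp a f + amp b f" for a b
    by (rule ell2_eqI) (simp add: plus_ell2.rep_eq blinfun.add_left)
  have amp_scaleR: "amp (r *\<^sub>R a) f = r *\<^sub>R amp a f" for r a
    by (rule ell2_eqI) (simp add: scaleR_ell2.rep_eq blinfun.scaleR_left)
  have amp_scaleC: "amp (scaleC_op c a) g = c *\<^sub>C amp a g" for c a and g :: "('i, 'h) ell2"
    by (rule ell2_eqI) (simp add: scaleC_ell2.rep_eq)
  have amp_comp: "amp (a o\<^sub>L b) g = amp a (amp b g)" for a b and g :: "('i, 'h) ell2"
    by (rule ell2_eqI) simp
  have "subspace ((\<lambda>a. amp a f) ` A)"
    unfolding subspace_def
  proof (intro conjI ballI allI)
    show "0 \<in> (\<lambda>a. amp a f) ` A"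
      using subspace_0[OF sub] by (intro image_eqI[of _ _ 0]) (auto intro!: ell2_eqI simp: zero_ell2.rep_eq)
  qed (auto simp flip: amp_add amp_scaleR intro!: imageI subspace_add[OF sub] subspace_scale[OF sub])
  then have M: "subspace M" "closed M"
    unfolding M_def by (auto intro: subspace_closure)
  have M_image: "F u \<in> M" if F: "continuous_on UNIV F" "\<And>a. a \<in> A \<Longrightarrow> F (amp a f) \<in> M" and u: "u \<in> M" for F u
  proof -
    have "closed {u. F u \<in> M}"
      using continuous_closed_vimage[OF M(2), of F] F(1)
          by (simp add: vimage_def continuous_on_eq_continuous_at)
    then have "M \<subseteq> {u. F u \<in> M}"
      unfolding M_def by (intro closure_minimal) (use F(2) M_def in auto)
    then show ?thesis
      using u by blast
  qed
  have M_amp: "amp a u \<in> M" if "a \<in> A" "u \<in> M" for a u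
    by (rule M_image[OF _ _ that(2)])
       (auto intro!: blinfun.continuous_on continuous_on_id subsetD[OF closure_subset] comp that
         simp: M_def simp flip: amp_comp)
  have M_scaleC: "c *\<^sub>C u \<in> M" if "u \<in> M" for c u
    by (rule M_image[OF _ _ that])
       (auto intro!: linear_continuous_on bounded_linear_scaleC subsetD[OF closure_subset] scaleC that
         simp: M_def simp flip: amp_scaleC)
  obtain P :: "('i, 'h) ell2 \<Rightarrow>\<^sub>L ('i, 'h) ell2"
    where P: "\<And>x. P x \<in> M" "\<And>x y. y \<in> M \<Longrightarrow> inner (x - P x) y = 0"
    "\<And>x q. q \<in> M \<Longrightarrow> (\<And>y. y \<in> M \<Longrightarrow> inner (x - q) y = 0) \<Longrightarrow> P x = q"
    using projection_blinfun_exists[OF M] by blast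
  have P_clin: "clin P"
    unfolding clin_def
  proof (intro allI P(3))
    fix c u y
    show "c *\<^sub>C P u \<in> M"
      by (intro M_scaleC P)
    assume "y \<in> M"
    then have "inner (u - P u) (cnj c *\<^sub>C y) = 0"
      by (intro P(2) M_scaleC)
    then show "inner (c *\<^sub>C u - c *\<^sub>C P u) y = 0"
      by (simp add: inner_eq_Re_cinner flip: scaleC_diff_right)
  qed
  have P_amp: "P (amp a u) = amp a (P u)" if a: "a \<in> A" for a u
  proof (rule P(3))
    show "amp a (P u) \<in> M"
      by (intro M_amp a P)
    fix y
    assume "y \<in> M"
    then have "inner (u - P u) (amp (adj a) y) = 0"
      by (intro P(2) M_amp adj a)
    then show "inner (amp a u - amp a (P u)) y = 0"
      by (simp add: inner_eq_Re_cinner cinner_amp_adj clin a flip: blinfun.diff_right)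
  qed
  \<comment> \<open>The matrix entries of the projection are operators on \<open>'h\<close>
    commuting with \<open>A\<close>, hence with \<open>x\<close>; entry by entry this transfers to
    \<open>amp x\<close>.\<close>
  define E where "E i j = coord i o\<^sub>L P o\<^sub>L incl j" for i j
  have E: "E i j v = Rep_ell2 (P (single j v)) i" for i j v
    by (simp add: E_def coord.rep_eq incl.rep_eq)
  have "x o\<^sub>L E i j = E i j o\<^sub>L x" for i j
  proof (rule vn_generated_commutes[OF _ _ _ _ x])
    show "clin (E i j)"
      unfolding E_def by (intro clin_compose clin_coord clin_incl P_clin)
    show "a o\<^sub>L E i j = E i j o\<^sub>L a" if "a \<in> A" for a
      by (rule blinfun_eqI) (simp add: E P_amp[OF that] flip: amp_single)
  qed (use clin adj in auto)
  then have Ex: "x (E i j v) = E i j (x v)" for i j v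
    by (metis blinfun_apply_blinfun_compose)
  have "amp x o\<^sub>L P = P o\<^sub>L amp x"
  proof (rule blinfun_eq_on_dense[OF single_dense])
    fix u :: "('i, 'h) ell2"
    assume "u \<in> {single i v | i v. True}"
    then obtain j v where u: "u = single j v"
      by blast
    show "(amp x o\<^sub>L P) u = (P o\<^sub>L amp x) u"
      by (rule ell2_eqI) (simp add: u amp_single Ex flip: E)
  qed
  moreover have "P f = f"
  proof (rule P(3))
    have "amp id_blinfun f = f"
      by (rule ell2_eqI) simp
    then show "f \<in> M"
      unfolding M_def using id closure_subset by (metis (no_types, lifting) image_eqI subsetD)
  qed simp
  ultimately have "amp x f = P (amp x f)"
    by (metis blinfun_apply_blinfun_compose)
  then have "amp x f \<in> M"
    using P(1) by metis
  then obtain u where "u \<in> (\<lambda>a. amp a f) ` A" "dist u (amp x f) < e"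
    unfolding M_def closure_approachable using e by blast
  then show ?thesis
    by (auto simp: dist_norm norm_minus_commute)
qed

text \<open>A basic ultraweak neighbourhood involves finitely many pairs of sequences. Stored in
  disjoint blocks of coordinates, the first components form one vector of a Hilbert sum, so a single
  norm approximation by \<open>amp_density\<close> controls all these functionals at once.\<close>

lemma vn_generated_subset_ultraweak_closure: "vn_generated A \<subseteq> ultraweak_topology closure_of A"
proof
  fix x
  assume x: "x \<in> vn_generated A"
  show "x \<in> ultraweak_topology closure_of A"
    unfolding in_closure_of
  proof (intro conjI allI impI)
    show "x \<in> topspace ultraweak_topology"
      by (simp add: ultraweak_topology_def topspace_pullback_topology)
    fix T
    assume T: "x \<in> T \<and> openin ultraweak_topology T"
    then obtain U where U: "open U" "T = ultraweak_functional -` U"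
      by (auto simp: ultraweak_topology_def openin_pullback_topology)
    have "openin (product_topology (\<lambda>_. euclidean) UNIV) U" "ultraweak_functional x \<in> U"
      using U T by (auto simp: open_fun_def)
    from product_topology_open_contains_basis[OF this] obtain X
      where X: "ultraweak_functional x \<in> (\<Pi>\<^sub>E p\<in>UNIV. X p)" "\<And>p. open (X p)"
        "finite {p. X p \<noteq> UNIV}" "(\<Pi>\<^sub>E p\<in>UNIV. X p) \<subseteq> U"
      by auto
    \<comment> \<open>For pairs that are not square summable the functional is the constant
      \<open>0\<close>, so only the good pairs restrict the operator.\<close>
    define good where "good p \<longleftrightarrow> summable (\<lambda>n. (norm (fst p n))\<^sup>2) \<and> summable (\<lambda>n. (norm (snd p n))\<^sup>2)"
      for p :: "(nat \<Rightarrow> 'h) \<times> (nat \<Rightarrow> 'h)"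
    define J where "J = {p. X p \<noteq> UNIV \<and> good p}"
    have J: "finite J"
      using X(3) by (rule rev_finite_subset) (auto simp: J_def)
    define emb :: "((nat \<Rightarrow> 'h) \<times> (nat \<Rightarrow> 'h)) \<Rightarrow> (nat \<Rightarrow> 'h) \<Rightarrow> (nat \<times> ((nat \<Rightarrow> 'h) \<times> (nat \<Rightarrow> 'h)), 'h) ell2"
      where "emb p s = Abs_ell2 (\<lambda>(n, q). if q = p then s n else 0)" for p s
    have Rep_emb: "Rep_ell2 (emb p s) = (\<lambda>(n, q). if q = p then s n else 0)"
      if s: "summable (\<lambda>n. (norm (s n))\<^sup>2)" for p s
    proof -
      have "(\<lambda>n. (norm (s n))\<^sup>2) summable_on UNIV"
        using s by (simp add: summable_on_UNIV_nonneg_real_iff)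
      then have "((\<lambda>i. (norm (case i of (n, q) \<Rightarrow> if q = p then s n else 0))\<^sup>2) \<circ> (\<lambda>n. (n, p))) summable_on UNIV"
        by (simp add: o_def)
      then have "(\<lambda>i. (norm (case i of (n, q) \<Rightarrow> if q = p then s n else 0))\<^sup>2) summable_on range (\<lambda>n. (n, p))"
        by (subst summable_on_reindex) (auto simp: inj_on_def)
      then have "(\<lambda>i. (norm (case i of (n, q) \<Rightarrow> if q = p then s n else 0))\<^sup>2) summable_on UNIV"
        by (rule iffD1[OF summable_on_cong_neutral, rotated -1]) auto
      then show ?thesis
        unfolding emb_def by (intro Abs_ell2_inverse) simp
    qed
    have cinner_emb: "cinner f (emb p s) = (\<Sum>n. cinner (Rep_ell2 f (n, p)) (s n))"
      if s: "summable (\<lambda>n. (norm (s n))\<^sup>2)" for f p s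
    proof -
      have sm: "(\<lambda>i. cinner (Rep_ell2 f i) (Rep_ell2 (emb p s) i)) summable_on UNIV"
        using Rep_ell2[of f] Rep_ell2[of "emb p s"] by (intro sq_summable_cinner) auto
      have "cinner f (emb p s) = infsum (\<lambda>i. cinner (Rep_ell2 f i) (Rep_ell2 (emb p s) i)) UNIV"
        by (simp add: cinner_ell2.rep_eq)
      also have "\<dots> = infsum (\<lambda>i. cinner (Rep_ell2 f i) (Rep_ell2 (emb p s) i)) (range (\<lambda>n. (n, p)))"
        by (rule infsum_cong_neutral) (auto simp: Rep_emb[OF s])
      also have "\<dots> = infsum ((\<lambda>i. cinner (Rep_ell2 f i) (Rep_ell2 (emb p s) i)) \<circ> (\<lambda>n. (n, p))) UNIV"
        by (rule infsum_reindex) (auto simp: inj_on_def)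
      also have "\<dots> = infsum (\<lambda>n. cinner (Rep_ell2 f (n, p)) (s n)) UNIV"
        by (simp add: Rep_emb[OF s] o_def)
      also have "\<dots> = (\<Sum>n. cinner (Rep_ell2 f (n, p)) (s n))"
      proof -
        have "(\<lambda>i. cinner (Rep_ell2 f i) (Rep_ell2 (emb p s) i)) summable_on (range (\<lambda>n. (n, p)))"
          by (rule summable_on_subset_banach[OF sm]) simp
        then have "((\<lambda>i. cinner (Rep_ell2 f i) (Rep_ell2 (emb p s) i)) \<circ> (\<lambda>n. (n, p))) summable_on UNIV"
          by (subst (asm) summable_on_reindex) (auto simp: inj_on_def)
        then have "(\<lambda>n. cinner (Rep_ell2 f (n, p)) (s n)) summable_on UNIV"
          by (simp add: Rep_emb[OF s] o_def)
        from has_sum_imp_sums[OF has_sum_infsum[OF this]] show ?thesis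
          by (simp add: sums_iff)
      qed
      finally show ?thesis .
    qed
    define f where "f = (\<Sum>p\<in>J. emb p (fst p))"
    have Rep_sum: "Rep_ell2 (\<Sum>p\<in>K. g p) i = (\<Sum>p\<in>K. Rep_ell2 (g p) i)"
      for K i and g :: "((nat \<Rightarrow> 'h) \<times> (nat \<Rightarrow> 'h)) \<Rightarrow> (nat \<times> ((nat \<Rightarrow> 'h) \<times> (nat \<Rightarrow> 'h)), 'h) ell2"
      by (induction K rule: infinite_finite_induct) (auto simp: zero_ell2.rep_eq plus_ell2.rep_eq)
    have Rep_f: "Rep_ell2 f (n, p) = fst p n" if "p \<in> J" for n p
    proof -
      have "Rep_ell2 f (n, p) = (\<Sum>q\<in>J. if p = q then fst q n else 0)"
        unfolding f_def Rep_sum by (intro sum.cong) (auto simp: Rep_emb J_def good_def)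
      then show ?thesis
        using J that by (simp add: sum.delta')
    qed
    have uw: "ultraweak_functional S p = cinner (amp S f) (emb p (snd p))" if "p \<in> J" for S p
      using that by (simp add: cinner_emb Rep_f J_def good_def ultraweak_functional_def case_prod_beta)
    have "\<exists>e>0. ball (ultraweak_functional x p) e \<subseteq> X p" for p
      using X(1,2) by (metis PiE_mem UNIV_I open_contains_ball)
    then obtain e where e: "\<And>p. e p > 0" "\<And>p. ball (ultraweak_functional x p) (e p) \<subseteq> X p"
      by metis
    \<comment> \<open>The inserted \<open>1\<close> covers an empty \<open>J\<close>, and adding
      \<open>1\<close> to the norm avoids division by zero.\<close>
    define d where "d = Min (insert 1 ((\<lambda>p. e p / (norm (emb p (snd p)) + 1)) ` J))"
    have d: "d > 0" "\<And>p. p \<in> J \<Longrightarrow> d * norm (emb p (snd p)) < e p"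
    proof -
      show "d > 0"
        unfolding d_def using J e(1) by (subst Min_gr_iff) (auto intro!: divide_pos_pos add_nonneg_pos)
      fix p
      assume "p \<in> J"
      then have "d \<le> e p / (norm (emb p (snd p)) + 1)"
        unfolding d_def using J by (intro Min_le) auto
      then have "d * (norm (emb p (snd p)) + 1) \<le> e p"
        by (simp add: pos_le_divide_eq add_nonneg_pos)
      with \<open>d > 0\<close> show "d * norm (emb p (snd p)) < e p"
        by (simp add: distrib_left)
    qed
    obtain a where a: "a \<in> A" "norm (amp x f - amp a f) < d"
      using amp_density[OF x d(1)] by blast
    have "ultraweak_functional a p \<in> X p" for p
    proof (cases "p \<in> J")
      case True
      have "dist (ultraweak_functional x p) (ultraweak_functional a p)
          = cmod (cinner (amp x f - amp a f) (emb p (snd p)))"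
        by (simp add: uw True dist_norm cinner_diff_left)
      also have "\<dots> \<le> norm (amp x f - amp a f) * norm (emb p (snd p))"
        by (rule cmod_cinner_le)
      also have "\<dots> \<le> d * norm (emb p (snd p))"
        using a(2) by (intro mult_right_mono) auto
      also have "\<dots> < e p"
        by (rule d(2)[OF True])
      finally show ?thesis
        using e(2)[of p] by auto
    next
      case False
      show ?thesis
      proof (cases "X p = UNIV")
        case False
        then have "\<not> good p"
          using \<open>p \<notin> J\<close> by (simp add: J_def)
        then have "ultraweak_functional a p = ultraweak_functional x p"
          by (auto simp: ultraweak_functional_def good_def case_prod_beta)
        then show ?thesis
          using X(1) by (metis PiE_mem UNIV_I)
      qed simp
    qed
    then have "ultraweak_functional a \<in> U"
      using X(4) by auto
    then show "\<exists>y. y \<in> A \<and> y \<in> T"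
      using a(1) U(2) by auto
  qed
qed

end

section \<open>The left regular representation\<close>

lemma abs_L2_eqI:
  assumes "square_integrable f" "square_integrable g" "AE x in haar. f x = g x"
  shows "abs_L2 f = abs_L2 g"
  using Quotient_rel_abs[OF Quotient_L2, of f g] assms by (simp add: L2_rel_def)

lemma abs_L2_add:
  "square_integrable f \<Longrightarrow> square_integrable g \<Longrightarrow> abs_L2 f + abs_L2 g = abs_L2 (\<lambda>x. f x + g x)"
  by (simp add: plus_L2.abs_eq L2_rel_refl)

lemma abs_L2_scaleC: "square_integrable f \<Longrightarrow> c *\<^sub>C abs_L2 f = abs_L2 (\<lambda>x. c * f x)"
  by (simp add: scaleC_L2.abs_eq L2_rel_refl)

lemma cinner_abs_L2:
  "square_integrable f \<Longrightarrow> square_integrable g \<Longrightarrow> cinner (abs_L2 f) (abs_L2 g) = (\<integral>x. f x * cnj (g x) \<partial>haar)"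
  by (simp add: cinner_L2.abs_eq L2_rel_refl)

lemma lreg_abs_L2: "square_integrable f \<Longrightarrow> lreg s (abs_L2 f) = abs_L2 (\<lambda>t. f (- s + t))"
  by (simp add: lreg.rep_eq translate.abs_eq L2_rel_refl)

lemma lreg_lreg: "lreg s (lreg t x) = lreg (s + t) x"
proof -
  obtain f where "square_integrable f" "x = abs_L2 f"
    by (rule L2_repE)
  moreover have "- t + (- s + u) = - (s + t) + u" for u
    by (simp only: minus_add add.assoc)
  ultimately show ?thesis
    by (simp add: lreg_abs_L2 square_integrable_translate)
qed

lemma lreg_zero [simp]: "lreg 0 x = x"
proof -
  obtain f where "square_integrable f" "x = abs_L2 f"
    by (rule L2_repE)
  then show ?thesis
    by (simp add: lreg_abs_L2)
qed

lemma cinner_lreg_lreg: "cinner (lreg s x) (lreg s y) = cinner x y"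
proof -
  obtain f where f: "square_integrable f" "x = abs_L2 f"
    by (rule L2_repE)
  obtain g where g: "square_integrable g" "y = abs_L2 g"
    by (rule L2_repE)
  have "(\<lambda>t. f t * cnj (g t)) \<in> borel_measurable haar"
    by (rule borel_measurable_integrable[OF square_integrable_mult[OF f(1) g(1)]])
  from integral_translate[OF this, of "- s"] show ?thesis
    by (simp add: f g lreg_abs_L2 cinner_abs_L2 square_integrable_translate)
qed

lemma norm_lreg [simp]: "norm (lreg s x) = norm x"
  using cmod_cinner_self[of "lreg s x"] cmod_cinner_self[of x]
  by (simp add: cinner_lreg_lreg flip: power2_eq_square)

lemma clin_lreg [simp]: "clin (lreg s)"
  unfolding clin_def
proof (intro allI)
  fix c and x :: "'a L2"
  obtain f where f: "square_integrable f" "x = abs_L2 f"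
    by (rule L2_repE)
  show "lreg s (c *\<^sub>C x) = c *\<^sub>C lreg s x"
    by (simp add: f abs_L2_scaleC lreg_abs_L2 square_integrable_cmult square_integrable_translate)
qed

lemma cinner_lreg: "cinner (lreg s x) y = cinner x (lreg (- s) y)"
  using cinner_lreg_lreg[of "- s" "lreg s x" y] by (simp add: lreg_lreg)

lemma lreg_zero_id: "lreg 0 = id_blinfun"
  by (rule blinfun_eqI) simp

text \<open>Complex multiples are put among the generators so that the real span is a complex
  subspace.\<close>

definition lreg_span :: "('g::haar_group L2 \<Rightarrow>\<^sub>L 'g L2) set" where
  "lreg_span = span {scaleC_op c (lreg s) | c s. True}"

lemma scaleC_op_add: "scaleC_op c (S + T) = scaleC_op c S + scaleC_op c T"
  by (rule blinfun_eqI) (simp add: blinfun.add_left scaleC_add_right)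

lemma scaleC_op_scaleR: "scaleC_op c (r *\<^sub>R T) = r *\<^sub>R scaleC_op c T"
  by (rule blinfun_eqI) (simp add: blinfun.scaleR_left mult.commute flip: scaleC_of_real)

lemma scaleC_op_of_real: "scaleC_op (of_real r) T = r *\<^sub>R T"
  by (rule blinfun_eqI) (simp add: blinfun.scaleR_left scaleC_of_real)

lemma scaleC_op_zero [simp]: "scaleC_op c 0 = 0"
  by (rule blinfun_eqI) simp

lemma lreg_span_base: "scaleC_op c (lreg s) \<in> lreg_span"
  unfolding lreg_span_def by (rule span_base) auto

lemma subspace_lreg_span: "subspace lreg_span"
  by (simp add: lreg_span_def)

lemma lreg_span_induct [consumes 1, case_names base subspace]:
  assumes "a \<in> lreg_span" "\<And>c s. P (scaleC_op c (lreg s))" "subspace {a. P a}"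
  shows "P a"
  using assms(1) unfolding lreg_span_def
  by (rule span_induct) (use assms in auto)

lemma lreg_span_clin: "a \<in> lreg_span \<Longrightarrow> clin a"
  by (induction rule: lreg_span_induct)
     (auto simp: subspace_def clin_scaleC_op clin_add clin_scaleR)

lemma lreg_span_scaleC: "a \<in> lreg_span \<Longrightarrow> scaleC_op d a \<in> lreg_span"
proof (induction rule: lreg_span_induct)
  case (base c s)
  have "scaleC_op d (scaleC_op c (lreg s)) = scaleC_op (d * c) (lreg s)"
    by (rule blinfun_eqI) simp
  then show ?case
    using lreg_span_base[of "d * c" s] by simp
next
  case subspace
  then show ?case
    using subspace_lreg_span unfolding subspace_def by (auto simp: scaleC_op_add scaleC_op_scaleR)
qed

lemma lreg_span_compose:
  assumes "a \<in> lreg_span" "b \<in> lreg_span"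
  shows "a o\<^sub>L b \<in> lreg_span"
  using assms
proof (induction a rule: lreg_span_induct)
  case (base c s)
  from base show ?case
  proof (induction b rule: lreg_span_induct)
    case (base d t)
    have "scaleC_op c (lreg s) o\<^sub>L scaleC_op d (lreg t) = scaleC_op (c * d) (lreg (s + t))"
      by (rule blinfun_eqI) (simp add: clinD lreg_lreg)
    then show ?case
      using lreg_span_base by simp
  next
    case subspace
    show ?case
      using subspace_lreg_span unfolding subspace_def
      by (auto simp: bounded_bilinear.add_right[OF bounded_bilinear_blinfun_compose]
          bounded_bilinear.scaleR_right[OF bounded_bilinear_blinfun_compose]
          bounded_bilinear.zero_right[OF bounded_bilinear_blinfun_compose])
  qed
next
  case subspace
  show ?case
    using subspace_lreg_span assms(2) unfolding subspace_def
    by (auto simp: bounded_bilinear.add_left[OF bounded_bilinear_blinfun_compose]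
        bounded_bilinear.scaleR_left[OF bounded_bilinear_blinfun_compose]
        bounded_bilinear.zero_left[OF bounded_bilinear_blinfun_compose])
qed

lemma lreg_span_adj: "a \<in> lreg_span \<Longrightarrow> adj a \<in> lreg_span"
proof -
  assume a: "a \<in> lreg_span"
  \<comment> \<open>Complex linearity is carried along because \<open>adj\<close> is shown to be
    additive on complex linear operators only.\<close>
  then have "clin a \<and> adj a \<in> lreg_span"
  proof (induction rule: lreg_span_induct)
    case (base c s)
    have "adj (scaleC_op c (lreg s)) = scaleC_op (cnj c) (lreg (- s))"
      by (rule adj_unique) (auto simp: clin_scaleC_op cinner_lreg)
    then show ?case
      using lreg_span_base by (simp add: clin_scaleC_op)
  next
    case subspace
    have *: "adj 0 = (0 :: 'a L2 \<Rightarrow>\<^sub>L 'a L2)"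
      by (rule adj_unique) auto
    have **: "adj (S + T) = adj S + adj T" if "clin S" "clin T" for S T :: "'a L2 \<Rightarrow>\<^sub>L 'a L2"
      by (rule adj_unique)
         (auto simp: that clin_add blinfun.add_left cinner_add_left cinner_add_right cinner_adj)
    have ***: "adj (r *\<^sub>R T) = r *\<^sub>R adj T" if "clin T" for r and T :: "'a L2 \<Rightarrow>\<^sub>L 'a L2"
      by (rule adj_unique) (auto simp: that clin_scaleR blinfun.scaleR_left cinner_adj)
    show ?case
      using subspace_lreg_span unfolding subspace_def by (auto simp: * ** *** clin_add clin_scaleR)
  qed
  then show ?thesis
    by simp
qed

lemma lreg_in_lreg_span: "lreg s \<in> lreg_span"
proof -
  have "scaleC_op 1 (lreg s) = lreg s"
    by (rule blinfun_eqI) simp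
  then show ?thesis
    using lreg_span_base[of 1 s] by simp
qed

section \<open>Testing normal functionals on translations\<close>

lemma VN_star:
  shows lreg_in_VN: "lreg s \<in> VN" and VN_id: "id_blinfun \<in> VN"
    and VN_add: "S \<in> VN \<Longrightarrow> T \<in> VN \<Longrightarrow> S + T \<in> VN"
    and VN_scaleC: "T \<in> VN \<Longrightarrow> scaleC_op c T \<in> VN"
    and VN_cadjoint: "T \<in> VN \<Longrightarrow> cadjoint T \<in> VN"
    and VN_zero: "0 \<in> VN"
  unfolding VN_def by (auto intro: vn_generated_star vn_generated_superset[THEN subsetD])

lemma VN_clin: "x \<in> VN \<Longrightarrow> clin x"
  unfolding VN_def by (rule vn_generated_clin[of "range lreg"]) auto

lemma VN_scaleR: "T \<in> VN \<Longrightarrow> r *\<^sub>R T \<in> VN"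
  using VN_scaleC[of T "of_real r"] by (simp add: scaleC_op_of_real)

lemma subspace_VN: "subspace VN"
  by (auto simp: subspace_def VN_star VN_scaleR)

lemma lreg_span_subset_VN: "lreg_span \<subseteq> VN"
  unfolding lreg_span_def by (rule span_minimal[OF _ subspace_VN]) (auto intro: VN_scaleC lreg_in_VN)

lemma VN_subset_ultraweak_closure: "VN \<subseteq> ultraweak_topology closure_of lreg_span"
proof -
  have "VN \<subseteq> vn_generated lreg_span"
    unfolding VN_def vn_generated_def using lreg_in_lreg_span by blast
  also have "\<dots> \<subseteq> ultraweak_topology closure_of lreg_span"
    by (rule vn_generated_subset_ultraweak_closure)
       (auto intro: lreg_span_clin subspace_lreg_span lreg_span_scaleC lreg_span_compose lreg_span_adj
         simp flip: lreg_zero_id intro: lreg_in_lreg_span)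
  finally show ?thesis .
qed

text \<open>The principle behind every identity about \<open>\<Delta>\<close> below: ultraweakly
  continuous complex linear functionals on \<open>VN\<close> are determined by their values on
  translations.\<close>

lemma VN_functional_eqI:
  fixes f g :: "('g::haar_group L2 \<Rightarrow>\<^sub>L 'g L2) \<Rightarrow> complex"
  assumes cont: "continuous_map (subtopology ultraweak_topology VN) euclidean f"
      "continuous_map (subtopology ultraweak_topology VN) euclidean g"
    and add: "\<And>S T. S \<in> VN \<Longrightarrow> T \<in> VN \<Longrightarrow> f (S + T) = f S + f T" "\<And>S T. S \<in> VN \<Longrightarrow> T \<in> VN \<Longrightarrow> g (S + T) = g S + g T"
    and scale: "\<And>c T. T \<in> VN \<Longrightarrow> f (scaleC_op c T) = c * f T" "\<And>c T. T \<in> VN \<Longrightarrow> g (scaleC_op c T) = c * g T"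
    and eq: "\<And>s. f (lreg s) = g (lreg s)" and x: "x \<in> VN"
  shows "f x = g x"
proof (rule forall_in_closure_of_eq[OF _ _ cont])
  show "x \<in> subtopology ultraweak_topology VN closure_of lreg_span"
    unfolding closure_of_subtopology Int_absorb1[OF lreg_span_subset_VN]
    using VN_subset_ultraweak_closure x by blast
  fix a :: "'g L2 \<Rightarrow>\<^sub>L 'g L2"
  assume "a \<in> lreg_span"
  then have "a \<in> VN \<and> f a = g a"
  proof (induction rule: lreg_span_induct)
    case (base c s)
    show ?case
      by (simp add: VN_scaleC lreg_in_VN scale eq)
  next
    case subspace
    have "f 0 = 0" "g 0 = 0"
      using scale[OF VN_zero, of 0] by simp_all
    moreover have "f (r *\<^sub>R T) = of_real r * f T" "g (r *\<^sub>R T) = of_real r * g T" if "T \<in> VN" for r T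
      using scale[OF that, of "of_real r"] by (simp_all add: scaleC_op_of_real)
    ultimately show ?case
      by (auto simp: subspace_def VN_zero VN_add VN_scaleR add)
  qed
  then show "f a = g a"
    by simp
qed simp

text \<open>A vector functional is the ultraweak functional of two sequences supported at index
  \<open>0\<close>.\<close>

lemma continuous_map_vector_functional:
  "continuous_map ultraweak_topology euclidean (\<lambda>T :: 'h::complex_inner \<Rightarrow>\<^sub>L 'h. cinner (T \<xi>) \<eta>)"
proof -
  define p where "p = (\<lambda>n::nat. if n = 0 then \<xi> else 0, \<lambda>n::nat. if n = 0 then \<eta> else 0)"
  have s: "summable (\<lambda>n::nat. (norm (if n = 0 then z else 0))\<^sup>2)" for z :: 'h
    by (rule summable_finite[of "{0}"]) auto
  have u: "ultraweak_functional T p = cinner (T \<xi>) \<eta>" for T :: "'h \<Rightarrow>\<^sub>L 'h"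
  proof -
    have "(\<lambda>n. cinner (T (fst p n)) (snd p n)) sums (\<Sum>n\<in>{0}. cinner (T (fst p n)) (snd p n))"
      by (rule sums_finite) (auto simp: p_def)
    then show ?thesis
      using s[of \<xi>] s[of \<eta>] by (simp add: ultraweak_functional_def case_prod_beta p_def sums_iff)
  qed
  have "continuous_map ultraweak_topology euclidean ((\<lambda>F. F p) \<circ> ultraweak_functional)"
    unfolding ultraweak_topology_def
    by (rule continuous_map_pullback) (auto intro: continuous_on_product_coordinates)
  then show ?thesis
    by (simp add: o_def u)
qed

lemma continuous_map_VN_vector_functional:
  "continuous_map (subtopology ultraweak_topology N) euclidean (\<lambda>T. cinner (T \<xi>) \<eta>)"
  by (rule continuous_map_from_subtopology[OF continuous_map_vector_functional])

section \<open>Multiplication operators\<close>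

definition bdd_borel :: "('g::haar_group \<Rightarrow> complex) \<Rightarrow> bool" where
  "bdd_borel g \<longleftrightarrow> g \<in> borel_measurable haar \<and> (\<exists>C. \<forall>x. cmod (g x) \<le> C)"

lemma square_integrable_mul:
  assumes g: "g \<in> borel_measurable haar" and C: "\<And>x. cmod (g x) \<le> C" and f: "square_integrable f"
  shows "square_integrable (\<lambda>x. g x * f x)"
  unfolding square_integrable_def
proof
  have [measurable]: "g \<in> borel_measurable haar" "f \<in> borel_measurable haar"
    using g f by (auto simp: square_integrable_def)
  show "(\<lambda>x. g x * f x) \<in> borel_measurable haar"
    by measurable
  show "integrable haar (\<lambda>x. (cmod (g x * f x))\<^sup>2)"
  proof (rule Bochner_Integration.integrable_bound)
    show "integrable haar (\<lambda>x. C\<^sup>2 * (cmod (f x))\<^sup>2)"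
      using f by (simp add: square_integrable_def)
    show "AE x in haar. norm ((cmod (g x * f x))\<^sup>2) \<le> norm (C\<^sup>2 * (cmod (f x))\<^sup>2)"
      using C by (auto simp: norm_mult power_mult_distrib intro!: AE_I2 mult_right_mono power_mono)
  qed measurable
qed

lemma square_integrable_bdd_borel: "bdd_borel g \<Longrightarrow> square_integrable f \<Longrightarrow> square_integrable (\<lambda>x. g x * f x)"
  unfolding bdd_borel_def using square_integrable_mul by blast

text \<open>A representative is chosen instead of lifting, because boundedness of \<open>g\<close>
  is not part of its type. For \<open>bdd_borel\<close> symbols the choice is irrelevant by
  \<open>mul_abs_L2\<close>.\<close>

definition mul :: "('g::haar_group \<Rightarrow> complex) \<Rightarrow> 'g L2 \<Rightarrow> 'g L2" where
  "mul g x = abs_L2 (\<lambda>t. g t * (SOME f. square_integrable f \<and> x = abs_L2 f) t)"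

lemma AE_eq_if_abs_L2_eq:
  assumes "square_integrable f" "square_integrable g" "abs_L2 f = abs_L2 g"
  shows "AE x in haar. f x = g x"
  using Quotient_rel[OF Quotient_L2, of f g] assms by (simp add: L2_rel_def)

lemma mul_abs_L2:
  assumes g: "bdd_borel g" and f: "square_integrable f"
  shows "mul g (abs_L2 f) = abs_L2 (\<lambda>t. g t * f t)"
proof -
  define f' where "f' = (SOME f'. square_integrable f' \<and> abs_L2 f = abs_L2 f')"
  have f': "square_integrable f'" "abs_L2 f = abs_L2 f'"
    unfolding f'_def using someI_ex[of "\<lambda>f'. square_integrable f' \<and> abs_L2 f = abs_L2 f'"] f by blast+
  from AE_eq_if_abs_L2_eq[OF f f'] show ?thesis
    unfolding mul_def f'_def[symmetric]
    by (intro abs_L2_eqI square_integrable_bdd_borel g f f') (auto elim: eventually_mono)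
qed

lemma norm_mul_le:
  assumes g: "g \<in> borel_measurable haar" and C: "\<And>x. cmod (g x) \<le> C"
  shows "norm (mul g x) \<le> C * norm x"
proof -
  obtain f where f: "square_integrable f" "x = abs_L2 f"
    by (rule L2_repE)
  have b: "bdd_borel g"
    using assms by (auto simp: bdd_borel_def)
  have C0: "0 \<le> C"
    using C[of undefined] norm_ge_zero order.trans by blast
  have "(norm (mul g x))\<^sup>2 = (\<integral>t. (cmod (g t * f t))\<^sup>2 \<partial>haar)"
    by (simp add: f mul_abs_L2[OF b] norm_abs_L2 square_integrable_bdd_borel[OF b])
  also have "\<dots> \<le> (\<integral>t. C\<^sup>2 * (cmod (f t))\<^sup>2 \<partial>haar)"
    using square_integrable_bdd_borel[OF b f(1)] f(1) C
    by (intro integral_mono) (auto simp: square_integrable_def norm_mult power_mult_distrib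
        intro!: mult_right_mono power_mono)
  also have "\<dots> = (C * norm x)\<^sup>2"
    by (simp add: f norm_abs_L2 power_mult_distrib)
  finally show ?thesis
    by (rule power2_le_imp_le) (simp add: C0)
qed

lemma mul_add_right:
  assumes g: "bdd_borel g"
  shows "mul g (x + y) = mul g x + mul g y"
proof -
  obtain f f' where "square_integrable f" "x = abs_L2 f" "square_integrable f'" "y = abs_L2 f'"
    by (metis L2_repE)
  then show ?thesis
    by (simp add: abs_L2_add mul_abs_L2 g square_integrable_add square_integrable_bdd_borel distrib_left)
qed

lemma mul_scaleC_right:
  assumes g: "bdd_borel g"
  shows "mul g (c *\<^sub>C x) = c *\<^sub>C mul g x"
proof -
  obtain f where "square_integrable f" "x = abs_L2 f"
    by (metis L2_repE)
  then show ?thesis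
    by (simp add: abs_L2_scaleC mul_abs_L2 g square_integrable_cmult square_integrable_bdd_borel
        mult.left_commute)
qed

lemma mul_scaleR_right:
  assumes g: "bdd_borel g"
  shows "mul g (r *\<^sub>R x) = r *\<^sub>R mul g x"
  using mul_scaleC_right[OF g, of "of_real r"] by (simp add: scaleC_of_real)

lemma bdd_borel_add: "bdd_borel g \<Longrightarrow> bdd_borel h \<Longrightarrow> bdd_borel (\<lambda>x. g x + h x)"
  unfolding bdd_borel_def by (auto intro!: borel_measurable_add) (meson add_mono norm_triangle_le)

lemma bdd_borel_mult: 
  assumes "bdd_borel g" "bdd_borel h"
  shows "bdd_borel (\<lambda>x. g x * h x)"
proof -
  obtain C D where "\<And>x. cmod (g x) \<le> C" "\<And>x. cmod (h x) \<le> D"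
    using assms unfolding bdd_borel_def by blast
  then have "cmod (g x * h x) \<le> C * D" for x
    unfolding norm_mult by (metis mult_mono' norm_ge_zero)
  then show ?thesis
    using assms unfolding bdd_borel_def by auto
qed

lemma bdd_borel_const: "bdd_borel (\<lambda>_. c)"
  unfolding bdd_borel_def by auto

lemma bdd_borel_cnj: "bdd_borel g \<Longrightarrow> bdd_borel (\<lambda>x. cnj (g x))"
  unfolding bdd_borel_def
  by (auto intro!: borel_measurable_continuous_on[of cnj, OF continuous_on_cnj[OF continuous_on_id]])

lemma bdd_borel_indicator: "A \<in> sets borel \<Longrightarrow> bdd_borel (indicator A)"
  unfolding bdd_borel_def by (auto intro!: borel_measurable_indicator exI[of _ 1] simp: indicator_def)

lemma bdd_borel_sum:
  assumes "\<And>i. i \<in> I \<Longrightarrow> bdd_borel (g i)"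
  shows "bdd_borel (\<lambda>x. \<Sum>i\<in>I. g i x)"
  using assms by (induction I rule: infinite_finite_induct) (auto intro: bdd_borel_add bdd_borel_const)

lemma mul_add_left:
  assumes "bdd_borel g" "bdd_borel h"
  shows "mul (\<lambda>t. g t + h t) x = mul g x + mul h x"
proof -
  obtain f where "square_integrable f" "x = abs_L2 f"
    by (metis L2_repE)
  then show ?thesis
    by (simp add: abs_L2_add mul_abs_L2 assms bdd_borel_add square_integrable_bdd_borel distrib_right)
qed

lemma mul_const: "mul (\<lambda>_. c) x = c *\<^sub>C x"
proof -
  obtain f where "square_integrable f" "x = abs_L2 f"
    by (metis L2_repE)
  then show ?thesis
    by (simp add: abs_L2_scaleC mul_abs_L2 bdd_borel_const)
qed

lemma mul_mul:
  assumes "bdd_borel g" "bdd_borel h"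
  shows "mul g (mul h x) = mul (\<lambda>t. g t * h t) x"
proof -
  obtain f where "square_integrable f" "x = abs_L2 f"
    by (metis L2_repE)
  then show ?thesis
    by (simp add: mul_abs_L2 assms bdd_borel_mult square_integrable_bdd_borel mult.assoc)
qed

lemma mul_sum_left:
  assumes "\<And>i. i \<in> I \<Longrightarrow> bdd_borel (g i)"
  shows "mul (\<lambda>t. \<Sum>i\<in>I. g i t) x = (\<Sum>i\<in>I. mul (g i) x)"
  using assms
  by (induction I rule: infinite_finite_induct)
     (auto simp: mul_add_left bdd_borel_sum mul_const)

lemma cinner_mul:
  assumes "bdd_borel g"
  shows "cinner (mul g x) y = cinner x (mul (\<lambda>t. cnj (g t)) y)"
proof -
  obtain f f' where "square_integrable f" "x = abs_L2 f" "square_integrable f'" "y = abs_L2 f'"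
    by (metis L2_repE)
  then show ?thesis
    by (simp add: cinner_abs_L2 mul_abs_L2 assms bdd_borel_cnj square_integrable_bdd_borel)
       (simp add: mult_ac)
qed

lemma bdd_borel_translate: "bdd_borel g \<Longrightarrow> bdd_borel (\<lambda>t. g (s + t))"
  unfolding bdd_borel_def using measurable_compose[OF measurable_translate] by blast

lemma lreg_mul:
  assumes g: "bdd_borel g"
  shows "lreg s (mul g x) = mul (\<lambda>t. g (- s + t)) (lreg s x)"
proof -
  obtain f where "square_integrable f" "x = abs_L2 f"
    by (metis L2_repE)
  then show ?thesis
    by (simp add: lreg_abs_L2 mul_abs_L2 g bdd_borel_translate square_integrable_translate
        square_integrable_bdd_borel)
qed

section \<open>Complex conjugation\<close>

lemma square_integrable_cnj: "square_integrable f \<Longrightarrow> square_integrable (\<lambda>x. cnj (f x))"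
  unfolding square_integrable_def
  by (auto intro!: borel_measurable_continuous_on[of cnj, OF continuous_on_cnj[OF continuous_on_id]])

lift_definition conj_L2 :: "'g::haar_group L2 \<Rightarrow> 'g L2" is "\<lambda>f x. cnj (f x)"
  by (auto simp: L2_rel_def square_integrable_cnj)

lemma conj_abs_L2: "square_integrable f \<Longrightarrow> conj_L2 (abs_L2 f) = abs_L2 (\<lambda>x. cnj (f x))"
  by (simp add: conj_L2.abs_eq L2_rel_refl)

lemma cinner_conj: "cinner (conj_L2 x) y = cinner (conj_L2 y) x"
proof -
  obtain f f' where "square_integrable f" "x = abs_L2 f" "square_integrable f'" "y = abs_L2 f'"
    by (metis L2_repE)
  then show ?thesis
    by (simp add: cinner_abs_L2 conj_abs_L2 square_integrable_cnj mult.commute)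
qed

lemma cinner_conj_conj: "cinner (conj_L2 x) (conj_L2 y) = cnj (cinner x y)"
proof -
  obtain f f' where "square_integrable f" "x = abs_L2 f" "square_integrable f'" "y = abs_L2 f'"
    by (metis L2_repE)
  then show ?thesis
    by (simp add: cinner_abs_L2 conj_abs_L2 square_integrable_cnj flip: Bochner_Integration.integral_cnj)
qed

lemma norm_conj [simp]: "norm (conj_L2 x) = norm x"
  using cmod_cinner_self[of "conj_L2 x"] cmod_cinner_self[of x]
  by (simp add: cinner_conj_conj flip: power2_eq_square)

lemma conj_conj [simp]: "conj_L2 (conj_L2 x) = x"
proof -
  obtain f where "square_integrable f" "x = abs_L2 f"
    by (metis L2_repE)
  then show ?thesis
    by (simp add: conj_abs_L2 square_integrable_cnj)
qed

lemma conj_lreg: "conj_L2 (lreg s x) = lreg s (conj_L2 x)"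
proof -
  obtain f where "square_integrable f" "x = abs_L2 f"
    by (metis L2_repE)
  then show ?thesis
    by (simp add: conj_abs_L2 square_integrable_cnj lreg_abs_L2 square_integrable_translate)
qed

section \<open>Haar measure\<close>

lemma image_plus_eq: "(+) s ` A = (\<lambda>t. - s + t) -` (A :: 'g::group_add set)"
proof (intro set_eqI iffI)
  fix x
  assume "x \<in> (\<lambda>t. - s + t) -` A"
  then show "x \<in> (+) s ` A"
    by (intro image_eqI[of _ _ "- s + x"]) (auto simp flip: add.assoc)
qed (auto simp flip: add.assoc)

lemma image_plus_right_eq: "(\<lambda>x. x + y) ` A = (\<lambda>t. t - y) -` (A :: 'g::group_add set)"
proof (intro set_eqI iffI)
  fix x
  assume "x \<in> (\<lambda>t. t - y) -` A"
  then show "x \<in> (\<lambda>x. x + y) ` A"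
    by (intro image_eqI[of _ _ "x - y"]) auto
qed auto

lemma open_image_plus: "open U \<Longrightarrow> open ((+) s ` (U :: 'g::topological_group_add set))"
  unfolding image_plus_eq by (intro open_vimage continuous_intros)

lemma compact_image_plus: "compact K \<Longrightarrow> compact ((+) s ` (K :: 'g::topological_group_add set))"
  by (intro compact_continuous_image continuous_intros)

lemma compact_image_plus_right: "compact K \<Longrightarrow> compact ((\<lambda>x. x + s) ` (K :: 'g::topological_group_add set))"
  by (intro compact_continuous_image continuous_intros)

lemma borel_image_plus: "A \<in> sets borel \<Longrightarrow> (+) s ` A \<in> sets (borel :: 'g::haar_group measure)"
  unfolding image_plus_eq using measurable_sets[OF measurable_translate, of A "- s"] by simp

lemma borel_compact: "compact K \<Longrightarrow> K \<in> sets (borel :: 'g::t2_space measure)"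
  by (intro borel_closed compact_imp_closed)

lemma emeasure_haar_translate: "A \<in> sets borel \<Longrightarrow> emeasure haar ((+) s ` A)
    = emeasure haar (A :: 'g::haar_group set)"
  by (simp add: haar_left_invariant)

lemma fmeasurable_compact: "compact K \<Longrightarrow> K \<in> fmeasurable (haar :: 'g::haar_group measure)"
  using haar_finite_on_compact[of K] by (auto simp: fmeasurable_def borel_compact)

text \<open>The tube lemma at the parameter \<open>0\<close>: compactness of \<open>K\<close> yields
  one neighbourhood for all \<open>k\<close>.\<close>

lemma compact_nbhd:
  fixes f :: "'g::topological_group_add \<Rightarrow> 'g \<Rightarrow> 'g"
  assumes f: "continuous_on UNIV (\<lambda>(a, b). f a b)" and K: "compact K" and U: "open U"
    and K0: "\<And>k. k \<in> K \<Longrightarrow> f 0 k \<in> U"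
  shows "\<exists>N. open N \<and> 0 \<in> N \<and> (\<forall>n\<in>N. \<forall>k\<in>K. f n k \<in> U)"
proof -
  have op: "open ((\<lambda>(a, b). f a b) -` U)"
    by (rule open_vimage[OF U f])
  have "\<exists>A B. open A \<and> open B \<and> 0 \<in> A \<and> k \<in> B \<and> (\<forall>a\<in>A. \<forall>b\<in>B. f a b \<in> U)" if "k \<in> K" for k
  proof -
    have "(0, k) \<in> (\<lambda>(a, b). f a b) -` U"
      using K0[OF that] by simp
    with op obtain A B where "open A" "open B" "(0, k) \<in> A \<times> B" "A \<times> B \<subseteq> (\<lambda>(a, b). f a b) -` U"
      by (rule open_prod_elim)
    then show ?thesis
      by (intro exI[of _ A] exI[of _ B]) auto
  qed
  then obtain A B where AB: "\<And>k. k \<in> K \<Longrightarrow> open (A k) \<and> open (B k) \<and> 0 \<in> A k \<and> k \<in> B k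
      \<and> (\<forall>a\<in>A k. \<forall>b\<in>B k. f a b \<in> U)"
    by metis
  obtain C where C: "C \<subseteq> K" "finite C" "K \<subseteq> (\<Union>k\<in>C. B k)"
    using compactE_image[OF K, of K B] AB by blast
  show ?thesis
  proof (intro exI conjI ballI)
    show "open (\<Inter>k\<in>C. A k)"
      using C AB by (intro open_INT) auto
    show "0 \<in> (\<Inter>k\<in>C. A k)"
      using C AB by auto
    show "f n k \<in> U" if "n \<in> (\<Inter>k\<in>C. A k)" "k \<in> K" for n k
      using that C AB by blast
  qed
qed

lemma finite_disjointify:
  fixes C :: "'a \<Rightarrow> 'b set"
  assumes "finite Z"
  shows "\<exists>B. (\<forall>z\<in>Z. B z \<subseteq> C z) \<and> disjoint_family_on B Z \<and> (\<Union>z\<in>Z. B z) = (\<Union>z\<in>Z. C z) \<and>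
      ((\<forall>z\<in>Z. C z \<in> sets M) \<longrightarrow> (\<forall>z\<in>Z. B z \<in> sets M))"
  using assms
proof (induction Z)
  case empty
  then show ?case
    by (auto simp: disjoint_family_on_def)
next
  case (insert z Z)
  then obtain B where B: "\<forall>z\<in>Z. B z \<subseteq> C z" "disjoint_family_on B Z" "(\<Union>z\<in>Z. B z) = (\<Union>z\<in>Z. C z)"
     "(\<forall>z\<in>Z. C z \<in> sets M) \<longrightarrow> (\<forall>z\<in>Z. B z \<in> sets M)"
    by blast
  show ?case
  proof (intro exI conjI)
    let ?B = "B(z := C z - (\<Union>z\<in>Z. C z))"
    show "\<forall>y\<in>insert z Z. ?B y \<subseteq> C y"
      using B(1) by auto
    show "disjoint_family_on ?B (insert z Z)"
      using B(1,2) insert.hyps unfolding disjoint_family_on_def by (auto simp: fun_upd_def) blast+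
    show "(\<Union>y\<in>insert z Z. ?B y) = (\<Union>y\<in>insert z Z. C y)"
      using B(3) insert.hyps by (auto simp: fun_upd_def split: if_splits)
    show "(\<forall>y\<in>insert z Z. C y \<in> sets M) \<longrightarrow> (\<forall>y\<in>insert z Z. ?B y \<in> sets M)"
      using B(4) insert.hyps by (auto intro!: sets.Diff sets.finite_UN)
  qed
qed

text \<open>The source of all step function approximations: a field of vectors that varies little
  over translates of \<open>N\<close> is nearly constant on each piece.\<close>

lemma compact_partition:
  fixes K :: "'g::haar_group set"
  assumes K: "compact K" and N: "open N" "0 \<in> N"
  obtains Z B where "finite Z" "Z \<subseteq> K" "disjoint_family_on B Z" "(\<Union>z\<in>Z. B z) = K"
    "\<And>z. z \<in> Z \<Longrightarrow> B z \<in> sets borel" "\<And>z. z \<in> Z \<Longrightarrow> B z \<subseteq> (+) z ` N"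
proof -
  have "z \<in> (+) z ` N" for z
    using N(2) by (intro image_eqI[of _ _ 0]) auto
  then have "K \<subseteq> (\<Union>z\<in>K. (+) z ` N)"
    by blast
  with open_image_plus[OF N(1)] obtain Z where Z: "Z \<subseteq> K" "finite Z" "K \<subseteq> (\<Union>z\<in>Z. (+) z ` N)"
    by (rule compactE_image[OF K, of K "\<lambda>z. (+) z ` N"])
  obtain B where B: "\<forall>z\<in>Z. B z \<subseteq> K \<inter> (+) z ` N" "disjoint_family_on B Z"
      "(\<Union>z\<in>Z. B z) = (\<Union>z\<in>Z. K \<inter> (+) z ` N)"
      "(\<forall>z\<in>Z. K \<inter> (+) z ` N \<in> sets borel) \<longrightarrow> (\<forall>z\<in>Z. B z \<in> sets (borel :: 'g measure))"
    using finite_disjointify[OF Z(2), of "\<lambda>z. K \<inter> (+) z ` N" "borel :: 'g measure"]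
    by (elim exE conjE) (rule that)
  have "\<forall>z\<in>Z. K \<inter> (+) z ` N \<in> sets borel"
    by (intro ballI sets.Int borel_compact K borel_open open_image_plus N)
  with B(4) have "\<forall>z\<in>Z. B z \<in> sets borel"
    by blast
  moreover have "(\<Union>z\<in>Z. B z) = K"
    unfolding B(3) using Z(3) by blast
  ultimately show ?thesis
    using B(1,2) Z(1,2) by (intro that[of Z B]) auto
qed

text \<open>Finitely many translates of a nonempty open null set would cover any compact set. All
  compact sets would then be null, and by inner regularity so would the whole group.\<close>

lemma haar_open_pos:
  assumes U: "open U" "U \<noteq> {}"
  shows "emeasure haar (U :: 'g::haar_group set) > 0"
proof (rule ccontr)
  assume "\<not> 0 < emeasure haar U"
  then have U0: "emeasure haar U = 0"
    by simp
  obtain u where u: "u \<in> U"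
    using U by blast
  define N where "N = (+) (- u) ` U"
  have N: "open N" "0 \<in> N"
    using U u unfolding N_def by (auto intro!: open_image_plus image_eqI[of _ _ u])
  have N0: "emeasure haar ((+) z ` N) = 0" for z
    using U U0 by (simp add: N_def emeasure_haar_translate borel_image_plus)
  have "emeasure haar K = 0" if K: "compact K" for K :: "'g set"
  proof -
    obtain Z B where ZB: "finite Z" "Z \<subseteq> K" "disjoint_family_on B Z" "(\<Union>z\<in>Z. B z) = K"
      "\<And>z. z \<in> Z \<Longrightarrow> B z \<in> sets borel" "\<And>z. z \<in> Z \<Longrightarrow> B z \<subseteq> (+) z ` N"
      using compact_partition[OF K N] by metis
    have "emeasure haar (B z) = 0" if "z \<in> Z" for z
      using emeasure_mono[OF ZB(6)[OF that], of haar] N0[of z] N by (auto intro: borel_open open_image_plus)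
    then have "emeasure haar (\<Union>z\<in>Z. B z) = 0"
      using ZB by (subst sum_emeasure[symmetric]) auto
    then show ?thesis
      by (simp add: ZB)
  qed
  then have "(SUP K\<in>{K :: 'g set. compact K \<and> K \<subseteq> UNIV}. emeasure haar K) \<le> (0 :: ennreal)"
    by (intro SUP_least) auto
  then show False
    using haar_inner_regular[of "UNIV :: 'g set"] haar_nonzero[where 'a = 'g] by simp
qed

lemma compact_outer_approx:
  assumes K: "compact (K :: 'g::haar_group set)" and e: "e > 0"
  obtains U where "open U" "K \<subseteq> U" "U \<in> fmeasurable haar" "measure haar U < measure haar K + e"
proof -
  have fin: "emeasure haar K < \<infinity>"
    by (rule haar_finite_on_compact[OF K])
  have "(INF U\<in>{U. open U \<and> K \<subseteq> U}. emeasure haar U) = emeasure haar K"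
    using haar_outer_regular[of K] K by (simp add: borel_compact)
  also have "\<dots> < emeasure haar K + ennreal e"
    using fin e by (simp add: ennreal_add_left_cancel_less less_top[symmetric])
  finally obtain U where U: "open U" "K \<subseteq> U" "emeasure haar U < emeasure haar K + ennreal e"
    by (auto simp: INF_less_iff)
  have finU: "emeasure haar U < \<infinity>"
    using U(3) fin by (metis ennreal_less_top ennreal_add_less_top infinity_ennreal_def less_trans)
  then have f: "U \<in> fmeasurable haar"
    using U(1) by (auto simp: fmeasurable_def)
  have "ennreal (measure haar U) < ennreal (measure haar K + e)"
    using U(3) f fmeasurable_compact[OF K] e
    by (simp add: emeasure_eq_measure2 ennreal_plus less_imp_le)
  then show ?thesis
    using that[OF U(1,2) f] by (simp add: ennreal_less_iff)
qed

text \<open>Inner regularity is available for open sets only, so \<open>K\<close> is found inside an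
  open superset of \<open>A\<close> and may stick out of \<open>A\<close>; hence the symmetric
  difference.\<close>

lemma borel_inner_approx:
  fixes A :: "'g::haar_group set"
  assumes A: "A \<in> fmeasurable haar" and e: "e > 0"
  obtains K where "compact K" "measure haar (A - K) + measure haar (K - A) < e"
proof -
  have fin: "emeasure haar A < \<infinity>" and sA: "A \<in> sets borel"
    using A by (auto simp: fmeasurable_def)
  have "(INF U\<in>{U. open U \<and> A \<subseteq> U}. emeasure haar U) = emeasure haar A"
    using haar_outer_regular[of A] sA by simp
  also have "\<dots> < emeasure haar A + ennreal (e / 2)"
    using fin e by (simp add: ennreal_add_left_cancel_less less_top[symmetric])
  finally obtain U where U: "open U" "A \<subseteq> U" "emeasure haar U < emeasure haar A + ennreal (e / 2)"
    by (auto simp: INF_less_iff)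
  have finU: "emeasure haar U < \<infinity>"
    using U(3) fin by (metis ennreal_less_top ennreal_add_less_top infinity_ennreal_def less_trans)
  then have fU: "U \<in> fmeasurable haar"
    using U(1) by (auto simp: fmeasurable_def)
  have mU: "measure haar U < measure haar A + e / 2"
  proof -
    have "ennreal (measure haar U) < ennreal (measure haar A + e / 2)"
      using U(3) fU A e by (simp add: emeasure_eq_measure2 ennreal_plus less_imp_le)
    then show ?thesis
      by (simp add: ennreal_less_iff)
  qed
  have "\<exists>K. compact K \<and> K \<subseteq> U \<and> measure haar U - e / 2 < measure haar K"
  \<comment> \<open>\<open>ennreal\<close> truncates negative numbers to \<open>0\<close>, which
    would spoil the strict inequality; in that case the empty set serves.\<close>
  proof (cases "measure haar U - e / 2 < 0")
    case True
    then show ?thesis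
      by (intro exI[of _ "{}"]) auto
  next
    case False
    have "ennreal (measure haar U - e / 2) < emeasure haar U"
      using False e fU by (simp add: emeasure_eq_measure2 ennreal_less_iff)
    then have "ennreal (measure haar U - e / 2) < (SUP K\<in>{K. compact K \<and> K \<subseteq> U}. emeasure haar K)"
      using haar_inner_regular[OF U(1)] by simp
    then obtain K where K: "compact K" "K \<subseteq> U" "ennreal (measure haar U - e / 2) < emeasure haar K"
      by (auto simp: less_SUP_iff)
    then show ?thesis
      using fmeasurable_compact[OF K(1)] False by (auto simp: emeasure_eq_measure2 ennreal_less_iff)
  qed
  then obtain K where K: "compact K" "K \<subseteq> U" "measure haar U - e / 2 < measure haar K"
    by blast
  have "measure haar (A - K) \<le> measure haar (U - K)" "measure haar (K - A) \<le> measure haar (U - A)"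
    using U(2) K(2) fU A fmeasurable_compact[OF K(1)]
        by (auto intro!: measure_mono_fmeasurable fmeasurable_Diff)
  moreover have "measure haar (U - K) = measure haar U - measure haar K" "measure haar (U - A)
      = measure haar U - measure haar A"
    using U(2) K(2) fU A fmeasurable_compact[OF K(1)] by (auto intro!: measurable_measure_Diff)
  ultimately show ?thesis
    using that[OF K(1)] K(3) mU by linarith
qed

subsection \<open>Unimodularity of SIN groups\<close>

text \<open>Beyond conjugation invariance, compactness makes \<open>V\<close> Borel of finite
  measure, and symmetry lets differences of elements of \<open>V\<close> be treated as sums.\<close>

definition inv_nbhd :: "'g::haar_group set \<Rightarrow> bool" where
  "inv_nbhd V \<longleftrightarrow> compact V \<and> 0 \<in> interior V \<and> (\<forall>x\<in>V. - x \<in> V) \<and> (\<forall>g. \<forall>x\<in>V. g + x - g \<in> V)"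

text \<open>The invariant set provided by the group need not be closed or symmetric. Its closure
  stays invariant, and intersecting with the set of negatives symmetrises it.\<close>

lemma SIN_inv_nbhd:
  assumes SIN: "SIN_group TYPE('g::haar_group)" and U: "open (U :: 'g set)" "0 \<in> U"
  shows "\<exists>V \<subseteq> U. inv_nbhd V"
proof -
  obtain U0 K0 :: "'g set" where K0: "0 \<in> U0" "U0 \<subseteq> K0" "open U0" "compact K0"
    using locally_compact[of "0 :: 'g"] by blast
  have op: "open ((\<lambda>(a, b). a - b) -` (U \<inter> U0) :: ('g \<times> 'g) set)"
    by (intro open_vimage open_Int U K0) (auto simp: case_prod_beta intro!: continuous_intros)
  have "(0, 0) \<in> (\<lambda>(a, b). a - b) -` (U \<inter> U0)"
    using U K0 by simp
  with op obtain A B :: "'g set" where AB: "open A" "open B" "(0, 0) \<in> A \<times> B"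
      "A \<times> B \<subseteq> (\<lambda>(a, b). a - b) -` (U \<inter> U0)"
    by (rule open_prod_elim)
  have "open (A \<inter> B) \<and> 0 \<in> A \<inter> B"
    using AB by auto
  then have "\<exists>V. V \<subseteq> A \<inter> B \<and> 0 \<in> interior V \<and> (\<forall>g. (\<lambda>x. g + x - g) ` V = V)"
    using SIN unfolding SIN_group_def by blast
  then obtain V0 where V0: "V0 \<subseteq> A \<inter> B" "0 \<in> interior V0" "\<And>g. (\<lambda>x. g + x - g) ` V0 = V0"
    by blast
  \<comment> \<open>A point \<open>x\<close> of the closure satisfies \<open>x + v \<in> V0\<close>
    for some \<open>v\<close> in the interior of \<open>V0\<close>, so it is a difference of an
    element of \<open>A\<close> and one of \<open>B\<close>.\<close>
  have clV0: "closure V0 \<subseteq> U \<inter> U0"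
  proof
    fix x
    assume x: "x \<in> closure V0"
    have "open ((+) x ` interior V0)" "x \<in> (+) x ` interior V0"
      using V0(2) by (auto intro!: open_image_plus image_eqI[of _ _ 0])
    then have "(+) x ` interior V0 \<inter> V0 \<noteq> {}"
      using x by (metis closure_iff_nhds_not_empty subset_refl Int_commute)
    then obtain v where v: "v \<in> interior V0" "x + v \<in> V0"
      by auto
    have "(x + v, v) \<in> A \<times> B"
      using v V0(1) interior_subset by blast
    from subsetD[OF AB(4) this] have "(x + v) - v \<in> U \<inter> U0"
      by simp
    then show "x \<in> U \<inter> U0"
      by simp
  qed
  define V where "V = closure V0 \<inter> uminus -` closure V0"
  have "compact (closure V0)"
  proof -
    have "closure V0 \<subseteq> K0"
      using clV0 K0(2) by blast
    then show ?thesis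
      using compact_Int_closed[OF K0(4), of "closure V0"] by (simp add: Int_absorb1)
  qed
  moreover have "closed (uminus -` closure V0)"
    by (intro closed_vimage continuous_intros) auto
  ultimately have "compact V"
    unfolding V_def by (rule compact_Int_closed)
  moreover have "0 \<in> interior V"
  proof (rule interiorI)
    show "open (interior V0 \<inter> uminus -` interior V0)"
      by (intro open_Int open_vimage continuous_intros) auto
    show "interior V0 \<inter> uminus -` interior V0 \<subseteq> V"
      unfolding V_def using interior_subset closure_subset by blast
  qed (use V0 in auto)
  moreover have "g + x - g \<in> V" if "x \<in> V" for g x
  proof -
    have *: "g + x - g \<in> closure V0" if "x \<in> closure V0" for x
    proof -
      have "(\<lambda>x. g + x - g) ` closure V0 \<subseteq> closure ((\<lambda>x. g + x - g) ` V0)"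
        by (intro image_closure_subset closure_subset closed_closure continuous_intros)
      then show ?thesis
        using that V0(3)[of g] by auto
    qed
    have "- (g + x - g) = g + (- x) - g"
      by (simp add: diff_add_eq_diff_diff_swap)
    then show ?thesis
      using *[of x] *[of "- x"] that unfolding V_def by simp
  qed
  moreover have "V \<subseteq> U"
    using clV0 unfolding V_def by blast
  ultimately show ?thesis
    unfolding inv_nbhd_def V_def by (intro exI[of _ "closure V0 \<inter> uminus -` closure V0"]) (auto simp: V_def)
qed

lemma inv_nbhd_measure_pos:
  assumes V: "inv_nbhd V"
  shows "measure haar V > 0"
proof -
  have c: "compact V" and i: "0 \<in> interior V"
    using V by (auto simp: inv_nbhd_def)
  have "0 < emeasure haar (interior V)"
    using i by (intro haar_open_pos) auto
  also have "\<dots> \<le> emeasure haar V"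
    by (intro emeasure_mono interior_subset) (simp add: borel_compact c)
  finally show ?thesis
    using fmeasurable_compact[OF c] by (simp add: emeasure_eq_measure2)
qed

lemma inv_nbhd_right_translate:
  assumes V: "inv_nbhd V"
  shows "(\<lambda>x. x + y) ` V = (+) y ` V"
proof -
  have *: "g + x - g \<in> V" if "x \<in> V" for g x
    using V that by (auto simp: inv_nbhd_def)
  show ?thesis
  proof (intro set_eqI iffI)
    fix z
    assume "z \<in> (\<lambda>x. x + y) ` V"
    then obtain x where "x \<in> V" "z = x + y"
      by auto
    then show "z \<in> (+) y ` V"
      using *[of x "- y"] by (intro image_eqI[of _ _ "- y + x + y"]) (auto simp flip: add.assoc)
  next
    fix z
    assume "z \<in> (+) y ` V"
    then obtain x where "x \<in> V" "z = y + x"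
      by auto
    then show "z \<in> (\<lambda>x. x + y) ` V"
      using *[of x y] by (intro image_eqI[of _ _ "y + x - y"]) auto
  qed
qed

text \<open>
  Covering argument: cut \<open>K\<close> into pieces \<open>B\<^sub>z \<subseteq> z + N\<close> and integrate \<open>\<Sum>\<^sub>z \<mu>'(B\<^sub>z) 1\<^bsub>z + V\<^esub>\<close>.
\<close>

lemma right_translate_measure_le:
  fixes K :: "'g::haar_group set"
  assumes SIN: "SIN_group TYPE('g)" and K: "compact K"
  shows "measure haar ((\<lambda>x. x + y) ` K) \<le> measure haar K"
proof (rule field_le_epsilon)
  fix e :: real
  assume e: "e > 0"
  obtain A where A: "open A" "K \<subseteq> A" "A \<in> fmeasurable haar" "measure haar A < measure haar K + e"
    using compact_outer_approx[OF K e] .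
  obtain N0 where N0: "open N0" "0 \<in> N0" "\<And>n k. n \<in> N0 \<Longrightarrow> k \<in> K \<Longrightarrow> k + n \<in> A"
    using compact_nbhd[of "\<lambda>n k. k + n", OF _ K A(1)] A(2)
    by (force simp: case_prod_beta intro!: continuous_intros)
  obtain V where V: "V \<subseteq> N0" "inv_nbhd V"
    using SIN_inv_nbhd[OF SIN N0(1,2)] by blast
  have cV: "compact V" and symV: "\<And>x. x \<in> V \<Longrightarrow> - x \<in> V"
    using V by (auto simp: inv_nbhd_def)
  \<comment> \<open>The measure of the right translate by \<open>y\<close>. It is again left
    invariant, since left and right translations commute.\<close>
  define \<mu>' where "\<mu>' = distr haar haar (\<lambda>x. x - y :: 'g)"
  have meas: "(\<lambda>x. x - y :: 'g) \<in> measurable haar haar"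
  proof -
    have "(\<lambda>x. x - y :: 'g) \<in> borel_measurable borel"
      by (intro borel_measurable_continuous_onI continuous_intros)
    then show ?thesis
      by (simp cong: measurable_cong_sets)
  qed
  have \<mu>': "emeasure \<mu>' S = emeasure haar ((\<lambda>x. x + y) ` S)" if "S \<in> sets borel" for S :: "'g set"
    unfolding \<mu>'_def image_plus_right_eq using that by (subst emeasure_distr[OF meas]) auto
  have sets': "sets \<mu>' = sets borel"
    by (simp add: \<mu>'_def)
  have \<mu>'_inv: "emeasure \<mu>' ((+) x ` S) = emeasure \<mu>' S" if S: "S \<in> sets borel" for x and S :: "'g set"
  proof -
    have "(\<lambda>x. x + y) ` S \<in> sets borel"
      unfolding image_plus_right_eq using measurable_sets[OF meas, of S] S by simp
    moreover have "(\<lambda>x. x + y) ` (+) x ` S = (+) x ` (\<lambda>x. x + y) ` S"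
      by (auto simp: image_image add.assoc)
    ultimately show ?thesis
      using S by (simp add: \<mu>' borel_image_plus emeasure_haar_translate)
  qed
  have main: "measure haar ((\<lambda>x. x + y) ` K) * measure haar V \<le> measure haar A * (measure haar V + d)"
      if d: "d > 0" for d
  proof -
    obtain W where W: "open W" "(\<lambda>x. x + y) ` V \<subseteq> W" "W \<in> fmeasurable haar" "measure haar W
        < measure haar ((\<lambda>x. x + y) ` V) + d"
      using compact_outer_approx[OF compact_image_plus_right[OF cV] d] .
    obtain N where N: "open N" "0 \<in> N" "\<And>n v. n \<in> N \<Longrightarrow> v \<in> V \<Longrightarrow> v + n + y \<in> W"
      using compact_nbhd[of "\<lambda>n k. k + n + y", OF _ cV W(1)] W(2)
      by (force simp: case_prod_beta intro!: continuous_intros)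
    \<comment> \<open>A local name for \<open>V\<close> thickened by \<open>N\<close>, unrelated to
      the von Neumann algebra.\<close>
    define VN where "VN = (\<Union>v\<in>V. (+) v ` N)"
    have oVN: "open VN"
      unfolding VN_def by (intro open_UN ballI open_image_plus N)
    have "emeasure \<mu>' VN \<le> emeasure haar W"
      using N(3) oVN W by (subst \<mu>') (auto simp: VN_def intro!: emeasure_mono)
    also have "\<dots> = ennreal (measure haar W)"
      using W(3) by (simp add: emeasure_eq_measure2)
    \<comment> \<open>Invariance of \<open>V\<close> is decisive here: its right translate by
      \<open>y\<close> equals the left translate, whose measure is known.\<close>
    also have "\<dots> \<le> ennreal (measure haar V + d)"
    proof -
      have "measure haar ((\<lambda>x. x + y) ` V) = measure haar V"
        unfolding inv_nbhd_right_translate[OF V(2)] measure_def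
        by (simp add: emeasure_haar_translate borel_compact cV)
      then show ?thesis
        using W(4) by (intro ennreal_leI) simp
    qed
    finally have VN: "emeasure \<mu>' VN \<le> ennreal (measure haar V + d)" .
    obtain Z B where ZB: "finite Z" "Z \<subseteq> K" "disjoint_family_on B Z" "(\<Union>z\<in>Z. B z) = K"
      "\<And>z. z \<in> Z \<Longrightarrow> B z \<in> sets borel" "\<And>z. z \<in> Z \<Longrightarrow> B z \<subseteq> (+) z ` N"
      using compact_partition[OF K N(1,2)] by metis
    have zV: "(+) z ` V \<in> sets borel" for z
      by (intro borel_image_plus borel_compact cV)
    have "emeasure \<mu>' K * emeasure haar V = (\<Sum>z\<in>Z. emeasure \<mu>' (B z)) * emeasure haar V"
      using ZB by (subst sum_emeasure) (auto simp: sets')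
    also have "\<dots> = (\<Sum>z\<in>Z. emeasure \<mu>' (B z) * emeasure haar ((+) z ` V))"
      by (simp add: sum_distrib_right emeasure_haar_translate borel_compact cV)
    also have "\<dots> = (\<Sum>z\<in>Z. \<integral>\<^sup>+x. emeasure \<mu>' (B z) * indicator ((+) z ` V) x \<partial>haar)"
      by (intro sum.cong refl, subst nn_integral_cmult_indicator) (auto simp: zV)
    also have "\<dots> = (\<integral>\<^sup>+x. (\<Sum>z\<in>Z. emeasure \<mu>' (B z) * indicator ((+) z ` V) x) \<partial>haar)"
      using zV by (subst nn_integral_sum) (auto intro!: borel_measurable_times borel_measurable_indicator)
    \<comment> \<open>Pointwise in \<open>x\<close>: the pieces \<open>B z\<close> whose set
      \<open>z + V\<close> contains \<open>x\<close> are disjoint and lie in the translate by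
      \<open>x\<close> of the thickened set, whose \<open>\<mu>'\<close> measure does not depend on
      \<open>x\<close>. For \<open>x\<close> outside \<open>A\<close> there are no such
      pieces.\<close>
    also have "\<dots> \<le> (\<integral>\<^sup>+x. emeasure \<mu>' VN * indicator A x \<partial>haar)"
    proof (rule nn_integral_mono)
      fix x :: 'g
      let ?Z = "{z \<in> Z. x \<in> (+) z ` V}"
      have "(\<Sum>z\<in>Z. emeasure \<mu>' (B z) * indicator ((+) z ` V) x) = (\<Sum>z\<in>?Z. emeasure \<mu>' (B z))"
        using ZB(1) by (simp add: sum.inter_filter[symmetric] indicator_def if_distrib Int_def cong: if_cong)
      also have "\<dots> = emeasure \<mu>' (\<Union>z\<in>?Z. B z)"
        using ZB by (intro sum_emeasure) (auto simp: sets' disjoint_family_on_def)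
      also have "\<dots> \<le> emeasure \<mu>' VN * indicator A x"
      proof (cases "x \<in> A")
        case True
        have "(\<Union>z\<in>?Z. B z) \<subseteq> (+) x ` VN"
        proof
          fix w
          assume "w \<in> (\<Union>z\<in>?Z. B z)"
          then obtain z v where z: "z \<in> Z" "v \<in> V" "x = z + v" "w \<in> B z"
            by auto
          then obtain n where n: "n \<in> N" "w = z + n"
            using ZB(6) by blast
          have "- v + n \<in> VN"
            unfolding VN_def using symV z(2) n(1) by blast
          moreover have "w = x + (- v + n)"
            by (simp add: z n add.assoc)
          ultimately show "w \<in> (+) x ` VN"
            by blast
        qed
        then have "emeasure \<mu>' (\<Union>z\<in>?Z. B z) \<le> emeasure \<mu>' ((+) x ` VN)"
          using oVN by (intro emeasure_mono) (auto simp: sets' intro!: borel_image_plus)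
        then show ?thesis
          using True oVN by (simp add: \<mu>'_inv)
      next
        case False
        have "?Z = {}"
          using False N0(3) V(1) ZB(2) by auto
        then show ?thesis
          by (simp only: ) simp
      qed
      finally show "(\<Sum>z\<in>Z. emeasure \<mu>' (B z) * indicator ((+) z ` V) x) \<le> emeasure \<mu>' VN * indicator A x" .
    qed
    also have "\<dots> = emeasure \<mu>' VN * emeasure haar A"
      using A by (subst nn_integral_cmult_indicator) auto
    also have "\<dots> \<le> ennreal (measure haar V + d) * ennreal (measure haar A)"
      using VN A(3) by (intro mult_mono) (auto simp: emeasure_eq_measure2)
    finally have "ennreal (measure haar ((\<lambda>x. x + y) ` K)) * ennreal (measure haar V)
        \<le> ennreal (measure haar V + d) * ennreal (measure haar A)"
      using K fmeasurable_compact[OF cV] fmeasurable_compact[OF compact_image_plus_right[OF K]]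
      by (simp add: \<mu>' borel_compact emeasure_eq_measure2)
    then have "measure haar ((\<lambda>x. x + y) ` K) * measure haar V \<le> (measure haar V + d) * measure haar A"
      using d by (subst (asm) (1 2) ennreal_mult[symmetric]) (auto simp: ennreal_le_iff)
    then show ?thesis
      by (simp add: mult.commute)
  qed
  have Vpos: "measure haar V > 0"
    by (rule inv_nbhd_measure_pos[OF V(2)])
  have "measure haar ((\<lambda>x. x + y) ` K) * measure haar V \<le> measure haar A * measure haar V"
  proof (rule field_le_epsilon)
    fix d :: real
    assume "d > 0"
    then have "d / (measure haar A + 1) > 0"
      by (simp add: add_nonneg_pos)
    from main[OF this] have "measure haar ((\<lambda>x. x + y) ` K) * measure haar V
        \<le> measure haar A * measure haar V + measure haar A * (d / (measure haar A + 1))"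
      by (simp add: distrib_left)
    also have "measure haar A * (d / (measure haar A + 1)) \<le> d"
    proof -
      have pos: "0 < measure haar A + 1"
        by (simp add: add_nonneg_pos)
      show ?thesis
        unfolding times_divide_eq_right pos_divide_le_eq[OF pos]
        using \<open>d > 0\<close> by (simp add: algebra_simps)
    qed
    finally show "measure haar ((\<lambda>x. x + y) ` K) * measure haar V \<le> measure haar A * measure haar V + d"
      by simp
  qed
  then show "measure haar ((\<lambda>x. x + y) ` K) \<le> measure haar K + e"
    using Vpos A(4) by simp
qed

lemma right_translate_measure:
  fixes K :: "'g::haar_group set"
  assumes SIN: "SIN_group TYPE('g)" and K: "compact K"
  shows "measure haar ((\<lambda>x. x + y) ` K) = measure haar K"
proof (rule antisym)
  have "(\<lambda>x. x + - y) ` (\<lambda>x. x + y) ` K = K"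
    by (simp add: image_image)
  then show "measure haar K \<le> measure haar ((\<lambda>x. x + y) ` K)"
    using right_translate_measure_le[OF SIN compact_image_plus_right[OF K], of "- y" y] by simp
qed (rule right_translate_measure_le[OF assms])

section \<open>Indicator functions and strong continuity\<close>

definition ind_L2 :: "'g::haar_group set \<Rightarrow> 'g L2" where
  "ind_L2 A = abs_L2 (indicator A)"

lemma square_integrable_indicator:
  assumes "A \<in> fmeasurable haar"
  shows "square_integrable (indicator A :: 'g::haar_group \<Rightarrow> complex)"
proof -
  have "(\<lambda>x. (cmod (indicator A x))\<^sup>2) = (indicator A :: 'g \<Rightarrow> real)"
    by (auto simp: indicator_def)
  then show ?thesis
    using assms unfolding square_integrable_def
    by (auto intro!: borel_measurable_indicator simp: fmeasurable_def less_top)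
qed

lemma cinner_ind_L2:
  assumes "A \<in> fmeasurable haar" "B \<in> fmeasurable haar"
  shows "cinner (ind_L2 A) (ind_L2 B) = of_real (measure haar (A \<inter> B))"
proof -
  have "(\<lambda>x. indicator A x * cnj (indicator B x)) = (\<lambda>x. complex_of_real (indicator (A \<inter> B) x))"
    by (auto simp: indicator_def)
  then show ?thesis
    using assms by (simp add: ind_L2_def cinner_abs_L2 square_integrable_indicator)
qed

lemma norm_ind_L2_square:
  assumes "A \<in> fmeasurable haar"
  shows "(norm (ind_L2 A))\<^sup>2 = measure haar A"
proof -
  have "complex_of_real ((norm (ind_L2 A))\<^sup>2) = of_real (measure haar A)"
    using cinner_ind_L2[OF assms assms] by (simp only: cinner_self Int_absorb)
  then show ?thesis
    by (simp only: of_real_eq_iff)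
qed

lemma norm_ind_L2_diff_square:
  assumes "A \<in> fmeasurable haar" "B \<in> fmeasurable haar"
  shows "(norm (ind_L2 A - ind_L2 B))\<^sup>2 = measure haar (A - B) + measure haar (B - A)"
proof -
  have "measure haar A = measure haar (A \<inter> B) + measure haar (A - B)"
    using measure_Un2[OF fmeasurable_Int_fmeasurable[OF assms(1), of B] assms(1)] fmeasurableD[OF assms(2)]
    by (simp add: Int_absorb2 Un_absorb1 Diff_Int)
  moreover have "measure haar B = measure haar (A \<inter> B) + measure haar (B - A)"
    using measure_Un2[OF fmeasurable_Int_fmeasurable[OF assms(2), of A] assms(2)] fmeasurableD[OF assms(1)]
    by (simp add: Int_commute Un_absorb1 Diff_Int)
  ultimately show ?thesis
    by (simp add: norm_diff_square norm_ind_L2_square cinner_ind_L2 assms)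
qed

lemma lreg_ind_L2:
  assumes "A \<in> fmeasurable haar"
  shows "lreg s (ind_L2 A) = ind_L2 ((+) s ` A)"
proof -
  have "(\<lambda>t. indicator A (- s + t) :: complex) = indicator ((+) s ` A)"
    unfolding image_plus_eq by (auto simp: indicator_def)
  then show ?thesis
    by (simp add: ind_L2_def lreg_abs_L2 square_integrable_indicator assms)
qed

text \<open>The superlevel sets of \<open>Re (c * f x)\<close> at positive heights have finite
  measure by Chebyshev's inequality. Pairing \<open>f\<close> with their indicators shows that they
  are null. With \<open>c\<close> among the four units \<open>1\<close>, \<open>- 1\<close>,
  \<open>\<i>\<close>, \<open>- \<i>\<close> this forces \<open>f\<close> to vanish almost
  everywhere.\<close>

lemma Re_le_0_AE:
  fixes f :: "'g::haar_group \<Rightarrow> complex"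
  assumes f: "square_integrable f" and 0: "\<And>A. A \<in> fmeasurable haar \<Longrightarrow> cinner (abs_L2 f) (ind_L2 A) = 0"
  shows "AE x in haar. Re (c * f x) \<le> 0"
proof -
  have [measurable]: "f \<in> borel_measurable haar"
    using f by (simp add: square_integrable_def)
  define A where "A n = {x. Re (c * f x) \<ge> 1 / real (Suc n)}" for n
  have A: "A n \<in> fmeasurable haar" for n
  proof -
    have sA [measurable]: "A n \<in> sets haar"
      unfolding A_def by measurable
    have "integrable haar (\<lambda>x. (real (Suc n))\<^sup>2 * (cmod c)\<^sup>2 * (cmod (f x))\<^sup>2)"
      using f by (simp add: square_integrable_def)
    then have "integrable haar (indicator (A n) :: 'g \<Rightarrow> real)"
    proof (rule Bochner_Integration.integrable_bound)
      have "indicator (A n) x \<le> (real (Suc n))\<^sup>2 * (cmod c)\<^sup>2 * (cmod (f x))\<^sup>2" for x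
      proof (cases "x \<in> A n")
        case True
        then have "1 / real (Suc n) \<le> cmod (c * f x)"
          unfolding A_def using complex_Re_le_cmod order.trans by blast
        then have "1 \<le> real (Suc n) * cmod (c * f x)"
          by (simp add: field_simps)
        then have "1\<^sup>2 \<le> (real (Suc n) * cmod (c * f x))\<^sup>2"
          by (intro power_mono) auto
        then show ?thesis
          using True by (simp add: norm_mult power_mult_distrib mult.assoc)
      qed simp
      then show "AE x in haar. norm (indicator (A n) x :: real)
          \<le> norm ((real (Suc n))\<^sup>2 * (cmod c)\<^sup>2 * (cmod (f x))\<^sup>2)"
        by (intro AE_I2) (auto simp: abs_mult)
    qed measurable
    then show ?thesis
      using sA unfolding fmeasurable_def integrable_indicator_iff by simp
  qed
  have "emeasure haar (A n) = 0" for n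
  proof -
    have sA: "A n \<in> sets haar"
      using A[of n] by (simp add: fmeasurable_def)
    have int: "integrable haar (\<lambda>x. f x * cnj (indicator (A n) x))"
      by (intro square_integrable_mult f square_integrable_indicator A)
    have "0 = Re (c * cinner (abs_L2 f) (ind_L2 (A n)))"
      using 0[OF A] by simp
    also have "\<dots> = Re (c * (\<integral>x. f x * cnj (indicator (A n) x) \<partial>haar))"
      using f A by (simp add: ind_L2_def cinner_abs_L2 square_integrable_indicator)
    also have "\<dots> = (\<integral>x. Re (c * (f x * cnj (indicator (A n) x))) \<partial>haar)"
      using integral_Re[OF integrable_mult_right[of c, OF int]] by simp
    also have "\<dots> \<ge> (\<integral>x. 1 / real (Suc n) * indicator (A n) x \<partial>haar)"
    proof (rule integral_mono)
      show "integrable haar (\<lambda>x. 1 / real (Suc n) * indicator (A n) x)"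
        using A[of n] by (intro integrable_mult_right) (auto simp: fmeasurable_def less_top)
      show "integrable haar (\<lambda>x. Re (c * (f x * cnj (indicator (A n) x))))"
        using int by (intro integrable_Re integrable_mult_right) auto
      show "1 / real (Suc n) * indicator (A n) x \<le> Re (c * (f x * cnj (indicator (A n) x)))" for x
        by (auto simp: A_def indicator_def)
    qed
    finally have "1 / real (Suc n) * measure haar (A n) \<le> 0"
      using A[of n] by (simp add: fmeasurable_def)
    then have "measure haar (A n) \<le> 0"
      using pos_divide_le_eq[of "real (Suc n)" "measure haar (A n)" 0] by simp
    then have "measure haar (A n) = 0"
      by (simp add: measure_le_0_iff)
    then show ?thesis
      using A[of n] by (simp add: emeasure_eq_measure2)
  qed
  then have "AE x in haar. \<forall>n. x \<notin> A n"
    using A by (subst AE_all_countable) (auto intro!: AE_not_in null_setsI)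
  then show ?thesis
  proof eventually_elim
    case (elim x)
    show ?case
    proof (rule ccontr)
      assume "\<not> Re (c * f x) \<le> 0"
      then obtain n where "inverse (real (Suc n)) < Re (c * f x)"
        using reals_Archimedean[of "Re (c * f x)"] by auto
      then have "x \<in> A n"
        by (simp add: A_def inverse_eq_divide)
      then show False
        using elim by blast
    qed
  qed
qed

lemma eq_0_if_orthogonal_ind_L2:
  assumes 0: "\<And>A. A \<in> fmeasurable haar \<Longrightarrow> cinner x (ind_L2 A) = 0"
  shows "x = 0"
proof -
  obtain f where f: "square_integrable f" "x = abs_L2 f"
    by (rule L2_repE)
  have *: "AE x in haar. Re (c * f x) \<le> 0" for c
    using Re_le_0_AE[OF f(1)] 0 unfolding f(2) by blast
  have "AE x in haar. f x = 0"
    using *[of 1] *[of "- 1"] *[of \<i>] *[of "- \<i>"]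
    by eventually_elim (simp add: complex_eq_iff)
  then have "abs_L2 f = abs_L2 (\<lambda>_. 0)"
    by (intro abs_L2_eqI f square_integrable_0)
  then show ?thesis
    by (simp add: f zero_L2.abs_eq)
qed

text \<open>Compact sets are used so that the dense subspace consists of compactly supported
  vectors. Real orthogonality to the multiples by \<open>1\<close> and \<open>\<i>\<close> yields
  complex orthogonality.\<close>

lemma dense_ind_L2: "closure (span {c *\<^sub>C ind_L2 K | c K. compact K}) = (UNIV :: 'g::haar_group L2 set)"
proof (rule dense_if_orthogonal_trivial)
  fix x :: "'g L2"
  assume *: "\<And>y. y \<in> {c *\<^sub>C ind_L2 K | c K. compact K} \<Longrightarrow> inner x y = 0"
  have K0: "cinner x (ind_L2 K) = 0" if K: "compact K" for K
  proof (rule complex_eqI)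
    have "inner x (1 *\<^sub>C ind_L2 K) = 0" "inner x (\<i> *\<^sub>C ind_L2 K) = 0"
      using K by (intro *; blast)+
    then show "Re (cinner x (ind_L2 K)) = Re 0" "Im (cinner x (ind_L2 K)) = Im 0"
      by (simp_all add: inner_eq_Re_cinner)
  qed
  show "x = 0"
  proof (rule eq_0_if_orthogonal_ind_L2)
    fix A :: "'g set"
    assume A: "A \<in> fmeasurable haar"
    have le: "cmod (cinner x (ind_L2 A)) \<le> norm x * e" if "e > 0" for e
    proof -
      have "e\<^sup>2 > 0"
        using that by simp
      from borel_inner_approx[OF A this] obtain K where K: "compact K"
          "measure haar (A - K) + measure haar (K - A) < e\<^sup>2" .
      have "(norm (ind_L2 A - ind_L2 K))\<^sup>2 \<le> e\<^sup>2"
        using K A by (simp add: norm_ind_L2_diff_square fmeasurable_compact)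
      then have n: "norm (ind_L2 A - ind_L2 K) \<le> e"
        by (rule power2_le_imp_le) (use that in simp)
      have "cinner x (ind_L2 A) = cinner x (ind_L2 A - ind_L2 K)"
        by (simp add: cinner_diff_right K0[OF K(1)])
      then have "cmod (cinner x (ind_L2 A)) \<le> norm x * norm (ind_L2 A - ind_L2 K)"
        by (metis cmod_cinner_le)
      also have "\<dots> \<le> norm x * e"
        by (intro mult_left_mono n) auto
      finally show ?thesis .
    qed
    have "cmod (cinner x (ind_L2 A)) \<le> 0"
    proof (rule field_le_epsilon)
      fix e :: real
      assume e: "e > 0"
      have pos: "norm x + 1 > 0"
        by (simp add: add_nonneg_pos)
      have "cmod (cinner x (ind_L2 A)) \<le> norm x * (e / (norm x + 1))"
        by (rule le) (use e pos in simp)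
      also have "\<dots> \<le> e"
        unfolding times_divide_eq_right pos_divide_le_eq[OF pos] using e by (simp add: algebra_simps)
      finally show "cmod (cinner x (ind_L2 A)) \<le> 0 + e"
        by simp
    qed
    then show "cinner x (ind_L2 A) = 0"
      by simp
  qed
qed

text \<open>The vectors with this property form a closed subspace, as translations are isometric. It
  contains the indicator of a compact \<open>K\<close>: if \<open>n + K\<close> stays in an open
  \<open>U\<close> of measure below that of \<open>K\<close> plus half of \<open>d\<^sup>2\<close>,
  then \<open>K\<close> and \<open>n + K\<close> differ by less than \<open>d\<^sup>2\<close> in
  measure.\<close>

lemma lreg_near:
  fixes x :: "'g::haar_group L2"
  assumes e: "e > 0"
  shows "\<exists>N. open N \<and> 0 \<in> N \<and> (\<forall>n\<in>N. norm (lreg n x - x) < e)"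
proof -
  define S where "S = {x :: 'g L2. \<forall>e>0. \<exists>N. open N \<and> 0 \<in> N \<and> (\<forall>n\<in>N. norm (lreg n x - x) < e)}"
  have SD: "\<exists>N. open N \<and> 0 \<in> N \<and> (\<forall>n\<in>N. norm (lreg n x - x) < d)" if "x \<in> S" "d > 0" for x d
    using that unfolding S_def by blast
  have "subspace S"
    unfolding subspace_def
  proof (intro conjI ballI allI)
    show "0 \<in> S"
      by (auto simp: S_def intro!: exI[of _ UNIV])
    fix x y
    assume xy: "x \<in> S" "y \<in> S"
    show "x + y \<in> S"
      unfolding S_def
    proof (intro CollectI allI impI)
      fix e :: real
      assume "e > 0"
      then have "e / 2 > 0"
        by simp
      note e2 = this
      from SD[OF xy(1) e2] obtain N where N: "open N" "0 \<in> N" "\<And>n. n \<in> N \<Longrightarrow> norm (lreg n x - x) < e / 2"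
        by blast
      from SD[OF xy(2) e2] obtain N' where N': "open N'" "0 \<in> N'" "\<And>n. n \<in> N' \<Longrightarrow> norm (lreg n y - y) < e / 2"
        by blast
      have lt: "norm (lreg n (x + y) - (x + y)) < e" if "n \<in> N \<inter> N'" for n
      proof -
        have *: "lreg n (x + y) - (x + y) = (lreg n x - x) + (lreg n y - y)"
          by (simp add: blinfun.add_right)
        have "norm (lreg n (x + y) - (x + y)) \<le> norm (lreg n x - x) + norm (lreg n y - y)"
          unfolding * by (rule norm_triangle_ineq)
        then show ?thesis
          using N(3)[of n] N'(3)[of n] that by simp
      qed
      show "\<exists>N. open N \<and> 0 \<in> N \<and> (\<forall>n\<in>N. norm (lreg n (x + y) - (x + y)) < e)"
        using lt N(1,2) N'(1,2) by (intro exI[of _ "N \<inter> N'"] conjI open_Int ballI) simp_all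
    qed
    fix r :: real
    show "r *\<^sub>R x \<in> S"
      unfolding S_def
    proof (intro CollectI allI impI)
      fix e :: real
      assume e: "e > 0"
      have pos: "\<bar>r\<bar> + 1 > 0"
        by linarith
      then have "e / (\<bar>r\<bar> + 1) > 0"
        using e by simp
      from SD[OF xy(1) this] obtain N where N: "open N" "0 \<in> N" "\<And>n. n \<in> N \<Longrightarrow> norm (lreg n x - x)
          < e / (\<bar>r\<bar> + 1)"
        by blast
      have "norm (lreg n (r *\<^sub>R x) - r *\<^sub>R x) < e" if "n \<in> N" for n
      proof -
        have "norm (lreg n (r *\<^sub>R x) - r *\<^sub>R x) = \<bar>r\<bar> * norm (lreg n x - x)"
          by (simp add: blinfun.scaleR_right flip: scaleR_diff_right)
        also have "\<dots> \<le> \<bar>r\<bar> * (e / (\<bar>r\<bar> + 1))"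
          using N(3)[OF that] by (intro mult_left_mono) auto
        also have "\<dots> < e"
          unfolding times_divide_eq_right pos_divide_less_eq[OF pos] using e by (simp add: algebra_simps)
        finally show ?thesis .
      qed
      then show "\<exists>N. open N \<and> 0 \<in> N \<and> (\<forall>n\<in>N. norm (lreg n (r *\<^sub>R x) - r *\<^sub>R x) < e)"
        using N(1,2) by blast
    qed
  qed
  moreover have "x \<in> S" if x: "x \<in> closure S" for x
    unfolding S_def
  proof (intro CollectI allI impI)
    fix e :: real
    assume e: "e > 0"
    then obtain y where y: "y \<in> S" "dist y x < e / 3"
      using x unfolding closure_approachable by (metis divide_pos_pos zero_less_numeral)
    then obtain N where N: "open N" "0 \<in> N" "\<And>n. n \<in> N \<Longrightarrow> norm (lreg n y - y) < e / 3"
      using SD[OF y(1), of "e / 3"] e by auto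
    have "norm (lreg n x - x) < e" if "n \<in> N" for n
    proof -
      have *: "lreg n x - x = lreg n (x - y) + ((lreg n y - y) + (y - x))"
        by (simp add: blinfun.diff_right)
      have "norm (lreg n x - x) \<le> norm (lreg n (x - y)) + (norm (lreg n y - y) + norm (y - x))"
        unfolding * by (intro order.trans[OF norm_triangle_ineq] add_mono norm_triangle_ineq order_refl)
      also have "\<dots> = norm (x - y) + (norm (lreg n y - y) + norm (y - x))"
        by simp
      also have "\<dots> < e"
        using N(3)[OF that] y(2) by (simp add: dist_norm norm_minus_commute)
      finally show ?thesis .
    qed
    then show "\<exists>N. open N \<and> 0 \<in> N \<and> (\<forall>n\<in>N. norm (lreg n x - x) < e)"
      using N(1,2) by blast
  qed
  then have "closed S"
    by (metis closure_subset_eq subsetI)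
  moreover have "c *\<^sub>C ind_L2 K \<in> S" if K: "compact K" for c K
    unfolding S_def
  proof (intro CollectI allI impI)
    fix e :: real
    assume e: "e > 0"
    have pos: "cmod c + 1 > 0"
      by (simp add: add_nonneg_pos)
    define d where "d = e / (cmod c + 1)"
    have d: "d > 0"
      using e pos by (simp add: d_def)
    then have "d\<^sup>2 / 2 > 0"
      by simp
    from compact_outer_approx[OF K this] obtain U where U: "open U" "K \<subseteq> U" "U \<in> fmeasurable haar"
      "measure haar U < measure haar K + d\<^sup>2 / 2" .
    have "continuous_on UNIV (\<lambda>(n, k). n + k :: 'g)"
      unfolding case_prod_beta by (intro continuous_intros)
    then have "\<exists>N. open N \<and> 0 \<in> N \<and> (\<forall>n\<in>N. \<forall>k\<in>K. n + k \<in> U)"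
      by (rule compact_nbhd[OF _ K U(1)]) (use U(2) in auto)
    then obtain N where N: "open N" "0 \<in> N" "\<And>n k. n \<in> N \<Longrightarrow> k \<in> K \<Longrightarrow> n + k \<in> U"
      by blast
    have "norm (lreg n (c *\<^sub>C ind_L2 K) - c *\<^sub>C ind_L2 K) < e" if n: "n \<in> N" for n
    proof -
      let ?K = "(+) n ` K"
      have fK: "K \<in> fmeasurable haar" "?K \<in> fmeasurable haar"
        using K by (auto intro: fmeasurable_compact compact_image_plus)
      have mK: "measure haar ?K = measure haar K"
        by (simp add: measure_def emeasure_haar_translate borel_compact K)
      have "measure haar (K \<union> ?K) \<le> measure haar U"
        by (rule measure_mono_fmeasurable[OF _ fmeasurableD[OF fmeasurable.Un[OF fK]] U(3)])
           (use U(2) N(3)[OF n] in auto)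
      moreover have "measure haar (K \<union> ?K) = measure haar K + measure haar (?K - K)"
        by (rule measure_Un2[OF fK])
      moreover have "measure haar (K \<union> ?K) = measure haar ?K + measure haar (K - ?K)"
        using measure_Un2[OF fK(2,1)] by (simp only: Un_commute)
      ultimately have "measure haar (?K - K) + measure haar (K - ?K) < d\<^sup>2"
        using U(4) mK by linarith
      then have "(norm (lreg n (ind_L2 K) - ind_L2 K))\<^sup>2 < d\<^sup>2"
        by (simp add: lreg_ind_L2 fK norm_ind_L2_diff_square)
      then have *: "norm (lreg n (ind_L2 K) - ind_L2 K) < d"
        using d by (simp add: power_less_imp_less_base)
      have "norm (lreg n (c *\<^sub>C ind_L2 K) - c *\<^sub>C ind_L2 K) = cmod c * norm (lreg n (ind_L2 K) - ind_L2 K)"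
        by (simp add: clinD[OF clin_lreg] flip: scaleC_diff_right)
      also have "\<dots> \<le> cmod c * d"
        using * by (intro mult_left_mono) auto
      also have "\<dots> < e"
        unfolding d_def times_divide_eq_right pos_divide_less_eq[OF pos] using e by (simp add: algebra_simps)
      finally show ?thesis .
    qed
    then show "\<exists>N. open N \<and> 0 \<in> N \<and> (\<forall>n\<in>N. norm (lreg n (c *\<^sub>C ind_L2 K) - c *\<^sub>C ind_L2 K) < e)"
      using N(1,2) by blast
  qed
  then have "{c *\<^sub>C ind_L2 K | c K. compact K} \<subseteq> S"
    by blast
  ultimately have "closure (span {c *\<^sub>C ind_L2 K | c K. compact K}) \<subseteq> S"
    by (intro closure_span_subset)
  then have "x \<in> S"
    unfolding dense_ind_L2 by blast
  then show ?thesis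
    using e unfolding S_def by blast
qed

lemma continuous_on_lreg: "continuous_on UNIV (\<lambda>s. lreg s x)"
  unfolding continuous_on_def
proof
  fix s :: 'a
  show "((\<lambda>s. lreg s x) \<longlongrightarrow> lreg s x) (at s within UNIV)"
  proof (rule tendstoI)
    fix e :: real
    assume "e > 0"
    from lreg_near[OF this, of x]
    obtain N where N: "open N" "0 \<in> N" "\<And>n. n \<in> N \<Longrightarrow> norm (lreg n x - x) < e"
      by blast
    have "dist (lreg t x) (lreg s x) < e" if "t \<in> (+) s ` N" for t
    proof -
      obtain n where n: "n \<in> N" "t = s + n"
        using \<open>t \<in> (+) s ` N\<close> by auto
      have "lreg t x - lreg s x = lreg s (lreg n x - x)"
        by (simp add: n lreg_lreg blinfun.diff_right)
      then show ?thesis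
        using N(3)[OF n(1)] by (simp add: dist_norm)
    qed
    moreover have "open ((+) s ` N)" "s \<in> (+) s ` N"
      using N(1,2) by (auto intro: open_image_plus image_eqI[of _ _ 0])
    ultimately show "\<forall>\<^sub>F t in at s. dist (lreg t x) (lreg s x) < e"
      unfolding eventually_at_topological by blast
  qed
qed

section \<open>Normalised indicators of invariant neighbourhoods\<close>

definition zeta :: "'g::haar_group set \<Rightarrow> 'g L2" where
  "zeta V = (1 / sqrt (measure haar V)) *\<^sub>R ind_L2 V"

lemma norm_zeta:
  assumes V: "inv_nbhd V"
  shows "norm (zeta V) = 1"
proof -
  have "V \<in> fmeasurable haar"
    using V by (auto simp: inv_nbhd_def intro: fmeasurable_compact)
  then have "norm (ind_L2 V) = sqrt (measure haar V)"
    by (metis norm_ind_L2_square norm_ge_zero real_sqrt_unique)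
  then show ?thesis
    using inv_nbhd_measure_pos[OF V] by (simp add: zeta_def)
qed

lemma conj_zeta [simp]:
  assumes V: "inv_nbhd V"
  shows "conj_L2 (zeta V) = zeta V"
proof -
  have "V \<in> fmeasurable haar"
    using V by (auto simp: inv_nbhd_def intro: fmeasurable_compact)
  then have sq: "square_integrable (indicator V :: 'a \<Rightarrow> complex)"
    by (rule square_integrable_indicator)
  show ?thesis
    unfolding zeta_def scaleC_of_real[symmetric] ind_L2_def abs_L2_scaleC[OF sq]
      conj_abs_L2[OF square_integrable_cmult[OF sq]]
    by (rule arg_cong[of _ _ abs_L2]) (auto simp: indicator_def)
qed

text \<open>The coefficient is the measure of the intersection of \<open>g + V\<close> and
  \<open>V\<close>, divided by that of \<open>V\<close>. Conjugating \<open>g\<close> by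
  \<open>y\<close> conjugates this compact intersection, and its measure is preserved because right
  translations preserve the measure of compact sets.\<close>

lemma cinner_lreg_zeta_conj:
  fixes V :: "'g::haar_group set"
  assumes SIN: "SIN_group TYPE('g)" and V: "inv_nbhd V"
  shows "cinner (lreg (y + g - y) (zeta V)) (zeta V) = cinner (lreg g (zeta V)) (zeta V)"
proof -
  have cV: "compact V" and inv: "\<And>g x. x \<in> V \<Longrightarrow> g + x - g \<in> V"
    using V by (auto simp: inv_nbhd_def)
  have inv': "g + x - g \<in> V \<longleftrightarrow> x \<in> V" for g x
  proof -
    have "- g + (g + x - g) - - g = x"
      by (simp add: diff_conv_add_uminus add.assoc del: add_uminus_conv_diff)
    then show ?thesis
      using inv[of x g] inv[of "g + x - g" "- g"] by auto
  qed
  define C where "C = (+) g ` V \<inter> V"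
  have C: "compact C"
    unfolding C_def using cV by (intro compact_Int compact_image_plus)
  have "(+) (y + g - y) ` V \<inter> V = (+) y ` (\<lambda>x. x + - y) ` C"
  proof (rule set_eqI)
    fix x
    have "x \<in> (+) y ` (\<lambda>x. x + - y) ` C \<longleftrightarrow> - y + x + y \<in> C"
      unfolding image_plus_eq image_plus_right_eq by simp
    also have "\<dots> \<longleftrightarrow> - g + (- y + x + y) \<in> V \<and> - y + x + y \<in> V"
      unfolding C_def image_plus_eq by simp
    also have "- y + x + y \<in> V \<longleftrightarrow> x \<in> V"
      using inv'[of "- y" x] by simp
    also have "- g + (- y + x + y) \<in> V \<longleftrightarrow> y + (- g + (- y + x + y)) - y \<in> V"
      by (rule inv'[symmetric])
    also have "y + (- g + (- y + x + y)) - y = - (y + g - y) + x"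
      by (simp add: minus_add add.assoc diff_conv_add_uminus del: add_uminus_conv_diff)
    also have "- (y + g - y) + x \<in> V \<and> x \<in> V \<longleftrightarrow> x \<in> (+) (y + g - y) ` V \<inter> V"
      unfolding image_plus_eq by simp
    finally show "x \<in> (+) (y + g - y) ` V \<inter> V \<longleftrightarrow> x \<in> (+) y ` (\<lambda>x. x + - y) ` C"
      by blast
  qed
  moreover have "measure haar ((+) y ` (\<lambda>x. x + - y) ` C) = measure haar ((\<lambda>x. x + - y) ` C)"
    using compact_image_plus_right[OF C, of "- y"]
        by (simp add: measure_def emeasure_haar_translate borel_compact)
  moreover have "measure haar ((\<lambda>x. x + - y) ` C) = measure haar C"
    by (rule right_translate_measure[OF SIN C])
  ultimately have "measure haar ((+) (y + g - y) ` V \<inter> V) = measure haar ((+) g ` V \<inter> V)"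
    by (simp add: C_def)
  then show ?thesis
    by (simp add: zeta_def blinfun.scaleR_right lreg_ind_L2 cinner_ind_L2 fmeasurable_compact
        compact_image_plus cV)
qed

section \<open>Operators given by fields of vectors\<close>

text \<open>
  For a bounded weakly measurable field \<open>k\<close> of vectors, \<open>fld tp k\<close> maps \<open>\<theta> \<otimes> f\<close> to the function
  \<open>y \<mapsto> \<langle>\<theta>, k y\<rangle> f y\<close>; its adjoint sends \<open>f\<close> to the ``direct integral'' of the vectors \<open>f y *\<^sub>C k y \<otimes> \<delta>\<^sub>y\<close>.
\<close>

definition wfield :: "('g::haar_group \<Rightarrow> 'a::complex_inner) \<Rightarrow> bool" where
  "wfield k \<longleftrightarrow> (\<forall>\<theta>. (\<lambda>y. cinner \<theta> (k y)) \<in> borel_measurable haar) \<and> (\<exists>C. \<forall>y. norm (k y) \<le> C)"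

lemma wfield_bdd_borel:
  assumes "wfield k"
  shows "bdd_borel (\<lambda>y. cinner \<theta> (k y))"
proof -
  obtain C where C: "\<And>y. norm (k y) \<le> C"
    using assms by (auto simp: wfield_def)
  have "cmod (cinner \<theta> (k y)) \<le> norm \<theta> * C" for y
    by (rule order.trans[OF cmod_cinner_le]) (intro mult_left_mono C norm_ge_zero)
  then show ?thesis
    using assms unfolding wfield_def bdd_borel_def by blast
qed

lemma wfield_const: "wfield (\<lambda>_. \<theta>)"
  unfolding wfield_def by auto

lemma wfield_orbit: "wfield (\<lambda>y. lreg y x)"
  unfolding wfield_def
proof (intro conjI allI exI)
  fix \<theta>
  have "(\<lambda>y. cinner \<theta> (lreg y x)) \<in> borel_measurable borel"
    by (intro borel_measurable_continuous_onI continuous_on_cinner continuous_on_const continuous_on_lreg)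
  then show "(\<lambda>y. cinner \<theta> (lreg y x)) \<in> borel_measurable haar"
    by (simp cong: measurable_cong_sets)
  show "norm (lreg y x) \<le> norm x" for y
    by simp
qed

lemma cnj_indicator [simp]: "cnj (indicator A y) = indicator A y"
  by (simp add: indicator_def)

lemma wfield_sum:
  fixes k :: "'i \<Rightarrow> 'g::haar_group \<Rightarrow> 'b::complex_inner"
  assumes "finite Z" "\<And>z. z \<in> Z \<Longrightarrow> wfield (k z)" "\<And>z. z \<in> Z \<Longrightarrow> B z \<in> sets borel"
  shows "wfield (\<lambda>y. \<Sum>z\<in>Z. indicator (B z) y *\<^sub>C k z y)"
  using assms
proof (induction Z)
  case empty
  then show ?case
    by (simp add: wfield_const)
next
  case (insert z Z)
  have IH: "wfield (\<lambda>y. \<Sum>z\<in>Z. indicator (B z) y *\<^sub>C k z y)" and kz: "wfield (k z)"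
    using insert by auto
  obtain C D where CD: "\<And>y. norm (\<Sum>z\<in>Z. indicator (B z) y *\<^sub>C k z y) \<le> C" "\<And>y. norm (k z y) \<le> D"
    using IH kz by (auto simp: wfield_def)
  have ind: "cmod (indicator (B z) y) \<le> 1" for y
    by (simp add: indicator_def)
  show ?case
    unfolding wfield_def
  proof (intro conjI allI exI)
    fix \<theta> y
    have [measurable]: "(\<lambda>y. cinner \<theta> (\<Sum>z\<in>Z. indicator (B z) y *\<^sub>C k z y)) \<in> borel_measurable haar"
      "(\<lambda>y. cinner \<theta> (k z y)) \<in> borel_measurable haar"
      using IH kz by (auto simp: wfield_def)
    have "(indicator (B z) :: 'g \<Rightarrow> complex) \<in> borel_measurable haar"
      using insert.prems by (intro borel_measurable_indicator) simp
    moreover have "cnj (indicator (B z) y) = indicator (B z) y" for y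
      by (simp add: indicator_def)
    ultimately show "(\<lambda>y. cinner \<theta> (\<Sum>z\<in>insert z Z. indicator (B z) y *\<^sub>C k z y)) \<in> borel_measurable haar"
      using insert.hyps by (simp add: cinner_add_right)
    have "norm (indicator (B z) y *\<^sub>C k z y) \<le> 1 * D"
      unfolding norm_scaleC by (intro mult_mono ind CD) auto
    then show "norm (\<Sum>z\<in>insert z Z. indicator (B z) y *\<^sub>C k z y) \<le> D + C"
      using insert.hyps by (auto intro!: norm_triangle_le add_mono CD)
  qed
qed

text \<open>The vector valued function represented by a formal sum when the tensor product is read
  as the space of square integrable \<open>'a\<close> valued functions. It permits norms to be
  computed as integrals without constructing that space.\<close>

definition vec_fun :: "('a::complex_inner \<times> ('g \<Rightarrow> complex)) list \<Rightarrow> 'g \<Rightarrow> 'a" where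
  "vec_fun M y = (\<Sum>(\<theta>, f)\<leftarrow>M. f y *\<^sub>C \<theta>)"

lemma vec_fun_simps [simp]:
  "vec_fun [] y = 0" "vec_fun ((\<theta>, f) # M) y = f y *\<^sub>C \<theta> + vec_fun M y"
  by (simp_all add: vec_fun_def)

context
  fixes tp :: "'a::complex_hilbert \<Rightarrow> 'g::haar_group L2 \<Rightarrow> 'k::complex_hilbert"
  assumes tp: "hilbert_tensor tp"
begin

lemma tensor_sum_rep:
  "\<exists>M. L = map (\<lambda>(\<theta>, f). (\<theta>, abs_L2 f)) M \<and> (\<forall>(\<theta>, f)\<in>set M. square_integrable f)"
proof (induction L)
  case Nil
  then show ?case
    by (intro exI[of _ "[]"]) auto
next
  case (Cons p L)
  then obtain M where M: "L = map (\<lambda>(\<theta>, f). (\<theta>, abs_L2 f)) M" "\<forall>(\<theta>, f)\<in>set M. square_integrable f"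
    by blast
  obtain \<theta> x where p: "p = (\<theta>, x)"
    by fastforce
  obtain f where "square_integrable f" "x = abs_L2 f"
    by (rule L2_repE)
  then show ?case
    using M p by (intro exI[of _ "(\<theta>, f) # M"]) auto
qed

lemma cinner_tensor_sum:
  assumes "\<forall>(\<theta>, f)\<in>set M. square_integrable f" "\<forall>(\<theta>, f)\<in>set M'. square_integrable f"
  shows "integrable haar (\<lambda>y. cinner (vec_fun M y) (vec_fun M' y)) \<and>
    cinner (tensor_sum tp (map (\<lambda>(\<theta>, f). (\<theta>, abs_L2 f)) M)) (tensor_sum tp (map (\<lambda>(\<theta>, f). (\<theta>, abs_L2 f)) M'))
      = (\<integral>y. cinner (vec_fun M y) (vec_fun M' y) \<partial>haar)"
  using assms(1)
proof (induction M)
  case Nil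
  then show ?case
    by simp
next
  case (Cons p M)
  obtain \<theta> f where p: "p = (\<theta>, f)"
    by fastforce
  have f: "square_integrable f"
    using Cons.prems p by auto
  have *: "integrable haar (\<lambda>y. cinner (f y *\<^sub>C \<theta>) (vec_fun M' y)) \<and>
    cinner (tp \<theta> (abs_L2 f)) (tensor_sum tp (map (\<lambda>(\<theta>, f). (\<theta>, abs_L2 f)) M'))
      = (\<integral>y. cinner (f y *\<^sub>C \<theta>) (vec_fun M' y) \<partial>haar)"
    using assms(2)
  proof (induction M')
    case Nil
    then show ?case
      by simp
  next
    case (Cons q M')
    obtain \<theta>' f' where q: "q = (\<theta>', f')"
      by fastforce
    have f': "square_integrable f'"
      using Cons.prems q by auto
    have int: "integrable haar (\<lambda>y. f y * cnj (f' y) * cinner \<theta> \<theta>')"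
      using square_integrable_mult[OF f f'] by simp
    have e: "cinner (f y *\<^sub>C \<theta>) (vec_fun (q # M') y)
        = f y * cnj (f' y) * cinner \<theta> \<theta>' + cinner (f y *\<^sub>C \<theta>) (vec_fun M' y)" for y
      by (simp add: q cinner_add_right distrib_left mult.assoc)
    have "\<forall>(\<theta>, f)\<in>set M'. square_integrable f"
      using Cons.prems by auto
    from Cons.IH[OF this] have IH: "integrable haar (\<lambda>y. cinner (f y *\<^sub>C \<theta>) (vec_fun M' y))"
      "cinner (tp \<theta> (abs_L2 f)) (tensor_sum tp (map (\<lambda>(\<theta>, f). (\<theta>, abs_L2 f)) M'))
        = (\<integral>y. cinner (f y *\<^sub>C \<theta>) (vec_fun M' y) \<partial>haar)"
      by blast+
    show ?case
      unfolding e using Bochner_Integration.integrable_add[OF int IH(1)]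
      by (simp add: Bochner_Integration.integral_add[OF int IH(1)] IH(2) q cinner_add_right cinner_tensor[OF tp]
          cinner_abs_L2[OF f f'] mult.commute[of "cinner \<theta> \<theta>'"] del: cinner_scaleC_left)
  qed
  then show ?case
    using Cons by (simp add: p cinner_add_left)
qed

lemma mul_tensor_sum:
  assumes k: "wfield k" and "\<forall>(\<theta>, f)\<in>set M. square_integrable f"
  shows "square_integrable (\<lambda>y. cinner (vec_fun M y) (k y)) \<and>
    tensor_sum (\<lambda>\<theta> x. mul (\<lambda>y. cinner \<theta> (k y)) x) (map (\<lambda>(\<theta>, f). (\<theta>, abs_L2 f)) M)
      = abs_L2 (\<lambda>y. cinner (vec_fun M y) (k y))"
  using assms(2)
proof (induction M)
  case Nil
  then show ?case
    by (simp add: square_integrable_0 zero_L2.abs_eq)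
next
  case (Cons p M)
  obtain \<theta> f where p: "p = (\<theta>, f)"
    by fastforce
  have f: "square_integrable f"
    using Cons.prems p by auto
  have 1: "square_integrable (\<lambda>y. cinner \<theta> (k y) * f y)"
    by (intro square_integrable_bdd_borel wfield_bdd_borel k f)
  have 2: "mul (\<lambda>y. cinner \<theta> (k y)) (abs_L2 f) = abs_L2 (\<lambda>y. cinner \<theta> (k y) * f y)"
    by (intro mul_abs_L2 wfield_bdd_borel k f)
  have 3: "cinner (vec_fun (p # M) y) (k y) = cinner \<theta> (k y) * f y + cinner (vec_fun M y) (k y)" for y
    by (simp add: p cinner_add_left mult.commute)
  have IH: "square_integrable (\<lambda>y. cinner (vec_fun M y) (k y))"
    "tensor_sum (\<lambda>\<theta> x. mul (\<lambda>y. cinner \<theta> (k y)) x) (map (\<lambda>(\<theta>, f). (\<theta>, abs_L2 f)) M)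
      = abs_L2 (\<lambda>y. cinner (vec_fun M y) (k y))"
    using Cons by auto
  show ?case
    unfolding 3 using square_integrable_add[OF 1 IH(1)] by (simp add: p 2 IH(2) abs_L2_add[OF 1 IH(1)])
qed

text \<open>The norm of the tensor sum is the square integral norm of \<open>vec_fun M\<close>, and
  its image is the function pairing \<open>vec_fun M y\<close> with \<open>k y\<close>; the bound is
  Cauchy-Schwarz under the integral.\<close>

lemma fld_bound:
  assumes k: "wfield k" and C: "\<And>y. norm (k y) \<le> C"
  shows "norm (tensor_sum (\<lambda>\<theta> x. mul (\<lambda>y. cinner \<theta> (k y)) x) L) \<le> C * norm (tensor_sum tp L)"
proof -
  obtain M where L: "L = map (\<lambda>(\<theta>, f). (\<theta>, abs_L2 f)) M" and M: "\<forall>(\<theta>, f)\<in>set M. square_integrable f"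
    using tensor_sum_rep[of L] by blast
  have C0: "0 \<le> C"
    using C[of undefined] norm_ge_zero order.trans by blast
  note 1 = cinner_tensor_sum[OF M M, folded L]
  note 2 = mul_tensor_sum[OF k M, folded L]
  have int: "integrable haar (\<lambda>y. (norm (vec_fun M y))\<^sup>2)"
    using integrable_Re[OF conjunct1[OF 1]] by (simp add: cinner_self)
  have "complex_of_real ((norm (tensor_sum tp L))\<^sup>2) = complex_of_real (\<integral>y. (norm (vec_fun M y))\<^sup>2 \<partial>haar)"
    using conjunct2[OF 1] unfolding cinner_self integral_complex_of_real .
  then have n: "(norm (tensor_sum tp L))\<^sup>2 = (\<integral>y. (norm (vec_fun M y))\<^sup>2 \<partial>haar)"
    by (simp only: of_real_eq_iff)
  have "(norm (tensor_sum (\<lambda>\<theta> x. mul (\<lambda>y. cinner \<theta> (k y)) x) L))\<^sup>2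
      = (\<integral>y. (cmod (cinner (vec_fun M y) (k y)))\<^sup>2 \<partial>haar)"
    using 2 by (simp add: norm_abs_L2)
  also have "\<dots> \<le> (\<integral>y. C\<^sup>2 * (norm (vec_fun M y))\<^sup>2 \<partial>haar)"
  proof (rule integral_mono)
    fix y
    have "cmod (cinner (vec_fun M y) (k y)) \<le> norm (vec_fun M y) * C"
      by (rule order.trans[OF cmod_cinner_le]) (intro mult_left_mono C norm_ge_zero)
    then have "(cmod (cinner (vec_fun M y) (k y)))\<^sup>2 \<le> (norm (vec_fun M y) * C)\<^sup>2"
      by (intro power_mono) auto
    then show "(cmod (cinner (vec_fun M y) (k y)))\<^sup>2 \<le> C\<^sup>2 * (norm (vec_fun M y))\<^sup>2"
      by (simp add: power_mult_distrib mult.commute)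
  qed (use 2 int in \<open>auto simp: square_integrable_def\<close>)
  also have "\<dots> = (C * norm (tensor_sum tp L))\<^sup>2"
    by (simp add: n power_mult_distrib)
  finally show ?thesis
    by (rule power2_le_imp_le) (simp add: C0)
qed

end

definition fld :: "('a::complex_hilbert \<Rightarrow> 'g::haar_group L2 \<Rightarrow> 'k::complex_hilbert) \<Rightarrow> ('g \<Rightarrow> 'a)
    \<Rightarrow> 'k \<Rightarrow>\<^sub>L 'g L2" where
  "fld tp k = (SOME R :: 'k \<Rightarrow>\<^sub>L 'g L2. \<forall>\<theta> x. blinfun_apply R (tp \<theta> x) = mul (\<lambda>y. cinner \<theta> (k y)) x)"

context
  fixes tp :: "'a::complex_hilbert \<Rightarrow> 'g::haar_group L2 \<Rightarrow> 'k::complex_hilbert"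
  assumes tp: "hilbert_tensor tp"
begin

lemma fld_exists:
  assumes k: "wfield k" and C: "\<And>y. norm (k y) \<le> C"
  shows "\<exists>R :: 'k \<Rightarrow>\<^sub>L 'g L2. (\<forall>\<theta> x. blinfun_apply R (tp \<theta> x) = mul (\<lambda>y. cinner \<theta> (k y)) x) \<and> norm R \<le> C"
proof (rule tensor_extend[OF tp, where B = "\<lambda>\<theta> x. mul (\<lambda>y. cinner \<theta> (k y)) x"])
  show "0 \<le> C"
    using C[of undefined] norm_ge_zero order.trans by blast
  fix r \<theta> and x :: "'g L2"
  have "mul (\<lambda>y. cinner (r *\<^sub>R \<theta>) (k y)) x = mul (\<lambda>y. of_real r * cinner \<theta> (k y)) x"
    by simp
  also have "\<dots> = mul (\<lambda>_. of_real r) (mul (\<lambda>y. cinner \<theta> (k y)) x)"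
    by (simp add: mul_mul bdd_borel_const wfield_bdd_borel[OF k])
  finally show "mul (\<lambda>y. cinner (r *\<^sub>R \<theta>) (k y)) x = r *\<^sub>R mul (\<lambda>y. cinner \<theta> (k y)) x"
    by (simp only: mul_const scaleC_of_real)
qed (rule fld_bound[OF tp k C])

lemma fld_apply:
  assumes k: "wfield k"
  shows "fld tp k (tp \<theta> x) = mul (\<lambda>y. cinner \<theta> (k y)) x"
proof -
  obtain C where C: "\<And>y. norm (k y) \<le> C"
    using assms by (auto simp: wfield_def)
  have "\<exists>R :: 'k \<Rightarrow>\<^sub>L 'g L2. \<forall>\<theta> x. blinfun_apply R (tp \<theta> x) = mul (\<lambda>y. cinner \<theta> (k y)) x"
    using fld_exists[OF k C] by blast
  from someI_ex[OF this] show ?thesis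
    unfolding fld_def[symmetric] by blast
qed

lemma norm_fld:
  assumes k: "wfield k" and C: "\<And>y. norm (k y) \<le> C"
  shows "norm (fld tp k) \<le> C"
proof -
  obtain R :: "'k \<Rightarrow>\<^sub>L 'g L2" where R: "\<And>\<theta> x. blinfun_apply R (tp \<theta> x) = mul (\<lambda>y. cinner \<theta> (k y)) x" "norm R \<le> C"
    using fld_exists[OF assms] by blast
  have "fld tp k = R"
    by (rule tensor_blinfun_eqI[OF tp]) (simp add: R fld_apply[OF k])
  then show ?thesis
    using R by simp
qed

lemma clin_fld:
  assumes k: "wfield k"
  shows "clin (fld tp k)"
proof (rule clin_on_tensor[OF tp])
  fix c \<theta> and x :: "'g L2"
  have "fld tp k (c *\<^sub>C tp \<theta> x) = fld tp k (tp \<theta> (c *\<^sub>C x))"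
    by (simp add: tensor_scaleC_right[OF tp])
  then show "fld tp k (c *\<^sub>C tp \<theta> x) = c *\<^sub>C fld tp k (tp \<theta> x)"
    by (simp add: fld_apply[OF k] mul_scaleC_right[OF wfield_bdd_borel[OF k]])
qed

lemma cinner_tensor_adj_fld:
  assumes k: "wfield k"
  shows "cinner (tp \<theta> w) (adj (fld tp k) x) = cinner (mul (\<lambda>y. cinner \<theta> (k y)) w) x"
  by (simp add: cinner_adj[OF clin_fld[OF k], symmetric] fld_apply[OF k])

lemma adj_fld_eqI:
  assumes k: "wfield k" and "\<And>\<theta> w. cinner (mul (\<lambda>y. cinner \<theta> (k y)) w) x = cinner (tp \<theta> w) v"
  shows "adj (fld tp k) x = v"
proof (rule cinner_eq_on_dense[OF tensor_dense[OF tp]])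
  fix z
  assume "z \<in> {tp x y | x y. True}"
  then show "cinner z (adj (fld tp k) x) = cinner z v"
    using assms(2) by (auto simp: cinner_tensor_adj_fld[OF k])
qed

lemma adj_fld_const: "adj (fld tp (\<lambda>_. \<theta>)) x = tp \<theta> x"
  by (rule adj_fld_eqI[OF wfield_const]) (simp add: mul_const cinner_tensor[OF tp])

lemma norm_adj_fld_le:
  assumes k: "wfield k" and C: "\<And>y. norm (k y) \<le> C"
  shows "norm (adj (fld tp k) x) \<le> C * norm x"
proof -
  have "norm (adj (fld tp k)) \<le> C"
    using norm_adj_le[OF clin_fld[OF k]] norm_fld[OF assms] by linarith
  then show ?thesis
    using norm_blinfun[of "adj (fld tp k)" x] mult_right_mono[OF _ norm_ge_zero] order.trans by blast
qed

text \<open>For step fields with constant values this writes the direct integral as a finite sum of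
  elementary tensors, on which operators of the form \<open>op_tensor\<close> can be
  evaluated.\<close>

lemma adj_fld_sum:
  assumes Z: "finite Z" and k: "\<And>z. z \<in> Z \<Longrightarrow> wfield (k z)" and B: "\<And>z. z \<in> Z \<Longrightarrow> B z \<in> sets borel"
  shows "adj (fld tp (\<lambda>y. \<Sum>z\<in>Z. indicator (B z) y *\<^sub>C k z y)) x
      = (\<Sum>z\<in>Z. adj (fld tp (k z)) (mul (indicator (B z)) x))"
proof (rule adj_fld_eqI[OF wfield_sum[OF Z k B]])
  fix \<theta> w
  have "cinner (mul (\<lambda>y. cinner \<theta> (\<Sum>z\<in>Z. indicator (B z) y *\<^sub>C k z y)) w) x
      = cinner (mul (\<lambda>y. \<Sum>z\<in>Z. indicator (B z) y * cinner \<theta> (k z y)) w) x"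
    by (simp add: cinner_sum_right)
  also have "\<dots> = (\<Sum>z\<in>Z. cinner (mul (\<lambda>y. indicator (B z) y * cinner \<theta> (k z y)) w) x)"
    by (subst mul_sum_left) (auto intro!: bdd_borel_mult bdd_borel_indicator B wfield_bdd_borel k
        simp: cinner_sum_left)
  also have "\<dots> = (\<Sum>z\<in>Z. cinner (mul (indicator (B z)) (mul (\<lambda>y. cinner \<theta> (k z y)) w)) x)"
    by (intro sum.cong refl) (simp add: mul_mul bdd_borel_indicator B wfield_bdd_borel k)
  also have "\<dots> = (\<Sum>z\<in>Z. cinner (tp \<theta> w) (adj (fld tp (k z)) (mul (indicator (B z)) x)))"
    by (intro sum.cong refl) (simp add: cinner_mul bdd_borel_indicator B cinner_tensor_adj_fld k)
  finally show "cinner (mul (\<lambda>y. cinner \<theta> (\<Sum>z\<in>Z. indicator (B z) y *\<^sub>C k z y)) w) x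
      = cinner (tp \<theta> w) (\<Sum>z\<in>Z. adj (fld tp (k z)) (mul (indicator (B z)) x))"
    by (simp add: cinner_sum_right)
qed

text \<open>The difference field cut off to \<open>A\<close> is bounded by \<open>e\<close>
  everywhere, and its adjoint acts on \<open>x\<close> like the difference of the two adjoints
  because \<open>x\<close> lives on \<open>A\<close>.\<close>

lemma norm_adj_fld_diff_le:
  assumes k: "wfield k" and k': "wfield k'" and A: "A \<in> sets borel" and x: "mul (indicator A) x = x"
    and e: "0 \<le> e" "\<And>y. y \<in> A \<Longrightarrow> norm (k y - k' y) \<le> e"
  shows "norm (adj (fld tp k) x - adj (fld tp k') x) \<le> e * norm x"
proof -
  define d where "d y = indicator A y *\<^sub>C (k y - k' y)" for y
  have "norm (d y) \<le> e" for y
    using e by (auto simp: d_def indicator_def)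
  have cd: "cinner \<theta> (d y) = indicator A y * (cinner \<theta> (k y) + - 1 * cinner \<theta> (k' y))" for \<theta> y
    by (simp add: d_def cinner_diff_right)
  have b: "bdd_borel (\<lambda>y. - 1 * cinner \<theta> (k' y))" for \<theta>
    by (intro bdd_borel_mult bdd_borel_const wfield_bdd_borel k')
  have "bdd_borel (\<lambda>y. cinner \<theta> (d y))" for \<theta>
    unfolding cd by (intro bdd_borel_mult bdd_borel_indicator A bdd_borel_add b wfield_bdd_borel k)
  then have d: "wfield d"
    using \<open>\<And>y. norm (d y) \<le> e\<close> unfolding wfield_def bdd_borel_def by blast
  have "adj (fld tp d) x = adj (fld tp k) x - adj (fld tp k') x"
  proof (rule adj_fld_eqI[OF d])
    fix \<theta> w
    have "mul (\<lambda>y. cinner \<theta> (d y)) w = mul (indicator A) (mul (\<lambda>y. cinner \<theta> (k y) + - 1 * cinner \<theta> (k' y)) w)"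
      unfolding cd by (rule mul_mul[symmetric])
          (intro bdd_borel_indicator A bdd_borel_add b wfield_bdd_borel k)+
    also have "mul (\<lambda>y. cinner \<theta> (k y) + - 1 * cinner \<theta> (k' y)) w
        = mul (\<lambda>y. cinner \<theta> (k y)) w + mul (\<lambda>y. - 1 * cinner \<theta> (k' y)) w"
      by (rule mul_add_left[OF wfield_bdd_borel[OF k] b])
    also have "mul (\<lambda>y. - 1 * cinner \<theta> (k' y)) w = - mul (\<lambda>y. cinner \<theta> (k' y)) w"
      by (simp only: mul_mul[OF bdd_borel_const wfield_bdd_borel[OF k'], symmetric] mul_const scaleC_minus1)
    finally have "cinner (mul (\<lambda>y. cinner \<theta> (d y)) w) x
        = cinner (mul (\<lambda>y. cinner \<theta> (k y)) w + - mul (\<lambda>y. cinner \<theta> (k' y)) w) (mul (\<lambda>t. cnj (indicator A t)) x)"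
      by (simp only: cinner_mul[OF bdd_borel_indicator[OF A]])
    also have "\<dots> = cinner (mul (\<lambda>y. cinner \<theta> (k y)) w - mul (\<lambda>y. cinner \<theta> (k' y)) w) x"
      by (simp add: x)
    finally show "cinner (mul (\<lambda>y. cinner \<theta> (d y)) w) x
        = cinner (tp \<theta> w) (adj (fld tp k) x - adj (fld tp k') x)"
      by (simp add: cinner_diff_left cinner_diff_right cinner_tensor_adj_fld k k')
  qed
  then show ?thesis
    using norm_adj_fld_le[OF d \<open>\<And>y. norm (d y) \<le> e\<close>, of x] by simp
qed

end

text \<open>Pairing \<open>lreg s \<theta>\<close> with the orbit of \<open>\<xi>\<close> at
  \<open>y\<close> is the same as pairing \<open>\<theta>\<close> with it at \<open>- s + y\<close>,
  so the coefficient function is translated together with \<open>x\<close>.\<close>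

lemma fld_orbit_lreg:
  fixes tp :: "'g::haar_group L2 \<Rightarrow> 'g L2 \<Rightarrow> 'k::complex_hilbert"
  assumes tp: "hilbert_tensor tp" and R: "\<And>\<theta> x. blinfun_apply R (tp \<theta> x) = tp (lreg s \<theta>) (lreg s x)"
  shows "fld tp (\<lambda>y. lreg y \<xi>) (blinfun_apply R \<Theta>) = lreg s (fld tp (\<lambda>y. lreg y \<xi>) \<Theta>)"
proof -
  have "fld tp (\<lambda>y. lreg y \<xi>) o\<^sub>L R = lreg s o\<^sub>L fld tp (\<lambda>y. lreg y \<xi>)"
  proof (rule tensor_blinfun_eqI[OF tp])
    fix \<theta> x
    have "cinner \<theta> (lreg (- s + y) \<xi>) = cinner (lreg s \<theta>) (lreg y \<xi>)" for y
      by (simp add: cinner_lreg lreg_lreg)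
    then show "(fld tp (\<lambda>y. lreg y \<xi>) o\<^sub>L R) (tp \<theta> x) = (lreg s o\<^sub>L fld tp (\<lambda>y. lreg y \<xi>)) (tp \<theta> x)"
      by (simp add: R fld_apply[OF tp wfield_orbit] lreg_mul wfield_bdd_borel wfield_orbit)
  qed
  then show ?thesis
    by (auto dest: arg_cong[where f = "\<lambda>Z. blinfun_apply Z \<Theta>"])
qed

section \<open>Compressions of the comultiplication\<close>

lemma eq_0_if_le_epsilon:
  fixes d :: "'a::real_normed_vector"
  assumes "\<And>e :: real. e > 0 \<Longrightarrow> norm d \<le> e * D" "0 \<le> D"
  shows "d = 0"
proof -
  have "norm d \<le> 0"
  proof (rule field_le_epsilon)
    fix e :: real
    assume e: "e > 0"
    have pos: "D + 1 > 0"
      using assms(2) by linarith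
    have "norm d \<le> e / (D + 1) * D"
      by (rule assms(1)) (use e pos in simp)
    also have "\<dots> \<le> e"
      unfolding times_divide_eq_left pos_divide_le_eq[OF pos] using e by (simp add: algebra_simps)
    finally show "norm d \<le> 0 + e"
      by simp
  qed
  then show ?thesis
    by simp
qed

lemma norm_lreg_zeta_conj:
  fixes V :: "'g::haar_group set"
  assumes SIN: "SIN_group TYPE('g)" and V: "inv_nbhd V"
  shows "norm (lreg (y + g - y) (zeta V) - zeta V) = norm (lreg g (zeta V) - zeta V)"
proof -
  have "(norm (lreg (y + g - y) (zeta V) - zeta V))\<^sup>2 = (norm (lreg g (zeta V) - zeta V))\<^sup>2"
    by (simp only: norm_diff_square norm_lreg cinner_lreg_zeta_conj[OF assms])
  then show ?thesis
    by simp
qed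

lemma sum_indicator_disjoint:
  assumes "finite Z" "disjoint_family_on B Z" "z \<in> Z" "y \<in> B z"
  shows "(\<Sum>w\<in>Z. indicator (B w) y *\<^sub>C f w) = (f z :: 'a::complex_inner)"
proof -
  have "(\<Sum>w\<in>Z. indicator (B w) y *\<^sub>C f w) = (\<Sum>w\<in>Z. if w = z then f w else 0)"
    using assms by (intro sum.cong refl) (auto simp: disjoint_family_on_def indicator_def)
  then show ?thesis
    using assms by simp
qed

text \<open>
  The matrix coefficient \<open>g \<mapsto> \<langle>y \<zeta>, \<lambda> g \<zeta>\<rangle>\<close> does not change if \<open>\<zeta>\<close> is replaced by a right translate; for
  the invariant vector \<open>\<zeta>\<close> right and left translates agree.
\<close>

definition conj_inv :: "'g::haar_group set \<Rightarrow> ('g L2 \<Rightarrow>\<^sub>L 'g L2) \<Rightarrow> bool" where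
  "conj_inv V y \<longleftrightarrow> (\<forall>s z. cinner (y (lreg z (zeta V))) (lreg (s + z) (zeta V))
      = cinner (y (zeta V)) (lreg s (zeta V)))"

text \<open>For a translation by \<open>t\<close> the two sides are diagonal coefficients of
  \<open>zeta V\<close> at conjugate group elements; normality extends this to all of
  \<open>VN\<close>.\<close>

lemma conj_inv_VN:
  fixes V :: "'g::haar_group set"
  assumes SIN: "SIN_group TYPE('g)" and V: "inv_nbhd V" and a: "a \<in> VN"
  shows "conj_inv V a"
  unfolding conj_inv_def
proof (intro allI)
  fix s z
  show "cinner (a (lreg z (zeta V))) (lreg (s + z) (zeta V)) = cinner (a (zeta V)) (lreg s (zeta V))"
  proof (rule VN_functional_eqI[OF continuous_map_VN_vector_functional continuous_map_VN_vector_functional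
      _ _ _ _ _ a])
    fix t
    have "cinner (lreg t (lreg z (zeta V))) (lreg (s + z) (zeta V))
        = cinner (lreg (- (s + z) + (t + z)) (zeta V)) (zeta V)"
      by (simp add: lreg_lreg[symmetric] cinner_lreg[of "- (s + z)"] del: minus_add)
    also have "- (s + z) + (t + z) = - z + (- s + t) - (- z)"
      by (simp add: minus_add add.assoc diff_conv_add_uminus del: add_uminus_conv_diff)
    also have "cinner (lreg \<dots> (zeta V)) (zeta V) = cinner (lreg (- s + t) (zeta V)) (zeta V)"
      by (rule cinner_lreg_zeta_conj[OF SIN V])
    also have "\<dots> = cinner (lreg t (zeta V)) (lreg s (zeta V))"
      using cinner_lreg[of "- s" "lreg t (zeta V)" "zeta V"] by (simp add: lreg_lreg)
    finally show "cinner (lreg t (lreg z (zeta V))) (lreg (s + z) (zeta V))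
        = cinner (lreg t (zeta V)) (lreg s (zeta V))" .
  qed (auto simp: blinfun.add_left cinner_add_left)
qed

section \<open>Orbit maps intertwining the comultiplication, and compressions by them\<close>

context
  fixes tp2 :: "'g::haar_group L2 \<Rightarrow> 'g L2 \<Rightarrow> 'h2::complex_hilbert"
    and \<Delta> :: "('g L2 \<Rightarrow>\<^sub>L 'g L2) \<Rightarrow> 'h2 \<Rightarrow>\<^sub>L 'h2"
  assumes SIN: "SIN_group TYPE('g)" and ht2: "hilbert_tensor tp2" and com: "comultiplication tp2 \<Delta>"
begin

lemma Delta_mem: "x \<in> VN \<Longrightarrow> \<Delta> x \<in> vn_tensor tp2 VN VN"
  and Delta_add: "x \<in> VN \<Longrightarrow> y \<in> VN \<Longrightarrow> \<Delta> (x + y) = \<Delta> x + \<Delta> y"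
  and Delta_scaleC: "x \<in> VN \<Longrightarrow> \<Delta> (scaleC_op c x) = scaleC_op c (\<Delta> x)"
  and Delta_cadjoint: "x \<in> VN \<Longrightarrow> \<Delta> (cadjoint x) = cadjoint (\<Delta> x)"
  and Delta_id: "\<Delta> id_blinfun = id_blinfun"
  and Delta_lreg: "\<Delta> (lreg s) = op_tensor tp2 (lreg s) (lreg s)"
  and Delta_continuous: "continuous_map (subtopology ultraweak_topology VN)
      (subtopology ultraweak_topology (vn_tensor tp2 VN VN)) \<Delta>"
  using com by (simp_all add: comultiplication_def normal_unital_star_hom_def)

lemma vn_tensor_clin:
  assumes "z \<in> vn_tensor tp2 VN VN"
  shows "clin z"
  using assms unfolding vn_tensor_def
  by (rule vn_generated_clin[rotated]) (auto intro: clin_op_tensor[OF ht2] VN_clin)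

lemma Delta_clin: "x \<in> VN \<Longrightarrow> clin (\<Delta> x)"
  by (intro vn_tensor_clin Delta_mem)

lemma continuous_map_Delta_functional:
  "continuous_map (subtopology ultraweak_topology VN) euclidean (\<lambda>x. cinner (\<Delta> x \<Theta>) \<Theta>')"
  using continuous_map_compose[OF Delta_continuous continuous_map_VN_vector_functional] by (simp add: o_def)

lemma Delta_lreg_apply: "\<Delta> (lreg s) (tp2 \<theta> x) = tp2 (lreg s \<theta>) (lreg s x)"
  by (simp add: Delta_lreg op_tensor_apply[OF ht2])

text \<open>The tensor product \<open>tp\<close> is left open since the identity is applied both to
  \<open>tp2\<close> and to its flip.\<close>

lemma fld_orbit_Delta:
  assumes tp: "hilbert_tensor tp" and act: "\<And>s \<theta> x. \<Delta> (lreg s) (tp \<theta> x) = tp (lreg s \<theta>) (lreg s x)"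
    and b: "b \<in> VN"
  shows "fld tp (\<lambda>y. lreg y \<xi>) (\<Delta> b \<Theta>) = b (fld tp (\<lambda>y. lreg y \<xi>) \<Theta>)"
proof (rule cinner_ext)
  fix \<eta>
  note cl = clin_fld[OF tp wfield_orbit, of \<xi>]
  have "cinner (\<Delta> b \<Theta>) (adj (fld tp (\<lambda>y. lreg y \<xi>)) \<eta>) = cinner (b (fld tp (\<lambda>y. lreg y \<xi>) \<Theta>)) \<eta>"
  proof (rule VN_functional_eqI[OF continuous_map_Delta_functional continuous_map_VN_vector_functional
      _ _ _ _ _ b])
    fix s
    show "cinner (\<Delta> (lreg s) \<Theta>) (adj (fld tp (\<lambda>y. lreg y \<xi>)) \<eta>) = cinner (lreg s (fld tp (\<lambda>y. lreg y \<xi>) \<Theta>)) \<eta>"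
      unfolding cinner_adj[OF cl, symmetric] fld_orbit_lreg[OF tp act] ..
  qed (auto simp: Delta_add Delta_scaleC blinfun.add_left cinner_add_left)
  then show "cinner (fld tp (\<lambda>y. lreg y \<xi>) (\<Delta> b \<Theta>)) \<eta> = cinner (b (fld tp (\<lambda>y. lreg y \<xi>) \<Theta>)) \<eta>"
    unfolding cinner_adj[OF cl] .
qed

lemma Delta_adj_fld_orbit:
  assumes tp: "hilbert_tensor tp" and act: "\<And>s \<theta> x. \<Delta> (lreg s) (tp \<theta> x) = tp (lreg s \<theta>) (lreg s x)"
    and b: "b \<in> VN"
  shows "\<Delta> b (adj (fld tp (\<lambda>y. lreg y \<xi>)) x) = adj (fld tp (\<lambda>y. lreg y \<xi>)) (b x)"
proof (rule cinner_ext)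
  fix \<Theta>
  let ?F = "fld tp (\<lambda>y. lreg y \<xi>)"
  note cl = clin_fld[OF tp wfield_orbit, of \<xi>]
  have "cinner (\<Delta> b (adj ?F x)) \<Theta> = cinner x (?F (adj (\<Delta> b) \<Theta>))"
    by (simp only: cinner_adj[OF Delta_clin[OF b]] cinner_adj'[OF cl])
  also have "adj (\<Delta> b) = \<Delta> (cadjoint b)"
    by (simp add: Delta_cadjoint b cadjoint_eq_adj Delta_clin)
  also have "?F (\<Delta> (cadjoint b) \<Theta>) = adj b (?F \<Theta>)"
    unfolding fld_orbit_Delta[OF tp act VN_cadjoint[OF b]] by (simp add: cadjoint_eq_adj VN_clin b)
  also have "cinner x (adj b (?F \<Theta>)) = cinner (adj ?F (b x)) \<Theta>"
    by (simp only: cinner_adj[OF VN_clin[OF b]] cinner_adj'[OF cl])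
  finally show "cinner (\<Delta> b (adj ?F x)) \<Theta> = cinner (adj ?F (b x)) \<Theta>" .
qed

definition orbit_map :: "'g set \<Rightarrow> 'h2 \<Rightarrow>\<^sub>L 'g L2" where
  "orbit_map V = fld tp2 (\<lambda>y. lreg y (zeta V))"

text \<open>What an elementary tensor of \<open>y\<close> and \<open>c\<close> becomes under the
  coisometry. Applied to \<open>\<Delta> x\<close> instead, the same compression would return
  \<open>x\<close>.\<close>

definition compress :: "'g set \<Rightarrow> ('g L2 \<Rightarrow>\<^sub>L 'g L2) \<Rightarrow> ('g L2 \<Rightarrow>\<^sub>L 'g L2) \<Rightarrow> 'g L2 \<Rightarrow>\<^sub>L 'g L2" where
  "compress V y c = orbit_map V o\<^sub>L op_tensor tp2 y c o\<^sub>L adj (orbit_map V)"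

lemma clin_orbit_map [simp]: "clin (orbit_map V)"
  unfolding orbit_map_def by (rule clin_fld[OF ht2 wfield_orbit])

lemma norm_orbit_map: "inv_nbhd V \<Longrightarrow> norm (orbit_map V) \<le> 1"
  unfolding orbit_map_def by (rule norm_fld[OF ht2 wfield_orbit]) (simp add: norm_zeta)

lemma clin_compress: "clin y \<Longrightarrow> clin c \<Longrightarrow> clin (compress V y c)"
  unfolding compress_def by (intro clin_compose clin_orbit_map clin_adj clin_op_tensor[OF ht2])

lemma norm_compress:
  assumes V: "inv_nbhd V" and "clin y" "clin c"
  shows "norm (compress V y c) \<le> norm y * norm c"
proof -
  have "norm (compress V y c) \<le> norm (orbit_map V o\<^sub>L op_tensor tp2 y c) * norm (adj (orbit_map V))"
    unfolding compress_def by (rule norm_blinfun_compose)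
  also have "\<dots> \<le> (norm (orbit_map V) * norm (op_tensor tp2 y c)) * 1"
    by (intro mult_mono norm_blinfun_compose order.trans[OF norm_adj_le norm_orbit_map] V clin_orbit_map)
       auto
  also have "\<dots> \<le> (1 * (norm y * norm c)) * 1"
    by (intro mult_mono norm_orbit_map V norm_op_tensor[OF ht2] assms) auto
  finally show ?thesis
    by simp
qed

text \<open>This trades the orbit field of \<open>zeta V\<close> in the first leg for a constant
  vector in the second. After a partition into small pieces, the orbit is replaced on the piece at
  \<open>z\<close> by the constant \<open>lreg z (zeta V)\<close>. Dually, the constant
  \<open>zeta V\<close> is replaced by the orbit of \<open>lreg (- z) (zeta V)\<close> in the
  flipped tensor product. Between these two substitutes the identity is exact, by the intertwining
  property and \<open>conj_inv\<close>.\<close>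

lemma compress_formula_compact:
  assumes V: "inv_nbhd V" and y: "clin y" "conj_inv V y" and c: "c \<in> VN"
    and C: "compact C" and \<xi>: "mul (indicator C) \<xi> = \<xi>"
  shows "cinner (compress V y c \<xi>) \<eta> = cinner (\<Delta> c (tp2 \<xi> (zeta V))) (tp2 \<eta> (conj_L2 (y (zeta V))))"
proof -
  let ?\<zeta> = "zeta V"
  let ?F = "orbit_map V"
  let ?T = "op_tensor tp2 y c"
  define tpf where "tpf = (\<lambda>x y. tp2 y x)"
  have htf: "hilbert_tensor tpf"
    unfolding tpf_def by (rule hilbert_tensor_flip[OF ht2])
  have actf: "\<Delta> (lreg s) (tpf \<theta> x) = tpf (lreg s \<theta>) (lreg s x)" for s \<theta> x
    by (simp add: tpf_def Delta_lreg_apply)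
  have cc: "clin c"
    by (rule VN_clin[OF c])
  \<comment> \<open>Collects the operator and vector norms, so that the two replacement errors add
    up to \<open>e * D\<close>.\<close>
  define D where "D = norm (?F o\<^sub>L ?T) * norm \<xi> * norm \<eta> + norm (\<Delta> c) * norm \<xi> * norm (tp2 \<eta> (conj_L2 (y ?\<zeta>)))"
  have "cinner (?F (?T (adj ?F \<xi>))) \<eta> - cinner (\<Delta> c (tp2 \<xi> ?\<zeta>)) (tp2 \<eta> (conj_L2 (y ?\<zeta>))) = 0"
  proof (rule eq_0_if_le_epsilon)
    show "0 \<le> D"
      unfolding D_def by (intro add_nonneg_nonneg mult_nonneg_nonneg norm_ge_zero)
    fix e :: real
    assume e: "e > 0"
    from lreg_near[OF e, of ?\<zeta>] obtain N where N: "open N" "0 \<in> N" "\<And>n. n \<in> N \<Longrightarrow> norm (lreg n ?\<zeta> - ?\<zeta>) < e"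
      by blast
    obtain Z B where ZB: "finite Z" "Z \<subseteq> C" "disjoint_family_on B Z" "(\<Union>z\<in>Z. B z) = C"
      "\<And>z. z \<in> Z \<Longrightarrow> B z \<in> sets borel" "\<And>z. z \<in> Z \<Longrightarrow> B z \<subseteq> (+) z ` N"
      using compact_partition[OF C N(1,2)] by metis
    define k1 where "k1 y = (\<Sum>z\<in>Z. indicator (B z) y *\<^sub>C lreg z ?\<zeta>)" for y
    \<comment> \<open>At \<open>w = z + n\<close> its value is the translate of
      \<open>zeta V\<close> by the conjugate \<open>z + n - z\<close>. Its distance from
      \<open>zeta V\<close> is that of the translate by \<open>n\<close>, so the error is uniform in
      \<open>z\<close>.\<close>
    define k2 where "k2 y = (\<Sum>z\<in>Z. indicator (B z) y *\<^sub>C lreg y (lreg (- z) ?\<zeta>))" for y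
    have wk1: "wfield k1" and wk2: "wfield k2"
      unfolding k1_def k2_def by (intro wfield_sum ZB wfield_const wfield_orbit; assumption)+
    have k: "norm (lreg w ?\<zeta> - k1 w) \<le> e \<and> norm (?\<zeta> - k2 w) \<le> e" if "w \<in> C" for w
    proof -
      obtain z where z: "z \<in> Z" "w \<in> B z"
        using ZB(4) \<open>w \<in> C\<close> by blast
      then obtain n where n: "n \<in> N" "w = z + n"
        using ZB(6) by blast
      have "k1 w = lreg z ?\<zeta>" "k2 w = lreg w (lreg (- z) ?\<zeta>)"
        unfolding k1_def k2_def by (rule sum_indicator_disjoint[OF ZB(1,3) z])+
      then have "lreg w ?\<zeta> - k1 w = lreg z (lreg n ?\<zeta> - ?\<zeta>)" "k2 w - ?\<zeta> = lreg (z + n - z) ?\<zeta> - ?\<zeta>"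
        by (simp_all add: n lreg_lreg blinfun.diff_right)
      then have "norm (lreg w ?\<zeta> - k1 w) = norm (lreg n ?\<zeta> - ?\<zeta>)" "norm (k2 w - ?\<zeta>) = norm (lreg n ?\<zeta> - ?\<zeta>)"
        using norm_lreg_zeta_conj[OF SIN V, of z n] by (simp_all only: norm_lreg)
      then show ?thesis
        using N(3)[OF n(1)] by (simp add: norm_minus_commute)
    qed
    have CB: "C \<in> sets borel"
      by (rule borel_compact[OF C])
    define \<Xi> where "\<Xi> = adj (fld tp2 k1) \<xi>"
    define \<Theta> where "\<Theta> = adj (fld tpf k2) \<xi>"
    have \<Xi>: "\<Xi> = (\<Sum>z\<in>Z. tp2 (lreg z ?\<zeta>) (mul (indicator (B z)) \<xi>))"
      unfolding \<Xi>_def k1_def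
      by (subst adj_fld_sum[OF ht2 ZB(1) wfield_const ZB(5)]) (auto simp: adj_fld_const[OF ht2])
    have \<Theta>: "\<Theta> = (\<Sum>z\<in>Z. adj (fld tpf (\<lambda>y. lreg y (lreg (- z) ?\<zeta>))) (mul (indicator (B z)) \<xi>))"
      unfolding \<Theta>_def k2_def
      by (rule adj_fld_sum[OF htf ZB(1) wfield_orbit ZB(5)])
    have n\<Xi>: "norm (adj ?F \<xi> - \<Xi>) \<le> e * norm \<xi>"
      unfolding orbit_map_def \<Xi>_def
      by (rule norm_adj_fld_diff_le[OF ht2 wfield_orbit wk1 CB \<xi>]) (use e k in auto)
    have "tp2 \<xi> ?\<zeta> = adj (fld tpf (\<lambda>_. ?\<zeta>)) \<xi>"
      by (simp add: adj_fld_const[OF htf]) (simp add: tpf_def)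
    then have n\<Theta>: "norm (tp2 \<xi> ?\<zeta> - \<Theta>) \<le> e * norm \<xi>"
      unfolding \<Theta>_def
      using norm_adj_fld_diff_le[OF htf wfield_const wk2 CB \<xi>, of e ?\<zeta>] e k by auto
    have eq: "cinner (?F (?T \<Xi>)) \<eta> = cinner (\<Delta> c \<Theta>) (tp2 \<eta> (conj_L2 (y ?\<zeta>)))"
    proof -
      have "cinner (?F (?T (tp2 (lreg z ?\<zeta>) x))) \<eta>
          = cinner (\<Delta> c (adj (fld tpf (\<lambda>y. lreg y (lreg (- z) ?\<zeta>))) x)) (tp2 \<eta> (conj_L2 (y ?\<zeta>)))" for z x
      proof -
        \<comment> \<open>\<open>zeta V\<close> is fixed by \<open>conj_L2\<close>, and
          \<open>conj_inv\<close> moves the shift by \<open>z\<close> from one side of the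
          coefficient of \<open>y\<close> to the other.\<close>
        have co: "cnj (cinner (conj_L2 (y ?\<zeta>)) (lreg w (lreg (- z) ?\<zeta>)))
            = cinner (y (lreg z ?\<zeta>)) (lreg w ?\<zeta>)" for w
        proof -
          have "cinner (conj_L2 (y ?\<zeta>)) (lreg w (lreg (- z) ?\<zeta>))
              = cinner (conj_L2 (y ?\<zeta>)) (conj_L2 (lreg (w - z) ?\<zeta>))"
            by (simp add: lreg_lreg conj_lreg V)
          then have "cnj (cinner (conj_L2 (y ?\<zeta>)) (lreg w (lreg (- z) ?\<zeta>))) = cinner (y ?\<zeta>) (lreg (w - z) ?\<zeta>)"
            by (simp add: cinner_conj_conj)
          also have "\<dots> = cinner (y (lreg z ?\<zeta>)) (lreg (w - z + z) ?\<zeta>)"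
            by (rule y(2)[unfolded conj_inv_def, rule_format, symmetric])
          finally show ?thesis
            by simp
        qed
        have "cinner (\<Delta> c (adj (fld tpf (\<lambda>y. lreg y (lreg (- z) ?\<zeta>))) x)) (tpf (conj_L2 (y ?\<zeta>)) \<eta>)
           = cinner (c x) (mul (\<lambda>w. cinner (conj_L2 (y ?\<zeta>)) (lreg w (lreg (- z) ?\<zeta>))) \<eta>)"
          by (simp only: Delta_adj_fld_orbit[OF htf actf c] cinner_adj'[OF clin_fld[OF htf wfield_orbit]]
              fld_apply[OF htf wfield_orbit])
        also have "\<dots> = cinner (mul (\<lambda>w. cinner (y (lreg z ?\<zeta>)) (lreg w ?\<zeta>)) (c x)) \<eta>"
          by (subst cinner_mul[OF wfield_bdd_borel[OF wfield_orbit]]) (simp add: co[symmetric])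
        also have "mul (\<lambda>w. cinner (y (lreg z ?\<zeta>)) (lreg w ?\<zeta>)) (c x) = ?F (?T (tp2 (lreg z ?\<zeta>) x))"
          by (simp add: op_tensor_apply[OF ht2 y(1) cc] orbit_map_def fld_apply[OF ht2 wfield_orbit])
        finally show ?thesis
          by (simp add: tpf_def)
      qed
      then show ?thesis
        unfolding \<Xi> \<Theta> by (simp add: blinfun.sum_right cinner_sum_left)
    qed
    have "cinner (?F (?T (adj ?F \<xi>))) \<eta> - cinner (\<Delta> c (tp2 \<xi> ?\<zeta>)) (tp2 \<eta> (conj_L2 (y ?\<zeta>)))
       = cinner (?F (?T (adj ?F \<xi> - \<Xi>))) \<eta> - cinner (\<Delta> c (tp2 \<xi> ?\<zeta> - \<Theta>)) (tp2 \<eta> (conj_L2 (y ?\<zeta>)))"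
      by (simp add: blinfun.diff_right cinner_diff_left eq)
    also have "norm \<dots> \<le> norm (?F (?T (adj ?F \<xi> - \<Xi>))) * norm \<eta> + norm (\<Delta> c (tp2 \<xi> ?\<zeta> - \<Theta>))
        * norm (tp2 \<eta> (conj_L2 (y ?\<zeta>)))"
      by (rule order.trans[OF norm_triangle_ineq4]) (intro add_mono cmod_cinner_le)
    also have "\<dots> \<le> (norm (?F o\<^sub>L ?T) * (e * norm \<xi>)) * norm \<eta> + (norm (\<Delta> c) * (e * norm \<xi>))
        * norm (tp2 \<eta> (conj_L2 (y ?\<zeta>)))"
    proof (intro add_mono mult_right_mono norm_ge_zero)
      show "norm (?F (?T (adj ?F \<xi> - \<Xi>))) \<le> norm (?F o\<^sub>L ?T) * (e * norm \<xi>)"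
        using order.trans[OF norm_blinfun[of "?F o\<^sub>L ?T" "adj ?F \<xi> - \<Xi>"]
            mult_left_mono[OF n\<Xi> norm_ge_zero]] by simp
      show "norm (\<Delta> c (tp2 \<xi> ?\<zeta> - \<Theta>)) \<le> norm (\<Delta> c) * (e * norm \<xi>)"
        by (rule order.trans[OF norm_blinfun mult_left_mono[OF n\<Theta> norm_ge_zero]])
    qed
    also have "\<dots> = e * D"
      by (simp add: D_def algebra_simps)
    finally show "norm (cinner (?F (?T (adj ?F \<xi>))) \<eta> - cinner (\<Delta> c (tp2 \<xi> ?\<zeta>)) (tp2 \<eta> (conj_L2 (y ?\<zeta>))))
        \<le> e * D" .
  qed
  then show ?thesis
    by (simp add: compress_def)
qed

lemma compress_formula:
  assumes V: "inv_nbhd V" and y: "clin y" "conj_inv V y" and c: "c \<in> VN"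
  shows "cinner (compress V y c \<xi>) \<eta> = cinner (\<Delta> c (tp2 \<xi> (zeta V))) (tp2 \<eta> (conj_L2 (y (zeta V))))"
proof -
  have "(\<lambda>\<xi>. cinner (compress V y c \<xi>) \<eta>) = (\<lambda>\<xi>. cinner (\<Delta> c (tp2 \<xi> (zeta V))) (tp2 \<eta> (conj_L2 (y (zeta V)))))"
  proof (rule bounded_linear_eq_on_dense[OF dense_ind_L2])
    show "bounded_linear (\<lambda>\<xi>. cinner (compress V y c \<xi>) \<eta>)"
      by (intro bounded_linear_compose[OF bounded_linear_cinner_left] blinfun.bounded_linear_right)
    show "bounded_linear (\<lambda>\<xi>. cinner (\<Delta> c (tp2 \<xi> (zeta V))) (tp2 \<eta> (conj_L2 (y (zeta V)))))"
      by (intro bounded_linear_compose[OF bounded_linear_cinner_left]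
          bounded_linear_compose[OF blinfun.bounded_linear_right]
          bounded_bilinear.bounded_linear_left[OF bounded_bilinear_tensor[OF ht2]])
    fix x :: "'g L2"
    assume "x \<in> {c *\<^sub>C ind_L2 K | c K. compact K}"
    then obtain d K where x: "x = d *\<^sub>C ind_L2 K" and K: "compact K"
      by blast
    have "mul (indicator K) (ind_L2 K) = ind_L2 K"
      unfolding ind_L2_def using K
      by (subst mul_abs_L2) (auto intro!: bdd_borel_indicator borel_compact square_integrable_indicator
          fmeasurable_compact arg_cong[of _ _ abs_L2] simp: indicator_def)
    then have "mul (indicator K) x = x"
      by (simp add: x mul_scaleC_right bdd_borel_indicator borel_compact K)
    then show "cinner (compress V y c x) \<eta> = cinner (\<Delta> c (tp2 x (zeta V))) (tp2 \<eta> (conj_L2 (y (zeta V))))"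
      by (rule compress_formula_compact[OF V y c K])
  qed
  then show ?thesis
    by metis
qed

text \<open>The coisometry property is read off from \<open>compress_formula\<close> with the
  identity in both legs, since \<open>zeta V\<close> is a real unit vector.\<close>

lemma orbit_map_adj:
  assumes V: "inv_nbhd V"
  shows "orbit_map V (adj (orbit_map V) x) = x"
proof (rule cinner_ext)
  fix \<eta>
  have "cinner (compress V id_blinfun id_blinfun x) \<eta> = cinner x \<eta>"
    by (subst compress_formula[OF V clin_id conj_inv_VN[OF SIN V VN_id] VN_id])
       (simp add: Delta_id cinner_tensor[OF ht2] V cinner_self norm_zeta)
  then show "cinner (orbit_map V (adj (orbit_map V) x)) \<eta> = cinner x \<eta>"
    by (simp add: compress_def op_tensor_id[OF ht2])
qed

text \<open>This makes compression iterable without placing \<open>compress W a b\<close> in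
  \<open>VN\<close>. By \<open>compress_formula\<close> its coefficients are normal functionals of
  \<open>b\<close>, and for a translation in place of \<open>b\<close> the claim is that of
  \<open>conj_inv_VN\<close>.\<close>

lemma conj_inv_compress:
  assumes V: "inv_nbhd V" and W: "inv_nbhd W" and a: "a \<in> VN" and b: "b \<in> VN"
  shows "conj_inv V (compress W a b)"
  unfolding conj_inv_def
proof (intro allI)
  fix s z
  have "cinner (\<Delta> b (tp2 (lreg z (zeta V)) (zeta W))) (tp2 (lreg (s + z) (zeta V)) (conj_L2 (a (zeta W))))
      = cinner (\<Delta> b (tp2 (zeta V) (zeta W))) (tp2 (lreg s (zeta V)) (conj_L2 (a (zeta W))))"
  proof (rule VN_functional_eqI[OF continuous_map_Delta_functional continuous_map_Delta_functional _ _ _ _ _ b])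
    fix t
    show "cinner (\<Delta> (lreg t) (tp2 (lreg z (zeta V)) (zeta W)))
        (tp2 (lreg (s + z) (zeta V)) (conj_L2 (a (zeta W))))
      = cinner (\<Delta> (lreg t) (tp2 (zeta V) (zeta W))) (tp2 (lreg s (zeta V)) (conj_L2 (a (zeta W))))"
      using conj_inv_VN[OF SIN V lreg_in_VN[of t]]
      by (simp add: Delta_lreg_apply cinner_tensor[OF ht2] conj_inv_def)
  qed (auto simp: Delta_add Delta_scaleC blinfun.add_left cinner_add_left)
  then show "cinner (compress W a b (lreg z (zeta V))) (lreg (s + z) (zeta V))
      = cinner (compress W a b (zeta V)) (lreg s (zeta V))"
    by (simp add: compress_formula[OF W VN_clin[OF a] conj_inv_VN[OF SIN W a] b])
qed

text \<open>On \<open>V\<close> the orbit of \<open>\<xi>\<close> stays within \<open>e\<close> of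
  \<open>\<xi>\<close>. So in \<open>compress_formula\<close> the elementary tensor of
  \<open>\<xi>\<close> and \<open>zeta V\<close> may be replaced by the direct integral of that
  orbit. Through it \<open>\<Delta> c\<close> passes as \<open>c\<close>, leaving multiplication by
  the coefficient function of \<open>\<xi>\<close> and \<open>\<eta>\<close>.\<close>

lemma compress_approx:
  assumes V: "inv_nbhd V" and y: "clin y" "conj_inv V y" and c: "c \<in> VN"
    and e: "0 \<le> e" "\<And>v. v \<in> V \<Longrightarrow> norm (lreg v \<xi> - \<xi>) \<le> e"
  shows "cmod (cinner (compress V y c \<xi>) \<eta> - cinner (y (zeta V))
      (conj_L2 (mul (\<lambda>w. cinner (lreg w \<xi>) \<eta>) (c (zeta V)))))
      \<le> norm (\<Delta> c) * e * (norm \<eta> * norm (y (zeta V)))"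
proof -
  let ?F = "fld tp2 (\<lambda>y. lreg y \<xi>)"
  let ?u = "conj_L2 (y (zeta V))"
  have bV: "V \<in> sets borel"
    using V by (auto simp: inv_nbhd_def intro: borel_compact)
  have "V \<in> fmeasurable haar"
    using V by (auto simp: inv_nbhd_def intro: fmeasurable_compact)
  then have "mul (indicator V) (ind_L2 V) = ind_L2 V"
    unfolding ind_L2_def
    by (subst mul_abs_L2) (auto intro!: bdd_borel_indicator bV square_integrable_indicator
        arg_cong[of _ _ abs_L2] simp: indicator_def)
  then have supp: "mul (indicator V) (zeta V) = zeta V"
    by (simp add: zeta_def mul_scaleR_right bdd_borel_indicator bV)
  have near: "norm (adj ?F (zeta V) - tp2 \<xi> (zeta V)) \<le> e * norm (zeta V)"
    using norm_adj_fld_diff_le[OF ht2 wfield_orbit wfield_const bV supp e(1), of \<xi> \<xi>] e(2)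
    by (simp add: adj_fld_const[OF ht2])
  have Fb: "bdd_borel (\<lambda>w. cinner (lreg w \<xi>) \<eta>)"
    using bdd_borel_cnj[OF wfield_bdd_borel[OF wfield_orbit, of \<eta> \<xi>]] by (simp add: cinner_commute[symmetric])
  have "cinner (\<Delta> c (adj ?F (zeta V))) (tp2 \<eta> ?u) = cinner (adj ?F (c (zeta V))) (tp2 \<eta> ?u)"
    by (simp add: Delta_adj_fld_orbit[OF ht2 Delta_lreg_apply c])
  also have "\<dots> = cinner (c (zeta V)) (mul (\<lambda>w. cinner \<eta> (lreg w \<xi>)) ?u)"
    by (simp add: cinner_adj'[OF clin_fld[OF ht2 wfield_orbit]] fld_apply[OF ht2 wfield_orbit])
  also have "\<dots> = cinner (mul (\<lambda>w. cinner (lreg w \<xi>) \<eta>) (c (zeta V))) ?u"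
    by (simp add: cinner_mul[OF Fb] cinner_commute[symmetric])
  also have "\<dots> = cinner (conj_L2 (conj_L2 (mul (\<lambda>w. cinner (lreg w \<xi>) \<eta>) (c (zeta V))))) ?u"
    by simp
  also have "\<dots> = cinner (y (zeta V)) (conj_L2 (mul (\<lambda>w. cinner (lreg w \<xi>) \<eta>) (c (zeta V))))"
    by (subst cinner_conj) simp
  finally have "cinner (compress V y c \<xi>) \<eta> - cinner (y (zeta V))
      (conj_L2 (mul (\<lambda>w. cinner (lreg w \<xi>) \<eta>) (c (zeta V))))
     = cinner (\<Delta> c (tp2 \<xi> (zeta V) - adj ?F (zeta V))) (tp2 \<eta> ?u)"
    by (simp add: compress_formula[OF V y c] blinfun.diff_right cinner_diff_left)
  also have "cmod \<dots> \<le> norm (\<Delta> c (tp2 \<xi> (zeta V) - adj ?F (zeta V))) * norm (tp2 \<eta> ?u)"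
    by (rule cmod_cinner_le)
  also have "\<dots> \<le> (norm (\<Delta> c) * (e * norm (zeta V))) * norm (tp2 \<eta> ?u)"
    using near by (intro mult_right_mono order.trans[OF norm_blinfun mult_left_mono])
        (simp_all add: norm_minus_commute)
  also have "\<dots> = norm (\<Delta> c) * e * (norm \<eta> * norm (y (zeta V)))"
    by (simp add: norm_tensor[OF ht2] norm_zeta V)
  finally show ?thesis .
qed

end

section \<open>Ultrafilters\<close>

definition ultra :: "'a filter \<Rightarrow> bool" where
  "ultra F \<longleftrightarrow> F \<noteq> bot \<and> (\<forall>P. eventually P F \<or> eventually (\<lambda>x. \<not> P x) F)"

text \<open>Zorn's lemma for proper filters below \<open>F0\<close>. A chain has a proper infimum,
  and a minimal proper filter must decide every predicate.\<close>

lemma ultrafilter_exists: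
  fixes F0 :: "'a filter"
  assumes "F0 \<noteq> bot"
  shows "\<exists>F \<le> F0. ultra F"
proof -
  let ?A = "{F. F \<noteq> bot \<and> F \<le> F0}"
  \<comment> \<open>The order is reversed, so that a maximal element is a finest filter.\<close>
  let ?P = "\<lambda>F G :: 'a filter. G \<le> F"
  have "\<exists>m\<in>?A. \<forall>a\<in>?A. ?P m a \<longrightarrow> a = m"
  proof (rule predicate_Zorn)
    show "partial_order_on ?A (relation_of ?P ?A)"
      by (rule partial_order_on_relation_ofI) auto
    fix C
    assume C: "C \<in> Chains (relation_of ?P ?A)"
    have CA: "C \<subseteq> ?A"
      using C by (auto simp: Chains_def relation_of_def)
    have tot: "a \<le> b \<or> b \<le> a" if "a \<in> C" "b \<in> C" for a b
      using C that by (auto simp: Chains_def relation_of_def)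
    show "\<exists>u\<in>?A. \<forall>a\<in>C. u \<le> a"
    proof (cases "C = {}")
      case True
      then show ?thesis
        using assms by auto
    next
      case False
      have ev: "eventually P (Inf C) \<longleftrightarrow> (\<exists>b\<in>C. eventually P b)" for P
      proof (rule eventually_Inf_base[OF False])
        fix a b
        assume "a \<in> C" "b \<in> C"
        then show "\<exists>x\<in>C. x \<le> inf a b"
          using tot[of a b] by (auto intro: bexI[of _ a] bexI[of _ b])
      qed
      have "Inf C \<noteq> bot"
        using ev[of "\<lambda>_. False"] CA by (auto simp: trivial_limit_def)
      moreover have "Inf C \<le> F0"
      proof -
        obtain a where "a \<in> C"
          using False by blast
        then show ?thesis
          using CA by (intro Inf_lower2[of a]) auto
      qed
      ultimately show ?thesis
        by (intro bexI[of _ "Inf C"]) (auto intro: Inf_lower)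
    qed
  qed
  then obtain F where F: "F \<noteq> bot" "F \<le> F0" and m: "\<forall>a\<in>?A. a \<le> F \<longrightarrow> a = F"
    by auto
  have max: "G = F" if "G \<noteq> bot" "G \<le> F" for G
    using m that order.trans[OF that(2) F(2)] by auto
  have "eventually P F \<or> eventually (\<lambda>x. \<not> P x) F" for P
  proof (cases "inf F (principal {x. P x}) = bot")
    case True
    then have "eventually (\<lambda>x. \<not> P x) F"
      using eventually_inf_principal[of "\<lambda>_. False" F "{x. P x}"] by simp
    then show ?thesis
      by simp
  next
    case False
    then have "inf F (principal {x. P x}) = F"
      by (intro max) auto
    moreover have "eventually P (inf F (principal {x. P x}))"
      by (simp add: eventually_inf_principal)
    ultimately show ?thesis
      by simp
  qed
  then show ?thesis
    using F by (auto simp: ultra_def)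
qed

text \<open>Compactness gives a cluster point, and an ultrafilter converges to each of its cluster
  points.\<close>

lemma ultra_tendsto:
  fixes f :: "'a \<Rightarrow> 'b::heine_borel"
  assumes F: "ultra F" and b: "bounded (range f)"
  shows "\<exists>l. (f \<longlongrightarrow> l) F"
proof -
  have "compact (closure (range f))"
    by (simp add: compact_eq_bounded_closed bounded_closure b)
  moreover have "filtermap f F \<noteq> bot"
    using F by (simp add: ultra_def filtermap_bot_iff)
  moreover have "eventually (\<lambda>x. x \<in> closure (range f)) (filtermap f F)"
    using closure_subset[of "range f"] by (auto simp: eventually_filtermap intro!: always_eventually)
  ultimately obtain l where l: "inf (nhds l) (filtermap f F) \<noteq> bot"
    unfolding compact_filter by blast
  have "(f \<longlongrightarrow> l) F"
  proof (rule topological_tendstoI)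
    fix S
    assume S: "open S" "l \<in> S"
    have "\<not> eventually (\<lambda>x. \<not> f x \<in> S) F"
    proof
      assume "eventually (\<lambda>x. \<not> f x \<in> S) F"
      then have "eventually (\<lambda>x. x \<notin> S) (filtermap f F)" "eventually (\<lambda>x. x \<in> S) (nhds l)"
        using S by (auto simp: eventually_filtermap eventually_nhds)
      then have "eventually (\<lambda>x. False) (inf (nhds l) (filtermap f F))"
        unfolding eventually_inf by (intro exI[of _ "\<lambda>x. x \<in> S"] exI[of _ "\<lambda>x. x \<notin> S"]) auto
      then show False
        using l by (simp add: trivial_limit_def)
    qed
    then show "eventually (\<lambda>x. f x \<in> S) F"
      using F unfolding ultra_def by blast
  qed
  then show ?thesis
    by blast
qed

definition nbhd_ultrafilter :: "'g::haar_group set filter \<Rightarrow> bool" where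
  "nbhd_ultrafilter F \<longleftrightarrow> ultra F \<and> eventually inv_nbhd F \<and> (\<forall>U. open U \<longrightarrow> 0 \<in> U \<longrightarrow> eventually (\<lambda>V. V \<subseteq> U) F)"

lemma nbhd_ultrafilter_exists:
  assumes SIN: "SIN_group TYPE('g::haar_group)"
  shows "\<exists>F :: 'g set filter. nbhd_ultrafilter F"
proof -
  define B where "B = {U :: 'g set. open U \<and> 0 \<in> U}"
  define F0 where "F0 = (INF U\<in>B. principal {V. V \<subseteq> U \<and> inv_nbhd V})"
  have ev: "eventually P F0 \<longleftrightarrow> (\<exists>U\<in>B. \<forall>V. V \<subseteq> U \<and> inv_nbhd V \<longrightarrow> P V)" for P
  proof -
    have "eventually P F0 \<longleftrightarrow> (\<exists>U\<in>B. eventually P (principal {V. V \<subseteq> U \<and> inv_nbhd V}))"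
      unfolding F0_def
    proof (rule eventually_INF_base)
      show "B \<noteq> {}"
        by (auto simp: B_def)
      fix U U'
      assume "U \<in> B" "U' \<in> B"
      then show "\<exists>x\<in>B. principal {V. V \<subseteq> x \<and> inv_nbhd V}
          \<le> inf (principal {V. V \<subseteq> U \<and> inv_nbhd V}) (principal {V. V \<subseteq> U' \<and> inv_nbhd V})"
        by (intro bexI[of _ "U \<inter> U'"]) (auto simp: B_def)
    qed
    then show ?thesis
      by (simp add: eventually_principal)
  qed
  have "F0 \<noteq> bot"
    using ev[of "\<lambda>_. False"] SIN_inv_nbhd[OF SIN] by (auto simp: trivial_limit_def B_def)
  from ultrafilter_exists[OF this] obtain F where F: "F \<le> F0" "ultra F"
    by blast
  have "eventually inv_nbhd F0"
    unfolding ev by (intro bexI[of _ UNIV]) (auto simp: B_def)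
  moreover have "eventually (\<lambda>V. V \<subseteq> U) F0" if "open U" "0 \<in> U" for U
    unfolding ev using that by (intro bexI[of _ U]) (auto simp: B_def)
  ultimately have "nbhd_ultrafilter F"
    unfolding nbhd_ultrafilter_def using F by (blast intro: filter_leD)
  then show ?thesis
    by blast
qed

section \<open>Atoms of limits of measures\<close>

lemma finite_separating_nbhd:
  assumes "finite (T :: 'g::haar_group set)"
  shows "\<exists>U. open U \<and> 0 \<in> U \<and> disjoint_family_on (\<lambda>t. (+) t ` U) T"
proof -
  have ex: "\<exists>U. open U \<and> 0 \<in> U \<and> (s \<noteq> t \<longrightarrow> (+) s ` U \<inter> (+) t ` U = {})" for s t :: 'g
  proof (cases "s = t")
    case True
    then show ?thesis
      by (intro exI[of _ UNIV]) auto
  next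
    case False
    from hausdorff[OF this] obtain A B where AB: "open A" "open B" "s \<in> A" "t \<in> B" "A \<inter> B = {}"
      by blast
    show ?thesis
    proof (intro exI conjI impI)
      show "open ((\<lambda>x. s + x) -` A \<inter> (\<lambda>x. t + x) -` B)"
        by (intro open_Int open_vimage AB continuous_intros)
      show "0 \<in> (\<lambda>x. s + x) -` A \<inter> (\<lambda>x. t + x) -` B"
        using AB by simp
      show "(+) s ` ((\<lambda>x. s + x) -` A \<inter> (\<lambda>x. t + x) -` B) \<inter> (+) t ` ((\<lambda>x. s + x) -` A \<inter> (\<lambda>x. t + x) -` B) = {}"
      proof (rule equals0I)
        fix w
        assume "w \<in> (+) s ` ((\<lambda>x. s + x) -` A \<inter> (\<lambda>x. t + x) -` B) \<inter> (+)
            t ` ((\<lambda>x. s + x) -` A \<inter> (\<lambda>x. t + x) -` B)"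
        then have "w \<in> A \<inter> B"
          by auto
        then show False
          using AB(5) by simp
      qed
    qed
  qed
  have "\<exists>U. \<forall>s t :: 'g. open (U s t) \<and> 0 \<in> U s t \<and> (s \<noteq> t \<longrightarrow> (+) s ` U s t \<inter> (+) t ` U s t = {})"
    by (intro choice allI ex)
  then obtain U where "\<forall>s t :: 'g. open (U s t) \<and> 0 \<in> U s t \<and> (s \<noteq> t \<longrightarrow> (+) s ` U s t \<inter> (+) t ` U s t = {})"
    by (rule exE)
  then have U: "\<And>s t. open (U s t)" "\<And>s t. 0 \<in> U s t" "\<And>s t. s \<noteq> t \<Longrightarrow> (+) s ` U s t \<inter> (+) t ` U s t = {}"
    by simp_all
  let ?U = "\<Inter>s\<in>T. \<Inter>t\<in>T. U s t"
  have "(+) s ` ?U \<inter> (+) t ` ?U = {}" if "s \<in> T" "t \<in> T" "s \<noteq> t" for s t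
  proof -
    have "?U \<subseteq> U s t"
      using that by auto
    then have "(+) s ` ?U \<inter> (+) t ` ?U \<subseteq> (+) s ` U s t \<inter> (+) t ` U s t"
      by (intro Int_mono image_mono)
    then show ?thesis
      using U(3)[OF that(3)] by simp
  qed
  moreover have "open ?U" "0 \<in> ?U"
    using assms U by (auto intro!: open_INT)
  ultimately show ?thesis
    unfolding disjoint_family_on_def by (intro exI[of _ ?U]) auto
qed

lemma half_nbhd:
  assumes U: "open (U :: 'g::topological_group_add set)" "0 \<in> U"
  shows "\<exists>W. open W \<and> 0 \<in> W \<and> (\<forall>a\<in>W. \<forall>b\<in>W. a + b \<in> U)"
proof -
  have op: "open ((\<lambda>(a, b). a + b) -` U :: ('g \<times> 'g) set)"
    by (intro open_vimage U) (auto simp: case_prod_beta intro!: continuous_intros)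
  have "(0, 0) \<in> (\<lambda>(a, b). a + b) -` U"
    using U by simp
  with op obtain A B where "open A" "open B" "(0, 0) \<in> A \<times> B" "A \<times> B \<subseteq> (\<lambda>(a, b). a + b) -` U"
    by (rule open_prod_elim)
  then show ?thesis
    by (intro exI[of _ "A \<inter> B"]) auto
qed

section \<open>Limits of mass and charge along an ultrafilter\<close>

context
  fixes F :: "'i filter" and h :: "'i \<Rightarrow> 'g::haar_group \<Rightarrow> complex" and M :: real
  assumes F: "ultra F" and h: "\<And>i. integrable haar (h i)" and M: "\<And>i. (\<integral>x. cmod (h i x) \<partial>haar) \<le> M"
begin

definition mass :: "'i \<Rightarrow> 'g set \<Rightarrow> real" where
  "mass i A = (\<integral>x. indicator A x * cmod (h i x) \<partial>haar)"

text \<open>No limit measure is constructed: the limit over Borel sets is finitely additive, which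
  is all that the estimates on atoms use.\<close>

definition lmass :: "'g set \<Rightarrow> real" where
  "lmass A = Lim F (\<lambda>i. mass i A)"

definition charge :: "'i \<Rightarrow> 'g set \<Rightarrow> complex" where
  "charge i A = (\<integral>x. indicator A x * h i x \<partial>haar)"

definition lcharge :: "'g set \<Rightarrow> complex" where
  "lcharge A = Lim F (\<lambda>i. charge i A)"

lemma M_nonneg: "0 \<le> M"
  using order.trans[OF Bochner_Integration.integral_nonneg M] by force

lemma integrable_mass: "A \<in> sets borel \<Longrightarrow> integrable haar (\<lambda>x. indicator A x * cmod (h i x))"
  using integrable_real_mult_indicator[of A haar "\<lambda>x. cmod (h i x)"] h[of i] by (simp add: mult.commute)

lemma integrable_charge: "A \<in> sets borel \<Longrightarrow> integrable haar (\<lambda>x. indicator A x * h i x)"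
  using integrable_mult_indicator[of A haar "h i"] h[of i]
  by (simp add: indicator_scaleR_eq_if indicator_times_eq_if)

lemma mass_mono:
  assumes "A \<in> sets borel" "B \<in> sets borel" "A \<subseteq> B"
  shows "mass i A \<le> mass i B"
  unfolding mass_def using assms
  by (intro integral_mono integrable_mass) (auto simp: indicator_def)

lemma mass_nonneg: "0 \<le> mass i A"
  unfolding mass_def by (intro Bochner_Integration.integral_nonneg) auto

lemma mass_le: 
  assumes "A \<in> sets borel"
  shows "mass i A \<le> M"
proof -
  have "mass i A \<le> mass i UNIV"
    using assms by (intro mass_mono) auto
  also have "\<dots> \<le> M"
    using M[of i] by (simp add: mass_def)
  finally show ?thesis .
qed

lemma cmod_charge_le: 
  assumes "A \<in> sets borel"
  shows "cmod (charge i A) \<le> mass i A"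
proof -
  have "cmod (charge i A) \<le> (\<integral>x. cmod (indicator A x * h i x) \<partial>haar)"
    unfolding charge_def by (rule integral_norm_bound)
  also have "(\<lambda>x. cmod (indicator A x * h i x)) = (\<lambda>x. indicator A x * cmod (h i x))"
    by (auto simp: indicator_def)
  finally show ?thesis
    by (simp add: mass_def)
qed

lemma mass_tendsto:
  assumes A: "A \<in> sets borel"
  shows "((\<lambda>i. mass i A) \<longlongrightarrow> lmass A) F"
proof -
  have "bounded (range (\<lambda>i. mass i A))"
    using mass_nonneg mass_le[OF A] by (auto simp: bounded_iff intro!: exI[of _ M])
  from ultra_tendsto[OF F this] obtain l where l: "((\<lambda>i. mass i A) \<longlongrightarrow> l) F"
    by blast
  then show ?thesis
    using F unfolding lmass_def ultra_def by (simp add: tendsto_Lim)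
qed

lemma charge_tendsto:
  assumes A: "A \<in> sets borel"
  shows "((\<lambda>i. charge i A) \<longlongrightarrow> lcharge A) F"
proof -
  have "bounded (range (\<lambda>i. charge i A))"
    using order.trans[OF cmod_charge_le[OF A] mass_le[OF A]] by (auto simp: bounded_iff intro!: exI[of _ M])
  from ultra_tendsto[OF F this] obtain l where l: "((\<lambda>i. charge i A) \<longlongrightarrow> l) F"
    by blast
  then show ?thesis
    using F unfolding lcharge_def ultra_def by (simp add: tendsto_Lim)
qed

lemma F_ne: "F \<noteq> bot"
  using F by (simp add: ultra_def)

lemma lmass_mono:
  assumes "A \<in> sets borel" "B \<in> sets borel" "A \<subseteq> B"
  shows "lmass A \<le> lmass B"
  by (rule tendsto_le[OF F_ne mass_tendsto mass_tendsto]) (use assms mass_mono in auto)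

lemma lmass_nonneg: "A \<in> sets borel \<Longrightarrow> 0 \<le> lmass A"
  by (rule tendsto_lowerbound[OF mass_tendsto _ F_ne]) (auto simp: mass_nonneg)

lemma mass_Diff:
  assumes "A \<in> sets borel" "B \<in> sets borel" "B \<subseteq> A"
  shows "mass i (A - B) = mass i A - mass i B"
proof -
  have "indicator (A - B) x * cmod (h i x) = indicator A x * cmod (h i x) - indicator B x * cmod (h i x)" for x
    using assms(3) by (auto simp: indicator_def)
  then show ?thesis
    unfolding mass_def using assms by (simp add: Bochner_Integration.integral_diff integrable_mass)
qed

lemma charge_Diff:
  assumes "A \<in> sets borel" "B \<in> sets borel" "B \<subseteq> A"
  shows "charge i (A - B) = charge i A - charge i B"
proof -
  have "indicator (A - B) x * h i x = indicator A x * h i x - indicator B x * h i x" for x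
    using assms(3) by (auto simp: indicator_def)
  then show ?thesis
    unfolding charge_def using assms by (simp add: Bochner_Integration.integral_diff integrable_charge)
qed

lemma lmass_Diff:
  assumes "A \<in> sets borel" "B \<in> sets borel" "B \<subseteq> A"
  shows "lmass (A - B) = lmass A - lmass B"
proof (rule tendsto_unique[OF F_ne mass_tendsto])
  show "((\<lambda>i. mass i (A - B)) \<longlongrightarrow> lmass A - lmass B) F"
    using tendsto_diff[OF mass_tendsto[OF assms(1)] mass_tendsto[OF assms(2)]] by (simp add: mass_Diff assms)
qed (use assms in auto)

lemma cmod_lcharge_diff_le:
  assumes "A \<in> sets borel" "B \<in> sets borel" "B \<subseteq> A"
  shows "cmod (lcharge A - lcharge B) \<le> lmass A - lmass B"
proof (rule tendsto_le[OF F_ne])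
  show "((\<lambda>i. cmod (charge i A - charge i B)) \<longlongrightarrow> cmod (lcharge A - lcharge B)) F"
    by (intro tendsto_intros charge_tendsto assms)
  show "((\<lambda>i. mass i A - mass i B) \<longlongrightarrow> lmass A - lmass B) F"
    by (intro tendsto_intros mass_tendsto assms)
  have "cmod (charge i A - charge i B) \<le> mass i A - mass i B" for i
    using cmod_charge_le[of "A - B" i] assms by (simp add: mass_Diff charge_Diff)
  then show "eventually (\<lambda>i. cmod (charge i A - charge i B) \<le> mass i A - mass i B) F"
    by simp
qed

lemma sum_mass_disjoint_le:
  assumes "finite T" "\<And>t. t \<in> T \<Longrightarrow> A t \<in> sets borel" "disjoint_family_on A T"
  shows "(\<Sum>t\<in>T. mass i (A t)) \<le> M"
proof -
  have "(\<Sum>t\<in>T. mass i (A t)) = (\<integral>x. (\<Sum>t\<in>T. indicator (A t) x * cmod (h i x)) \<partial>haar)"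
    unfolding mass_def using assms by (subst Bochner_Integration.integral_sum) (auto intro: integrable_mass)
  also have "(\<lambda>x. \<Sum>t\<in>T. indicator (A t) x * cmod (h i x)) = (\<lambda>x. indicator (\<Union>t\<in>T. A t) x * cmod (h i x))"
    using assms by (simp add: indicator_UN_disjoint sum_distrib_right)
  also have "(\<integral>x. indicator (\<Union>t\<in>T. A t) x * cmod (h i x) \<partial>haar) \<le> M"
  proof -
    have "(\<Union>t\<in>T. A t) \<in> sets borel"
      using assms by (intro sets.finite_UN) auto
    from mass_le[OF this, of i] show ?thesis
      unfolding mass_def .
  qed
  finally show ?thesis .
qed

lemma sum_lmass_disjoint_le:
  assumes "finite T" "\<And>t. t \<in> T \<Longrightarrow> A t \<in> sets borel" "disjoint_family_on A T"
  shows "(\<Sum>t\<in>T. lmass (A t)) \<le> M"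
proof (rule tendsto_upperbound[OF _ _ F_ne])
  show "((\<lambda>i. \<Sum>t\<in>T. mass i (A t)) \<longlongrightarrow> (\<Sum>t\<in>T. lmass (A t))) F"
    by (intro tendsto_sum mass_tendsto assms)
qed (use sum_mass_disjoint_le[OF assms] in auto)

lemma borel_open_translate: "open U \<Longrightarrow> (+) t ` U \<in> sets (borel :: 'g measure)"
  by (intro borel_open open_image_plus)

text \<open>The points near which limit mass at least \<open>d\<close> persists at every scale, even
  though each \<open>h i\<close> is a density.\<close>

definition atoms :: "real \<Rightarrow> 'g set" where
  "atoms d = {t. \<forall>U. open U \<longrightarrow> 0 \<in> U \<longrightarrow> d \<le> lmass ((+) t ` U)}"

text \<open>Disjoint neighbourhoods of distinct atoms carry mass \<open>d\<close> each out of a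
  total of at most \<open>M\<close>.\<close>

lemma finite_atoms:
  assumes d: "d > 0"
  shows "finite (atoms d)"
proof -
  obtain C where C: "M / d < real C"
    using reals_Archimedean2 by blast
  have "finite (atoms d) \<and> card (atoms d) \<le> C"
  proof (rule finite_if_finite_subsets_card_bdd)
    fix T
    assume T: "T \<subseteq> atoms d" "finite T"
    obtain U where U: "open U" "0 \<in> U" "disjoint_family_on (\<lambda>t. (+) t ` U) T"
      using finite_separating_nbhd[OF T(2)] by blast
    have "real (card T) * d = (\<Sum>t\<in>T. d)"
      by simp
    also have "\<dots> \<le> (\<Sum>t\<in>T. lmass ((+) t ` U))"
      using T U by (intro sum_mono) (auto simp: atoms_def)
    also have "\<dots> \<le> M"
      by (intro sum_lmass_disjoint_le T U borel_open_translate)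
    finally have "real (card T) \<le> M / d"
      using d by (simp add: field_simps)
    then show "card T \<le> C"
      using C by linarith
  qed
  then show ?thesis
    by blast
qed

text \<open>The limit mass of neighbourhoods of \<open>t\<close> is bounded below; \<open>U0\<close>
  comes within \<open>d\<close> of the infimum, so shrinking it further loses at most
  \<open>d\<close>.\<close>

lemma atom_shrink:
  assumes d: "d > 0"
  shows "\<exists>U0. open U0 \<and> 0 \<in> U0 \<and> (\<forall>U. open U \<longrightarrow> 0 \<in> U \<longrightarrow> lmass ((+) t ` U0) - lmass ((+) t ` (U0 \<inter> U)) \<le> d)"
proof -
  define S where "S = (\<lambda>U. lmass ((+) t ` U)) ` {U. open U \<and> 0 \<in> U}"
  have bdd: "bdd_below S"
    unfolding S_def by (rule bdd_belowI[of _ 0]) (auto intro!: lmass_nonneg borel_open_translate)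
  have "lmass ((+) t ` UNIV) \<in> S"
    unfolding S_def by (intro imageI) auto
  then have "S \<noteq> {}"
    by blast
  then obtain s where "s \<in> S" "s < Inf S + d"
    using cInf_lessD[of S "Inf S + d"] d by auto
  then obtain U0 where U0: "open U0" "0 \<in> U0" "lmass ((+) t ` U0) < Inf S + d"
    unfolding S_def by auto
  have "lmass ((+) t ` U0) - lmass ((+) t ` (U0 \<inter> U)) \<le> d" if "open U" "0 \<in> U" for U
  proof -
    have "Inf S \<le> lmass ((+) t ` (U0 \<inter> U))"
      using U0 that by (intro cInf_lower bdd) (auto simp: S_def)
    then show ?thesis
      using U0(3) by linarith
  qed
  then show ?thesis
    using U0 by blast
qed

text \<open>The point is that \<open>U0\<close> is chosen before \<open>U\<close> and serves all of
  \<open>C\<close>. Around an atom, \<open>atom_shrink\<close> bounds what remains after removing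
  any smaller neighbourhood; around any other point some neighbourhood has limit mass below
  \<open>d\<close>. Halving these neighbourhoods and compactness make the choice uniform.\<close>

lemma uniform_off_atoms:
  assumes d: "d > 0" and C: "compact C"
  shows "\<exists>U0. open U0 \<and> 0 \<in> U0 \<and> (\<forall>r\<in>C. \<forall>U. open U \<longrightarrow> 0 \<in> U \<longrightarrow>
      lmass ((+) r ` U0 - (\<Union>t\<in>atoms d. (+) t ` U)) \<le> d)"
proof -
  have "\<exists>W. open W \<and> 0 \<in> W \<and> (\<forall>U. open U \<longrightarrow> 0 \<in> U \<longrightarrow> lmass ((+) s ` W - (\<Union>t\<in>atoms d. (+) t ` U)) \<le> d)" for s
  proof (cases "s \<in> atoms d")
    case True
    obtain U0 where U0: "open U0" "0 \<in> U0" "\<And>U. open U \<Longrightarrow> 0 \<in> U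
        \<Longrightarrow> lmass ((+) s ` U0) - lmass ((+) s ` (U0 \<inter> U)) \<le> d"
      using atom_shrink[OF d, of s] by blast
    have "lmass ((+) s ` U0 - (\<Union>t\<in>atoms d. (+) t ` U)) \<le> d" if U: "open U" "0 \<in> U" for U
    proof -
      have "lmass ((+) s ` U0 - (\<Union>t\<in>atoms d. (+) t ` U)) \<le> lmass ((+) s ` U0 - (+) s ` (U0 \<inter> U))"
        using True U U0 by (intro lmass_mono)
            (auto intro!: sets.Diff sets.finite_UN borel_open_translate finite_atoms d)
      also have "\<dots> = lmass ((+) s ` U0) - lmass ((+) s ` (U0 \<inter> U))"
        using U U0 by (intro lmass_Diff) (auto intro!: borel_open_translate)
      also have "\<dots> \<le> d"
        by (rule U0(3)[OF U])
      finally show ?thesis .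
    qed
    then show ?thesis
      using U0 by blast
  next
    case False
    then obtain W where W: "open W" "0 \<in> W" "lmass ((+) s ` W) < d"
      by (auto simp: atoms_def not_le)
    have "lmass ((+) s ` W - (\<Union>t\<in>atoms d. (+) t ` U)) \<le> d" if U: "open U" "0 \<in> U" for U
    proof -
      have "lmass ((+) s ` W - (\<Union>t\<in>atoms d. (+) t ` U)) \<le> lmass ((+) s ` W)"
        using U W by (intro lmass_mono) (auto intro!: sets.Diff sets.finite_UN borel_open_translate
            finite_atoms d)
      then show ?thesis
        using W by simp
    qed
    then show ?thesis
      using W by blast
  qed
  then obtain W where W: "\<And>s. open (W s)" "\<And>s. 0 \<in> W s"
    "\<And>s U. open U \<Longrightarrow> 0 \<in> U \<Longrightarrow> lmass ((+) s ` W s - (\<Union>t\<in>atoms d. (+) t ` U)) \<le> d"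
    by metis
  have "\<exists>W'. \<forall>s. open (W' s) \<and> 0 \<in> W' s \<and> (\<forall>a\<in>W' s. \<forall>b\<in>W' s. a + b \<in> W s)"
    by (intro choice allI half_nbhd W)
  then obtain W' where W': "\<And>s. open (W' s)" "\<And>s. 0 \<in> W' s" "\<And>s a b. a \<in> W' s \<Longrightarrow> b \<in> W' s \<Longrightarrow> a + b \<in> W s"
    by blast
  have "s \<in> (+) s ` W' s" for s
    using W'(2) by (intro image_eqI[of _ _ 0]) auto
  then have "C \<subseteq> (\<Union>s\<in>C. (+) s ` W' s)"
    by blast
  with open_image_plus[OF W'(1)] obtain S where S: "S \<subseteq> C" "finite S" "C \<subseteq> (\<Union>s\<in>S. (+) s ` W' s)"
    by (rule compactE_image[OF C, of C "\<lambda>s. (+) s ` W' s"])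
  have "lmass ((+) r ` (\<Inter>s\<in>S. W' s) - (\<Union>t\<in>atoms d. (+) t ` U)) \<le> d" if r: "r \<in> C" and U: "open U" "0 \<in> U"
      for r U
  proof -
    obtain s a where s: "s \<in> S" "a \<in> W' s" "r = s + a"
      using S(3) r by blast
    have "(+) r ` (\<Inter>s\<in>S. W' s) \<subseteq> (+) s ` W s"
      using s W'(3) by (auto simp: add.assoc)
    then have "lmass ((+) r ` (\<Inter>s\<in>S. W' s) - (\<Union>t\<in>atoms d. (+) t ` U))
        \<le> lmass ((+) s ` W s - (\<Union>t\<in>atoms d. (+) t ` U))"
      using U W W' S(2) by (intro lmass_mono)
        (auto intro!: sets.Diff sets.finite_UN borel_open_translate finite_atoms d open_INT)
    then show ?thesis
      using W(3)[OF U, of s] by linarith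
  qed
  moreover have "open (\<Inter>s\<in>S. W' s)" "0 \<in> (\<Inter>s\<in>S. W' s)"
    using S(2) W' by (auto intro!: open_INT)
  ultimately show ?thesis
    by blast
qed

text \<open>Among sets of points where \<open>G\<close> is at least \<open>\<kappa>\<close> and
  whose translates of \<open>V\<close> are disjoint, square summability bounds the cardinality, so a
  largest one exists. By maximality its translates meet those of every other such point.\<close>

lemma maximal_packing:
  fixes V :: "'g set"
  assumes \<kappa>: "\<kappa> > 0" and V: "V \<noteq> {}"
    and bessel: "\<And>R. finite R \<Longrightarrow> disjoint_family_on (\<lambda>r. (+) r ` V) R \<Longrightarrow> (\<Sum>r\<in>R. (cmod (G r))\<^sup>2) \<le> B\<^sup>2"
  obtains R where "finite R" "\<And>r. r \<in> R \<Longrightarrow> \<kappa> \<le> cmod (G r)" "real (card R) \<le> B\<^sup>2 / \<kappa>\<^sup>2"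
    "\<And>x. \<kappa> \<le> cmod (G x) \<Longrightarrow> \<exists>r\<in>R. (+) x ` V \<inter> (+) r ` V \<noteq> {}"
proof -
  define P where "P R \<longleftrightarrow> finite R \<and> (\<forall>r\<in>R. \<kappa> \<le> cmod (G r)) \<and> disjoint_family_on (\<lambda>r. (+) r ` V) R" for R
  have card: "real (card R) \<le> B\<^sup>2 / \<kappa>\<^sup>2" if "P R" for R
  proof -
    have "real (card R) * \<kappa>\<^sup>2 = (\<Sum>r\<in>R. \<kappa>\<^sup>2)"
      by simp
    also have "\<dots> \<le> (\<Sum>r\<in>R. (cmod (G r))\<^sup>2)"
      using that \<kappa> by (intro sum_mono power_mono) (auto simp: P_def)
    also have "\<dots> \<le> B\<^sup>2"
      using that by (intro bessel) (auto simp: P_def)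
    finally show ?thesis
      using \<kappa> by (simp add: pos_le_divide_eq)
  qed
  have P0: "P {}"
    by (simp add: P_def disjoint_family_on_def)
  have bound: "card R < Suc (nat \<lfloor>B\<^sup>2 / \<kappa>\<^sup>2\<rfloor>)" if "P R" for R
    using card[OF that] by (simp add: le_nat_floor less_Suc_eq_le)
  have "\<exists>R. P R \<and> (\<forall>R'. P R' \<longrightarrow> card R' \<le> card R)"
    using ex_has_greatest_nat[of P, OF P0, of card] bound by auto
  then obtain R where R: "P R" "\<And>R'. P R' \<Longrightarrow> card R' \<le> card R"
    by auto
  have "\<exists>r\<in>R. (+) x ` V \<inter> (+) r ` V \<noteq> {}" if x: "\<kappa> \<le> cmod (G x)" for x
  proof (rule ccontr)
    assume no: "\<not> (\<exists>r\<in>R. (+) x ` V \<inter> (+) r ` V \<noteq> {})"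
    then have "x \<notin> R"
      using V by auto
    moreover have "P (insert x R)"
      using R(1) x no \<open>x \<notin> R\<close> unfolding P_def disjoint_family_on_insert[OF \<open>x \<notin> R\<close>] by auto
    ultimately show False
      using R(2)[of "insert x R"] R(1) by (simp add: P_def)
  qed
  then show ?thesis
    using R(1) card[OF R(1)] by (intro that[of R]) (auto simp: P_def)
qed

lemma integrable_mult_bounded:
  fixes G :: "'g \<Rightarrow> complex"
  assumes G: "continuous_on UNIV G" "\<And>x. cmod (G x) \<le> B"
  shows "integrable haar (\<lambda>x. h i x * G x)"
proof (rule Bochner_Integration.integrable_bound)
  show "integrable haar (\<lambda>x. B * cmod (h i x))"
    using h[of i] by simp
  have "G \<in> borel_measurable borel"
    by (rule borel_measurable_continuous_onI[OF G(1)])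
  then have "G \<in> borel_measurable haar"
    by (simp cong: measurable_cong_sets)
  then show "(\<lambda>x. h i x * G x) \<in> borel_measurable haar"
    using borel_measurable_integrable[OF h[of i]] by simp
  have "cmod (h i x) * cmod (G x) \<le> B * cmod (h i x)" for x
    using G(2)[of x] by (simp add: mult.commute mult_right_mono)
  then show "AE x in haar. norm (h i x * G x) \<le> norm (B * cmod (h i x))"
    by (intro AE_I2) (auto simp: norm_mult intro: order.trans[OF _ abs_ge_self])
qed

text \<open>
  A continuous function whose values at points with disjoint translates of \<open>V\<close> are square summable
  is small outside few translates of \<open>V - V\<close>, so asymptotically \<open>h\<close> sees it only through its atoms.
\<close>

lemma integral_near_atoms:
  assumes e: "e > 0" and B: "0 \<le> B"
  shows "\<exists>T w. finite T \<and> (\<forall>C. compact C \<longrightarrow> (\<exists>U0. open U0 \<and> 0 \<in> U0 \<and> (\<forall>V G. V \<noteq> {} \<longrightarrow> (\<forall>v\<in>V. \<forall>v'\<in>V. v - v' \<in> U0) \<longrightarrow>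
      continuous_on UNIV G \<longrightarrow> (\<forall>x. cmod (G x) \<le> B) \<longrightarrow> (\<forall>x. x \<notin> C \<longrightarrow> G x = 0) \<longrightarrow>
      (\<forall>R. finite R \<longrightarrow> disjoint_family_on (\<lambda>r. (+) r ` V) R \<longrightarrow> (\<Sum>r\<in>R. (cmod (G r))\<^sup>2) \<le> B\<^sup>2) \<longrightarrow>
      eventually (\<lambda>i. cmod ((\<integral>x. h i x * G x \<partial>haar) - (\<Sum>t\<in>T. G t * w t)) \<le> e) F)))"
proof -
  \<comment> \<open>The error is spent in fifths: two on \<open>2 * \<kappa> * M\<close>, one on the
    mass left away from the atoms, two on replacing charges by weights. The added \<open>1\<close>s
    keep the denominators positive.\<close>
  define \<kappa> where "\<kappa> = e / (5 * (M + 1))"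
  define N0 where "N0 = B\<^sup>2 / \<kappa>\<^sup>2"
  define d where "d = e / (10 * (B + 1) * (N0 + 1))"
  define T where "T = atoms d"
  define d' where "d' = e / (5 * (B + 1) * (real (card T) + 1))"
  have M0: "0 \<le> M"
    by (rule M_nonneg)
  have N0: "0 \<le> N0"
    by (simp add: N0_def)
  have \<kappa>: "\<kappa> > 0"
    unfolding \<kappa>_def using e M0 by (intro divide_pos_pos mult_pos_pos) auto
  have d: "d > 0"
    unfolding d_def using e B N0 by (intro divide_pos_pos mult_pos_pos) auto
  have d': "d' > 0"
    unfolding d'_def using e B by (intro divide_pos_pos mult_pos_pos) auto
  have fT: "finite T"
    unfolding T_def by (rule finite_atoms[OF d])
  have small1: "\<kappa> * M \<le> e / 5"
  proof -
    have "\<kappa> * M \<le> \<kappa> * (M + 1)"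
      using \<kappa> by (intro mult_left_mono) auto
    also have "\<dots> = e / 5"
      using M0 by (simp add: \<kappa>_def field_simps)
    finally show ?thesis .
  qed
  have small2: "B * (N0 * (2 * d)) \<le> e / 5"
  proof -
    have "B * (N0 * (2 * d)) \<le> (B + 1) * ((N0 + 1) * (2 * d))"
      using B N0 d by (intro mult_mono) auto
    also have "\<dots> = e / 5"
    proof -
      have "(B + 1) * (N0 + 1) \<noteq> 0"
        using B N0 by auto
      then show ?thesis
        by (simp add: d_def field_simps)
    qed
    finally show ?thesis .
  qed
  have small3: "real (card T) * (B * d') \<le> e / 5"
  proof -
    have "real (card T) * (B * d') \<le> (real (card T) + 1) * ((B + 1) * d')"
      using B d' by (intro mult_mono) auto
    also have "\<dots> = e / 5"
    proof -
      have "(B + 1) * (real (card T) + 1) \<noteq> 0"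
        using B by auto
      then show ?thesis
        by (simp add: d'_def field_simps)
    qed
    finally show ?thesis .
  qed
  have "\<exists>Us. \<forall>t. open (Us t) \<and> 0 \<in> Us t \<and> (\<forall>U. open U \<longrightarrow> 0 \<in> U \<longrightarrow> lmass ((+) t ` Us t)
      - lmass ((+) t ` (Us t \<inter> U)) \<le> d')"
    by (intro choice allI atom_shrink[OF d'])
  then obtain Us where Us: "\<And>t. open (Us t)" "\<And>t. 0 \<in> Us t"
    "\<And>t U. open U \<Longrightarrow> 0 \<in> U \<Longrightarrow> lmass ((+) t ` Us t) - lmass ((+) t ` (Us t \<inter> U)) \<le> d'"
    by blast
  \<comment> \<open>A stand-in for the charge of the atom \<open>t\<close>: by the choice of
    \<open>Us t\<close>, every smaller neighbourhood has limit charge within \<open>d'\<close> of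
    it. Neither \<open>T\<close> nor \<open>w\<close> depends on \<open>C\<close>, \<open>V\<close>
    or \<open>G\<close>.\<close>
  define w where "w t = lcharge ((+) t ` Us t)" for t
  show ?thesis
  proof (rule exI[of _ T], rule exI[of _ w], intro conjI fT allI impI)
    fix C :: "'g set"
    assume C: "compact C"
    obtain U0 where U0: "open U0" "0 \<in> U0"
      "\<And>r U. r \<in> C \<Longrightarrow> open U \<Longrightarrow> 0 \<in> U \<Longrightarrow> lmass ((+) r ` U0 - (\<Union>t\<in>atoms d. (+) t ` U)) \<le> d"
      using uniform_off_atoms[OF d C] by blast
    show "\<exists>U0. open U0 \<and> 0 \<in> U0 \<and> (\<forall>V G. V \<noteq> {} \<longrightarrow> (\<forall>v\<in>V. \<forall>v'\<in>V. v - v' \<in> U0) \<longrightarrow>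
      continuous_on UNIV G \<longrightarrow> (\<forall>x. cmod (G x) \<le> B) \<longrightarrow> (\<forall>x. x \<notin> C \<longrightarrow> G x = 0) \<longrightarrow>
      (\<forall>R. finite R \<longrightarrow> disjoint_family_on (\<lambda>r. (+) r ` V) R \<longrightarrow> (\<Sum>r\<in>R. (cmod (G r))\<^sup>2) \<le> B\<^sup>2) \<longrightarrow>
      eventually (\<lambda>i. cmod ((\<integral>x. h i x * G x \<partial>haar) - (\<Sum>t\<in>T. G t * w t)) \<le> e) F)"
    proof (intro exI[of _ U0] conjI U0(1,2) allI impI)
      fix V :: "'g set" and G :: "'g \<Rightarrow> complex"
      assume V: "V \<noteq> {}" "\<forall>v\<in>V. \<forall>v'\<in>V. v - v' \<in> U0" and cG: "continuous_on UNIV G" and GB: "\<forall>x. cmod (G x) \<le> B"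
        and GC: "\<forall>x. x \<notin> C \<longrightarrow> G x = 0"
        and bessel: "\<forall>R. finite R \<longrightarrow> disjoint_family_on (\<lambda>r. (+) r ` V) R \<longrightarrow> (\<Sum>r\<in>R. (cmod (G r))\<^sup>2) \<le> B\<^sup>2"
      obtain R where R: "finite R" "\<And>r. r \<in> R \<Longrightarrow> \<kappa> \<le> cmod (G r)" "real (card R) \<le> B\<^sup>2 / \<kappa>\<^sup>2"
        "\<And>x. \<kappa> \<le> cmod (G x) \<Longrightarrow> \<exists>r\<in>R. (+) x ` V \<inter> (+) r ` V \<noteq> {}"
        by (rule maximal_packing[OF \<kappa> V(1), of G B]) (use bessel in auto)
      have RC: "r \<in> C" if "r \<in> R" for r
        using R(2)[OF that] GC \<kappa> by (metis norm_zero not_le)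
      have cover: "x \<in> (\<Union>r\<in>R. (+) r ` U0)" if x: "\<kappa> \<le> cmod (G x)" for x
      proof -
        obtain r v v' where r: "r \<in> R" "v \<in> V" "v' \<in> V" "x + v = r + v'"
          using R(4)[OF x] by auto
        have "x = r + (v' - v)"
          by (simp add: add_diff_eq r(4)[symmetric])
        then show ?thesis
          using r V(2) by blast
      qed
      obtain U1 where U1: "open U1" "0 \<in> U1" "disjoint_family_on (\<lambda>t. (+) t ` U1) T"
        using finite_separating_nbhd[OF fT] by (elim exE conjE) (rule that)
      \<comment> \<open>This neighbourhood depends on \<open>G\<close>. That is harmless, because
        \<open>U0\<close> and the weights are already fixed and only the eventual range of
        \<open>i\<close> is affected.\<close>
      define U2 where "U2 t = (\<lambda>u. G (t + u)) -` ball (G t) \<kappa>" for t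
      have "continuous_on UNIV (\<lambda>u. G (t + u))" for t
        by (intro continuous_on_compose2[OF cG] continuous_intros) auto
      then have U2: "open (U2 t)" "0 \<in> U2 t" for t
        unfolding U2_def using \<kappa> by (auto intro: open_vimage)
      define U where "U = U1 \<inter> (\<Inter>t\<in>T. Us t \<inter> U2 t)"
      have U: "open U" "0 \<in> U"
        unfolding U_def using U1 U2 Us fT by (auto intro!: open_Int open_INT)
      have UT: "U \<subseteq> Us t" "U \<subseteq> U2 t" if "t \<in> T" for t
        using that unfolding U_def by auto
      have disj: "disjoint_family_on (\<lambda>t. (+) t ` U) T"
        unfolding disjoint_family_on_def
      proof (intro ballI impI)
        fix s t
        assume st: "s \<in> T" "t \<in> T" "s \<noteq> t"
        have "(+) s ` U \<inter> (+) t ` U \<subseteq> (+) s ` U1 \<inter> (+) t ` U1"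
          by (intro Int_mono image_mono) (auto simp: U_def)
        also have "\<dots> = {}"
          using U1(3) st by (simp add: disjoint_family_on_def)
        finally show "(+) s ` U \<inter> (+) t ` U = {}"
          by simp
      qed
      define X where "X = (\<Union>t\<in>T. (+) t ` U)"
      have bU: "(+) t ` U \<in> sets borel" for t
        by (rule borel_open_translate[OF U(1)])
      have bX: "X \<in> sets borel"
        unfolding X_def using fT bU by (intro sets.finite_UN) auto
      have bRX: "(+) r ` U0 - X \<in> sets borel" for r
        by (intro sets.Diff bX borel_open_translate U0)
      \<comment> \<open>Three cases: near an atom \<open>t\<close>, \<open>G x\<close> is within
        \<open>\<kappa>\<close> of \<open>G t\<close>; elsewhere either \<open>G x\<close> is below
        \<open>\<kappa>\<close>, or \<open>x\<close> lies in one of the few sets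
        \<open>r + U0\<close> with the atoms cut out.\<close>
      have point: "cmod (h i x * G x - (\<Sum>t\<in>T. G t * (indicator ((+) t ` U) x * h i x)))
          \<le> 2 * \<kappa> * cmod (h i x) + B * (\<Sum>r\<in>R. indicator ((+) r ` U0 - X) x * cmod (h i x))" for i x
      proof (cases "x \<in> X")
        case True
        then obtain t where t: "t \<in> T" "x \<in> (+) t ` U"
          unfolding X_def by blast
        have "(\<Sum>t\<in>T. G t * (indicator ((+) t ` U) x * h i x)) = (\<Sum>s\<in>T. if s = t then G s * h i x else 0)"
          using disj t by (intro sum.cong refl) (auto simp: disjoint_family_on_def indicator_def)
        also have "\<dots> = G t * h i x"
          using fT t by simp
        finally have "cmod (h i x * G x - (\<Sum>t\<in>T. G t * (indicator ((+) t ` U) x * h i x)))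
            = cmod (h i x) * cmod (G x - G t)"
          by (simp add: norm_mult[symmetric] algebra_simps)
        also have "\<dots> \<le> cmod (h i x) * \<kappa>"
        proof -
          obtain u where "u \<in> U" "x = t + u"
            using t by blast
          then have "dist (G t) (G x) < \<kappa>"
            using UT(2)[OF t(1)] unfolding U2_def by auto
          then show ?thesis
            by (intro mult_left_mono) (auto simp: dist_norm norm_minus_commute)
        qed
        also have "\<dots> \<le> 2 * \<kappa> * cmod (h i x)"
          using \<kappa> by (simp add: mult.commute)
        also have "\<dots> \<le> 2 * \<kappa> * cmod (h i x) + B * (\<Sum>r\<in>R. indicator ((+) r ` U0 - X) x * cmod (h i x))"
          using B by (simp add: sum_nonneg)
        finally show ?thesis .
      next
        case False
        then have "(\<Sum>t\<in>T. G t * (indicator ((+) t ` U) x * h i x)) = 0"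
          unfolding X_def by (intro sum.neutral) (auto simp: indicator_def)
        then have eq: "cmod (h i x * G x - (\<Sum>t\<in>T. G t * (indicator ((+) t ` U) x * h i x)))
            = cmod (h i x) * cmod (G x)"
          by (simp add: norm_mult)
        show ?thesis
        proof (cases "\<kappa> \<le> cmod (G x)")
          case True
          then obtain r where r: "r \<in> R" "x \<in> (+) r ` U0"
            using cover by blast
          have "cmod (h i x) = indicator ((+) r ` U0 - X) x * cmod (h i x)"
            using r False by simp
          also have "\<dots> \<le> (\<Sum>r\<in>R. indicator ((+) r ` U0 - X) x * cmod (h i x))"
            using r R(1) by (intro member_le_sum) auto
          finally have "cmod (h i x) * cmod (G x) \<le> (\<Sum>r\<in>R. indicator ((+) r ` U0 - X) x * cmod (h i x)) * B"
            using GB by (intro mult_mono) (auto intro!: sum_nonneg)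
          then show ?thesis
            unfolding eq using \<kappa> by (simp add: mult.commute add_increasing)
        next
          case False
          then have "cmod (h i x) * cmod (G x) \<le> cmod (h i x) * (2 * \<kappa>)"
            using \<kappa> by (intro mult_left_mono) auto
          also have "\<dots> \<le> 2 * \<kappa> * cmod (h i x) + B * (\<Sum>r\<in>R. indicator ((+) r ` U0 - X) x * cmod (h i x))"
            using B by (simp add: sum_nonneg mult.commute)
          finally show ?thesis
            unfolding eq .
        qed
      qed
      have int1: "integrable haar (\<lambda>x. h i x * G x)" for i
        using integrable_mult_bounded[OF cG] GB by blast
      have int2: "integrable haar (\<lambda>x. \<Sum>t\<in>T. G t * (indicator ((+) t ` U) x * h i x))" for i
        by (intro Bochner_Integration.integrable_sum integrable_mult_right integrable_charge bU)
      have int3: "integrable haar (\<lambda>x. \<Sum>r\<in>R. indicator ((+) r ` U0 - X) x * cmod (h i x))" for i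
        by (intro Bochner_Integration.integrable_sum integrable_mass bRX)
      have I: "cmod ((\<integral>x. h i x * G x \<partial>haar) - (\<Sum>t\<in>T. G t * charge i ((+) t ` U)))
          \<le> 2 * \<kappa> * M + B * (\<Sum>r\<in>R. mass i ((+) r ` U0 - X))" for i
      proof -
        have "(\<Sum>t\<in>T. G t * charge i ((+) t ` U)) = (\<integral>x. (\<Sum>t\<in>T. G t * (indicator ((+) t ` U) x * h i x)) \<partial>haar)"
          unfolding charge_def
          by (subst Bochner_Integration.integral_sum) (auto intro!: integrable_mult_right integrable_charge bU)
        then have "cmod ((\<integral>x. h i x * G x \<partial>haar) - (\<Sum>t\<in>T. G t * charge i ((+) t ` U)))
           = cmod (\<integral>x. h i x * G x - (\<Sum>t\<in>T. G t * (indicator ((+) t ` U) x * h i x)) \<partial>haar)"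
          by (simp add: Bochner_Integration.integral_diff[OF int1 int2])
        also have "\<dots> \<le> (\<integral>x. cmod (h i x * G x - (\<Sum>t\<in>T. G t * (indicator ((+) t ` U) x * h i x))) \<partial>haar)"
          by (rule integral_norm_bound)
        also have "\<dots> \<le> (\<integral>x. 2 * \<kappa> * cmod (h i x) + B * (\<Sum>r\<in>R. indicator ((+) r ` U0 - X) x * cmod (h i x))
            \<partial>haar)"
          using int1[of i] int2[of i] int3[of i] h[of i]
          by (intro integral_mono point) (auto intro!: integrable_norm Bochner_Integration.integrable_diff
              Bochner_Integration.integrable_add integrable_mult_right)
        also have "\<dots> = 2 * \<kappa> * (\<integral>x. cmod (h i x) \<partial>haar)
            + B * (\<integral>x. (\<Sum>r\<in>R. indicator ((+) r ` U0 - X) x * cmod (h i x)) \<partial>haar)"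
          using int3[of i] h[of i] by (subst Bochner_Integration.integral_add)
              (auto intro!: integrable_mult_right)
        also have "(\<integral>x. (\<Sum>r\<in>R. indicator ((+) r ` U0 - X) x * cmod (h i x)) \<partial>haar)
            = (\<Sum>r\<in>R. mass i ((+) r ` U0 - X))"
          unfolding mass_def by (rule Bochner_Integration.integral_sum) (intro integrable_mass bRX)
        also have "2 * \<kappa> * (\<integral>x. cmod (h i x) \<partial>haar) \<le> 2 * \<kappa> * M"
          using M[of i] \<kappa> by (intro mult_left_mono) auto
        finally show ?thesis
          by simp
      qed
      have "eventually (\<lambda>i. mass i ((+) r ` U0 - X) < 2 * d) F" if "r \<in> R" for r
      proof -
        have "lmass ((+) r ` U0 - X) < 2 * d"
          using U0(3)[OF RC[OF that] U] d unfolding X_def T_def by simp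
        then show ?thesis
          by (rule order_tendstoD(2)[OF mass_tendsto[OF bRX]])
      qed
      then have ev1: "eventually (\<lambda>i. \<forall>r\<in>R. mass i ((+) r ` U0 - X) < 2 * d) F"
        using R(1) by (simp add: eventually_ball_finite)
      have "eventually (\<lambda>i. dist (charge i ((+) t ` U)) (lcharge ((+) t ` U)) < d') F" for t
        by (rule tendstoD[OF charge_tendsto[OF bU] d'])
      then have ev2: "eventually (\<lambda>i. \<forall>t\<in>T. dist (charge i ((+) t ` U)) (lcharge ((+) t ` U)) < d') F"
        using fT by (simp add: eventually_ball_finite)
      show "eventually (\<lambda>i. cmod ((\<integral>x. h i x * G x \<partial>haar) - (\<Sum>t\<in>T. G t * w t)) \<le> e) F"
        using ev1 ev2
      proof eventually_elim
        case (elim i)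
        have "cmod (charge i ((+) t ` U) - w t) \<le> 2 * d'" if t: "t \<in> T" for t
        proof -
          have "Us t \<inter> U = U"
            using UT(1)[OF t] by blast
          then have "lmass ((+) t ` Us t) - lmass ((+) t ` U) \<le> d'"
            using Us(3)[OF U, of t] by simp
          moreover have "cmod (lcharge ((+) t ` Us t) - lcharge ((+) t ` U))
              \<le> lmass ((+) t ` Us t) - lmass ((+) t ` U)"
            by (rule cmod_lcharge_diff_le[OF borel_open_translate[OF Us(1)] bU]) (use UT(1)[OF t] in blast)
          ultimately have "cmod (lcharge ((+) t ` Us t) - lcharge ((+) t ` U)) \<le> d'"
            by linarith
          moreover have "cmod (charge i ((+) t ` U) - lcharge ((+) t ` U)) < d'"
            using elim(2) t by (simp add: dist_norm)
          ultimately show ?thesis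
            unfolding w_def
            using norm_triangle_ineq4[of "charge i ((+) t ` U) - lcharge ((+) t ` U)"
                "lcharge ((+) t ` Us t) - lcharge ((+) t ` U)"]
            by simp
        qed
        then have "cmod (\<Sum>t\<in>T. G t * (charge i ((+) t ` U) - w t)) \<le> (\<Sum>t\<in>T. B * (2 * d'))"
          using GB B by (intro sum_norm_le) (auto simp: norm_mult intro!: mult_mono)
        also have "\<dots> = 2 * (real (card T) * (B * d'))"
          by simp
        also have "\<dots> \<le> 2 * (e / 5)"
          using small3 by linarith
        finally have 2: "cmod (\<Sum>t\<in>T. G t * (charge i ((+) t ` U) - w t)) \<le> 2 * (e / 5)" .
        have "(\<Sum>r\<in>R. mass i ((+) r ` U0 - X)) \<le> (\<Sum>r\<in>R. 2 * d)"
          using elim(1) by (intro sum_mono) (auto intro: less_imp_le)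
        also have "\<dots> = real (card R) * (2 * d)"
          by simp
        also have "\<dots> \<le> N0 * (2 * d)"
          using R(3) d by (intro mult_right_mono) (auto simp: N0_def)
        finally have "B * (\<Sum>r\<in>R. mass i ((+) r ` U0 - X)) \<le> B * (N0 * (2 * d))"
          using B by (intro mult_left_mono)
        then have 1: "cmod ((\<integral>x. h i x * G x \<partial>haar) - (\<Sum>t\<in>T. G t * charge i ((+) t ` U))) \<le> 3 * (e / 5)"
          using I[of i] small1 small2 by linarith
        have "(\<integral>x. h i x * G x \<partial>haar) - (\<Sum>t\<in>T. G t * w t) =
            ((\<integral>x. h i x * G x \<partial>haar) - (\<Sum>t\<in>T. G t * charge i ((+) t ` U)))
                + (\<Sum>t\<in>T. G t * (charge i ((+) t ` U) - w t))"
          by (simp add: right_diff_distrib sum_subtractf)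
        also have "cmod \<dots> \<le> 3 * (e / 5) + 2 * (e / 5)"
          by (intro order.trans[OF norm_triangle_ineq] add_mono 1 2)
        finally show ?case
          by simp
      qed
    qed
  qed
qed

end

section \<open>The limit of the compressions of elementary tensors\<close>

text \<open>The conjugation turns the inner product into the bilinear integral of \<open>u\<close>,
  \<open>v\<close> and \<open>G\<close>, so \<open>h\<close> is the product of representatives. Its
  integral norm is bounded by Cauchy-Schwarz for the moduli.\<close>

lemma L1_representation:
  fixes u v :: "'g::haar_group L2"
  shows "\<exists>h. integrable haar h \<and> (\<integral>x. cmod (h x) \<partial>haar) \<le> norm u * norm v \<and>
    (\<forall>G. bdd_borel G \<longrightarrow> cinner u (conj_L2 (mul G v)) = (\<integral>x. h x * G x \<partial>haar))"
proof -
  obtain f where f: "square_integrable f" "u = abs_L2 f"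
    by (rule L2_repE)
  obtain g where g: "square_integrable g" "v = abs_L2 g"
    by (rule L2_repE)
  have abs: "square_integrable (\<lambda>x. complex_of_real (cmod (k x)))"
      "norm (abs_L2 (\<lambda>x. complex_of_real (cmod (k x)))) = norm (abs_L2 k)"
    if k: "square_integrable k" for k :: "'g \<Rightarrow> complex"
  proof -
    have "k \<in> borel_measurable haar"
      using k by (simp add: square_integrable_def)
    then have "(\<lambda>x. complex_of_real (cmod (k x))) \<in> borel_measurable haar"
      by measurable
    then show 1: "square_integrable (\<lambda>x. complex_of_real (cmod (k x)))"
      using k by (simp add: square_integrable_def)
    have "(norm (abs_L2 (\<lambda>x. complex_of_real (cmod (k x)))))\<^sup>2 = (norm (abs_L2 k))\<^sup>2"
      using norm_abs_L2[OF 1] norm_abs_L2[OF k] by simp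
    then show "norm (abs_L2 (\<lambda>x. complex_of_real (cmod (k x)))) = norm (abs_L2 k)"
      by simp
  qed
  show ?thesis
  proof (intro exI[of _ "\<lambda>x. f x * g x"] conjI allI impI)
    show "integrable haar (\<lambda>x. f x * g x)"
      using square_integrable_mult[OF f(1) square_integrable_cnj[OF g(1)]] by simp
    have "complex_of_real (\<integral>x. cmod (f x * g x) \<partial>haar)
        = cinner (abs_L2 (\<lambda>x. complex_of_real (cmod (f x)))) (abs_L2 (\<lambda>x. complex_of_real (cmod (g x))))"
      using abs(1)[OF f(1)] abs(1)[OF g(1)] by (simp add: cinner_abs_L2 norm_mult flip:
          integral_complex_of_real)
    then have "cmod (complex_of_real (\<integral>x. cmod (f x * g x) \<partial>haar)) \<le> norm u * norm v"
      using cmod_cinner_le[of "abs_L2 (\<lambda>x. complex_of_real (cmod (f x)))"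
          "abs_L2 (\<lambda>x. complex_of_real (cmod (g x)))"]
      by (simp only: abs(2)[OF f(1)] abs(2)[OF g(1)] f(2) g(2))
    then show "(\<integral>x. cmod (f x * g x) \<partial>haar) \<le> norm u * norm v"
      unfolding norm_of_real by linarith
    fix G :: "'g \<Rightarrow> complex"
    assume G: "bdd_borel G"
    note Gg = square_integrable_bdd_borel[OF G g(1)]
    show "cinner u (conj_L2 (mul G v)) = (\<integral>x. f x * g x * G x \<partial>haar)"
      by (simp add: f(2) g(2) mul_abs_L2[OF G g(1)] conj_abs_L2[OF Gg]
          cinner_abs_L2[OF f(1) square_integrable_cnj[OF Gg]] del: complex_cnj_mult)
         (simp add: mult_ac)
  qed
qed

lemma bessel_inequality:
  fixes b :: "'i \<Rightarrow> 'a::complex_inner"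
  assumes R: "finite R" and on: "\<And>r s. r \<in> R \<Longrightarrow> s \<in> R \<Longrightarrow> cinner (b r) (b s) = (if r = s then 1 else 0)"
  shows "(\<Sum>r\<in>R. (cmod (cinner (b r) x))\<^sup>2) \<le> (norm x)\<^sup>2"
proof -
  define p where "p = (\<Sum>r\<in>R. cinner x (b r) *\<^sub>C b r)"
  have xp: "cinner x p = of_real (\<Sum>r\<in>R. (cmod (cinner x (b r)))\<^sup>2)"
    unfolding of_real_sum complex_norm_square p_def cinner_sum_right by (simp add: mult.commute)
  have pb: "cinner p (b r) = cinner x (b r)" if "r \<in> R" for r
  proof -
    have "cinner p (b r) = (\<Sum>s\<in>R. if s = r then cinner x (b s) else 0)"
      unfolding p_def cinner_sum_left using that on by (intro sum.cong) auto
    then show ?thesis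
      using R that by simp
  qed
  have "cinner q p = (\<Sum>r\<in>R. cnj (cinner x (b r)) * cinner q (b r))" for q
    unfolding p_def cinner_sum_right by simp
  then have "cinner p p = (\<Sum>r\<in>R. cnj (cinner x (b r)) * cinner p (b r))" .
  also have "\<dots> = (\<Sum>r\<in>R. cnj (cinner x (b r)) * cinner x (b r))"
    by (intro sum.cong refl) (simp add: pb)
  also have "\<dots> = of_real (\<Sum>r\<in>R. (cmod (cinner x (b r)))\<^sup>2)"
    unfolding of_real_sum complex_norm_square by (simp add: mult.commute)
  finally have "complex_of_real ((norm p)\<^sup>2) = of_real (\<Sum>r\<in>R. (cmod (cinner x (b r)))\<^sup>2)"
    unfolding cinner_self .
  then have pp: "(norm p)\<^sup>2 = (\<Sum>r\<in>R. (cmod (cinner x (b r)))\<^sup>2)"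
    by (simp only: of_real_eq_iff)
  have "0 \<le> (norm (x - p))\<^sup>2"
    by simp
  also have "\<dots> = (norm x)\<^sup>2 - (\<Sum>r\<in>R. (cmod (cinner x (b r)))\<^sup>2)"
    by (simp add: norm_diff_square xp pp)
  finally have "(\<Sum>r\<in>R. (cmod (cinner x (b r)))\<^sup>2) \<le> (norm x)\<^sup>2"
    by simp
  moreover have "cmod (cinner (b r) x) = cmod (cinner x (b r))" for r
    by (subst cinner_commute) simp
  ultimately show ?thesis
    by simp
qed

lemma cinner_conj_swap: "cinner x (conj_L2 y) = cinner y (conj_L2 x)"
  using cinner_conj[of "conj_L2 x" "conj_L2 y"] by (metis cinner_conj conj_conj)

lemma mul_indicator_zeta:
  assumes V: "inv_nbhd V"
  shows "mul (indicator ((+) r ` V)) (lreg r (zeta V)) = lreg r (zeta V)"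
proof -
  have bV: "V \<in> sets borel" and fV: "V \<in> fmeasurable haar"
    using V by (auto simp: inv_nbhd_def intro: borel_compact fmeasurable_compact)
  have "mul (indicator V) (ind_L2 V) = ind_L2 V"
    unfolding ind_L2_def
    by (subst mul_abs_L2) (auto intro!: bdd_borel_indicator bV square_integrable_indicator fV
        arg_cong[of _ _ abs_L2] simp: indicator_def)
  then have supp: "mul (indicator V) (zeta V) = zeta V"
    by (simp add: zeta_def mul_scaleR_right bdd_borel_indicator bV)
  have "(\<lambda>t. indicator V (- r + t) :: complex) = indicator ((+) r ` V)"
    unfolding image_plus_eq by (auto simp: indicator_def)
  then show ?thesis
    using lreg_mul[OF bdd_borel_indicator[OF bV], of r "zeta V"] by (simp add: supp)
qed

lemma cinner_lreg_zeta_disjoint: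
  assumes V: "inv_nbhd V" and d: "(+) r ` V \<inter> (+) s ` V = {}"
  shows "cinner (lreg r (zeta V)) (lreg s (zeta V)) = 0"
proof -
  have cV: "compact V"
    using V by (simp add: inv_nbhd_def)
  show ?thesis
    by (simp add: zeta_def blinfun.scaleR_right lreg_ind_L2 fmeasurable_compact cV cinner_ind_L2
        compact_image_plus d)
qed

definition csupp :: "'g::haar_group L2 \<Rightarrow> bool" where
  "csupp x \<longleftrightarrow> (\<exists>C. compact C \<and> mul (indicator C) x = x)"

text \<open>The translate of the first support can meet the second only for \<open>w\<close> in the
  set of differences of the two, which is compact.\<close>

lemma csupp_coefficient:
  assumes "csupp x" "csupp y"
  shows "\<exists>D. compact D \<and> (\<forall>w. w \<notin> D \<longrightarrow> cinner (lreg w x) y = 0)"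
proof -
  obtain C C' where C: "compact C" "mul (indicator C) x = x" and C': "compact C'" "mul (indicator C') y = y"
    using assms by (auto simp: csupp_def)
  have b: "C \<in> sets borel" "C' \<in> sets borel"
    by (intro borel_compact C C')+
  have "compact ((\<lambda>(a, b). a - b) ` (C' \<times> C))"
    by (intro compact_continuous_image compact_Times C C') (auto simp: case_prod_beta intro!: continuous_intros)
  moreover have "cinner (lreg w x) y = 0" if w: "w \<notin> (\<lambda>(a, b). a - b) ` (C' \<times> C)" for w
  proof -
    have disj: "(+) w ` C \<inter> C' = {}"
    proof (rule equals0I)
      fix z
      assume "z \<in> (+) w ` C \<inter> C'"
      then obtain c where "c \<in> C" "w + c \<in> C'"
        by auto
      then have "w \<in> (\<lambda>(a, b). a - b) ` (C' \<times> C)"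
        by (intro image_eqI[of _ _ "(w + c, c)"]) auto
      then show False
        using w by blast
    qed
    have i: "(\<lambda>t. indicator C (- w + t) :: complex) = indicator ((+) w ` C)"
      unfolding image_plus_eq by (auto simp: indicator_def)
    have x: "lreg w x = mul (indicator ((+) w ` C)) (lreg w x)"
      using lreg_mul[OF bdd_borel_indicator[OF b(1)], of w x] by (simp add: C i)
    have bw: "(+) w ` C \<in> sets borel"
      by (intro borel_image_plus b)
    have "cinner (lreg w x) y = cinner (mul (indicator ((+) w ` C)) (lreg w x)) (mul (indicator C') y)"
      using x C' by simp
    also have "\<dots> = cinner (lreg w x) (mul (\<lambda>t. indicator ((+) w ` C) t * indicator C' t) y)"
      by (simp add: cinner_mul bdd_borel_indicator bw b mul_mul)
    also have "(\<lambda>t. indicator ((+) w ` C) t * indicator C' t :: complex) = (\<lambda>_. 0)"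
      using disj by (auto simp: indicator_def fun_eq_iff)
    finally show ?thesis
      by (simp add: mul_const)
  qed
  ultimately show ?thesis
    by blast
qed

lemma continuous_coefficient: "continuous_on UNIV (\<lambda>w. cinner (lreg w x) y)"
  by (intro continuous_on_cinner continuous_on_lreg continuous_on_const)

lemma bdd_borel_coefficient: "bdd_borel (\<lambda>w. cinner (lreg w x) y)"
proof -
  have "bdd_borel (\<lambda>w. cnj (cinner y (lreg w x)))"
    by (intro bdd_borel_cnj wfield_bdd_borel wfield_orbit)
  then show ?thesis
    by (simp add: cinner_commute[symmetric])
qed

lemma cmod_coefficient_le: "cmod (cinner (lreg w x) y) \<le> norm x * norm y"
  using cmod_cinner_le[of "lreg w x" y] by simp

lemma norm_mul_coefficient_le: "norm (mul (\<lambda>w. cinner (lreg w x) y) v) \<le> (norm x * norm y) * norm v"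
  using bdd_borel_coefficient[of x y] cmod_coefficient_le by (intro norm_mul_le) (auto simp: bdd_borel_def)

lemma inv_nbhd_diff_subset:
  assumes U: "open U" "0 \<in> U" and F: "nbhd_ultrafilter F"
  shows "eventually (\<lambda>V. \<forall>v\<in>V. \<forall>v'\<in>V. v - v' \<in> U) F"
proof -
  obtain W where W: "open W" "0 \<in> W" "\<forall>a\<in>W. \<forall>b\<in>W. a + b \<in> U"
    using half_nbhd[OF U] by blast
  have "eventually (\<lambda>V. V \<subseteq> W) F" "eventually inv_nbhd F"
    using F W by (auto simp: nbhd_ultrafilter_def)
  then show ?thesis
  proof eventually_elim
    case (elim V)
    show ?case
    proof (intro ballI)
      fix v v'
      assume "v \<in> V" "v' \<in> V"
      then have "v \<in> W" "- v' \<in> W"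
        using elim by (auto simp: inv_nbhd_def)
      then have "v + - v' \<in> U"
        using W(3) by blast
      then show "v - v' \<in> U"
        by simp
    qed
  qed
qed

lemma eventually_lreg_near:
  assumes F: "nbhd_ultrafilter F" and e: "e > 0"
  shows "eventually (\<lambda>V. \<forall>v\<in>V. norm (lreg v x - x) \<le> e) F"
proof -
  obtain N where N: "open N" "0 \<in> N" "\<forall>n\<in>N. norm (lreg n x - x) < e"
    using lreg_near[OF e, of x] by blast
  have "eventually (\<lambda>V. V \<subseteq> N) F"
    using F N by (simp add: nbhd_ultrafilter_def)
  then show ?thesis
    by (rule eventually_mono) (use N(3) in \<open>auto intro: less_imp_le\<close>)
qed

text \<open>The translate of \<open>zeta V\<close> by \<open>t\<close> is real and lives on
  \<open>t + V\<close>, where \<open>f\<close> is within \<open>e\<close> of the constant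
  \<open>f t\<close>.\<close>

lemma coefficient_zeta_near:
  assumes V: "inv_nbhd V" and f: "bdd_borel f" and e: "0 \<le> e" "\<And>v. v \<in> V \<Longrightarrow> cmod (f (t + v) - f t) \<le> e"
  shows "cmod (cinner (lreg t (zeta V)) (conj_L2 (mul f u)) - f t * cinner u (lreg t (zeta V))) \<le> norm u * e"
proof -
  let ?x = "lreg t (zeta V)"
  have bV: "(+) t ` V \<in> sets borel"
    by (rule borel_image_plus, rule borel_compact) (use V in \<open>simp add: inv_nbhd_def\<close>)
  let ?g = "\<lambda>y. indicator ((+) t ` V) y * (cnj (f y) + - cnj (f t))"
  have bg0: "bdd_borel (\<lambda>y. cnj (f y) + - cnj (f t))"
    by (intro bdd_borel_add bdd_borel_cnj f bdd_borel_const)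
  have bg: "bdd_borel ?g"
    by (intro bdd_borel_mult bdd_borel_indicator bV bg0)
  have g: "cmod (?g y) \<le> e" for y
  proof (cases "y \<in> (+) t ` V")
    case True
    then obtain v where v: "v \<in> V" "y = t + v"
      by blast
    have "cmod (cnj (f y - f t)) \<le> e"
      using e(2)[OF v(1)] unfolding complex_mod_cnj v(2) .
    then show ?thesis
      using True by simp
  qed (use e in simp)
  have "cinner ?x (conj_L2 (mul f u)) = cinner (mul f u) (conj_L2 ?x)"
    by (rule cinner_conj_swap)
  also have "conj_L2 ?x = ?x"
    by (simp add: conj_lreg V)
  also have "cinner (mul f u) ?x = cinner u (mul (\<lambda>y. cnj (f y)) ?x)"
    by (rule cinner_mul[OF f])
  finally have "cinner ?x (conj_L2 (mul f u)) - f t * cinner u ?x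
      = cinner u (mul (\<lambda>y. cnj (f y)) ?x + - (cnj (f t) *\<^sub>C ?x))"
    by (simp add: cinner_diff_right)
  also have "mul (\<lambda>y. cnj (f y)) ?x + - (cnj (f t) *\<^sub>C ?x) = mul (\<lambda>y. cnj (f y) + - cnj (f t)) ?x"
  proof -
    have "- (cnj (f t) *\<^sub>C ?x) = mul (\<lambda>_. - cnj (f t)) ?x"
      unfolding mul_const scaleC_minus1[symmetric] by simp
    then show ?thesis
      by (simp only: mul_add_left[OF bdd_borel_cnj[OF f] bdd_borel_const])
  qed
  also have "\<dots> = mul (\<lambda>y. cnj (f y) + - cnj (f t)) (mul (indicator ((+) t ` V)) ?x)"
    by (simp only: mul_indicator_zeta[OF V])
  also have "\<dots> = mul ?g ?x"
    by (subst mul_mul[OF bg0 bdd_borel_indicator[OF bV]]) (simp only: mult.commute)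
  finally have "cmod (cinner ?x (conj_L2 (mul f u)) - f t * cinner u ?x) \<le> norm u * norm (mul ?g ?x)"
    by (metis cmod_cinner_le)
  also have "norm (mul ?g ?x) \<le> e * norm ?x"
    using bg g unfolding bdd_borel_def by (intro norm_mul_le) auto
  finally show ?thesis
    by (simp add: norm_zeta V mult_left_mono)
qed

context
  fixes tp2 :: "'g::haar_group L2 \<Rightarrow> 'g L2 \<Rightarrow> 'h2::complex_hilbert"
    and \<Delta> :: "('g L2 \<Rightarrow>\<^sub>L 'g L2) \<Rightarrow> 'h2 \<Rightarrow>\<^sub>L 'h2"
    and F :: "'g set filter"
  assumes SIN: "SIN_group TYPE('g)" and ht2: "hilbert_tensor tp2" and com: "comultiplication tp2 \<Delta>"
    and F: "nbhd_ultrafilter F"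
begin

lemma ultra_F: "ultra F" and F_inv: "eventually inv_nbhd F"
  using F by (simp_all add: nbhd_ultrafilter_def)

text \<open>Four replacements, each costing a quarter of \<open>e\<close>: the outer compression by
  a pairing with \<open>\<eta>' V\<close>, the inner one by the integral of \<open>h W\<close>
  against \<open>G V\<close>, the integral by its sum over atoms, and \<open>G V t\<close> by its
  limit \<open>f t * l t\<close>. The resulting sum is a coefficient of \<open>z\<close>, and
  \<open>z\<close> is built from \<open>a\<close>, \<open>b\<close>, \<open>c\<close>,
  \<open>e\<close> alone.\<close>

lemma compress_elementary_limit:
  assumes a: "a \<in> VN" and b: "b \<in> VN" and c: "c \<in> VN" and e: "e > 0"
  shows "\<exists>z\<in>lreg_span. \<forall>\<xi> \<eta>. norm \<xi> \<le> 1 \<longrightarrow> norm \<eta> \<le> 1 \<longrightarrow> csupp \<xi> \<longrightarrow> csupp \<eta> \<longrightarrow>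
    eventually (\<lambda>V. eventually (\<lambda>W. cmod (cinner (compress tp2 V (compress tp2 W a b) c \<xi>) \<eta>
        - cinner (z \<xi>) \<eta>) \<le> e) F) F"
proof -
  have cl: "clin a" "clin b" "clin c"
    using a b c by (auto intro: VN_clin)
  define M where "M = norm a * norm b"
  define B where "B = norm c"
  have M0: "0 \<le> M" and B0: "0 \<le> B"
    by (simp_all add: M_def B_def)
  \<comment> \<open>The bounds on \<open>h\<close> are demanded for every index set, hence the zero
    function when \<open>W\<close> is not an invariant neighbourhood.\<close>
  have "\<exists>h. integrable haar h \<and> (\<integral>x. cmod (h x) \<partial>haar) \<le> M \<and> (inv_nbhd W \<longrightarrow>
    (\<forall>G. bdd_borel G \<longrightarrow> cinner (a (zeta W)) (conj_L2 (mul G (b (zeta W)))) = (\<integral>x. h x * G x \<partial>haar)))"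
        for W :: "'g set"
  proof (cases "inv_nbhd W")
    case True
    obtain h where h: "integrable haar h" "(\<integral>x. cmod (h x) \<partial>haar) \<le> norm (a (zeta W)) * norm (b (zeta W))"
      "\<forall>G. bdd_borel G \<longrightarrow> cinner (a (zeta W)) (conj_L2 (mul G (b (zeta W)))) = (\<integral>x. h x * G x \<partial>haar)"
      using L1_representation[of "a (zeta W)" "b (zeta W)"] by blast
    have "norm (a (zeta W)) * norm (b (zeta W)) \<le> M"
      unfolding M_def using norm_blinfun[of a "zeta W"] norm_blinfun[of b "zeta W"]
      by (intro mult_mono) (auto simp: norm_zeta True)
    then show ?thesis
      using h by (intro exI[of _ h]) auto
  next
    case False
    then show ?thesis
      using M0 by (intro exI[of _ "\<lambda>_. 0"]) auto
  qed
  then obtain h where h: "\<And>W. integrable haar (h W)" "\<And>W. (\<integral>x. cmod (h W x) \<partial>haar) \<le> M"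
    "\<And>W G. inv_nbhd W \<Longrightarrow> bdd_borel G \<Longrightarrow> cinner (a (zeta W)) (conj_L2 (mul G (b (zeta W))))
        = (\<integral>x. h W x * G x \<partial>haar)"
    by metis
  have quarter: "e / (4 * k) * k = e / 4" if "k > 0" for k
    using that by simp
  have e4: "e / 4 > 0"
    using e by simp
  obtain T w where T: "finite T" and flight: "\<And>C. compact C \<Longrightarrow> \<exists>U0. open U0 \<and> 0 \<in> U0
      \<and> (\<forall>V G. V \<noteq> {} \<longrightarrow> (\<forall>v\<in>V. \<forall>v'\<in>V. v - v' \<in> U0) \<longrightarrow>
      continuous_on UNIV G \<longrightarrow> (\<forall>x. cmod (G x) \<le> B) \<longrightarrow> (\<forall>x. x \<notin> C \<longrightarrow> G x = 0) \<longrightarrow>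
      (\<forall>R. finite R \<longrightarrow> disjoint_family_on (\<lambda>r. (+) r ` V) R \<longrightarrow> (\<Sum>r\<in>R. (cmod (G r))\<^sup>2) \<le> B\<^sup>2) \<longrightarrow>
      eventually (\<lambda>i. cmod ((\<integral>x. h i x * G x \<partial>haar) - (\<Sum>t\<in>T. G t * w t)) \<le> e / 4) F)"
    using integral_near_atoms[where h = h and M = M, OF ultra_F h(1) h(2) e4 B0]
        by (elim exE conjE) (rule that, assumption, drule spec, drule mp, assumption, assumption)
  \<comment> \<open>The default \<open>0\<close> keeps the function bounded on all sets, as
    convergence along the ultrafilter requires.\<close>
  have "\<exists>l. ((\<lambda>V. if inv_nbhd V then cinner (c (zeta V)) (lreg t (zeta V)) else 0) \<longlongrightarrow> l) F" for t
  proof (rule ultra_tendsto[OF ultra_F])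
    have "cmod (if inv_nbhd V then cinner (c (zeta V)) (lreg t (zeta V)) else 0) \<le> norm c" for V
      using order.trans[OF cmod_cinner_le[of "c (zeta V)" "lreg t (zeta V)"], of "norm c"]
          norm_blinfun[of c "zeta V"]
      by (auto simp: norm_zeta)
    then show "bounded (range (\<lambda>V. if inv_nbhd V then cinner (c (zeta V)) (lreg t (zeta V)) else 0))"
      unfolding bounded_iff by blast
  qed
  then obtain l where l: "\<And>t. ((\<lambda>V. if inv_nbhd V then cinner (c (zeta V)) (lreg t (zeta V)) else 0) \<longlongrightarrow> l t) F"
    by metis
  define z where "z = (\<Sum>t\<in>T. scaleC_op (w t * l t) (lreg t :: 'g L2 \<Rightarrow>\<^sub>L 'g L2))"
  have "z \<in> lreg_span"
    unfolding z_def by (intro subspace_sum subspace_lreg_span lreg_span_base)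
  moreover have "eventually (\<lambda>V. eventually (\<lambda>W. cmod (cinner (compress tp2 V (compress tp2 W a b) c \<xi>) \<eta>
      - cinner (z \<xi>) \<eta>) \<le> e) F) F"
    if \<xi>: "norm \<xi> \<le> 1" "csupp \<xi>" and \<eta>: "norm \<eta> \<le> 1" "csupp \<eta>" for \<xi> \<eta>
  proof -
    define f where "f = (\<lambda>r. cinner (lreg r \<xi>) \<eta>)"
    have fb: "bdd_borel f" and fc: "continuous_on UNIV f"
      unfolding f_def by (rule bdd_borel_coefficient, rule continuous_coefficient)
    have f1: "norm \<xi> * norm \<eta> \<le> 1"
      using mult_mono[OF \<xi>(1) \<eta>(1)] by simp
    define \<eta>' where "\<eta>' V = conj_L2 (mul f (c (zeta V)))" for V
    define G where "G V r = cinner (lreg r (zeta V)) (\<eta>' V)" for V r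
    have n\<eta>': "norm (\<eta>' V) \<le> B" if V: "inv_nbhd V" for V
    proof -
      have "norm (\<eta>' V) \<le> (norm \<xi> * norm \<eta>) * norm (c (zeta V))"
        unfolding \<eta>'_def f_def norm_conj by (rule norm_mul_coefficient_le)
      also have "\<dots> \<le> 1 * (norm c * norm (zeta V))"
        by (intro mult_mono f1 norm_blinfun) auto
      finally show ?thesis
        by (simp add: B_def norm_zeta V)
    qed
    have Gc: "continuous_on UNIV (G V)" and Gb: "bdd_borel (G V)" for V
      unfolding G_def by (rule continuous_coefficient, rule bdd_borel_coefficient)
    have GB: "cmod (G V r) \<le> B" if V: "inv_nbhd V" for V r
      unfolding G_def using order.trans[OF cmod_coefficient_le n\<eta>'[OF V, THEN mult_left_mono]]
      by (simp add: norm_zeta V n\<eta>') (metis cmod_coefficient_le mult_1 n\<eta>' norm_zeta order_trans V)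
    have GR: "(\<Sum>r\<in>R. (cmod (G V r))\<^sup>2) \<le> B\<^sup>2"
      if V: "inv_nbhd V" and R: "finite R" "disjoint_family_on (\<lambda>r. (+) r ` V) R" for V R
    proof -
      have "(\<Sum>r\<in>R. (cmod (cinner (lreg r (zeta V)) (\<eta>' V)))\<^sup>2) \<le> (norm (\<eta>' V))\<^sup>2"
      proof (rule bessel_inequality[OF R(1)])
        fix r s
        assume "r \<in> R" "s \<in> R"
        then show "cinner (lreg r (zeta V)) (lreg s (zeta V)) = (if r = s then 1 else 0)"
          using R(2) V by (auto simp: cinner_self norm_zeta disjoint_family_on_def
              intro!: cinner_lreg_zeta_disjoint)
      qed
      also have "\<dots> \<le> B\<^sup>2"
        by (intro power_mono n\<eta>' V) auto
      finally show ?thesis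
        by (simp add: G_def)
    qed
    obtain D where D: "compact D" "\<And>r. r \<notin> D \<Longrightarrow> f r = 0"
      using csupp_coefficient[OF \<xi>(2) \<eta>(2)] unfolding f_def by blast
    obtain V1 where V1: "inv_nbhd (V1 :: 'g set)"
      using SIN_inv_nbhd[OF SIN open_UNIV] by auto
    \<comment> \<open>One compact set supporting \<open>G V\<close> for all small \<open>V\<close>
      simultaneously; it must be known before \<open>U0\<close>, and \<open>U0\<close> before
      \<open>V\<close>.\<close>
    define C where "C = (\<lambda>(d, v). d - v) ` (D \<times> V1)"
    have C: "compact C"
      unfolding C_def using V1 D(1)
      by (intro compact_continuous_image compact_Times)
          (auto simp: case_prod_beta inv_nbhd_def intro!: continuous_intros)
    \<comment> \<open>Outside \<open>C\<close> the function \<open>f\<close> vanishes on all of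
      \<open>r + V\<close> and at \<open>r\<close>, so \<open>coefficient_zeta_near\<close> applies
      with error \<open>0\<close>.\<close>
    have GC: "G V r = 0" if V: "inv_nbhd V" "V \<subseteq> V1" and r: "r \<notin> C" for V r
    proof -
      have "f (r + v) = 0" if "v \<in> V" for v
      proof (rule D(2), rule notI)
        assume "r + v \<in> D"
        then have "r \<in> C"
          unfolding C_def using that V(2) by (intro image_eqI[of _ _ "(r + v, v)"]) auto
        then show False
          using r by simp
      qed
      moreover have "f r = 0"
        using V(1) calculation[of 0] interior_subset[of V] by (auto simp: inv_nbhd_def)
      ultimately have "cmod (cinner (lreg r (zeta V)) (conj_L2 (mul f (c (zeta V))))
          - f r * cinner (c (zeta V)) (lreg r (zeta V))) \<le> norm (c (zeta V)) * 0"
        by (intro coefficient_zeta_near V fb) auto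
      then show ?thesis
        using \<open>f r = 0\<close> by (simp add: G_def \<eta>'_def)
    qed
    obtain U0 where U0: "open U0" "0 \<in> U0" and flight0: "\<forall>V G. V \<noteq> {} \<longrightarrow> (\<forall>v\<in>V. \<forall>v'\<in>V. v - v' \<in> U0) \<longrightarrow>
      continuous_on UNIV G \<longrightarrow> (\<forall>x. cmod (G x) \<le> B) \<longrightarrow> (\<forall>x. x \<notin> C \<longrightarrow> G x = 0) \<longrightarrow>
      (\<forall>R. finite R \<longrightarrow> disjoint_family_on (\<lambda>r. (+) r ` V) R \<longrightarrow> (\<Sum>r\<in>R. (cmod (G r))\<^sup>2) \<le> B\<^sup>2) \<longrightarrow>
      eventually (\<lambda>i. cmod ((\<integral>x. h i x * G x \<partial>haar) - (\<Sum>t\<in>T. G t * w t)) \<le> e / 4) F"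
      using flight[OF C] by (elim exE conjE) (rule that)
    have Gt: "((\<lambda>V. G V t) \<longlongrightarrow> f t * l t) F" for t
    proof -
      have near: "((\<lambda>V. G V t - f t * (if inv_nbhd V then cinner (c (zeta V)) (lreg t (zeta V)) else 0)) \<longlongrightarrow> 0) F"
      proof (rule tendstoI)
        fix d :: real
        assume d: "d > 0"
        define d' where "d' = d / (B + 1)"
        have pos: "B + 1 > 0"
          using B0 by linarith
        then have d': "d' > 0"
          using d by (simp add: d'_def)
        have "continuous_on UNIV (\<lambda>v. f (t + v))"
          by (intro continuous_on_compose2[OF fc] continuous_intros) auto
        then have "open ((\<lambda>v. f (t + v)) -` ball (f t) d')"
          by (rule open_vimage[OF open_ball])
        moreover have "0 \<in> (\<lambda>v. f (t + v)) -` ball (f t) d'"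
          using d' by simp
        ultimately have "eventually (\<lambda>V. V \<subseteq> (\<lambda>v. f (t + v)) -` ball (f t) d') F"
          using F unfolding nbhd_ultrafilter_def by blast
        then show "eventually (\<lambda>V. dist (G V t
            - f t * (if inv_nbhd V then cinner (c (zeta V)) (lreg t (zeta V)) else 0)) 0 < d) F"
          using F_inv
        proof eventually_elim
          case (elim V)
          have "cmod (G V t - f t * cinner (c (zeta V)) (lreg t (zeta V))) \<le> norm (c (zeta V)) * d'"
            unfolding G_def \<eta>'_def
            by (rule coefficient_zeta_near[OF elim(2) fb])
               (use elim(1) d' in \<open>auto simp: dist_norm norm_minus_commute intro: less_imp_le\<close>)
          also have "\<dots> \<le> B * d'"
            using norm_blinfun[of c "zeta V"] d' by (intro mult_right_mono) (auto simp: B_def norm_zeta elim(2))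
          also have "\<dots> < d"
            unfolding d'_def times_divide_eq_right pos_divide_less_eq[OF pos] using d
                by (simp add: algebra_simps)
          finally show ?case
            using elim(2) by simp
        qed
      qed
      have "((\<lambda>V. (G V t - f t * (if inv_nbhd V then cinner (c (zeta V)) (lreg t (zeta V)) else 0))
          + f t * (if inv_nbhd V then cinner (c (zeta V)) (lreg t (zeta V)) else 0)) \<longlongrightarrow> 0 + f t * l t) F"
        by (intro tendsto_add near tendsto_mult tendsto_const l)
      then show ?thesis
        by simp
    qed
    have zf: "cinner (z \<xi>) \<eta> = (\<Sum>t\<in>T. (f t * l t) * w t)"
      unfolding z_def f_def by (simp add: blinfun.sum_left cinner_sum_left mult_ac)
    have "((\<lambda>V. \<Sum>t\<in>T. G V t * w t) \<longlongrightarrow> cinner (z \<xi>) \<eta>) F"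
      unfolding zf by (intro tendsto_intros Gt)
    from tendstoD[OF this e4] have ev1: "eventually (\<lambda>V. dist (\<Sum>t\<in>T. G V t * w t) (cinner (z \<xi>) \<eta>) < e / 4) F" .
    \<comment> \<open>Scaled so that the bound of \<open>compress_approx\<close>, with
      \<open>M\<close> bounding the compressed vector, stays below a quarter of
      \<open>e\<close>.\<close>
    define \<epsilon> where "\<epsilon> = e / (4 * (norm (\<Delta> c) * M + 1))"
    have p1: "norm (\<Delta> c) * M + 1 > 0"
      using M0 by (simp add: add_nonneg_pos)
    have \<epsilon>: "\<epsilon> > 0"
      unfolding \<epsilon>_def using e p1 by simp
    have ev2: "eventually (\<lambda>V. \<forall>v\<in>V. norm (lreg v \<xi> - \<xi>) \<le> \<epsilon>) F"
      by (rule eventually_lreg_near[OF F \<epsilon>])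
    have ev3: "eventually (\<lambda>V. \<forall>v\<in>V. \<forall>v'\<in>V. v - v' \<in> U0) F"
      by (rule inv_nbhd_diff_subset[OF U0 F])
    have "open (interior V1)" "0 \<in> interior V1"
      using V1 by (auto simp: inv_nbhd_def)
    then have ev4: "eventually (\<lambda>V. V \<subseteq> interior V1) F"
      using F unfolding nbhd_ultrafilter_def by blast
    show ?thesis
      using ev1 ev2 ev3 ev4 F_inv
    proof eventually_elim
      case V: (elim V)
      have "V \<noteq> {}"
        using V(5) interior_subset[of V] by (auto simp: inv_nbhd_def)
      moreover have "V \<subseteq> V1"
        using V(4) interior_subset by blast
      ultimately have evW1: "eventually (\<lambda>W. cmod ((\<integral>x. h W x * G V x \<partial>haar) - (\<Sum>t\<in>T. G V t * w t)) \<le> e / 4) F"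
        using V(3) Gc GB[OF V(5)] GC[OF V(5)] GR[OF V(5)]
            by (intro flight0[THEN spec, THEN spec, THEN mp, THEN mp, THEN mp, THEN mp, THEN mp, THEN mp]) auto
      define \<epsilon>' where "\<epsilon>' = e / (4 * (norm (\<Delta> b) * (B * norm a) + 1))"
      have p2: "norm (\<Delta> b) * (B * norm a) + 1 > 0"
        using B0 by (simp add: add_nonneg_pos)
      have \<epsilon>': "\<epsilon>' > 0"
        unfolding \<epsilon>'_def using e p2 by simp
      have evW2: "eventually (\<lambda>W. \<forall>v\<in>W. norm (lreg v (zeta V) - zeta V) \<le> \<epsilon>') F"
        by (rule eventually_lreg_near[OF F \<epsilon>'])
      show ?case
        using evW1 evW2 F_inv
      proof eventually_elim
        case W: (elim W)
        let ?y = "compress tp2 W a b"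
        have ycl: "clin ?y"
          by (rule clin_compress[OF SIN ht2 com cl(1,2)])
        have nz: "norm (zeta V) = 1" "norm (zeta W) = 1"
          by (simp_all add: norm_zeta V(5) W(3))
        have "norm (?y (zeta V)) \<le> M"
          using norm_blinfun[of ?y "zeta V"] norm_compress[OF SIN ht2 com W(3) cl(1,2)] by (simp add: nz M_def)
        then have y\<eta>: "norm \<eta> * norm (?y (zeta V)) \<le> 1 * M"
          by (intro mult_mono \<eta>) auto
        have "cmod (cinner (compress tp2 V ?y c \<xi>) \<eta> - cinner (?y (zeta V)) (\<eta>' V))
            \<le> norm (\<Delta> c) * \<epsilon> * (norm \<eta> * norm (?y (zeta V)))"
          unfolding \<eta>'_def f_def
          by (rule compress_approx[OF SIN ht2 com V(5) ycl conj_inv_compress[OF SIN ht2 com V(5) W(3) a b] c])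
             (use V(2) \<epsilon> in auto)
        also have "\<dots> \<le> norm (\<Delta> c) * \<epsilon> * (1 * M)"
          using \<epsilon> by (intro mult_left_mono y\<eta>) auto
        also have "\<dots> = \<epsilon> * (norm (\<Delta> c) * M)"
          by simp
        also have "\<dots> \<le> \<epsilon> * (norm (\<Delta> c) * M + 1)"
          using \<epsilon> by (intro mult_left_mono) auto
        also have "\<dots> = e / 4"
          unfolding \<epsilon>_def by (rule quarter[OF p1])
        finally have 1: "cmod (cinner (compress tp2 V ?y c \<xi>) \<eta> - cinner (?y (zeta V)) (\<eta>' V)) \<le> e / 4" .
        have "cmod (cinner (?y (zeta V)) (\<eta>' V)
            - cinner (a (zeta W)) (conj_L2 (mul (\<lambda>r. cinner (lreg r (zeta V)) (\<eta>' V)) (b (zeta W)))))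
            \<le> norm (\<Delta> b) * \<epsilon>' * (norm (\<eta>' V) * norm (a (zeta W)))"
          by (rule compress_approx[OF SIN ht2 com W(3) cl(1) conj_inv_VN[OF SIN W(3) a] b])
             (use W(2) \<epsilon>' in auto)
        also have "\<dots> \<le> norm (\<Delta> b) * \<epsilon>' * (B * norm a)"
          using \<epsilon>' n\<eta>'[OF V(5)] norm_blinfun[of a "zeta W"] B0 by (intro mult_left_mono mult_mono)
              (auto simp: nz)
        also have "\<dots> = \<epsilon>' * (norm (\<Delta> b) * (B * norm a))"
          by simp
        also have "\<dots> \<le> \<epsilon>' * (norm (\<Delta> b) * (B * norm a) + 1)"
          using \<epsilon>' by (intro mult_left_mono) auto
        also have "\<dots> = e / 4"
          unfolding \<epsilon>'_def by (rule quarter[OF p2])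
        finally have 2: "cmod (cinner (?y (zeta V)) (\<eta>' V) - (\<integral>x. h W x * G V x \<partial>haar)) \<le> e / 4"
          unfolding h(3)[OF W(3) Gb, symmetric] unfolding G_def .
        have tri: "cmod (p1 - p5) \<le> e" if "cmod (p1 - p2) \<le> e / 4" "cmod (p2 - p3) \<le> e / 4"
            "cmod (p3 - p4) \<le> e / 4" "cmod (p4 - p5) \<le> e / 4"
          for p1 p2 p3 p4 p5
          using that norm_triangle_ineq[of "p1 - p2" "p2 - p3"] norm_triangle_ineq[of "p1 - p3" "p3 - p4"]
            norm_triangle_ineq[of "p1 - p4" "p4 - p5"] by simp
        show ?case
          by (rule tri[OF 1 2 W(1)]) (use V(1) in \<open>simp add: dist_norm\<close>)
      qed
    qed
  qed
  ultimately show ?thesis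
    by blast
qed

end

section \<open>Norm approximation by translations\<close>

lemma csupp_subspace: "subspace {x :: 'g::haar_group L2. csupp x}"
  unfolding subspace_def
proof (intro conjI ballI allI)
  show "0 \<in> {x :: 'g L2. csupp x}"
    using mul_scaleC_right[OF bdd_borel_indicator[of "{}"], of 0 0]
        by (auto simp: csupp_def intro!: exI[of _ "{}"])
  fix x :: "'g L2" and r
  assume x: "x \<in> {x. csupp x}"
  then obtain C where C: "compact C" "mul (indicator C) x = x"
    by (auto simp: csupp_def)
  note bC = bdd_borel_indicator[OF borel_compact[OF C(1)]]
  show "r *\<^sub>R x \<in> {x. csupp x}"
    using C by (auto simp: csupp_def mul_scaleR_right[OF bC])
  fix y :: "'g L2"
  assume "y \<in> {x. csupp x}"
  then obtain C' where C': "compact C'" "mul (indicator C') y = y"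
    by (auto simp: csupp_def)
  note bC' = bdd_borel_indicator[OF borel_compact[OF C'(1)]]
  have cU: "compact (C \<union> C')"
    using C C' by blast
  note bU = bdd_borel_indicator[OF borel_compact[OF cU]]
  have "mul (indicator (C \<union> C')) x = mul (\<lambda>t. indicator (C \<union> C') t * indicator C t) x"
    using mul_mul[OF bU bC, of x] by (simp add: C)
  also have "(\<lambda>t. indicator (C \<union> C') t * indicator C t) = (indicator C :: 'g \<Rightarrow> complex)"
    by (auto simp: indicator_def)
  finally have 1: "mul (indicator (C \<union> C')) x = x"
    by (simp add: C)
  have "mul (indicator (C \<union> C')) y = mul (\<lambda>t. indicator (C \<union> C') t * indicator C' t) y"
    using mul_mul[OF bU bC', of y] by (simp add: C')
  also have "(\<lambda>t. indicator (C \<union> C') t * indicator C' t) = (indicator C' :: 'g \<Rightarrow> complex)"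
    by (auto simp: indicator_def)
  finally have "mul (indicator (C \<union> C')) (x + y) = x + y"
    by (simp add: mul_add_right[OF bU] 1 C')
  then show "x + y \<in> {x. csupp x}"
    using cU by (auto simp: csupp_def)
qed

lemma csupp_dense: "closure {x :: 'g::haar_group L2. csupp x} = UNIV"
proof -
  have "csupp (c *\<^sub>C ind_L2 K)" if K: "compact K" for c and K :: "'g set"
  proof -
    note b = bdd_borel_indicator[OF borel_compact[OF K]]
    have "mul (indicator K) (ind_L2 K) = ind_L2 K"
      unfolding ind_L2_def
      by (subst mul_abs_L2[OF b square_integrable_indicator[OF fmeasurable_compact[OF K]]])
         (auto intro!: arg_cong[of _ _ abs_L2] simp: indicator_def)
    then show ?thesis
      using K by (auto simp: csupp_def mul_scaleC_right[OF b])
  qed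
  then have "span {c *\<^sub>C ind_L2 K | c K. compact K} \<subseteq> {x :: 'g L2. csupp x}"
    by (intro span_minimal csupp_subspace) auto
  then show ?thesis
    using closure_mono[of "span {c *\<^sub>C ind_L2 K | c K. compact K}" "{x :: 'g L2. csupp x}"]
        unfolding dense_ind_L2 by blast
qed

text \<open>The scaled inequality defines a closed set of pairs, and pairs of compactly supported
  vectors are dense. Normalising with \<open>sgn\<close> preserves compact support.\<close>

lemma norm_le_if_csupp:
  fixes T :: "'g::haar_group L2 \<Rightarrow>\<^sub>L 'g L2"
  assumes "\<And>\<xi> \<eta>. norm \<xi> \<le> 1 \<Longrightarrow> norm \<eta> \<le> 1 \<Longrightarrow> csupp \<xi> \<Longrightarrow> csupp \<eta> \<Longrightarrow> cmod (cinner (T \<xi>) \<eta>) \<le> e"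
    and e: "0 \<le> e"
  shows "norm T \<le> e"
proof -
  define S where "S = {p :: 'g L2 \<times> 'g L2. cmod (cinner (T (fst p)) (snd p)) \<le> e * norm (fst p) * norm (snd p)}"
  have "closed S"
    unfolding S_def
    by (intro closed_Collect_le continuous_intros bounded_bilinear.continuous_on[OF bounded_bilinear_cinner])
  moreover have "{x. csupp x} \<times> {x. csupp x} \<subseteq> S"
  proof (rule subsetI, unfold mem_Times_iff mem_Collect_eq)
    fix p :: "'g L2 \<times> 'g L2"
    assume p: "csupp (fst p) \<and> csupp (snd p)"
    define \<xi> \<eta> where "\<xi> = fst p" and "\<eta> = snd p"
    have "cmod (cinner (T (sgn \<xi>)) (sgn \<eta>)) \<le> e"
    proof (rule assms(1))
      show "csupp (sgn \<xi>)" "csupp (sgn \<eta>)"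
        using p subspace_scale[OF csupp_subspace, of \<xi>] subspace_scale[OF csupp_subspace, of \<eta>]
        by (simp_all add: \<xi>_def \<eta>_def sgn_div_norm)
    qed (simp_all add: norm_sgn)
    then have "norm \<xi> * norm \<eta> * cmod (cinner (T (sgn \<xi>)) (sgn \<eta>)) \<le> norm \<xi> * norm \<eta> * e"
      by (intro mult_left_mono) auto
    moreover have "norm z *\<^sub>R sgn z = z" for z :: "'g L2"
      by (cases "z = 0") (simp_all add: sgn_div_norm)
    then have "cinner (T \<xi>) \<eta> = cinner (T (norm \<xi> *\<^sub>R sgn \<xi>)) (norm \<eta> *\<^sub>R sgn \<eta>)"
      by simp
    then have "cmod (cinner (T \<xi>) \<eta>) = norm \<xi> * norm \<eta> * cmod (cinner (T (sgn \<xi>)) (sgn \<eta>))"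
      by (simp only: blinfun.scaleR_right cinner_scaleR_left cinner_scaleR_right norm_mult norm_of_real
          abs_norm_cancel mult_ac)
    ultimately show "p \<in> S"
      by (simp add: S_def \<xi>_def \<eta>_def mult_ac)
  qed
  ultimately have "closure ({x. csupp x} \<times> {x. csupp x}) \<subseteq> S"
    by (rule closure_minimal[rotated])
  then have S: "p \<in> S" for p
    unfolding closure_Times csupp_dense by auto
  show ?thesis
  proof (rule norm_blinfun_bound[OF e])
    fix x
    show "norm (T x) \<le> e * norm x"
      using S[of "(x, _)"] e by (intro norm_le_if_cinner_le) (auto simp: S_def)
  qed
qed

lemma lreg_span_subset_Cstar: "closure lreg_span \<subseteq> Cstar_delta"
  unfolding Cstar_delta_def cstar_generated_def
proof (rule Inter_greatest)
  fix M :: "('a L2 \<Rightarrow>\<^sub>L 'a L2) set"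
  assume "M \<in> {M. star_subalgebra M \<and> closed M \<and> range lreg \<subseteq> M}"
  then have M: "star_subalgebra M" "closed M" "range lreg \<subseteq> M"
    by auto
  have sc: "scaleC_op c T \<in> M" if "T \<in> M" for c T
    using M(1) that by (simp add: star_subalgebra_def)
  then have "subspace M"
    using M(1) scaleC_op_of_real unfolding star_subalgebra_def subspace_def by metis
  then show "closure lreg_span \<subseteq> M"
    unfolding lreg_span_def using M sc by (intro closure_span_subset) auto
qed

lemma closed_clin: "closed {T :: 'a::complex_inner \<Rightarrow>\<^sub>L 'b::complex_inner. clin T}"
proof -
  have "{T :: 'a \<Rightarrow>\<^sub>L 'b. clin T} = (\<Inter>c. \<Inter>x. {T. blinfun_apply T (c *\<^sub>C x) = c *\<^sub>C blinfun_apply T x})"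
    by (auto simp: clin_def)
  moreover have "closed {T :: 'a \<Rightarrow>\<^sub>L 'b. T (c *\<^sub>C x) = c *\<^sub>C T x}" for c x
    by (intro closed_Collect_eq continuous_intros bounded_linear.continuous_on[OF bounded_linear_scaleC])
  ultimately show ?thesis
    by (auto intro!: closed_INT)
qed

context
  fixes tp2 :: "'g::haar_group L2 \<Rightarrow> 'g L2 \<Rightarrow> 'h2::complex_hilbert"
    and tp3 :: "'h2 \<Rightarrow> 'g L2 \<Rightarrow> 'h3::complex_hilbert"
    and \<Delta> :: "('g L2 \<Rightarrow>\<^sub>L 'g L2) \<Rightarrow> 'h2 \<Rightarrow>\<^sub>L 'h2"
    and \<Delta>\<iota> :: "('h2 \<Rightarrow>\<^sub>L 'h2) \<Rightarrow> 'h3 \<Rightarrow>\<^sub>L 'h3"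
    and F :: "'g set filter"
  assumes SIN: "SIN_group TYPE('g)" and ht2: "hilbert_tensor tp2" and ht3: "hilbert_tensor tp3"
    and com: "comultiplication tp2 \<Delta>"
    and twi: "tensor_with_id tp2 tp3 VN (vn_tensor tp2 VN VN) VN \<Delta> \<Delta>\<iota>"
    and F: "nbhd_ultrafilter F"
begin

section \<open>The iterated coisometry and the twofold comultiplication\<close>

definition double_orbit_map :: "'g set \<Rightarrow> 'g set \<Rightarrow> 'h3 \<Rightarrow>\<^sub>L 'g L2" where
  "double_orbit_map V W = orbit_map tp2 V o\<^sub>L tensor_left tp3 tp2 (orbit_map tp2 W)"

lemma clin_omap: "clin (orbit_map tp2 V)"
  by (rule clin_orbit_map[OF SIN ht2 com])

lemma clin_tl: "clin (tensor_left tp3 tp2 (orbit_map tp2 W))"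
  by (rule clin_tensor_left[OF ht3 ht2 clin_omap])

lemma clin_double_orbit_map: "clin (double_orbit_map V W)"
  unfolding double_orbit_map_def by (intro clin_compose clin_omap clin_tl)

lemma adj_double_orbit_map: "adj (double_orbit_map V W) \<xi>
    = adj (tensor_left tp3 tp2 (orbit_map tp2 W)) (adj (orbit_map tp2 V) \<xi>)"
  unfolding double_orbit_map_def by (simp add: adj_compose clin_omap clin_tl)

lemma norm_adj_double_orbit_map:
  assumes "inv_nbhd V" "inv_nbhd W"
  shows "norm (adj (double_orbit_map V W) \<xi>) \<le> norm \<xi>"
proof -
  have "norm (double_orbit_map V W) \<le> 1 * 1"
    unfolding double_orbit_map_def
    by (rule order.trans[OF norm_blinfun_compose])
       (intro mult_mono norm_orbit_map[OF SIN ht2 com]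
           order.trans[OF norm_tensor_left[OF ht3 ht2 clin_omap]] assms norm_ge_zero; simp)
  then have "norm (adj (double_orbit_map V W)) \<le> 1"
    using norm_adj_le[OF clin_double_orbit_map, of V W] by simp
  then show ?thesis
    using norm_blinfun[of "adj (double_orbit_map V W)" \<xi>] mult_right_mono[of
        "norm (adj (double_orbit_map V W))" 1 "norm \<xi>"] by simp
qed

text \<open>Conjugating by an operator on the first two legs leaves the third leg alone. Thus one
  orbit map acts on the pair of first legs and the next one sees an elementary tensor again.\<close>

lemma tensor_left_conj:
  assumes A: "clin A" and c: "clin c"
  shows "tensor_left tp3 tp2 (orbit_map tp2 W) (op_tensor tp3 A
      c (adj (tensor_left tp3 tp2 (orbit_map tp2 W)) \<Theta>))
    = op_tensor tp2 (orbit_map tp2 W o\<^sub>L A o\<^sub>L adj (orbit_map tp2 W)) c \<Theta>"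
proof -
  have "op_tensor tp2 (orbit_map tp2 W o\<^sub>L A o\<^sub>L adj (orbit_map tp2 W)) c
      = tensor_left tp3 tp2 (orbit_map tp2 W) o\<^sub>L op_tensor tp3 A c o\<^sub>L
          adj (tensor_left tp3 tp2 (orbit_map tp2 W))"
  proof (rule op_tensor_eqI[OF ht2])
    show "clin (orbit_map tp2 W o\<^sub>L A o\<^sub>L adj (orbit_map tp2 W))"
      by (intro clin_compose clin_omap A clin_adj)
  qed (simp_all add: adj_tensor_left_apply[OF ht3 ht2 clin_omap] op_tensor_apply[OF ht3]
      A c tensor_left_apply[OF ht3 ht2 clin_omap])
  then show ?thesis
    by simp
qed

lemma double_orbit_map_adj:
  assumes "inv_nbhd V" "inv_nbhd W"
  shows "double_orbit_map V W (adj (double_orbit_map V W) \<xi>) = \<xi>"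
proof -
  have "orbit_map tp2 W o\<^sub>L id_blinfun o\<^sub>L adj (orbit_map tp2 W) = id_blinfun"
    by (rule blinfun_eqI) (simp add: orbit_map_adj[OF SIN ht2 com assms(2)])
  then show ?thesis
    using tensor_left_conj[OF clin_id clin_id, of W "adj (orbit_map tp2 V) \<xi>"]
    unfolding adj_double_orbit_map by (simp add: double_orbit_map_def op_tensor_id[OF ht3]
        op_tensor_id[OF ht2] orbit_map_adj[OF SIN ht2 com assms(1)])
qed

lemma cinner_double_orbit_map_elementary:
  assumes "clin a" "clin b" "clin c"
  shows "cinner (op_tensor tp3 (op_tensor tp2 a b) c (adj (double_orbit_map V W) \<xi>))
      (adj (double_orbit_map V W) \<eta>)
    = cinner (compress tp2 V (compress tp2 W a b) c \<xi>) \<eta>"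
  unfolding cinner_adj[OF clin_double_orbit_map, symmetric]
  unfolding adj_double_orbit_map by (simp add: double_orbit_map_def compress_def[OF SIN ht2 com]
      tensor_left_conj clin_op_tensor[OF ht2] assms)

lemma continuous_map_Delta2_functional:
  "continuous_map (subtopology ultraweak_topology VN) euclidean (\<lambda>x. cinner (\<Delta>\<iota> (\<Delta> x) \<Theta>) \<Theta>')"
proof -
  have "continuous_map (subtopology ultraweak_topology (vn_tensor tp2 VN VN))
      (subtopology ultraweak_topology (vn_tensor tp3 (vn_tensor tp2 VN VN) VN)) \<Delta>\<iota>"
    using twi by (simp add: tensor_with_id_def normal_unital_star_hom_def)
  from continuous_map_compose[OF continuous_map_compose[OF Delta_continuous[OF SIN ht2 com] this]
      continuous_map_VN_vector_functional]
  show ?thesis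
    by (simp add: o_def)
qed

lemma double_orbit_map_Delta2_lreg: "double_orbit_map V W (\<Delta>\<iota> (\<Delta> (lreg s)) \<Theta>) = lreg s (double_orbit_map V W \<Theta>)"
proof -
  have "\<Delta>\<iota> (\<Delta> (lreg s)) = op_tensor tp3 (\<Delta> (lreg s)) (lreg s)"
    using twi by (simp add: tensor_with_id_def Delta_lreg[OF SIN ht2 com] lreg_in_VN)
  moreover have "tensor_left tp3 tp2 (orbit_map tp2 W) o\<^sub>L op_tensor tp3 (\<Delta> (lreg s)) (lreg s)
      = \<Delta> (lreg s) o\<^sub>L tensor_left tp3 tp2 (orbit_map tp2 W)"
  proof (rule tensor_blinfun_eqI[OF ht3])
    fix \<theta> x
    have "orbit_map tp2 W (\<Delta> (lreg s) \<theta>) = lreg s (orbit_map tp2 W \<theta>)"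
      unfolding orbit_map_def[OF SIN ht2 com]
      by (rule fld_orbit_lreg[OF ht2 Delta_lreg_apply[OF SIN ht2 com]])
    then show "(tensor_left tp3 tp2 (orbit_map tp2 W) o\<^sub>L op_tensor tp3 (\<Delta> (lreg s)) (lreg s)) (tp3 \<theta> x)
      = (\<Delta> (lreg s) o\<^sub>L tensor_left tp3 tp2 (orbit_map tp2 W)) (tp3 \<theta> x)"
      by (simp add: op_tensor_apply[OF ht3] Delta_clin[OF SIN ht2 com] lreg_in_VN
          tensor_left_apply[OF ht3 ht2 clin_omap] Delta_lreg_apply[OF SIN ht2 com])
  qed
  ultimately have "tensor_left tp3 tp2 (orbit_map tp2 W) (\<Delta>\<iota> (\<Delta> (lreg s)) \<Theta>)
      = \<Delta> (lreg s) (tensor_left tp3 tp2 (orbit_map tp2 W) \<Theta>)"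
    by (metis blinfun_apply_blinfun_compose)
  moreover have "orbit_map tp2 V (\<Delta> (lreg s) \<Xi>) = lreg s (orbit_map tp2 V \<Xi>)" for \<Xi>
    unfolding orbit_map_def[OF SIN ht2 com]
    by (rule fld_orbit_lreg[OF ht2 Delta_lreg_apply[OF SIN ht2 com]])
  ultimately show ?thesis
    by (simp add: double_orbit_map_def)
qed

text \<open>Both sides are normal in \<open>x\<close>, and on translations the identity is two
  applications of \<open>fld_orbit_lreg\<close>.\<close>

lemma double_orbit_map_Delta2:
  assumes x: "x \<in> VN"
  shows "double_orbit_map V W (\<Delta>\<iota> (\<Delta> x) \<Theta>) = x (double_orbit_map V W \<Theta>)"
proof (rule cinner_ext)
  fix \<eta>
  have hom: "S \<in> vn_tensor tp2 VN VN \<Longrightarrow> T \<in> vn_tensor tp2 VN VN \<Longrightarrow> \<Delta>\<iota> (S + T) = \<Delta>\<iota> S + \<Delta>\<iota> T"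
    "T \<in> vn_tensor tp2 VN VN \<Longrightarrow> \<Delta>\<iota> (scaleC_op c T) = scaleC_op c (\<Delta>\<iota> T)" for S T c
    using twi by (simp_all add: tensor_with_id_def normal_unital_star_hom_def)
  have "cinner (\<Delta>\<iota> (\<Delta> x) \<Theta>) (adj (double_orbit_map V W) \<eta>) = cinner (x (double_orbit_map V W \<Theta>)) \<eta>"
  proof (rule VN_functional_eqI[OF continuous_map_Delta2_functional continuous_map_VN_vector_functional
      _ _ _ _ _ x])
    show "cinner (\<Delta>\<iota> (\<Delta> (lreg s)) \<Theta>) (adj (double_orbit_map V W) \<eta>)
        = cinner (lreg s (double_orbit_map V W \<Theta>)) \<eta>" for s
      unfolding cinner_adj[OF clin_double_orbit_map, symmetric] double_orbit_map_Delta2_lreg ..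
  qed (auto simp: Delta_add[OF SIN ht2 com] Delta_scaleC[OF SIN ht2 com] hom Delta_mem[OF SIN ht2 com]
      blinfun.add_left cinner_add_left)
  then show "cinner (double_orbit_map V W (\<Delta>\<iota> (\<Delta> x) \<Theta>)) \<eta> = cinner (x (double_orbit_map V W \<Theta>)) \<eta>"
    unfolding cinner_adj[OF clin_double_orbit_map] .
qed

section \<open>Operators whose limiting states come from finite combinations of translations\<close>

definition state where
  "state u \<xi> \<eta> V W = cinner (u (adj (double_orbit_map V W) \<xi>)) (adj (double_orbit_map V W) \<eta>)"

text \<open>\<open>z\<close> and \<open>e\<close> are common to all vectors, whereas the eventual
  ranges of \<open>V\<close> and \<open>W\<close> may depend on them. \<open>W\<close> shrinks while
  \<open>V\<close> is held fixed.\<close>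

definition near :: "('h3 \<Rightarrow>\<^sub>L 'h3) \<Rightarrow> ('g L2 \<Rightarrow>\<^sub>L 'g L2) \<Rightarrow> real \<Rightarrow> bool" where
  "near u z e \<longleftrightarrow> (\<forall>\<xi> \<eta>. norm \<xi> \<le> 1 \<longrightarrow> norm \<eta> \<le> 1 \<longrightarrow> csupp \<xi> \<longrightarrow> csupp \<eta> \<longrightarrow>
     (\<forall>\<^sub>F V in F. \<forall>\<^sub>F W in F. cmod (state u \<xi> \<eta> V W - cinner (z \<xi>) \<eta>) \<le> e))"

definition good :: "('h3 \<Rightarrow>\<^sub>L 'h3) \<Rightarrow> bool" where
  "good u \<longleftrightarrow> (\<forall>e>0. \<exists>z\<in>lreg_span. near u z e)"

lemma near_add:
  assumes "near u z d" "near v w e"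
  shows "near (u + v) (z + w) (d + e)"
  unfolding near_def
proof (intro allI impI)
  fix \<xi> \<eta> :: "'g L2"
  assume *: "norm \<xi> \<le> 1" "norm \<eta> \<le> 1" "csupp \<xi>" "csupp \<eta>"
  show "\<forall>\<^sub>F V in F. \<forall>\<^sub>F W in F. cmod (state (u + v) \<xi> \<eta> V W - cinner ((z + w) \<xi>) \<eta>) \<le> d + e"
    using assms(1)[unfolded near_def, rule_format, OF *] assms(2)[unfolded near_def, rule_format, OF *]
  proof eventually_elim
    case (elim V)
    then show ?case
    proof eventually_elim
      case (elim W)
      then show ?case
        using norm_triangle_ineq[of "state u \<xi> \<eta> V W - cinner (z \<xi>) \<eta>" "state v \<xi> \<eta> V W - cinner (w \<xi>) \<eta>"]
        by (simp add: state_def blinfun.add_left cinner_add_left algebra_simps)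
    qed
  qed
qed

lemma near_scaleR:
  assumes "near u z d"
  shows "near (r *\<^sub>R u) (r *\<^sub>R z) (\<bar>r\<bar> * d)"
  unfolding near_def
proof (intro allI impI)
  fix \<xi> \<eta> :: "'g L2"
  assume *: "norm \<xi> \<le> 1" "norm \<eta> \<le> 1" "csupp \<xi>" "csupp \<eta>"
  show "\<forall>\<^sub>F V in F. \<forall>\<^sub>F W in F. cmod (state (r *\<^sub>R u) \<xi> \<eta> V W - cinner ((r *\<^sub>R z) \<xi>) \<eta>) \<le> \<bar>r\<bar> * d"
    using assms[unfolded near_def, rule_format, OF *]
  proof eventually_elim
    case (elim V)
    then show ?case
    proof eventually_elim
      case (elim W)
      have "state (r *\<^sub>R u) \<xi> \<eta> V W - cinner ((r *\<^sub>R z) \<xi>) \<eta> = of_real r * (state u \<xi> \<eta> V W - cinner (z \<xi>) \<eta>)"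
        by (simp add: state_def blinfun.scaleR_left right_diff_distrib)
      then show ?case
        using elim by (simp only: norm_mult norm_of_real mult_left_mono abs_ge_zero)
    qed
  qed
qed

text \<open>The adjoint coisometries are contractions, so states are bounded by the operator norm
  uniformly in \<open>V\<close> and \<open>W\<close>; this carries the approximation to norm
  limits.\<close>

lemma near_zero_if_norm_le:
  assumes "norm u \<le> e"
  shows "near u 0 e"
  unfolding near_def
proof (intro allI impI)
  fix \<xi> \<eta> :: "'g L2"
  assume *: "norm \<xi> \<le> 1" "norm \<eta> \<le> 1"
  have Fi: "eventually inv_nbhd F"
    using F by (simp add: nbhd_ultrafilter_def)
  have e: "0 \<le> e"
    using assms norm_ge_zero order.trans by blast
  show "\<forall>\<^sub>F V in F. \<forall>\<^sub>F W in F. cmod (state u \<xi> \<eta> V W - cinner ((0 :: 'g L2 \<Rightarrow>\<^sub>L 'g L2) \<xi>) \<eta>) \<le> e"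
    using Fi
  proof eventually_elim
    case V: (elim V)
    show ?case
      using Fi
    proof eventually_elim
      case W: (elim W)
      note n = order.trans[OF norm_adj_double_orbit_map[OF V W]]
      have "cmod (state u \<xi> \<eta> V W) \<le> norm (u (adj (double_orbit_map V W) \<xi>))
          * norm (adj (double_orbit_map V W) \<eta>)"
        unfolding state_def by (rule cmod_cinner_le)
      also have "\<dots> \<le> (e * 1) * 1"
        by (intro mult_mono order.trans[OF norm_blinfun] assms n *) (use e in simp_all)
      finally show ?case
        by simp
    qed
  qed
qed

lemma good_add:
  assumes "good u" "good v"
  shows "good (u + v)"
  unfolding good_def
proof (intro allI impI)
  fix e :: real
  assume "e > 0"
  then have "e / 2 > 0"
    by simp
  then obtain z w where "z \<in> lreg_span" "near u z (e / 2)" "w \<in> lreg_span" "near v w (e / 2)"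
    using assms unfolding good_def by metis
  then show "\<exists>z\<in>lreg_span. near (u + v) z e"
    using near_add[of u z "e / 2" v w "e / 2"]
    by (intro bexI[of _ "z + w"]) (auto intro: subspace_add[OF subspace_lreg_span])
qed

lemma good_scaleR:
  assumes "good u"
  shows "good (r *\<^sub>R u)"
  unfolding good_def
proof (intro allI impI)
  fix e :: real
  assume e: "e > 0"
  show "\<exists>z\<in>lreg_span. near (r *\<^sub>R u) z e"
  proof (cases "r = 0")
    case True
    then show ?thesis
      using near_zero_if_norm_le[of 0 e] e by (intro bexI[of _ 0])
          (auto intro: subspace_0[OF subspace_lreg_span])
  next
    case False
    with e have "e / \<bar>r\<bar> > 0"
      by simp
    then obtain z where "z \<in> lreg_span" "near u z (e / \<bar>r\<bar>)"
      using assms unfolding good_def by metis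
    then show ?thesis
      using near_scaleR[of u z "e / \<bar>r\<bar>" r] False
      by (intro bexI[of _ "r *\<^sub>R z"]) (auto intro: subspace_scale[OF subspace_lreg_span])
  qed
qed

lemma good_approx:
  assumes "\<And>d. d > 0 \<Longrightarrow> \<exists>v. good v \<and> norm (u - v) \<le> d"
  shows "good u"
  unfolding good_def
proof (intro allI impI)
  fix e :: real
  assume "e > 0"
  then have e2: "e / 2 > 0"
    by simp
  obtain v where v: "good v" "norm (u - v) \<le> e / 2"
    using assms[OF e2] by blast
  obtain z where "z \<in> lreg_span" "near v z (e / 2)"
    using v(1) e2 unfolding good_def by metis
  then show "\<exists>z\<in>lreg_span. near u z e"
    using near_add[OF near_zero_if_norm_le[OF v(2)], of v z "e / 2"] by (intro bexI[of _ z]) auto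
qed

lemma good_zero: "good 0"
  by (auto simp: good_def intro!: bexI[of _ 0] near_zero_if_norm_le subspace_0[OF subspace_lreg_span])

lemma subspace_good: "subspace {u. good u}"
  unfolding subspace_def using good_zero good_add good_scaleR by blast

lemma closed_good: "closed {u. good u}"
  unfolding closure_subset_eq[symmetric]
proof
  fix u
  assume "u \<in> closure {u. good u}"
  then show "u \<in> {u. good u}"
    unfolding closure_approachable dist_norm mem_Collect_eq
    by (intro good_approx) (metis less_imp_le norm_minus_commute mem_Collect_eq)
qed

lemma good_elementary:
  assumes "a \<in> VN" "b \<in> VN" "c \<in> VN"
  shows "good (op_tensor tp3 (op_tensor tp2 a b) c)"
  unfolding good_def near_def state_def cinner_double_orbit_map_elementary[OF assms[THEN VN_clin]]
  by (intro allI impI compress_elementary_limit[OF SIN ht2 com F assms])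

text \<open>The minimal tensor product is iterated, so the closure in the first two legs is taken
  before the third leg is attached. Complex linearity is proved alongside because the rules for
  \<open>op_tensor\<close> demand it.\<close>

lemma good_tensor:
  assumes S: "S \<in> min_tensor tp2 VN VN" and c: "c \<in> VN"
  shows "clin S \<and> good (op_tensor tp3 S c)"
proof -
  let ?X = "{S. clin S \<and> good (op_tensor tp3 S c)}"
  note cc = VN_clin[OF c]
  have "closure (span {op_tensor tp2 a b | a b. a \<in> VN \<and> b \<in> VN}) \<subseteq> ?X"
  proof (rule closure_span_subset)
    show "subspace ?X"
      unfolding subspace_def
    proof (intro conjI ballI allI)
      have "op_tensor tp3 0 c = 0"
        using op_tensor_scaleR_left[OF ht3 clin_zero cc, of 0] by simp
      then show "0 \<in> ?X"
        by (simp add: good_zero)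
    qed (auto simp: op_tensor_add_left[OF ht3] op_tensor_scaleR_left[OF ht3] cc clin_add clin_scaleR
        good_add good_scaleR)
    show "closed ?X"
      unfolding closure_subset_eq[symmetric]
    proof
      fix S
      assume S: "S \<in> closure ?X"
      moreover have "closure ?X \<subseteq> {S. clin S}"
        by (rule closure_minimal[OF _ closed_clin]) auto
      ultimately have cS: "clin S"
        by blast
      have "good (op_tensor tp3 S c)"
      proof (rule good_approx)
        fix d :: real
        assume d: "d > 0"
        define d' where "d' = d / (norm c + 1)"
        have pos: "norm c + 1 > 0"
          by (simp add: add_nonneg_pos)
        have d': "d' > 0"
          using d pos by (simp add: d'_def)
        obtain S' where S': "clin S'" "good (op_tensor tp3 S' c)" "dist S' S < d'"
          using S d' unfolding closure_approachable by blast
        have "norm (op_tensor tp3 S c - op_tensor tp3 S' c) \<le> norm (S - S') * norm c"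
          using norm_op_tensor[OF ht3 clin_diff[OF cS S'(1)] cc]
              by (simp add: op_tensor_diff_left[OF ht3] cS S' cc)
        also have "\<dots> \<le> d' * (norm c + 1)"
          using S'(3) d' by (intro mult_mono) (auto simp: dist_norm norm_minus_commute)
        also have "\<dots> = d"
          using pos by (simp add: d'_def)
        finally show "\<exists>v. good v \<and> norm (op_tensor tp3 S c - v) \<le> d"
          using S'(2) by blast
      qed
      with cS show "S \<in> ?X"
        by blast
    qed
    show "{op_tensor tp2 a b | a b. a \<in> VN \<and> b \<in> VN} \<subseteq> ?X"
      using c by (auto intro: good_elementary clin_op_tensor[OF ht2] VN_clin)
  qed
  then show ?thesis
    using S by (auto simp: min_tensor_def)
qed

lemma good_min_tensor: "min_tensor tp3 (min_tensor tp2 VN VN) VN \<subseteq> {u. good u}"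
  unfolding min_tensor_def[of tp3]
  by (rule closure_span_subset[OF subspace_good closed_good]) (use good_tensor in auto)

text \<open>For this operator the state does not depend on \<open>V\<close> and \<open>W\<close>: it
  equals \<open>cinner (x \<xi>) \<eta>\<close>, since the coisometry intertwines and is a left
  inverse of its adjoint. An eventual estimate of a constant along a proper filter is a plain
  estimate, so \<open>z\<close> is close to \<open>x\<close> in norm.\<close>

lemma mem_closure_lreg_span:
  assumes x: "x \<in> VN" and "\<Delta>\<iota> (\<Delta> x) \<in> min_tensor tp3 (min_tensor tp2 VN VN) VN"
  shows "x \<in> closure lreg_span"
  unfolding closure_approachable
proof (intro allI impI)
  fix e :: real
  assume e: "e > 0"
  then have e2: "e / 2 > 0"
    by simp
  have g: "good (\<Delta>\<iota> (\<Delta> x))"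
    using good_min_tensor assms(2) by blast
  obtain z where z: "z \<in> lreg_span" "near (\<Delta>\<iota> (\<Delta> x)) z (e / 2)"
    using g e2 unfolding good_def by metis
  have Fi: "eventually inv_nbhd F" and nb: "F \<noteq> bot"
    using F by (simp_all add: nbhd_ultrafilter_def ultra_def)
  have "norm (z - x) \<le> e / 2"
  proof (rule norm_le_if_csupp)
    fix \<xi> \<eta> :: "'g L2"
    assume *: "norm \<xi> \<le> 1" "norm \<eta> \<le> 1" "csupp \<xi>" "csupp \<eta>"
    have "eventually (\<lambda>V. cmod (cinner ((z - x) \<xi>) \<eta>) \<le> e / 2) F"
      using z(2)[unfolded near_def, rule_format, OF *] Fi
    proof eventually_elim
      case V: (elim V)
      have "eventually (\<lambda>W. cmod (cinner ((z - x) \<xi>) \<eta>) \<le> e / 2) F"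
        using V(1) Fi
      proof eventually_elim
        case W: (elim W)
        have "state (\<Delta>\<iota> (\<Delta> x)) \<xi> \<eta> V W = cinner (x \<xi>) \<eta>"
          by (simp add: state_def cinner_adj[OF clin_double_orbit_map, symmetric]
              double_orbit_map_Delta2[OF x] double_orbit_map_adj[OF V(2) W(2)])
        then show ?case
          using W(1) by (simp add: blinfun.diff_left cinner_diff_left norm_minus_commute)
      qed
      then show ?case
        using nb by (simp add: eventually_const)
    qed
    then show "cmod (cinner ((z - x) \<xi>) \<eta>) \<le> e / 2"
      using nb by (simp add: eventually_const)
  qed (use e in simp)
  then show "\<exists>y\<in>lreg_span. dist y x < e"
    using z(1) e by (intro bexI[of _ z]) (simp_all add: dist_norm)
qed

end

theorem theorem5p3:
  fixes tp2 :: "'g::haar_group L2 \<Rightarrow> 'g L2 \<Rightarrow> 'h2::complex_hilbert"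
    and tp3 :: "'h2 \<Rightarrow> 'g L2 \<Rightarrow> 'h3::complex_hilbert"
    and \<Delta> :: "('g L2 \<Rightarrow>\<^sub>L 'g L2) \<Rightarrow> 'h2 \<Rightarrow>\<^sub>L 'h2"
    and \<Delta>\<iota> :: "('h2 \<Rightarrow>\<^sub>L 'h2) \<Rightarrow> 'h3 \<Rightarrow>\<^sub>L 'h3"
    and x0 :: "'g L2 \<Rightarrow>\<^sub>L 'g L2"
  assumes "SIN_group TYPE('g)"
    and "hilbert_tensor tp2" and "hilbert_tensor tp3"
    and "comultiplication tp2 \<Delta>"
    and "tensor_with_id tp2 tp3 VN (vn_tensor tp2 VN VN) VN \<Delta> \<Delta>\<iota>"
    and "x0 \<in> VN"
    and "\<Delta>\<iota> (\<Delta> x0) \<in> min_tensor tp3 (min_tensor tp2 VN VN) VN"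
  shows "x0 \<in> Cstar_delta"
proof -
  obtain F :: "'g set filter" where "nbhd_ultrafilter F"
    using nbhd_ultrafilter_exists[OF assms(1)] by blast
  from mem_closure_lreg_span[OF assms(1-5) this assms(6,7)] show ?thesis
    using lreg_span_subset_Cstar by blast
qed

end
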